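(* Let $K:\mathcal{A}^{\mathrm{op}}\otimes\mathcal{X}\to\mathcal{V}$ be a multiplicative kernel between small promonoidal $\mathcal{V}$-categories such that every component $\eta_f:f\to\underline{K}\,\overline{K}(f)$, $f\in[\mathcal{A},\mathcal{V}]$, of the unit of the adjunction $\overline{K}\dashv\underline{K}:[\mathcal{X},\mathcal{V}]\to[\mathcal{A},\mathcal{V}]$ is a regular monomorphism (an equaliser) in $[\mathcal{A},\mathcal{V}]$. Then $\overline{K}$ factors as the canonical Kleisli functor $\overline{K}_T:[\mathcal{A},\mathcal{V}]\to[\mathcal{A},\mathcal{V}]_T$ followed by the canonical fully faithful functor $[\mathcal{A},\mathcal{V}]_T\to[\mathcal{X},\mathcal{V}]$, the functor $\overline{K}_T$ is conservative, and $\mathbf{Joy}(K)$ is a $\mathcal{V}$-category for which there is an equivalence $$[\mathcal{A},\mathcal{V}]\xrightarrow{\ \simeq\ }\mathbf{Joy}(K)$$ (given by $f\mapsto f$ on objects and by $\beta\mapsto\overline{K}(\beta)$ on homs) and a conservative embedding $\mathbf{Joy}(K)\to[\mathcal{X},\mathcal{V}]$ (given by $f\mapsto\overline{K}(f)$ on objects and the defining inclusion on homs).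
   Context: Base: $\mathcal{V}$ is a complete (hence cocomplete) $*$-autonomous symmetric monoidal closed category with unit $I$ as dualising object. All categorical notions are $\mathcal{V}$-enriched. $[\mathcal{A},\mathcal{V}]$ is the $\mathcal{V}$-category of $\mathcal{V}$-functors $\mathcal{A}\to\mathcal{V}$. "Conservative" means isomorphism-reflecting. Promonoidal category (Day): a small $\mathcal{V}$-category $\mathcal{A}$ with $\mathcal{V}$-functors $p:\mathcal{A}^{\mathrm{op}}\otimes\mathcal{A}^{\mathrm{op}}\otimes\mathcal{A}\to\mathcal{V}$ and $j:\mathcal{A}\to\mathcal{V}$ together with coherent natural associativity isomorphisms $\int^{x}p(a,b,x)\otimes p(x,c,d)\cong\int^{x}p(b,c,x)\otimes p(a,x,d)$ and unit isomorphisms $\int^{x}j(x)\otimes p(x,a,b)\cong\mathcal{A}(a,b)\cong\int^{x}j(x)\otimes p(a,x,b)$. The letters $p,j$ are used for the structures of both $\mathcal{A}$ and $\mathcal{X}$. Multiplicative kernel from $\mathcal{A}$ to $\mathcal{X}$: a $\mathcal{V}$-functor $K:\mathcal{A}^{\mathrm{op}}\otimes\mathcal{X}\to\mathcal{V}$ with natural isomorphisms $\int^{yz}K(a,y)\otimes K(b,z)\otimes p(y,z,x)\cong\int^{c}K(c,x)\otimes p(a,b,c)$ and $j(x)\cong\int^{c}K(c,x)\otimes j(c)$. Kan adjunction: $\overline{K}(f)(x)=\int^{a}K(a,x)\otimes f(a)$ for $f\in[\mathcal{A},\mathcal{V}]$ and $\underline{K}(g)(a)=\int_{x}[K(a,x),g(x)]$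 for $g\in[\mathcal{X},\mathcal{V}]$; $\overline{K}\dashv\underline{K}$ with counit $\epsilon$ and unit $\eta$. $T=(\underline{K}\,\overline{K},\ \underline{K}\epsilon\overline{K},\ \eta)$ is the induced $\mathcal{V}$-monad on $[\mathcal{A},\mathcal{V}]$, and $[\mathcal{A},\mathcal{V}]_T$ is its Kleisli $\mathcal{V}$-category, with the same objects as $[\mathcal{A},\mathcal{V}]$ and homs $[\mathcal{A},\mathcal{V}](f,\underline{K}\,\overline{K}(g))\cong[\mathcal{X},\mathcal{V}](\overline{K}(f),\overline{K}(g))$. A map $\alpha:\overline{K}(f)\Rightarrow\overline{K}(g)$ in $[\mathcal{X},\mathcal{V}]$ is called regular when $\overline{K}\,\underline{K}(\alpha)\circ\overline{K}(\eta_f)=\overline{K}(\eta_g)\circ\alpha$. The Joyal-Wiener category $\mathbf{Joy}(K)$ is the $\mathcal{V}$-subcategory of $[\mathcal{A},\mathcal{V}]_T$ with the same objects and with $\mathbf{Joy}(K)(f,g)$ defined as the equaliser in $\mathcal{V}$ of the two maps $$[\mathcal{X},\mathcal{V}](\overline{K}(f),\overline{K}(g))\rightrightarrows[\mathcal{X},\mathcal{V}](\overline{K}(f),\overline{K}\,\underline{K}\,\overline{K}(g)),$$ one being the action of $\overline{K}\,\underline{K}$ on homs followed by precomposition with $\overline{K}(\eta_f)$, the other being postcomposition with $\overline{K}(\eta_g)$. *)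

theory Defs
  imports Main
begin

section \<open>Ordinary categories and small limits\<close>

record ('o, 'm) cat =
  Ob :: "'o set"
  Ar :: "'m set"
  Dom :: "'m \<Rightarrow> 'o"
  Cod :: "'m \<Rightarrow> 'o"
  Idn :: "'o \<Rightarrow> 'm"
  Cmp :: "'m \<Rightarrow> 'm \<Rightarrow> 'm"  \<comment> \<open>\<open>Cmp C g f\<close> is "g after f"\<close>

definition Hom :: "('o, 'm, 'z) cat_scheme \<Rightarrow> 'o \<Rightarrow> 'o \<Rightarrow> 'm set" where
  "Hom C a b = {f \<in> Ar C. Dom C f = a \<and> Cod C f = b}"

definition category :: "('o, 'm, 'z) cat_scheme \<Rightarrow> bool" where
  "category C \<longleftrightarrow>
     (\<forall>f\<in>Ar C. Dom C f \<in> Ob C \<and> Cod C f \<in> Ob C) \<and>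
     (\<forall>a\<in>Ob C. Idn C a \<in> Hom C a a) \<and>
     (\<forall>a b c f g. f \<in> Hom C a b \<longrightarrow> g \<in> Hom C b c \<longrightarrow> Cmp C g f \<in> Hom C a c) \<and>
     (\<forall>a b f. f \<in> Hom C a b \<longrightarrow> Cmp C f (Idn C a) = f \<and> Cmp C (Idn C b) f = f) \<and>
     (\<forall>a b c d f g h. f \<in> Hom C a b \<longrightarrow> g \<in> Hom C b c \<longrightarrow> h \<in> Hom C c d \<longrightarrow>
        Cmp C h (Cmp C g f) = Cmp C (Cmp C h g) f)"

definition ord_functor ::
    "('i, 'j, 'y) cat_scheme \<Rightarrow> ('o, 'm, 'z) cat_scheme \<Rightarrow> ('i \<Rightarrow> 'o) \<Rightarrow> ('j \<Rightarrow> 'm) \<Rightarrow> bool" where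
  "ord_functor J C Do Da \<longleftrightarrow>
     (\<forall>i\<in>Ob J. Do i \<in> Ob C) \<and>
     (\<forall>i j f. f \<in> Hom J i j \<longrightarrow> Da f \<in> Hom C (Do i) (Do j)) \<and>
     (\<forall>i\<in>Ob J. Da (Idn J i) = Idn C (Do i)) \<and>
     (\<forall>i j k f g. f \<in> Hom J i j \<longrightarrow> g \<in> Hom J j k \<longrightarrow> Da (Cmp J g f) = Cmp C (Da g) (Da f))"

definition is_cone ::
    "('i, 'j, 'y) cat_scheme \<Rightarrow> ('o, 'm, 'z) cat_scheme \<Rightarrow> ('i \<Rightarrow> 'o) \<Rightarrow> ('j \<Rightarrow> 'm) \<Rightarrow>
     'o \<Rightarrow> ('i \<Rightarrow> 'm) \<Rightarrow> bool" where
  "is_cone J C Do Da l \<pi> \<longleftrightarrow>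
     l \<in> Ob C \<and> (\<forall>i\<in>Ob J. \<pi> i \<in> Hom C l (Do i)) \<and>
     (\<forall>i j f. f \<in> Hom J i j \<longrightarrow> Cmp C (Da f) (\<pi> i) = \<pi> j)"

definition is_limit ::
    "('i, 'j, 'y) cat_scheme \<Rightarrow> ('o, 'm, 'z) cat_scheme \<Rightarrow> ('i \<Rightarrow> 'o) \<Rightarrow> ('j \<Rightarrow> 'm) \<Rightarrow>
     'o \<Rightarrow> ('i \<Rightarrow> 'm) \<Rightarrow> bool" where
  "is_limit J C Do Da l \<pi> \<longleftrightarrow>
     is_cone J C Do Da l \<pi> \<and>
     (\<forall>l' \<pi>'. is_cone J C Do Da l' \<pi>' \<longrightarrow>
        (\<exists>!u. u \<in> Hom C l' l \<and> (\<forall>i\<in>Ob J. Cmp C (\<pi> i) u = \<pi>' i)))"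

text \<open>Smallness is relative to a type \<open>'s\<close>: a category is small if its objects and arrows form
  sets of elements of \<open>'s\<close>, and a \<open>\<V>\<close>-category is small if its objects form a set of elements
  of \<open>'s\<close>.  Where this is used, \<open>'s\<close> is assumed infinite, so that small sets are closed
  under binary products up to bijection.\<close>

definition complete_cat :: "'s itself \<Rightarrow> ('o, 'm, 'z) cat_scheme \<Rightarrow> bool" where
  "complete_cat _ C \<longleftrightarrow>
     (\<forall>(J :: ('s, 's) cat) Do Da. category J \<longrightarrow> ord_functor J C Do Da \<longrightarrow>
        (\<exists>l \<pi>. is_limit J C Do Da l \<pi>))"


section \<open>Symmetric monoidal closed and \<open>*\<close>-autonomous categories\<close>

record ('o, 'm) smc = "('o, 'm) cat" +
  Ten :: "'o \<Rightarrow> 'o \<Rightarrow> 'o"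
  TenA :: "'m \<Rightarrow> 'm \<Rightarrow> 'm"
  Unt :: "'o"
  Asc :: "'o \<Rightarrow> 'o \<Rightarrow> 'o \<Rightarrow> 'm"  \<comment> \<open>\<open>(a \<otimes> b) \<otimes> c \<rightarrow> a \<otimes> (b \<otimes> c)\<close>\<close>
  Lun :: "'o \<Rightarrow> 'm"  \<comment> \<open>\<open>I \<otimes> a \<rightarrow> a\<close>\<close>
  Run :: "'o \<Rightarrow> 'm"  \<comment> \<open>\<open>a \<otimes> I \<rightarrow> a\<close>\<close>
  Sym :: "'o \<Rightarrow> 'o \<Rightarrow> 'm"  \<comment> \<open>\<open>a \<otimes> b \<rightarrow> b \<otimes> a\<close>\<close>
  IHom :: "'o \<Rightarrow> 'o \<Rightarrow> 'o"
  Ev :: "'o \<Rightarrow> 'o \<Rightarrow> 'm"  \<comment> \<open>\<open>[a, b] \<otimes> a \<rightarrow> b\<close>\<close>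

text \<open>A \<open>\<V>\<close>-category: \<open>VCmp C a b c : C(b,c) \<otimes> C(a,b) \<rightarrow> C(a,c)\<close>.\<close>

record ('a, 'o, 'm) vcat =
  VOb :: "'a set"
  VHom :: "'a \<Rightarrow> 'a \<Rightarrow> 'o"
  VId :: "'a \<Rightarrow> 'm"
  VCmp :: "'a \<Rightarrow> 'a \<Rightarrow> 'a \<Rightarrow> 'm"

record ('a, 'b, 'm) vfun =
  FOb :: "'a \<Rightarrow> 'b"
  FMap :: "'a \<Rightarrow> 'a \<Rightarrow> 'm"

text \<open>\<open>\<V>\<close>-functors are kept extensional (undefined off the objects of their domain), so that
  equality of records is equality of \<open>\<V>\<close>-functors.\<close>

definition mkfun ::
    "('a, 'o, 'm) vcat \<Rightarrow> ('a \<Rightarrow> 'b) \<Rightarrow> ('a \<Rightarrow> 'a \<Rightarrow> 'm) \<Rightarrow> ('a, 'b, 'm) vfun" where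
  "mkfun C fo fm =
     \<lparr>FOb = (\<lambda>a. if a \<in> VOb C then fo a else undefined),
      FMap = (\<lambda>a b. if a \<in> VOb C \<and> b \<in> VOb C then fm a b else undefined)\<rparr>"

record ('a, 'o, 'm) promon =
  pten :: "(('a \<times> 'a) \<times> 'a, 'o, 'm) vfun"
  pun :: "('a, 'o, 'm) vfun"
  pasc :: "'a \<Rightarrow> 'a \<Rightarrow> 'a \<Rightarrow> 'a \<Rightarrow> 'm"
  plun :: "'a \<Rightarrow> 'a \<Rightarrow> 'm"
  prun :: "'a \<Rightarrow> 'a \<Rightarrow> 'm"

locale vbase =
  fixes V :: "('o, 'm) smc"
begin

abbreviation cmp (infixr "\<cdot>" 55) where "g \<cdot> f \<equiv> Cmp V g f"
abbreviation hom where "hom \<equiv> Hom V"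
abbreviation idn where "idn \<equiv> Idn V"
abbreviation ten (infixl "\<otimes>" 70) where "a \<otimes> b \<equiv> Ten V a b"
abbreviation tenA (infixl "\<otimes>\<^sub>m" 70) where "f \<otimes>\<^sub>m g \<equiv> TenA V f g"
abbreviation unt ("\<I>") where "\<I> \<equiv> Unt V"
abbreviation ih (infixr "\<multimap>" 60) where "a \<multimap> b \<equiv> IHom V a b"
abbreviation asc where "asc \<equiv> Asc V"
abbreviation lun where "lun \<equiv> Lun V"
abbreviation run where "run \<equiv> Run V"
abbreviation sym where "sym \<equiv> Sym V"
abbreviation ev where "ev \<equiv> Ev V"

definition inverses :: "'m \<Rightarrow> 'm \<Rightarrow> bool" where
  "inverses f g \<longleftrightarrow> f \<in> Ar V \<and> g \<in> hom (Cod V f) (Dom V f) \<and>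
     g \<cdot> f = idn (Dom V f) \<and> f \<cdot> g = idn (Cod V f)"

definition iso :: "'m \<Rightarrow> bool" where
  "iso f \<longleftrightarrow> (\<exists>g. inverses f g)"

definition inv :: "'m \<Rightarrow> 'm" where
  "inv f = (THE g. inverses f g)"

definition mono :: "'m \<Rightarrow> bool" where
  "mono f \<longleftrightarrow> f \<in> Ar V \<and>
     (\<forall>a u v. u \<in> hom a (Dom V f) \<longrightarrow> v \<in> hom a (Dom V f) \<longrightarrow> f \<cdot> u = f \<cdot> v \<longrightarrow> u = v)"

definition is_equaliser :: "'o \<Rightarrow> 'm \<Rightarrow> 'm \<Rightarrow> 'm \<Rightarrow> bool" where
  "is_equaliser e i u v \<longleftrightarrow>
     u \<in> Ar V \<and> v \<in> hom (Dom V u) (Cod V u) \<and> i \<in> hom e (Dom V u) \<and> u \<cdot> i = v \<cdot> i \<and>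
     (\<forall>e' i'. i' \<in> hom e' (Dom V u) \<longrightarrow> u \<cdot> i' = v \<cdot> i' \<longrightarrow> (\<exists>!w. w \<in> hom e' e \<and> i \<cdot> w = i'))"

text \<open>\<open>curry c a b f : c \<rightarrow> [a, b]\<close> for \<open>f : c \<otimes> a \<rightarrow> b\<close>.\<close>

definition curry :: "'o \<Rightarrow> 'o \<Rightarrow> 'o \<Rightarrow> 'm \<Rightarrow> 'm" where
  "curry c a b f = (THE g. g \<in> hom c (a \<multimap> b) \<and> ev a b \<cdot> (g \<otimes>\<^sub>m idn a) = f)"

end

locale symmetric_monoidal_closed = vbase V for V :: "('o, 'm) smc" +
  assumes cat: "category V"
    and ten_ob: "\<lbrakk>a \<in> Ob V; b \<in> Ob V\<rbrakk> \<Longrightarrow> a \<otimes> b \<in> Ob V"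
    and ten_hom: "\<lbrakk>f \<in> hom a a'; g \<in> hom b b'\<rbrakk> \<Longrightarrow> f \<otimes>\<^sub>m g \<in> hom (a \<otimes> b) (a' \<otimes> b')"
    and ten_id: "\<lbrakk>a \<in> Ob V; b \<in> Ob V\<rbrakk> \<Longrightarrow> idn a \<otimes>\<^sub>m idn b = idn (a \<otimes> b)"
    and ten_cmp: "\<lbrakk>f \<in> hom a b; g \<in> hom b c; f' \<in> hom a' b'; g' \<in> hom b' c'\<rbrakk> \<Longrightarrow>
          (g \<cdot> f) \<otimes>\<^sub>m (g' \<cdot> f') = (g \<otimes>\<^sub>m g') \<cdot> (f \<otimes>\<^sub>m f')"
    and unt_ob: "\<I> \<in> Ob V"
    and asc_hom: "\<lbrakk>a \<in> Ob V; b \<in> Ob V; c \<in> Ob V\<rbrakk> \<Longrightarrow>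
          asc a b c \<in> hom ((a \<otimes> b) \<otimes> c) (a \<otimes> (b \<otimes> c)) \<and> iso (asc a b c)"
    and asc_nat: "\<lbrakk>f \<in> hom a a'; g \<in> hom b b'; h \<in> hom c c'\<rbrakk> \<Longrightarrow>
          asc a' b' c' \<cdot> ((f \<otimes>\<^sub>m g) \<otimes>\<^sub>m h) = (f \<otimes>\<^sub>m (g \<otimes>\<^sub>m h)) \<cdot> asc a b c"
    and lun_hom: "a \<in> Ob V \<Longrightarrow> lun a \<in> hom (\<I> \<otimes> a) a \<and> iso (lun a)"
    and lun_nat: "f \<in> hom a b \<Longrightarrow> lun b \<cdot> (idn \<I> \<otimes>\<^sub>m f) = f \<cdot> lun a"
    and run_hom: "a \<in> Ob V \<Longrightarrow> run a \<in> hom (a \<otimes> \<I>) a \<and> iso (run a)"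
    and run_nat: "f \<in> hom a b \<Longrightarrow> run b \<cdot> (f \<otimes>\<^sub>m idn \<I>) = f \<cdot> run a"
    and sym_hom: "\<lbrakk>a \<in> Ob V; b \<in> Ob V\<rbrakk> \<Longrightarrow> sym a b \<in> hom (a \<otimes> b) (b \<otimes> a)"
    and sym_nat: "\<lbrakk>f \<in> hom a a'; g \<in> hom b b'\<rbrakk> \<Longrightarrow>
          sym a' b' \<cdot> (f \<otimes>\<^sub>m g) = (g \<otimes>\<^sub>m f) \<cdot> sym a b"
    and sym_sym: "\<lbrakk>a \<in> Ob V; b \<in> Ob V\<rbrakk> \<Longrightarrow> sym b a \<cdot> sym a b = idn (a \<otimes> b)"
    and pentagon: "\<lbrakk>a \<in> Ob V; b \<in> Ob V; c \<in> Ob V; d \<in> Ob V\<rbrakk> \<Longrightarrow>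
          (idn a \<otimes>\<^sub>m asc b c d) \<cdot> asc a (b \<otimes> c) d \<cdot> (asc a b c \<otimes>\<^sub>m idn d)
            = asc a b (c \<otimes> d) \<cdot> asc (a \<otimes> b) c d"
    and triangle: "\<lbrakk>a \<in> Ob V; b \<in> Ob V\<rbrakk> \<Longrightarrow>
          (idn a \<otimes>\<^sub>m lun b) \<cdot> asc a \<I> b = run a \<otimes>\<^sub>m idn b"
    and hexagon: "\<lbrakk>a \<in> Ob V; b \<in> Ob V; c \<in> Ob V\<rbrakk> \<Longrightarrow>
          asc b c a \<cdot> sym a (b \<otimes> c) \<cdot> asc a b c
            = (idn b \<otimes>\<^sub>m sym a c) \<cdot> asc b a c \<cdot> (sym a b \<otimes>\<^sub>m idn c)"
    and ih_ob: "\<lbrakk>a \<in> Ob V; b \<in> Ob V\<rbrakk> \<Longrightarrow> a \<multimap> b \<in> Ob V"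
    and ev_hom: "\<lbrakk>a \<in> Ob V; b \<in> Ob V\<rbrakk> \<Longrightarrow> ev a b \<in> hom ((a \<multimap> b) \<otimes> a) b"
    and closed: "\<lbrakk>a \<in> Ob V; b \<in> Ob V; c \<in> Ob V; f \<in> hom (c \<otimes> a) b\<rbrakk> \<Longrightarrow>
          \<exists>!g. g \<in> hom c (a \<multimap> b) \<and> ev a b \<cdot> (g \<otimes>\<^sub>m idn a) = f"

text \<open>\<open>*\<close>-autonomy with dualising object \<open>d\<close>: the canonical \<open>a \<rightarrow> [[a, d], d]\<close> is invertible.\<close>

definition (in vbase) dualising :: "'o \<Rightarrow> bool" where
  "dualising d \<longleftrightarrow> d \<in> Ob V \<and>
     (\<forall>a\<in>Ob V. iso (curry a (a \<multimap> d) d (ev a d \<cdot> sym a (a \<multimap> d))))"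

locale star_autonomous_unit = symmetric_monoidal_closed +
  assumes unit_dualising: "dualising \<I>"


section \<open>\<open>\<V>\<close>-categories, \<open>\<V>\<close>-functors, \<open>\<V>\<close>-natural transformations\<close>

context vbase
begin

definition vcategory :: "('a, 'o, 'm) vcat \<Rightarrow> bool" where
  "vcategory C \<longleftrightarrow>
     (\<forall>a\<in>VOb C. \<forall>b\<in>VOb C. VHom C a b \<in> Ob V) \<and>
     (\<forall>a\<in>VOb C. VId C a \<in> hom \<I> (VHom C a a)) \<and>
     (\<forall>a\<in>VOb C. \<forall>b\<in>VOb C. \<forall>c\<in>VOb C. VCmp C a b c \<in> hom (VHom C b c \<otimes> VHom C a b) (VHom C a c)) \<and>
     (\<forall>a\<in>VOb C. \<forall>b\<in>VOb C.
        VCmp C a b b \<cdot> (VId C b \<otimes>\<^sub>m idn (VHom C a b)) = lun (VHom C a b) \<and>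
        VCmp C a a b \<cdot> (idn (VHom C a b) \<otimes>\<^sub>m VId C a) = run (VHom C a b)) \<and>
     (\<forall>a\<in>VOb C. \<forall>b\<in>VOb C. \<forall>c\<in>VOb C. \<forall>d\<in>VOb C.
        VCmp C a b d \<cdot> (VCmp C b c d \<otimes>\<^sub>m idn (VHom C a b))
          = VCmp C a c d \<cdot> (idn (VHom C c d) \<otimes>\<^sub>m VCmp C a b c)
              \<cdot> asc (VHom C c d) (VHom C b c) (VHom C a b))"

definition vfunctor :: "('a, 'o, 'm) vcat \<Rightarrow> ('b, 'o, 'm) vcat \<Rightarrow> ('a, 'b, 'm) vfun \<Rightarrow> bool" where
  "vfunctor C D F \<longleftrightarrow> vcategory C \<and> vcategory D \<and>
     (\<forall>a\<in>VOb C. FOb F a \<in> VOb D) \<and>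
     (\<forall>a\<in>VOb C. \<forall>b\<in>VOb C. FMap F a b \<in> hom (VHom C a b) (VHom D (FOb F a) (FOb F b))) \<and>
     (\<forall>a\<in>VOb C. FMap F a a \<cdot> VId C a = VId D (FOb F a)) \<and>
     (\<forall>a\<in>VOb C. \<forall>b\<in>VOb C. \<forall>c\<in>VOb C.
        FMap F a c \<cdot> VCmp C a b c
          = VCmp D (FOb F a) (FOb F b) (FOb F c) \<cdot> (FMap F b c \<otimes>\<^sub>m FMap F a b)) \<and>
     (\<forall>a. a \<notin> VOb C \<longrightarrow> FOb F a = undefined) \<and>
     (\<forall>a b. \<not> (a \<in> VOb C \<and> b \<in> VOb C) \<longrightarrow> FMap F a b = undefined)"

definition idfun :: "('a, 'o, 'm) vcat \<Rightarrow> ('a, 'a, 'm) vfun" where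
  "idfun C = mkfun C (\<lambda>a. a) (\<lambda>a b. idn (VHom C a b))"

definition compfun ::
    "('a, 'o, 'm) vcat \<Rightarrow> ('b, 'c, 'm) vfun \<Rightarrow> ('a, 'b, 'm) vfun \<Rightarrow> ('a, 'c, 'm) vfun" where
  "compfun C G F =
     mkfun C (\<lambda>a. FOb G (FOb F a)) (\<lambda>a b. FMap G (FOb F a) (FOb F b) \<cdot> FMap F a b)"

text \<open>An arrow \<open>a \<rightarrow> b\<close> of a \<open>\<V>\<close>-category \<open>C\<close>, i.e. of its underlying ordinary category, is an
  arrow \<open>\<I> \<rightarrow> C(a,b)\<close> of \<open>\<V>\<close>.\<close>

definition ucomp :: "('a, 'o, 'm) vcat \<Rightarrow> 'a \<Rightarrow> 'a \<Rightarrow> 'a \<Rightarrow> 'm \<Rightarrow> 'm \<Rightarrow> 'm" where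
  "ucomp C a b c g f = VCmp C a b c \<cdot> (g \<otimes>\<^sub>m f) \<cdot> inv (lun \<I>)"

definition uiso :: "('a, 'o, 'm) vcat \<Rightarrow> 'a \<Rightarrow> 'a \<Rightarrow> 'm \<Rightarrow> bool" where
  "uiso C a b f \<longleftrightarrow> f \<in> hom \<I> (VHom C a b) \<and>
     (\<exists>g. g \<in> hom \<I> (VHom C b a) \<and> ucomp C a b a g f = VId C a \<and> ucomp C b a b f g = VId C b)"

text \<open>\<open>postcomp C a b c e : C(a,b) \<rightarrow> C(a,c)\<close> for \<open>e : b \<rightarrow> c\<close>, and
  \<open>precomp C a b c e : C(b,c) \<rightarrow> C(a,c)\<close> for \<open>e : a \<rightarrow> b\<close>.\<close>

definition postcomp :: "('a, 'o, 'm) vcat \<Rightarrow> 'a \<Rightarrow> 'a \<Rightarrow> 'a \<Rightarrow> 'm \<Rightarrow> 'm" where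
  "postcomp C a b c e = VCmp C a b c \<cdot> (e \<otimes>\<^sub>m idn (VHom C a b)) \<cdot> inv (lun (VHom C a b))"

definition precomp :: "('a, 'o, 'm) vcat \<Rightarrow> 'a \<Rightarrow> 'a \<Rightarrow> 'a \<Rightarrow> 'm \<Rightarrow> 'm" where
  "precomp C a b c e = VCmp C a b c \<cdot> (idn (VHom C b c) \<otimes>\<^sub>m e) \<cdot> inv (run (VHom C b c))"

definition vnat ::
    "('a, 'o, 'm) vcat \<Rightarrow> ('b, 'o, 'm) vcat \<Rightarrow> ('a, 'b, 'm) vfun \<Rightarrow> ('a, 'b, 'm) vfun \<Rightarrow>
     ('a \<Rightarrow> 'm) \<Rightarrow> bool" where
  "vnat C D F G \<theta> \<longleftrightarrow>
     (\<forall>a\<in>VOb C. \<theta> a \<in> hom \<I> (VHom D (FOb F a) (FOb G a))) \<and>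
     (\<forall>a\<in>VOb C. \<forall>b\<in>VOb C.
        postcomp D (FOb F a) (FOb F b) (FOb G b) (\<theta> b) \<cdot> FMap F a b
          = precomp D (FOb F a) (FOb G a) (FOb G b) (\<theta> a) \<cdot> FMap G a b)"

definition vnat_iso ::
    "('a, 'o, 'm) vcat \<Rightarrow> ('b, 'o, 'm) vcat \<Rightarrow> ('a, 'b, 'm) vfun \<Rightarrow> ('a, 'b, 'm) vfun \<Rightarrow>
     ('a \<Rightarrow> 'm) \<Rightarrow> bool" where
  "vnat_iso C D F G \<theta> \<longleftrightarrow>
     vnat C D F G \<theta> \<and> (\<forall>a\<in>VOb C. uiso D (FOb F a) (FOb G a) (\<theta> a))"

definition vequivalence ::
    "('a, 'o, 'm) vcat \<Rightarrow> ('b, 'o, 'm) vcat \<Rightarrow> ('a, 'b, 'm) vfun \<Rightarrow> bool" where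
  "vequivalence C D F \<longleftrightarrow> vfunctor C D F \<and>
     (\<exists>G \<theta> \<phi>. vfunctor D C G \<and>
        vnat_iso C C (idfun C) (compfun C G F) \<theta> \<and>
        vnat_iso D D (compfun D F G) (idfun D) \<phi>)"

definition fully_faithful ::
    "('a, 'o, 'm) vcat \<Rightarrow> ('b, 'o, 'm) vcat \<Rightarrow> ('a, 'b, 'm) vfun \<Rightarrow> bool" where
  "fully_faithful C D F \<longleftrightarrow> vfunctor C D F \<and> (\<forall>a\<in>VOb C. \<forall>b\<in>VOb C. iso (FMap F a b))"

definition faithful ::
    "('a, 'o, 'm) vcat \<Rightarrow> ('b, 'o, 'm) vcat \<Rightarrow> ('a, 'b, 'm) vfun \<Rightarrow> bool" where
  "faithful C D F \<longleftrightarrow> vfunctor C D F \<and> (\<forall>a\<in>VOb C. \<forall>b\<in>VOb C. mono (FMap F a b))"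

definition conservative ::
    "('a, 'o, 'm) vcat \<Rightarrow> ('b, 'o, 'm) vcat \<Rightarrow> ('a, 'b, 'm) vfun \<Rightarrow> bool" where
  "conservative C D F \<longleftrightarrow> vfunctor C D F \<and>
     (\<forall>a\<in>VOb C. \<forall>b\<in>VOb C. \<forall>f. f \<in> hom \<I> (VHom C a b) \<longrightarrow>
        uiso D (FOb F a) (FOb F b) (FMap F a b \<cdot> f) \<longrightarrow> uiso C a b f)"

text \<open>Equalisers in a \<open>\<V>\<close>-category are \<open>\<V>\<close>-enriched: every representable \<open>C(d,-)\<close> sends them to
  equalisers in \<open>\<V>\<close>.\<close>

definition regular_mono :: "('a, 'o, 'm) vcat \<Rightarrow> 'a \<Rightarrow> 'a \<Rightarrow> 'm \<Rightarrow> bool" where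
  "regular_mono C a b e \<longleftrightarrow> e \<in> hom \<I> (VHom C a b) \<and>
     (\<exists>c\<in>VOb C. \<exists>u v. u \<in> hom \<I> (VHom C b c) \<and> v \<in> hom \<I> (VHom C b c) \<and>
        ucomp C a b c u e = ucomp C a b c v e \<and>
        (\<forall>d\<in>VOb C. is_equaliser (VHom C d a) (postcomp C d a b e)
           (postcomp C d b c u) (postcomp C d b c v)))"


section \<open>Opposites, tensor products and partial functors\<close>

definition vop :: "('a, 'o, 'm) vcat \<Rightarrow> ('a, 'o, 'm) vcat" where
  "vop A =
     \<lparr>VOb = VOb A, VHom = (\<lambda>a b. VHom A b a), VId = VId A,
      VCmp = (\<lambda>a b c. VCmp A c b a \<cdot> sym (VHom A c b) (VHom A b a))\<rparr>"

definition mid :: "'o \<Rightarrow> 'o \<Rightarrow> 'o \<Rightarrow> 'o \<Rightarrow> 'm" where  \<comment> \<open>\<open>(a \<otimes> b) \<otimes> (c \<otimes> d) \<rightarrow> (a \<otimes> c) \<otimes> (b \<otimes> d)\<close>\<close>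
  "mid a b c d =
     inv (asc a c (b \<otimes> d))
       \<cdot> (idn a \<otimes>\<^sub>m (asc c b d \<cdot> (sym b c \<otimes>\<^sub>m idn d) \<cdot> inv (asc b c d)))
       \<cdot> asc a b (c \<otimes> d)"

definition vtens :: "('a, 'o, 'm) vcat \<Rightarrow> ('b, 'o, 'm) vcat \<Rightarrow> ('a \<times> 'b, 'o, 'm) vcat" where
  "vtens A B =
     \<lparr>VOb = VOb A \<times> VOb B,
      VHom = (\<lambda>x y. VHom A (fst x) (fst y) \<otimes> VHom B (snd x) (snd y)),
      VId = (\<lambda>x. (VId A (fst x) \<otimes>\<^sub>m VId B (snd x)) \<cdot> inv (lun \<I>)),
      VCmp = (\<lambda>x y z.
        (VCmp A (fst x) (fst y) (fst z) \<otimes>\<^sub>m VCmp B (snd x) (snd y) (snd z))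
          \<cdot> mid (VHom A (fst y) (fst z)) (VHom B (snd y) (snd z))
                (VHom A (fst x) (fst y)) (VHom B (snd x) (snd y)))\<rparr>"

text \<open>\<open>T(a,-)\<close> and \<open>T(-,b)\<close> for \<open>T : A \<otimes> B \<rightarrow> C\<close>.\<close>

definition partR ::
    "('a, 'o, 'm) vcat \<Rightarrow> ('b, 'o, 'm) vcat \<Rightarrow> ('a \<times> 'b, 'c, 'm) vfun \<Rightarrow> 'a \<Rightarrow> ('b, 'c, 'm) vfun" where
  "partR A B T a =
     mkfun B (\<lambda>b. FOb T (a, b))
       (\<lambda>b b'. FMap T (a, b) (a, b') \<cdot> (VId A a \<otimes>\<^sub>m idn (VHom B b b')) \<cdot> inv (lun (VHom B b b')))"

definition partL ::
    "('a, 'o, 'm) vcat \<Rightarrow> ('b, 'o, 'm) vcat \<Rightarrow> ('a \<times> 'b, 'c, 'm) vfun \<Rightarrow> 'b \<Rightarrow> ('a, 'c, 'm) vfun" where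
  "partL A B T b =
     mkfun A (\<lambda>a. FOb T (a, b))
       (\<lambda>a a'. FMap T (a, b) (a', b) \<cdot> (idn (VHom A a a') \<otimes>\<^sub>m VId B b) \<cdot> inv (run (VHom A a a')))"

definition swapfun ::
    "('a, 'o, 'm) vcat \<Rightarrow> ('b, 'o, 'm) vcat \<Rightarrow> ('a \<times> 'b, 'c, 'm) vfun \<Rightarrow> ('b \<times> 'a, 'c, 'm) vfun" where
  "swapfun A B T =
     mkfun (vtens B A) (\<lambda>x. FOb T (snd x, fst x))
       (\<lambda>x y. FMap T (snd x, fst x) (snd y, fst y)
                \<cdot> sym (VHom B (fst x) (fst y)) (VHom A (snd x) (snd y)))"

text \<open>\<open>C(F-, G-) : A\<^sup>o\<^sup>p \<otimes> B \<rightarrow> \<V>\<close> for \<open>F : A \<rightarrow> C\<close> and \<open>G : B \<rightarrow> C\<close>.\<close>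

definition homfun ::
    "('c, 'o, 'm) vcat \<Rightarrow> ('a, 'o, 'm) vcat \<Rightarrow> ('b, 'o, 'm) vcat \<Rightarrow>
     ('a, 'c, 'm) vfun \<Rightarrow> ('b, 'c, 'm) vfun \<Rightarrow> ('a \<times> 'b, 'o, 'm) vfun" where
  "homfun C A B F G =
     mkfun (vtens (vop A) B) (\<lambda>x. VHom C (FOb F (fst x)) (FOb G (snd x)))
       (\<lambda>x y. let a = fst x; b = snd x; a' = fst y; b' = snd y;
                  p = VHom A a' a; q = VHom B b b'; h = VHom C (FOb F a) (FOb G b)
              in curry (p \<otimes> q) h (VHom C (FOb F a') (FOb G b'))
                   (VCmp C (FOb F a') (FOb G b) (FOb G b')
                     \<cdot> (FMap G b b' \<otimes>\<^sub>m
                          (VCmp C (FOb F a') (FOb F a) (FOb G b) \<cdot> (idn h \<otimes>\<^sub>m FMap F a' a)))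
                     \<cdot> asc q h p \<cdot> sym p (q \<otimes> h) \<cdot> asc p q h))"


section \<open>\<open>\<V>\<close>-valued functors, ends and coends\<close>

text \<open>\<open>\<V>\<close> as a \<open>\<V>\<close>-category.\<close>

definition vself :: "('o, 'o, 'm) vcat" where
  "vself =
     \<lparr>VOb = Ob V, VHom = IHom V, VId = (\<lambda>a. curry \<I> a a (lun a)),
      VCmp = (\<lambda>a b c. curry ((b \<multimap> c) \<otimes> (a \<multimap> b)) a c
                (ev b c \<cdot> (idn (b \<multimap> c) \<otimes>\<^sub>m ev a b) \<cdot> asc (b \<multimap> c) (a \<multimap> b) a))\<rparr>"

text \<open>The action \<open>C(x,y) \<otimes> F x \<rightarrow> F y\<close> of a \<open>\<V>\<close>-functor \<open>F : C \<rightarrow> \<V>\<close>.\<close>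

definition act :: "('a, 'o, 'm) vcat \<Rightarrow> ('a, 'o, 'm) vfun \<Rightarrow> 'a \<Rightarrow> 'a \<Rightarrow> 'm" where
  "act C F x y = ev (FOb F x) (FOb F y) \<cdot> (FMap F x y \<otimes>\<^sub>m idn (FOb F x))"

text \<open>A \<open>\<V>\<close>-natural isomorphism between \<open>\<V>\<close>-valued functors, with components given as arrows
  \<open>F x \<rightarrow> G x\<close> of \<open>\<V>\<close> rather than as \<open>\<I> \<rightarrow> [F x, G x]\<close>, and naturality in uncurried form.\<close>

definition vnat_iso_V ::
    "('a, 'o, 'm) vcat \<Rightarrow> ('a, 'o, 'm) vfun \<Rightarrow> ('a, 'o, 'm) vfun \<Rightarrow> ('a \<Rightarrow> 'm) \<Rightarrow> bool" where
  "vnat_iso_V C F G \<theta> \<longleftrightarrow>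
     (\<forall>x\<in>VOb C. \<theta> x \<in> hom (FOb F x) (FOb G x) \<and> iso (\<theta> x)) \<and>
     (\<forall>x\<in>VOb C. \<forall>y\<in>VOb C.
        \<theta> y \<cdot> act C F x y = act C G x y \<cdot> (idn (VHom C x y) \<otimes>\<^sub>m \<theta> x))"

text \<open>Ends and coends of \<open>T : A\<^sup>o\<^sup>p \<otimes> A \<rightarrow> \<V>\<close>.  The dinaturality conditions are equations
  between arrows \<open>A(a,b) \<otimes> e \<rightarrow> T(a,b)\<close> and \<open>A(a,b) \<otimes> T(b,a) \<rightarrow> c\<close>.\<close>

definition is_wedge ::
    "('a, 'o, 'm) vcat \<Rightarrow> ('a \<times> 'a, 'o, 'm) vfun \<Rightarrow> 'o \<Rightarrow> ('a \<Rightarrow> 'm) \<Rightarrow> bool" where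
  "is_wedge A T e \<pi> \<longleftrightarrow>
     e \<in> Ob V \<and> (\<forall>a\<in>VOb A. \<pi> a \<in> hom e (FOb T (a, a))) \<and>
     (\<forall>a\<in>VOb A. \<forall>b\<in>VOb A.
        act A (partR (vop A) A T a) a b \<cdot> (idn (VHom A a b) \<otimes>\<^sub>m \<pi> a)
          = act (vop A) (partL (vop A) A T b) b a \<cdot> (idn (VHom A a b) \<otimes>\<^sub>m \<pi> b))"

definition is_end ::
    "('a, 'o, 'm) vcat \<Rightarrow> ('a \<times> 'a, 'o, 'm) vfun \<Rightarrow> 'o \<Rightarrow> ('a \<Rightarrow> 'm) \<Rightarrow> bool" where
  "is_end A T e \<pi> \<longleftrightarrow> is_wedge A T e \<pi> \<and>
     (\<forall>e' \<pi>'. is_wedge A T e' \<pi>' \<longrightarrow>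
        (\<exists>!u. u \<in> hom e' e \<and> (\<forall>a\<in>VOb A. \<pi> a \<cdot> u = \<pi>' a)))"

definition is_cowedge ::
    "('a, 'o, 'm) vcat \<Rightarrow> ('a \<times> 'a, 'o, 'm) vfun \<Rightarrow> 'o \<Rightarrow> ('a \<Rightarrow> 'm) \<Rightarrow> bool" where
  "is_cowedge A T c \<iota> \<longleftrightarrow>
     c \<in> Ob V \<and> (\<forall>a\<in>VOb A. \<iota> a \<in> hom (FOb T (a, a)) c) \<and>
     (\<forall>a\<in>VOb A. \<forall>b\<in>VOb A.
        \<iota> b \<cdot> act A (partR (vop A) A T b) a b = \<iota> a \<cdot> act (vop A) (partL (vop A) A T a) b a)"

definition is_coend ::
    "('a, 'o, 'm) vcat \<Rightarrow> ('a \<times> 'a, 'o, 'm) vfun \<Rightarrow> 'o \<Rightarrow> ('a \<Rightarrow> 'm) \<Rightarrow> bool" where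
  "is_coend A T c \<iota> \<longleftrightarrow> is_cowedge A T c \<iota> \<and>
     (\<forall>c' \<iota>'. is_cowedge A T c' \<iota>' \<longrightarrow>
        (\<exists>!u. u \<in> hom c c' \<and> (\<forall>a\<in>VOb A. u \<cdot> \<iota> a = \<iota>' a)))"

definition the_end :: "('a, 'o, 'm) vcat \<Rightarrow> ('a \<times> 'a, 'o, 'm) vfun \<Rightarrow> 'o \<times> ('a \<Rightarrow> 'm)" where
  "the_end A T = (SOME x. is_end A T (fst x) (snd x))"

definition endob :: "('a, 'o, 'm) vcat \<Rightarrow> ('a \<times> 'a, 'o, 'm) vfun \<Rightarrow> 'o" where
  "endob A T = fst (the_end A T)"

definition endproj :: "('a, 'o, 'm) vcat \<Rightarrow> ('a \<times> 'a, 'o, 'm) vfun \<Rightarrow> 'a \<Rightarrow> 'm" where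
  "endproj A T = snd (the_end A T)"

definition the_coend :: "('a, 'o, 'm) vcat \<Rightarrow> ('a \<times> 'a, 'o, 'm) vfun \<Rightarrow> 'o \<times> ('a \<Rightarrow> 'm)" where
  "the_coend A T = (SOME x. is_coend A T (fst x) (snd x))"

definition coend :: "('a, 'o, 'm) vcat \<Rightarrow> ('a \<times> 'a, 'o, 'm) vfun \<Rightarrow> 'o" where
  "coend A T = fst (the_coend A T)"

definition coproj :: "('a, 'o, 'm) vcat \<Rightarrow> ('a \<times> 'a, 'o, 'm) vfun \<Rightarrow> 'a \<Rightarrow> 'm" where
  "coproj A T = snd (the_coend A T)"

text \<open>Actions \<open>P \<otimes> \<integral>\<^sup>a S(a,a) \<rightarrow> \<integral>\<^sup>a S'(a,a)\<close> and \<open>P \<otimes> \<integral>\<^sub>a S(a,a) \<rightarrow> \<integral>\<^sub>a S'(a,a)\<close> induced by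
  families \<open>t a : P \<otimes> S(a,a) \<rightarrow> S'(a,a)\<close>.\<close>

definition coend_act ::
    "('a, 'o, 'm) vcat \<Rightarrow> 'o \<Rightarrow> ('a \<times> 'a, 'o, 'm) vfun \<Rightarrow> ('a \<times> 'a, 'o, 'm) vfun \<Rightarrow> ('a \<Rightarrow> 'm) \<Rightarrow> 'm" where
  "coend_act A P S S' t =
     (THE u. u \<in> hom (P \<otimes> coend A S) (coend A S') \<and>
        (\<forall>a\<in>VOb A. u \<cdot> (idn P \<otimes>\<^sub>m coproj A S a) = coproj A S' a \<cdot> t a))"

definition end_act ::
    "('a, 'o, 'm) vcat \<Rightarrow> 'o \<Rightarrow> ('a \<times> 'a, 'o, 'm) vfun \<Rightarrow> ('a \<times> 'a, 'o, 'm) vfun \<Rightarrow> ('a \<Rightarrow> 'm) \<Rightarrow> 'm" where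
  "end_act A P S S' t =
     (THE u. u \<in> hom (P \<otimes> endob A S) (endob A S') \<and>
        (\<forall>a\<in>VOb A. endproj A S' a \<cdot> u = t a \<cdot> (idn P \<otimes>\<^sub>m endproj A S a)))"

text \<open>The \<open>\<V>\<close>-functor \<open>b \<mapsto> \<integral>\<^sup>a S b (a,a)\<close> of a family \<open>S b\<close> that is functorial in \<open>b\<close>
  through actions \<open>t b b' a : B(b,b') \<otimes> S b (a,a) \<rightarrow> S b' (a,a)\<close>.\<close>

definition coend_fun ::
    "('b, 'o, 'm) vcat \<Rightarrow> ('a, 'o, 'm) vcat \<Rightarrow> ('b \<Rightarrow> ('a \<times> 'a, 'o, 'm) vfun) \<Rightarrow>
     ('b \<Rightarrow> 'b \<Rightarrow> 'a \<Rightarrow> 'm) \<Rightarrow> ('b, 'o, 'm) vfun" where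
  "coend_fun B A S t =
     mkfun B (\<lambda>b. coend A (S b))
       (\<lambda>b b'. curry (VHom B b b') (coend A (S b)) (coend A (S b'))
                 (coend_act A (VHom B b b') (S b) (S b') (t b b')))"

text \<open>\<open>(a,b) \<mapsto> F a \<otimes> G b\<close> for \<open>F : A \<rightarrow> \<V>\<close> and \<open>G : B \<rightarrow> \<V>\<close>.\<close>

definition tensfun ::
    "('a, 'o, 'm) vcat \<Rightarrow> ('b, 'o, 'm) vcat \<Rightarrow> ('a, 'o, 'm) vfun \<Rightarrow> ('b, 'o, 'm) vfun \<Rightarrow>
     ('a \<times> 'b, 'o, 'm) vfun" where
  "tensfun A B F G =
     mkfun (vtens A B) (\<lambda>x. FOb F (fst x) \<otimes> FOb G (snd x))
       (\<lambda>x y. let a = fst x; b = snd x; a' = fst y; b' = snd y;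
                  p = VHom A a a'; q = VHom B b b'
              in curry (p \<otimes> q) (FOb F a \<otimes> FOb G b) (FOb F a' \<otimes> FOb G b')
                   ((act A F a a' \<otimes>\<^sub>m act B G b b') \<cdot> mid p q (FOb F a) (FOb G b)))"

text \<open>The functors \<open>A\<^sup>o\<^sup>p \<otimes> A \<rightarrow> \<V>\<close> whose coends are \<open>\<integral>\<^sup>a F a \<otimes> G a\<close>, where in \<open>covten\<close> the
  first factor is the covariant one and in \<open>contraten\<close> the second.\<close>

definition covten ::
    "('a, 'o, 'm) vcat \<Rightarrow> ('a, 'o, 'm) vfun \<Rightarrow> ('a, 'o, 'm) vfun \<Rightarrow> ('a \<times> 'a, 'o, 'm) vfun" where
  "covten A F G = swapfun A (vop A) (tensfun A (vop A) F G)"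

definition contraten ::
    "('a, 'o, 'm) vcat \<Rightarrow> ('a, 'o, 'm) vfun \<Rightarrow> ('a, 'o, 'm) vfun \<Rightarrow> ('a \<times> 'a, 'o, 'm) vfun" where
  "contraten A F G = tensfun (vop A) A F G"

definition whL :: "'o \<Rightarrow> 'o \<Rightarrow> 'o \<Rightarrow> 'm \<Rightarrow> 'm" where  \<comment> \<open>\<open>h \<otimes> (u \<otimes> v) \<rightarrow> u' \<otimes> v\<close> from \<open>h \<otimes> u \<rightarrow> u'\<close>\<close>
  "whL h u v f = (f \<otimes>\<^sub>m idn v) \<cdot> inv (asc h u v)"

definition exch :: "'o \<Rightarrow> 'o \<Rightarrow> 'o \<Rightarrow> 'm" where  \<comment> \<open>\<open>h \<otimes> (u \<otimes> v) \<rightarrow> u \<otimes> (h \<otimes> v)\<close>\<close>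
  "exch h u v = asc u h v \<cdot> (sym h u \<otimes>\<^sub>m idn v) \<cdot> inv (asc h u v)"

definition whR :: "'o \<Rightarrow> 'o \<Rightarrow> 'o \<Rightarrow> 'm \<Rightarrow> 'm" where  \<comment> \<open>\<open>h \<otimes> (u \<otimes> v) \<rightarrow> u \<otimes> v'\<close> from \<open>h \<otimes> v \<rightarrow> v'\<close>\<close>
  "whR h u v f = (idn u \<otimes>\<^sub>m f) \<cdot> exch h u v"

text \<open>\<open>par1\<close> is \<open>b \<mapsto> \<integral>\<^sup>a F(b,a) \<otimes> G a\<close>, where \<open>F\<close> is given by its partial functors
  \<open>F b = F(b,-)\<close> and \<open>F' a = F(-,a)\<close>; \<open>par2\<close> is \<open>b \<mapsto> \<integral>\<^sup>a F a \<otimes> G(b,a)\<close>.  The argument \<open>tn\<close> is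
  \<open>covten\<close> or \<open>contraten\<close>.\<close>

definition par1 ::
    "(('a, 'o, 'm) vcat \<Rightarrow> ('a, 'o, 'm) vfun \<Rightarrow> ('a, 'o, 'm) vfun \<Rightarrow> ('a \<times> 'a, 'o, 'm) vfun) \<Rightarrow>
     ('b, 'o, 'm) vcat \<Rightarrow> ('a, 'o, 'm) vcat \<Rightarrow> ('b \<Rightarrow> ('a, 'o, 'm) vfun) \<Rightarrow>
     ('a \<Rightarrow> ('b, 'o, 'm) vfun) \<Rightarrow> ('a, 'o, 'm) vfun \<Rightarrow> ('b, 'o, 'm) vfun" where
  "par1 tn B A F F' G =
     coend_fun B A (\<lambda>b. tn A (F b) G)
       (\<lambda>b b' a. whL (VHom B b b') (FOb (F b) a) (FOb G a) (act B (F' a) b b'))"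

definition par2 ::
    "(('a, 'o, 'm) vcat \<Rightarrow> ('a, 'o, 'm) vfun \<Rightarrow> ('a, 'o, 'm) vfun \<Rightarrow> ('a \<times> 'a, 'o, 'm) vfun) \<Rightarrow>
     ('b, 'o, 'm) vcat \<Rightarrow> ('a, 'o, 'm) vcat \<Rightarrow> ('a, 'o, 'm) vfun \<Rightarrow>
     ('b \<Rightarrow> ('a, 'o, 'm) vfun) \<Rightarrow> ('a \<Rightarrow> ('b, 'o, 'm) vfun) \<Rightarrow> ('b, 'o, 'm) vfun" where
  "par2 tn B A F G G' =
     coend_fun B A (\<lambda>b. tn A F (G b))
       (\<lambda>b b' a. whR (VHom B b b') (FOb F a) (FOb (G b) a) (act B (G' a) b b'))"


section \<open>The functor \<open>\<V>\<close>-category \<open>[A, \<V>]\<close>\<close>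

definition nhom :: "('a, 'o, 'm) vcat \<Rightarrow> ('a, 'o, 'm) vfun \<Rightarrow> ('a, 'o, 'm) vfun \<Rightarrow> 'o" where
  "nhom A F G = endob A (homfun vself A A F G)"

definition nproj :: "('a, 'o, 'm) vcat \<Rightarrow> ('a, 'o, 'm) vfun \<Rightarrow> ('a, 'o, 'm) vfun \<Rightarrow> 'a \<Rightarrow> 'm" where
  "nproj A F G = endproj A (homfun vself A A F G)"

definition fcat :: "('a, 'o, 'm) vcat \<Rightarrow> (('a, 'o, 'm) vfun, 'o, 'm) vcat" where
  "fcat A =
     \<lparr>VOb = {F. vfunctor A vself F},
      VHom = nhom A,
      VId = (\<lambda>F. THE u. u \<in> hom \<I> (nhom A F F) \<and>
               (\<forall>a\<in>VOb A. nproj A F F a \<cdot> u = VId vself (FOb F a))),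
      VCmp = (\<lambda>F G H. THE u. u \<in> hom (nhom A G H \<otimes> nhom A F G) (nhom A F H) \<and>
               (\<forall>a\<in>VOb A. nproj A F H a \<cdot> u
                  = VCmp vself (FOb F a) (FOb G a) (FOb H a) \<cdot> (nproj A G H a \<otimes>\<^sub>m nproj A F G a)))\<rparr>"

end


section \<open>Promonoidal \<open>\<V>\<close>-categories\<close>

locale promonoidal_data = vbase V for V :: "('o, 'm) smc" +
  fixes A :: "('a, 'o, 'm) vcat" and P :: "('a, 'o, 'm) promon"
begin

definition p12 :: "'a \<Rightarrow> ('a \<times> 'a, 'o, 'm) vfun" where  \<comment> \<open>\<open>p(-,-,c)\<close>\<close>
  "p12 c = partL (vtens (vop A) (vop A)) A (pten P) c"

definition p1 :: "'a \<Rightarrow> 'a \<Rightarrow> ('a, 'o, 'm) vfun" where  \<comment> \<open>\<open>p(-,b,c)\<close>\<close>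
  "p1 b c = partL (vop A) (vop A) (p12 c) b"

definition p2 :: "'a \<Rightarrow> 'a \<Rightarrow> ('a, 'o, 'm) vfun" where  \<comment> \<open>\<open>p(a,-,c)\<close>\<close>
  "p2 a c = partR (vop A) (vop A) (p12 c) a"

definition p3 :: "'a \<Rightarrow> 'a \<Rightarrow> ('a, 'o, 'm) vfun" where  \<comment> \<open>\<open>p(a,b,-)\<close>\<close>
  "p3 a b = partR (vtens (vop A) (vop A)) A (pten P) (a, b)"

definition pob :: "'a \<Rightarrow> 'a \<Rightarrow> 'a \<Rightarrow> 'o" where
  "pob a b c = FOb (pten P) ((a, b), c)"

abbreviation (input) \<alpha> where "\<alpha> \<equiv> pasc P"
abbreviation (input) jf where "jf \<equiv> pun P"

text \<open>\<open>L(a,b,c,d) = \<integral>\<^sup>x p(a,b,x) \<otimes> p(x,c,d)\<close> and \<open>R(a,b,c,d) = \<integral>\<^sup>x p(b,c,x) \<otimes> p(a,x,d)\<close>, as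
  \<open>\<V>\<close>-functors of each variable.\<close>

definition "L1 b c d = par1 covten (vop A) A (\<lambda>a. p3 a b) (\<lambda>x. p1 b x) (p1 c d)"
definition "L2 a c d = par1 covten (vop A) A (\<lambda>b. p3 a b) (\<lambda>x. p2 a x) (p1 c d)"
definition "L3 a b d = par2 covten (vop A) A (p3 a b) (\<lambda>c. p1 c d) (\<lambda>x. p2 x d)"
definition "L4 a b c = par2 covten A A (p3 a b) (\<lambda>d. p1 c d) (\<lambda>x. p3 x c)"

definition "R1 b c d = par2 covten (vop A) A (p3 b c) (\<lambda>a. p2 a d) (\<lambda>x. p1 x d)"
definition "R2 a c d = par1 covten (vop A) A (\<lambda>b. p3 b c) (\<lambda>x. p1 c x) (p2 a d)"
definition "R3 a b d = par1 covten (vop A) A (\<lambda>c. p3 b c) (\<lambda>x. p2 b x) (p2 a d)"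
definition "R4 a b c = par2 covten A A (p3 b c) (\<lambda>d. p2 a d) (\<lambda>x. p3 a x)"

definition assoc_iso :: bool where
  "assoc_iso \<longleftrightarrow>
     (\<forall>b\<in>VOb A. \<forall>c\<in>VOb A. \<forall>d\<in>VOb A. vnat_iso_V (vop A) (L1 b c d) (R1 b c d) (\<lambda>a. \<alpha> a b c d)) \<and>
     (\<forall>a\<in>VOb A. \<forall>c\<in>VOb A. \<forall>d\<in>VOb A. vnat_iso_V (vop A) (L2 a c d) (R2 a c d) (\<lambda>b. \<alpha> a b c d)) \<and>
     (\<forall>a\<in>VOb A. \<forall>b\<in>VOb A. \<forall>d\<in>VOb A. vnat_iso_V (vop A) (L3 a b d) (R3 a b d) (\<lambda>c. \<alpha> a b c d)) \<and>
     (\<forall>a\<in>VOb A. \<forall>b\<in>VOb A. \<forall>c\<in>VOb A. vnat_iso_V A (L4 a b c) (R4 a b c) (\<lambda>d. \<alpha> a b c d))"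

definition homA :: "('a \<times> 'a, 'o, 'm) vfun" where
  "homA = homfun A A A (idfun A) (idfun A)"

text \<open>\<open>plun P a b : \<integral>\<^sup>x j(x) \<otimes> p(x,a,b) \<rightarrow> A(a,b)\<close> and
  \<open>prun P a b : \<integral>\<^sup>x j(x) \<otimes> p(a,x,b) \<rightarrow> A(a,b)\<close>.\<close>

definition unit_iso :: bool where
  "unit_iso \<longleftrightarrow>
     (\<forall>b\<in>VOb A. vnat_iso_V (vop A) (par2 covten (vop A) A jf (\<lambda>a. p1 a b) (\<lambda>x. p2 x b))
                   (partL (vop A) A homA b) (\<lambda>a. plun P a b)) \<and>
     (\<forall>a\<in>VOb A. vnat_iso_V A (par2 covten A A jf (\<lambda>b. p1 a b) (\<lambda>x. p3 x a))
                   (partR (vop A) A homA a) (\<lambda>b. plun P a b)) \<and>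
     (\<forall>b\<in>VOb A. vnat_iso_V (vop A) (par2 covten (vop A) A jf (\<lambda>a. p2 a b) (\<lambda>x. p1 x b))
                   (partL (vop A) A homA b) (\<lambda>a. prun P a b)) \<and>
     (\<forall>a\<in>VOb A. vnat_iso_V A (par2 covten A A jf (\<lambda>b. p2 a b) (\<lambda>x. p3 a x))
                   (partR (vop A) A homA a) (\<lambda>b. prun P a b))"

text \<open>\<open>ct F G = \<integral>\<^sup>x F x \<otimes> G x\<close> with coprojections \<open>inj F G x\<close>.\<close>

definition ct :: "('a, 'o, 'm) vfun \<Rightarrow> ('a, 'o, 'm) vfun \<Rightarrow> 'o" where
  "ct F G = coend A (covten A F G)"

definition inj :: "('a, 'o, 'm) vfun \<Rightarrow> ('a, 'o, 'm) vfun \<Rightarrow> 'a \<Rightarrow> 'm" where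
  "inj F G x = coproj A (covten A F G) x"

definition ctmap ::
    "('a, 'o, 'm) vfun \<Rightarrow> ('a, 'o, 'm) vfun \<Rightarrow> ('a, 'o, 'm) vfun \<Rightarrow> ('a, 'o, 'm) vfun \<Rightarrow>
     ('a \<Rightarrow> 'm) \<Rightarrow> 'm" where
  "ctmap F G F' G' t =
     (THE u. u \<in> hom (ct F G) (ct F' G') \<and> (\<forall>x\<in>VOb A. u \<cdot> inj F G x = inj F' G' x \<cdot> t x))"

text \<open>The map out of a double coend \<open>s\<close> with coprojections \<open>i x y\<close> that has components \<open>k x y\<close>.\<close>

definition factor2 :: "'o \<Rightarrow> 'o \<Rightarrow> ('a \<Rightarrow> 'a \<Rightarrow> 'm) \<Rightarrow> ('a \<Rightarrow> 'a \<Rightarrow> 'm) \<Rightarrow> 'm" where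
  "factor2 s s' i k =
     (THE u. u \<in> hom s s' \<and> (\<forall>x\<in>VOb A. \<forall>y\<in>VOb A. u \<cdot> i x y = k x y))"

text \<open>The pentagon.  \<open>path1\<close> is
    \<open>\<integral>\<^sup>y L(a,b,c,y) \<otimes> p(y,d,e) \<rightarrow> \<integral>\<^sup>y R(a,b,c,y) \<otimes> p(y,d,e) \<cong> \<integral>\<^sup>x p(b,c,x) \<otimes> L(a,x,d,e)
      \<rightarrow> \<integral>\<^sup>x p(b,c,x) \<otimes> R(a,x,d,e) \<cong> \<integral>\<^sup>z L(b,c,d,z) \<otimes> p(a,z,e) \<rightarrow> \<integral>\<^sup>z R(b,c,d,z) \<otimes> p(a,z,e)\<close>
  and \<open>path2\<close> is
    \<open>\<integral>\<^sup>y L(a,b,c,y) \<otimes> p(y,d,e) \<cong> \<integral>\<^sup>x p(a,b,x) \<otimes> L(x,c,d,e) \<rightarrow> \<integral>\<^sup>x p(a,b,x) \<otimes> R(x,c,d,e)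
      \<cong> \<integral>\<^sup>w p(c,d,w) \<otimes> L(a,b,w,e) \<rightarrow> \<integral>\<^sup>w p(c,d,w) \<otimes> R(a,b,w,e) \<cong> \<integral>\<^sup>z R(b,c,d,z) \<otimes> p(a,z,e)\<close>.\<close>

definition path1 :: "'a \<Rightarrow> 'a \<Rightarrow> 'a \<Rightarrow> 'a \<Rightarrow> 'a \<Rightarrow> 'm" where
  "path1 a b c d e =
     ctmap (L4 b c d) (p2 a e) (R4 b c d) (p2 a e) (\<lambda>z. \<alpha> b c d z \<otimes>\<^sub>m idn (pob a z e))
     \<cdot> factor2 (ct (p3 b c) (R2 a d e)) (ct (L4 b c d) (p2 a e))
         (\<lambda>x z. inj (p3 b c) (R2 a d e) x
                  \<cdot> (idn (pob b c x) \<otimes>\<^sub>m inj (p3 x d) (p2 a e) z))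
         (\<lambda>x z. inj (L4 b c d) (p2 a e) z
                  \<cdot> (inj (p3 b c) (p1 d z) x \<otimes>\<^sub>m idn (pob a z e))
                  \<cdot> inv (asc (pob b c x) (pob x d z) (pob a z e)))
     \<cdot> ctmap (p3 b c) (L2 a d e) (p3 b c) (R2 a d e) (\<lambda>x. idn (pob b c x) \<otimes>\<^sub>m \<alpha> a x d e)
     \<cdot> factor2 (ct (R4 a b c) (p1 d e)) (ct (p3 b c) (L2 a d e))
         (\<lambda>x y. inj (R4 a b c) (p1 d e) y
                  \<cdot> (inj (p3 b c) (p2 a y) x \<otimes>\<^sub>m idn (pob y d e)))
         (\<lambda>x y. inj (p3 b c) (L2 a d e) x
                  \<cdot> (idn (pob b c x) \<otimes>\<^sub>m inj (p3 a x) (p1 d e) y)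
                  \<cdot> asc (pob b c x) (pob a x y) (pob y d e))
     \<cdot> ctmap (L4 a b c) (p1 d e) (R4 a b c) (p1 d e) (\<lambda>y. \<alpha> a b c y \<otimes>\<^sub>m idn (pob y d e))"

definition path2 :: "'a \<Rightarrow> 'a \<Rightarrow> 'a \<Rightarrow> 'a \<Rightarrow> 'a \<Rightarrow> 'm" where
  "path2 a b c d e =
     factor2 (ct (p3 c d) (R3 a b e)) (ct (R4 b c d) (p2 a e))
         (\<lambda>w z. inj (p3 c d) (R3 a b e) w
                  \<cdot> (idn (pob c d w) \<otimes>\<^sub>m inj (p3 b w) (p2 a e) z))
         (\<lambda>w z. inj (R4 b c d) (p2 a e) z
                  \<cdot> (inj (p3 c d) (p2 b z) w \<otimes>\<^sub>m idn (pob a z e))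
                  \<cdot> inv (asc (pob c d w) (pob b w z) (pob a z e)))
     \<cdot> ctmap (p3 c d) (L3 a b e) (p3 c d) (R3 a b e) (\<lambda>w. idn (pob c d w) \<otimes>\<^sub>m \<alpha> a b w e)
     \<cdot> factor2 (ct (p3 a b) (R1 c d e)) (ct (p3 c d) (L3 a b e))
         (\<lambda>x w. inj (p3 a b) (R1 c d e) x
                  \<cdot> (idn (pob a b x) \<otimes>\<^sub>m inj (p3 c d) (p2 x e) w))
         (\<lambda>x w. inj (p3 c d) (L3 a b e) w
                  \<cdot> (idn (pob c d w) \<otimes>\<^sub>m inj (p3 a b) (p1 w e) x)
                  \<cdot> exch (pob a b x) (pob c d w) (pob x w e))
     \<cdot> ctmap (p3 a b) (L1 c d e) (p3 a b) (R1 c d e) (\<lambda>x. idn (pob a b x) \<otimes>\<^sub>m \<alpha> x c d e)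
     \<cdot> factor2 (ct (L4 a b c) (p1 d e)) (ct (p3 a b) (L1 c d e))
         (\<lambda>x y. inj (L4 a b c) (p1 d e) y
                  \<cdot> (inj (p3 a b) (p1 c y) x \<otimes>\<^sub>m idn (pob y d e)))
         (\<lambda>x y. inj (p3 a b) (L1 c d e) x
                  \<cdot> (idn (pob a b x) \<otimes>\<^sub>m inj (p3 x c) (p1 d e) y)
                  \<cdot> asc (pob a b x) (pob x c y) (pob y d e))"

text \<open>The unit triangle.  For each \<open>y\<close>, \<open>tri_r a b c y : j(y) \<otimes> L(a,y,b,c) \<rightarrow> p(a,b,c)\<close> is induced by
  \<open>j(y) \<otimes> p(a,y,x) \<otimes> p(x,b,c) \<rightarrow> A(a,x) \<otimes> p(x,b,c) \<rightarrow> p(a,b,c)\<close> and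
  \<open>tri_l a b c y : j(y) \<otimes> R(a,y,b,c) \<rightarrow> p(a,b,c)\<close> by
  \<open>j(y) \<otimes> p(y,b,x) \<otimes> p(a,x,c) \<rightarrow> A(b,x) \<otimes> p(a,x,c) \<rightarrow> p(a,b,c)\<close>; the domain of the triangle,
  \<open>\<integral>\<^sup>y j(y) \<otimes> L(a,y,b,c)\<close>, is tested on its coprojections.\<close>

definition tri_r :: "'a \<Rightarrow> 'a \<Rightarrow> 'a \<Rightarrow> 'a \<Rightarrow> 'm" where
  "tri_r a b c y =
     (THE u. u \<in> hom (FOb jf y \<otimes> ct (p3 a y) (p1 b c)) (pob a b c) \<and>
        (\<forall>x\<in>VOb A. u \<cdot> (idn (FOb jf y) \<otimes>\<^sub>m inj (p3 a y) (p1 b c) x)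
           = act (vop A) (p1 b c) x a
               \<cdot> ((prun P a x \<cdot> inj jf (p2 a x) y) \<otimes>\<^sub>m idn (pob x b c))
               \<cdot> inv (asc (FOb jf y) (pob a y x) (pob x b c))))"

definition tri_l :: "'a \<Rightarrow> 'a \<Rightarrow> 'a \<Rightarrow> 'a \<Rightarrow> 'm" where
  "tri_l a b c y =
     (THE u. u \<in> hom (FOb jf y \<otimes> ct (p3 y b) (p2 a c)) (pob a b c) \<and>
        (\<forall>x\<in>VOb A. u \<cdot> (idn (FOb jf y) \<otimes>\<^sub>m inj (p3 y b) (p2 a c) x)
           = act (vop A) (p2 a c) x b
               \<cdot> ((plun P b x \<cdot> inj jf (p1 b x) y) \<otimes>\<^sub>m idn (pob a x c))
               \<cdot> inv (asc (FOb jf y) (pob y b x) (pob a x c))))"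

definition promonoidal :: bool where
  "promonoidal \<longleftrightarrow>
     vcategory A \<and>
     vfunctor (vtens (vtens (vop A) (vop A)) A) vself (pten P) \<and>
     vfunctor A vself jf \<and>
     assoc_iso \<and> unit_iso \<and>
     (\<forall>a\<in>VOb A. \<forall>b\<in>VOb A. \<forall>c\<in>VOb A. \<forall>d\<in>VOb A. \<forall>e\<in>VOb A. path1 a b c d e = path2 a b c d e) \<and>
     (\<forall>a\<in>VOb A. \<forall>b\<in>VOb A. \<forall>c\<in>VOb A. \<forall>y\<in>VOb A.
        tri_r a b c y = tri_l a b c y \<cdot> (idn (FOb jf y) \<otimes>\<^sub>m \<alpha> a y b c))"

end


section \<open>Kernels, the Kan adjunction and its Kleisli category\<close>

locale kernel_data = vbase V for V :: "('o, 'm) smc" +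
  fixes A :: "('a, 'o, 'm) vcat" and X :: "('x, 'o, 'm) vcat"
    and K :: "('a \<times> 'x, 'o, 'm) vfun"
begin

definition Kl :: "'x \<Rightarrow> ('a, 'o, 'm) vfun" where  \<comment> \<open>\<open>K(-,x) : A\<^sup>o\<^sup>p \<rightarrow> \<V>\<close>\<close>
  "Kl x = partL (vop A) X K x"

definition Kr :: "'a \<Rightarrow> ('x, 'o, 'm) vfun" where  \<comment> \<open>\<open>K(a,-) : X \<rightarrow> \<V>\<close>\<close>
  "Kr a = partR (vop A) X K a"

definition Kbar_ob :: "('a, 'o, 'm) vfun \<Rightarrow> ('x, 'o, 'm) vfun" where
  "Kbar_ob f = par1 contraten X A Kl Kr f"

definition Kbar_map :: "('a, 'o, 'm) vfun \<Rightarrow> ('a, 'o, 'm) vfun \<Rightarrow> 'm" where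
  "Kbar_map f g =
     (THE u. u \<in> hom (nhom A f g) (nhom X (Kbar_ob f) (Kbar_ob g)) \<and>
        (\<forall>x\<in>VOb X. nproj X (Kbar_ob f) (Kbar_ob g) x \<cdot> u
           = curry (nhom A f g) (coend A (contraten A (Kl x) f)) (coend A (contraten A (Kl x) g))
               (coend_act A (nhom A f g) (contraten A (Kl x) f) (contraten A (Kl x) g)
                 (\<lambda>a. whR (nhom A f g) (FOb K (a, x)) (FOb f a)
                        (ev (FOb f a) (FOb g a) \<cdot> (nproj A f g a \<otimes>\<^sub>m idn (FOb f a)))))))"

definition Kbar :: "(('a, 'o, 'm) vfun, ('x, 'o, 'm) vfun, 'm) vfun" where
  "Kbar = mkfun (fcat A) Kbar_ob Kbar_map"

text \<open>The functor whose end over \<open>X\<close> is \<open>\<integral>\<^sub>x [K(a,x), g(x)]\<close>.\<close>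

definition Kg :: "('x, 'o, 'm) vfun \<Rightarrow> 'a \<Rightarrow> ('x \<times> 'x, 'o, 'm) vfun" where
  "Kg g a = homfun vself X X (Kr a) g"

definition Kund_ob :: "('x, 'o, 'm) vfun \<Rightarrow> ('a, 'o, 'm) vfun" where
  "Kund_ob g =
     mkfun A (\<lambda>a. endob X (Kg g a))
       (\<lambda>a b. curry (VHom A a b) (endob X (Kg g a)) (endob X (Kg g b))
          (end_act X (VHom A a b) (Kg g a) (Kg g b)
            (\<lambda>x. VCmp vself (FOb K (b, x)) (FOb K (a, x)) (FOb g x)
                   \<cdot> (idn (FOb K (a, x) \<multimap> FOb g x) \<otimes>\<^sub>m FMap (Kl x) b a)
                   \<cdot> sym (VHom A a b) (FOb K (a, x) \<multimap> FOb g x))))"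

definition Kund_map :: "('x, 'o, 'm) vfun \<Rightarrow> ('x, 'o, 'm) vfun \<Rightarrow> 'm" where
  "Kund_map g h =
     (THE u. u \<in> hom (nhom X g h) (nhom A (Kund_ob g) (Kund_ob h)) \<and>
        (\<forall>a\<in>VOb A. nproj A (Kund_ob g) (Kund_ob h) a \<cdot> u
           = curry (nhom X g h) (endob X (Kg g a)) (endob X (Kg h a))
               (end_act X (nhom X g h) (Kg g a) (Kg h a)
                 (\<lambda>x. VCmp vself (FOb K (a, x)) (FOb g x) (FOb h x)
                        \<cdot> (nproj X g h x \<otimes>\<^sub>m idn (FOb K (a, x) \<multimap> FOb g x))))))"

definition Kund :: "(('x, 'o, 'm) vfun, ('a, 'o, 'm) vfun, 'm) vfun" where
  "Kund = mkfun (fcat X) Kund_ob Kund_map"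

text \<open>The component \<open>f a \<rightarrow> \<integral>\<^sub>x [K(a,x), \<integral>\<^sup>b K(b,x) \<otimes> f b]\<close> of the unit is the transpose of the
  coprojections; the component \<open>\<integral>\<^sup>a K(a,x) \<otimes> \<integral>\<^sub>y [K(a,y), g y] \<rightarrow> g x\<close> of the counit is induced by
  projection to \<open>y = x\<close> followed by evaluation.\<close>

definition eta_at :: "('a, 'o, 'm) vfun \<Rightarrow> 'a \<Rightarrow> 'm" where
  "eta_at f a =
     (THE u. u \<in> hom (FOb f a) (endob X (Kg (Kbar_ob f) a)) \<and>
        (\<forall>x\<in>VOb X. endproj X (Kg (Kbar_ob f) a) x \<cdot> u
           = curry (FOb f a) (FOb K (a, x)) (coend A (contraten A (Kl x) f))
               (coproj A (contraten A (Kl x) f) a \<cdot> sym (FOb f a) (FOb K (a, x)))))"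

definition eps_at :: "('x, 'o, 'm) vfun \<Rightarrow> 'x \<Rightarrow> 'm" where
  "eps_at g x =
     (THE u. u \<in> hom (coend A (contraten A (Kl x) (Kund_ob g))) (FOb g x) \<and>
        (\<forall>a\<in>VOb A. u \<cdot> coproj A (contraten A (Kl x) (Kund_ob g)) a
           = ev (FOb K (a, x)) (FOb g x)
               \<cdot> sym (FOb K (a, x)) (FOb K (a, x) \<multimap> FOb g x)
               \<cdot> (idn (FOb K (a, x)) \<otimes>\<^sub>m endproj X (Kg g a) x)))"

definition eta :: "('a, 'o, 'm) vfun \<Rightarrow> 'm" where  \<comment> \<open>\<open>\<I> \<rightarrow> [A,\<V>](f, Kund (Kbar f))\<close>\<close>
  "eta f =
     (let h = Kund_ob (Kbar_ob f) in
      THE u. u \<in> hom \<I> (nhom A f h) \<and>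
        (\<forall>a\<in>VOb A. nproj A f h a \<cdot> u = curry \<I> (FOb f a) (FOb h a) (eta_at f a \<cdot> lun (FOb f a))))"

definition eps :: "('x, 'o, 'm) vfun \<Rightarrow> 'm" where  \<comment> \<open>\<open>\<I> \<rightarrow> [X,\<V>](Kbar (Kund g), g)\<close>\<close>
  "eps g =
     (let h = Kbar_ob (Kund_ob g) in
      THE u. u \<in> hom \<I> (nhom X h g) \<and>
        (\<forall>x\<in>VOb X. nproj X h g x \<cdot> u = curry \<I> (FOb h x) (FOb g x) (eps_at g x \<cdot> lun (FOb h x))))"

end

context vbase
begin

text \<open>The Kleisli \<open>\<V>\<close>-category of a \<open>\<V>\<close>-monad \<open>(T, \<mu>, \<eta>)\<close> on \<open>C\<close>, its canonical functor, and, if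
  the monad comes from \<open>L : C \<rightarrow> D\<close>, \<open>R : D \<rightarrow> C\<close> with counit \<open>\<epsilon>\<close>, the canonical comparison to \<open>D\<close>,
  which on homs is \<open>C(a, R L b) \<rightarrow> D(L a, L R L b) \<rightarrow> D(L a, L b)\<close>.\<close>

definition kleisli ::
    "('c, 'o, 'm) vcat \<Rightarrow> ('c, 'c, 'm) vfun \<Rightarrow> ('c \<Rightarrow> 'm) \<Rightarrow> ('c \<Rightarrow> 'm) \<Rightarrow> ('c, 'o, 'm) vcat" where
  "kleisli C T \<mu> \<eta> =
     \<lparr>VOb = VOb C,
      VHom = (\<lambda>a b. VHom C a (FOb T b)),
      VId = \<eta>,
      VCmp = (\<lambda>a b c.
        let Tb = FOb T b; Tc = FOb T c; TTc = FOb T Tc in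
        VCmp C a Tb Tc
          \<cdot> ((postcomp C Tb TTc Tc (\<mu> c) \<cdot> FMap T b Tc) \<otimes>\<^sub>m idn (VHom C a Tb)))\<rparr>"

definition kleisli_functor ::
    "('c, 'o, 'm) vcat \<Rightarrow> ('c, 'c, 'm) vfun \<Rightarrow> ('c \<Rightarrow> 'm) \<Rightarrow> ('c, 'c, 'm) vfun" where
  "kleisli_functor C T \<eta> = mkfun C (\<lambda>a. a) (\<lambda>a b. postcomp C a b (FOb T b) (\<eta> b))"

definition kleisli_comparison ::
    "('c, 'o, 'm) vcat \<Rightarrow> ('d, 'o, 'm) vcat \<Rightarrow> ('c, 'd, 'm) vfun \<Rightarrow> ('d, 'c, 'm) vfun \<Rightarrow>
     ('d \<Rightarrow> 'm) \<Rightarrow> ('c, 'd, 'm) vfun" where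
  "kleisli_comparison C D L R \<epsilon> =
     mkfun C (FOb L)
       (\<lambda>a b. let La = FOb L a; Lb = FOb L b; RLb = FOb R Lb in
          postcomp D La (FOb L RLb) Lb (\<epsilon> Lb) \<cdot> FMap L a RLb)"

end

context kernel_data
begin

definition T :: "(('a, 'o, 'm) vfun, ('a, 'o, 'm) vfun, 'm) vfun" where
  "T = compfun (fcat A) Kund Kbar"

definition mu :: "('a, 'o, 'm) vfun \<Rightarrow> 'm" where
  "mu f = FMap Kund (FOb Kbar (FOb Kund (FOb Kbar f))) (FOb Kbar f) \<cdot> eps (FOb Kbar f)"

definition Kleisli :: "(('a, 'o, 'm) vfun, 'o, 'm) vcat" where  \<comment> \<open>\<open>[A,\<V>]\<^sub>T\<close>\<close>
  "Kleisli = kleisli (fcat A) T mu eta"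

definition Kbar_T :: "(('a, 'o, 'm) vfun, ('a, 'o, 'm) vfun, 'm) vfun" where
  "Kbar_T = kleisli_functor (fcat A) T eta"

definition Kcomp :: "(('a, 'o, 'm) vfun, ('x, 'o, 'm) vfun, 'm) vfun" where  \<comment> \<open>\<open>[A,\<V>]\<^sub>T \<rightarrow> [X,\<V>]\<close>\<close>
  "Kcomp = kleisli_comparison (fcat A) (fcat X) Kbar Kund eps"


section \<open>The Joyal-Wiener category\<close>

text \<open>The two maps \<open>[X,\<V>](Kbar f, Kbar g) \<rightarrow> [X,\<V>](Kbar f, Kbar (Kund (Kbar g)))\<close>.\<close>

definition joy_u :: "('a, 'o, 'm) vfun \<Rightarrow> ('a, 'o, 'm) vfun \<Rightarrow> 'm" where
  "joy_u f g =
     (let Bf = FOb Kbar f; Bg = FOb Kbar g; Tf = FOb Kund Bf; Tg = FOb Kund Bg in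
      precomp (fcat X) Bf (FOb Kbar Tf) (FOb Kbar Tg) (FMap Kbar f Tf \<cdot> eta f)
        \<cdot> FMap Kbar Tf Tg \<cdot> FMap Kund Bf Bg)"

definition joy_v :: "('a, 'o, 'm) vfun \<Rightarrow> ('a, 'o, 'm) vfun \<Rightarrow> 'm" where
  "joy_v f g =
     (let Bf = FOb Kbar f; Bg = FOb Kbar g; Tg = FOb Kund Bg in
      postcomp (fcat X) Bf Bg (FOb Kbar Tg) (FMap Kbar g Tg \<cdot> eta g))"

definition the_joy :: "('a, 'o, 'm) vfun \<Rightarrow> ('a, 'o, 'm) vfun \<Rightarrow> 'o \<times> 'm" where
  "the_joy f g = (SOME z. is_equaliser (fst z) (snd z) (joy_u f g) (joy_v f g))"

definition joy_hom :: "('a, 'o, 'm) vfun \<Rightarrow> ('a, 'o, 'm) vfun \<Rightarrow> 'o" where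
  "joy_hom f g = fst (the_joy f g)"

definition joy_incl :: "('a, 'o, 'm) vfun \<Rightarrow> ('a, 'o, 'm) vfun \<Rightarrow> 'm" where
    \<comment> \<open>\<open>Joy(f,g) \<rightarrow> [X,\<V>](Kbar f, Kbar g)\<close>\<close>
  "joy_incl f g = snd (the_joy f g)"

definition joy_incl_T :: "('a, 'o, 'm) vfun \<Rightarrow> ('a, 'o, 'm) vfun \<Rightarrow> 'm" where
    \<comment> \<open>\<open>Joy(f,g) \<rightarrow> [X,\<V>](Kbar f, Kbar g) \<cong> [A,\<V>]\<^sub>T(f,g)\<close>\<close>
  "joy_incl_T f g = inv (FMap Kcomp f g) \<cdot> joy_incl f g"

text \<open>Identities and composition are the restrictions of those of \<open>[A,\<V>]\<^sub>T\<close>.\<close>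

definition Joy :: "(('a, 'o, 'm) vfun, 'o, 'm) vcat" where
  "Joy =
     \<lparr>VOb = VOb (fcat A),
      VHom = joy_hom,
      VId = (\<lambda>f. THE u. u \<in> hom \<I> (joy_hom f f) \<and> joy_incl_T f f \<cdot> u = VId Kleisli f),
      VCmp = (\<lambda>f g h. THE u. u \<in> hom (joy_hom g h \<otimes> joy_hom f g) (joy_hom f h) \<and>
                joy_incl_T f h \<cdot> u
                  = VCmp Kleisli f g h \<cdot> (joy_incl_T g h \<otimes>\<^sub>m joy_incl_T f g))\<rparr>"

definition joy_sub :: "(('a, 'o, 'm) vfun, ('a, 'o, 'm) vfun, 'm) vfun" where  \<comment> \<open>\<open>Joy \<rightarrow> [A,\<V>]\<^sub>T\<close>\<close>
  "joy_sub = mkfun Joy (\<lambda>f. f) joy_incl_T"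

definition joy_emb :: "(('a, 'o, 'm) vfun, ('x, 'o, 'm) vfun, 'm) vfun" where  \<comment> \<open>\<open>Joy \<rightarrow> [X,\<V>]\<close>\<close>
  "joy_emb = mkfun Joy (FOb Kbar) joy_incl"

definition joy_equiv :: "(('a, 'o, 'm) vfun, ('a, 'o, 'm) vfun, 'm) vfun" where  \<comment> \<open>\<open>[A,\<V>] \<rightarrow> Joy\<close>\<close>
  "joy_equiv =
     mkfun (fcat A) (\<lambda>f. f)
       (\<lambda>f g. THE u. u \<in> hom (nhom A f g) (joy_hom f g) \<and> joy_incl f g \<cdot> u = FMap Kbar f g)"

end


section \<open>Multiplicative kernels\<close>

locale mult_kernel_data = kernel_data V A X K + PA: promonoidal_data V A PA + PX: promonoidal_data V X PX
  for V :: "('o, 'm) smc" and A :: "('a, 'o, 'm) vcat" and X :: "('x, 'o, 'm) vcat"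
    and K :: "('a \<times> 'x, 'o, 'm) vfun"
    and PA :: "('a, 'o, 'm) promon" and PX :: "('x, 'o, 'm) promon" +
  fixes k2 :: "'a \<Rightarrow> 'a \<Rightarrow> 'x \<Rightarrow> 'm" and k0 :: "'x \<Rightarrow> 'm"
begin

definition KK :: "'a \<Rightarrow> 'a \<Rightarrow> ('x \<times> 'x, 'o, 'm) vfun" where  \<comment> \<open>\<open>(y,z) \<mapsto> K(a,y) \<otimes> K(b,z)\<close>\<close>
  "KK a b = tensfun X X (Kr a) (Kr b)"

definition KK' :: "'x \<Rightarrow> 'x \<Rightarrow> ('a \<times> 'a, 'o, 'm) vfun" where  \<comment> \<open>\<open>(a,b) \<mapsto> K(a,y) \<otimes> K(b,z)\<close>\<close>
  "KK' y z = tensfun (vop A) (vop A) (Kl y) (Kl z)"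

text \<open>\<open>k2 a b x : \<integral>\<^sup>y\<^sup>z (K(a,y) \<otimes> K(b,z)) \<otimes> p(y,z,x) \<rightarrow> \<integral>\<^sup>c K(c,x) \<otimes> p(a,b,c)\<close>, where the coend on
  the left is over \<open>X \<otimes> X\<close>, and \<open>k0 x : j(x) \<rightarrow> \<integral>\<^sup>c K(c,x) \<otimes> j(c)\<close>.\<close>

definition multiplicative_kernel :: bool where
  "multiplicative_kernel \<longleftrightarrow>
     vfunctor (vtens (vop A) X) vself K \<and>
     (\<forall>b\<in>VOb A. \<forall>x\<in>VOb X. vnat_iso_V (vop A)
        (par1 covten (vop A) (vtens X X) (\<lambda>a. KK a b)
           (\<lambda>yz. partL (vop A) (vop A) (KK' (fst yz) (snd yz)) b) (PX.p12 x))
        (par2 contraten (vop A) A (Kl x) (\<lambda>a. PA.p3 a b) (\<lambda>c. PA.p1 b c))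
        (\<lambda>a. k2 a b x)) \<and>
     (\<forall>a\<in>VOb A. \<forall>x\<in>VOb X. vnat_iso_V (vop A)
        (par1 covten (vop A) (vtens X X) (\<lambda>b. KK a b)
           (\<lambda>yz. partR (vop A) (vop A) (KK' (fst yz) (snd yz)) a) (PX.p12 x))
        (par2 contraten (vop A) A (Kl x) (\<lambda>b. PA.p3 a b) (\<lambda>c. PA.p2 a c))
        (\<lambda>b. k2 a b x)) \<and>
     (\<forall>a\<in>VOb A. \<forall>b\<in>VOb A. vnat_iso_V X
        (par2 covten X (vtens X X) (KK a b) (\<lambda>x. PX.p12 x) (\<lambda>yz. PX.p3 (fst yz) (snd yz)))
        (par1 contraten X A Kl Kr (PA.p3 a b))
        (\<lambda>x. k2 a b x)) \<and>
     vnat_iso_V X (pun PX) (par1 contraten X A Kl Kr (pun PA)) k0"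

end

end

theory Submission
  imports Defs
begin

text \<open>The adjunction \<open>Kbar \<stileturn> Kund\<close> is one instance of an adjunction \<open>L
  \<stileturn> R : D \<rightarrow> C\<close> of \<open>\<V>\<close>-categories whose unit
  \<open>\<eta>\<close> consists of regular monomorphisms, and the theorem holds for all of these.

  On homs, the comparison from the Kleisli category to \<open>D\<close> is the transposition
  \<open>C(a, R L b) \<cong> D(L a, L b)\<close> (lemma \<open>KlC_iso\<close>), so it is fully
  faithful. Composing it with \<open>\<eta>\<close> gives back \<open>L\<close>.

  The main point is that an arrow \<open>\<alpha> : L a \<rightarrow> L b\<close> is regular,
  \<open>L R \<alpha> \<circ> L \<eta> = L \<eta> \<circ> \<alpha>\<close>, exactly if it is of
  the form \<open>L \<beta>\<close>, with a unique \<open>\<beta>\<close>. Arrows of this form are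
  regular by naturality of \<open>\<eta>\<close>, and \<open>\<beta>\<close> is unique because
  \<open>\<eta>\<close> is mono. Conversely, if \<open>\<eta> b\<close> is the equaliser of
  \<open>u\<close> and \<open>v\<close>, then regularity of \<open>\<alpha>\<close> makes the
  transpose of \<open>\<alpha>\<close> equalise \<open>u\<close> and \<open>v\<close>, so it
  factors through \<open>\<eta> b\<close>, and the factor is \<open>\<beta>\<close>. Carried out
  inside \<open>\<V>\<close>, this says that \<open>C(a,b) \<rightarrow> D(L a, L b)\<close> is an
  equaliser of the pair of maps that defines the Joyal-Wiener hom (theorem
  \<open>L_equaliser\<close>). So \<open>C\<close> is isomorphic to the Joyal-Wiener category by a
  functor that is the identity on objects. The inverse of a regular arrow is regular, which makes
  \<open>L\<close> reflect isomorphisms (lemma \<open>L_reflects_iso\<close>) and gives the two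
  statements on conservativity.

  What remains is to see that \<open>[A,\<V>]\<close>, \<open>Kbar\<close> and \<open>Kund\<close>
  exist and form an adjunction of \<open>\<V>\<close>-categories (theorem
  \<open>Kan_adjunction\<close>). Ends are built from products and equalisers. Coends are their
  duals under \<open>a \<mapsto> [a, \<I>]\<close>, and this is where \<open>\<V>\<close> has to
  be \<open>*\<close>-autonomous with dualising object \<open>\<I>\<close> (lemma
  \<open>wcolim_exists\<close>).

  All laws of functors and transformations are verified in a calculus of generalised elements:
  arrows out of a tensor product of named variables. Pairs are formed over disjoint sets of
  variables, and on pairs the associator, the symmetry and the unitors act as they do for sets.
  The coherence theorem behind this is proved once (lemmas \<open>unmerge_comm\<close> and
  \<open>unmerge_assoc\<close>). Arrows are equal if they agree on variables, elements of
  \<open>[a,b]\<close> if they agree on a fresh variable, and arrows out of a coend if they agree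
  on coprojections; after these reductions each law is a chain of rewriting steps as for sets.\<close>

context vbase
begin

abbreviation arrow_ten (infixl "**" 70) where "f ** g \<equiv> TenA V f g"

end

context symmetric_monoidal_closed
begin

section \<open>Arrows and isomorphisms\<close>

lemma hom_iff: "f \<in> hom a b \<longleftrightarrow> f \<in> Ar V \<and> Dom V f = a \<and> Cod V f = b"
  by (auto simp: Hom_def)

lemma ar_ob [simp]:
  assumes "f \<in> Ar V" shows "Dom V f \<in> Ob V" "Cod V f \<in> Ob V"
  using cat assms by (auto simp: category_def)

lemma idn_ar [simp]:
  assumes "a \<in> Ob V" shows "idn a \<in> Ar V" "Dom V (idn a) = a" "Cod V (idn a) = a"
  using cat assms by (auto simp: category_def hom_iff)

lemma cmp_ar [simp]:
  assumes "f \<in> Ar V" "g \<in> Ar V" "Cod V f = Dom V g"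
  shows "g \<cdot> f \<in> Ar V" "Dom V (g \<cdot> f) = Dom V f" "Cod V (g \<cdot> f) = Cod V g"
  using cat assms unfolding category_def hom_iff by blast+

lemma cmp_id [simp]:
  assumes "f \<in> Ar V"
  shows "Dom V f = a \<Longrightarrow> f \<cdot> idn a = f" "Cod V f = a \<Longrightarrow> idn a \<cdot> f = f"
  using cat assms unfolding category_def hom_iff by blast+

lemma cmp_assoc [simp]:
  assumes "f \<in> Ar V" "g \<in> Ar V" "h \<in> Ar V" "Cod V f = Dom V g" "Cod V g = Dom V h"
  shows "(h \<cdot> g) \<cdot> f = h \<cdot> g \<cdot> f"
  using cat assms unfolding category_def hom_iff by metis

declare ten_ob [simp] unt_ob [simp] ih_ob [simp] ten_id [simp]

lemma ten_ar [simp]: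
  assumes "f \<in> Ar V" "g \<in> Ar V"
  shows "f ** g \<in> Ar V" "Dom V (f ** g) = Dom V f \<otimes> Dom V g"
    "Cod V (f ** g) = Cod V f \<otimes> Cod V g"
  using ten_hom[of f "Dom V f" "Cod V f" g "Dom V g" "Cod V g"] assms by (auto simp: hom_iff)

lemma ten_comp:
  assumes "f \<in> Ar V" "g \<in> Ar V" "f' \<in> Ar V" "g' \<in> Ar V" "Cod V f = Dom V g" "Cod V f' = Dom V g'"
  shows "(g ** g') \<cdot> (f ** f') = (g \<cdot> f) ** (g' \<cdot> f')"
  using ten_cmp assms by (auto simp: hom_iff)

lemma ten_comp':
  assumes "f \<in> Ar V" "g \<in> Ar V" "f' \<in> Ar V" "g' \<in> Ar V" "Cod V f = Dom V g" "Cod V f' = Dom V g'"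
    "k \<in> Ar V" "Cod V k = Dom V f \<otimes> Dom V f'"
  shows "(g ** g') \<cdot> (f ** f') \<cdot> k = ((g \<cdot> f) ** (g' \<cdot> f')) \<cdot> k"
proof -
  have "((g ** g') \<cdot> (f ** f')) \<cdot> k = (g ** g') \<cdot> (f ** f') \<cdot> k" using assms by simp
  then show ?thesis using assms by (simp add: ten_comp)
qed

subsection \<open>Isomorphisms\<close>

lemma inverses_unique: "inverses f g \<Longrightarrow> inverses f h \<Longrightarrow> g = h"
proof -
  assume a: "inverses f g" "inverses f h"
  then have "(g \<cdot> f) \<cdot> h = h" "g \<cdot> (f \<cdot> h) = g"
    by (auto simp: inverses_def hom_iff simp del: cmp_assoc)
  moreover have "(g \<cdot> f) \<cdot> h = g \<cdot> f \<cdot> h"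
    by (rule cmp_assoc) (use a in \<open>auto simp: inverses_def hom_iff\<close>)
  ultimately show ?thesis by simp
qed

lemma inv_eq: "inverses f g \<Longrightarrow> inv f = g"
  unfolding inv_def by (blast intro: the_equality inverses_unique)

lemma inverses_inv: "iso f \<Longrightarrow> inverses f (inv f)"
  by (metis inv_eq iso_def)

lemma iso_ar: "iso f \<Longrightarrow> f \<in> Ar V"
  by (auto simp: iso_def inverses_def)

lemma inv_ar [simp]:
  assumes "iso f"
  shows "inv f \<in> Ar V" "Dom V (inv f) = Cod V f" "Cod V (inv f) = Dom V f"
  using inverses_inv[OF assms] by (auto simp: inverses_def hom_iff)

lemma inv_cmp [simp]:
  assumes "iso f"
  shows "inv f \<cdot> f = idn (Dom V f)" "f \<cdot> inv f = idn (Cod V f)"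
  using inverses_inv[OF assms] by (auto simp: inverses_def hom_iff)

lemma inv_cmp' [simp]:
  assumes "iso f" "k \<in> Ar V"
  shows "Cod V k = Dom V f \<Longrightarrow> inv f \<cdot> f \<cdot> k = k" "Cod V k = Cod V f \<Longrightarrow> f \<cdot> inv f \<cdot> k = k"
proof -
  assume "Cod V k = Dom V f"
  then have "inv f \<cdot> f \<cdot> k = (inv f \<cdot> f) \<cdot> k" using assms iso_ar[OF assms(1)] by (subst cmp_assoc) auto
  then show "inv f \<cdot> f \<cdot> k = k" using assms \<open>Cod V k = Dom V f\<close> by simp
next
  assume "Cod V k = Cod V f"
  then have "f \<cdot> inv f \<cdot> k = (f \<cdot> inv f) \<cdot> k" using assms iso_ar[OF assms(1)] by (subst cmp_assoc) auto
  then show "f \<cdot> inv f \<cdot> k = k" using assms \<open>Cod V k = Cod V f\<close> by simp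
qed

lemma isoI:
  assumes "f \<in> Ar V" "g \<in> Ar V" "Dom V g = Cod V f" "Cod V g = Dom V f"
    "g \<cdot> f = idn (Dom V f)" "f \<cdot> g = idn (Cod V f)"
  shows "iso f" "inv f = g"
proof -
  have "inverses f g" using assms by (auto simp: inverses_def hom_iff)
  then show "iso f" "inv f = g" by (auto simp: iso_def inv_eq)
qed

lemma iso_inv [simp]: "iso f \<Longrightarrow> iso (inv f)" "iso f \<Longrightarrow> inv (inv f) = f"
  by (rule isoI[of _ f]; simp add: iso_ar)+

lemma iso_idn [simp]: "a \<in> Ob V \<Longrightarrow> iso (idn a)" "a \<in> Ob V \<Longrightarrow> inv (idn a) = idn a"
  by (rule isoI[of _ "idn a"]; simp)+

lemma iso_cmp:
  assumes "iso f" "iso g" "Cod V f = Dom V g"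
  shows "iso (g \<cdot> f)" "inv (g \<cdot> f) = inv f \<cdot> inv g"
  using assms iso_ar by (intro isoI[of "g \<cdot> f" "inv f \<cdot> inv g"]; simp)+

lemma iso_ten [simp]:
  assumes "iso f" "iso g"
  shows "iso (f ** g)" "inv (f ** g) = inv f ** inv g"
  using assms iso_ar by (intro isoI[of "f ** g" "inv f ** inv g"]; simp add: ten_comp)+

lemma iso_cancelL:
  assumes "iso f" "g \<in> Ar V" "h \<in> Ar V" "Cod V g = Dom V f" "Cod V h = Dom V f" "f \<cdot> g = f \<cdot> h"
  shows "g = h"
  using assms inv_cmp'(1) by metis

lemma iso_cancelR:
  assumes "iso f" "g \<in> Ar V" "h \<in> Ar V" "Dom V g = Cod V f" "Dom V h = Cod V f" "g \<cdot> f = h \<cdot> f"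
  shows "g = h"
proof -
  have "g = (g \<cdot> f) \<cdot> inv f" using assms(1-5) iso_ar[OF assms(1)] by simp
  also have "\<dots> = (h \<cdot> f) \<cdot> inv f" unfolding assms(6) ..
  also have "\<dots> = h" using assms(1-5) iso_ar[OF assms(1)] by simp
  finally show ?thesis .
qed

lemma asc_ar [simp]:
  assumes "a \<in> Ob V" "b \<in> Ob V" "c \<in> Ob V"
  shows "asc a b c \<in> Ar V" "Dom V (asc a b c) = (a \<otimes> b) \<otimes> c"
    "Cod V (asc a b c) = a \<otimes> (b \<otimes> c)" "iso (asc a b c)"
  using asc_hom assms by (auto simp: hom_iff)

lemma lun_ar [simp]:
  assumes "a \<in> Ob V"
  shows "lun a \<in> Ar V" "Dom V (lun a) = \<I> \<otimes> a" "Cod V (lun a) = a" "iso (lun a)"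
  using lun_hom assms by (auto simp: hom_iff)

lemma run_ar [simp]:
  assumes "a \<in> Ob V"
  shows "run a \<in> Ar V" "Dom V (run a) = a \<otimes> \<I>" "Cod V (run a) = a" "iso (run a)"
  using run_hom assms by (auto simp: hom_iff)

lemma sym_ar [simp]:
  assumes "a \<in> Ob V" "b \<in> Ob V"
  shows "sym a b \<in> Ar V" "Dom V (sym a b) = a \<otimes> b" "Cod V (sym a b) = b \<otimes> a"
  using sym_hom assms by (auto simp: hom_iff)

lemma sym_iso [simp]:
  assumes "a \<in> Ob V" "b \<in> Ob V"
  shows "iso (sym a b)" "inv (sym a b) = sym b a"
  using assms by (intro isoI[of "sym a b" "sym b a"]; simp add: sym_sym)+

lemma ev_ar [simp]:
  assumes "a \<in> Ob V" "b \<in> Ob V"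
  shows "ev a b \<in> Ar V" "Dom V (ev a b) = (a \<multimap> b) \<otimes> a" "Cod V (ev a b) = b"
  using ev_hom assms by (auto simp: hom_iff)

lemma asc_natural:
  assumes "f \<in> Ar V" "g \<in> Ar V" "h \<in> Ar V"
  shows "(f ** (g ** h)) \<cdot> asc (Dom V f) (Dom V g) (Dom V h)
    = asc (Cod V f) (Cod V g) (Cod V h) \<cdot> ((f ** g) ** h)"
  by (rule asc_nat[symmetric]) (use assms in \<open>auto simp: hom_iff\<close>)

lemma asc_inv_natural:
  assumes "f \<in> Ar V" "g \<in> Ar V" "h \<in> Ar V"
  shows "((f ** g) ** h) \<cdot> inv (asc (Dom V f) (Dom V g) (Dom V h))
    = inv (asc (Cod V f) (Cod V g) (Cod V h)) \<cdot> (f ** (g ** h))"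
proof (rule iso_cancelL[where f = "asc (Cod V f) (Cod V g) (Cod V h)"])
  let ?i = "asc (Dom V f) (Dom V g) (Dom V h)"
  have "asc (Cod V f) (Cod V g) (Cod V h) \<cdot> ((f ** g) ** h) \<cdot> inv ?i
    = (asc (Cod V f) (Cod V g) (Cod V h) \<cdot> ((f ** g) ** h)) \<cdot> inv ?i" using assms by simp
  also have "\<dots> = f ** (g ** h)" using assms by (simp flip: asc_natural)
  finally show "asc (Cod V f) (Cod V g) (Cod V h) \<cdot> ((f ** g) ** h) \<cdot> inv ?i
    = asc (Cod V f) (Cod V g) (Cod V h) \<cdot> inv (asc (Cod V f) (Cod V g) (Cod V h)) \<cdot> (f ** (g ** h))"
    using assms by simp
qed (use assms in simp_all)

text \<open>Tensoring with \<open>\<I>\<close> is naturally isomorphic to the identity functor.\<close>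

lemma ten_unit_faithful:
  assumes "f \<in> Ar V" "g \<in> Ar V" "Dom V f = Dom V g" "Cod V f = Cod V g"
  shows "idn \<I> ** f = idn \<I> ** g \<Longrightarrow> f = g" "f ** idn \<I> = g ** idn \<I> \<Longrightarrow> f = g"
proof -
  assume e: "idn \<I> ** f = idn \<I> ** g"
  have "f \<cdot> lun (Dom V f) = g \<cdot> lun (Dom V f)"
    using lun_nat[of f "Dom V f" "Cod V f"] lun_nat[of g "Dom V f" "Cod V f"] e assms by (simp add: hom_iff)
  then show "f = g" by (rule iso_cancelR[rotated -1]) (use assms in simp_all)
next
  assume e: "f ** idn \<I> = g ** idn \<I>"
  have "f \<cdot> run (Dom V f) = g \<cdot> run (Dom V f)"
    using run_nat[of f "Dom V f" "Cod V f"] run_nat[of g "Dom V f" "Cod V f"] e assms by (simp add: hom_iff)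
  then show "f = g" by (rule iso_cancelR[rotated -1]) (use assms in simp_all)
qed

section \<open>Coherence\<close>

text \<open>Composites are kept associated to the right, where an equation \<open>g \<cdot> f = h\<close>
  can only rewrite a tail. In this form it also rewrites in the middle.\<close>

lemma trail:
  assumes "g \<cdot> f = h" "f \<in> Ar V" "g \<in> Ar V" "Cod V f = Dom V g" "k \<in> Ar V" "Cod V k = Dom V f"
  shows "g \<cdot> f \<cdot> k = h \<cdot> k"
  using cmp_assoc[of k f g] assms by simp

lemma trail3:
  assumes "a \<cdot> g \<cdot> f = h" "f \<in> Ar V" "g \<in> Ar V" "a \<in> Ar V" "Cod V f = Dom V g" "Cod V g = Dom V a"
    "k \<in> Ar V" "Cod V k = Dom V f"
  shows "a \<cdot> g \<cdot> f \<cdot> k = h \<cdot> k"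
  using trail[of a "g \<cdot> f" h k] assms by simp

lemma asc_nat3:
  assumes "f \<in> Ar V" "g \<in> Ar V" "h \<in> Ar V" "Dom V f = a" "Dom V g = b" "Dom V h = c"
    "Cod V f = a'" "Cod V g = b'" "Cod V h = c'"
  shows "asc a' b' c' \<cdot> ((f ** g) ** h) = (f ** (g ** h)) \<cdot> asc a b c"
    "inv (asc a' b' c') \<cdot> (f ** (g ** h)) = ((f ** g) ** h) \<cdot> inv (asc a b c)"
  using asc_natural[of f g h] asc_inv_natural[of f g h] assms by auto

lemma wh_comp:
  assumes "f \<in> Ar V" "g \<in> Ar V" "Cod V f = Dom V g" "a \<in> Ob V"
  shows "(idn a ** g) \<cdot> (idn a ** f) = idn a ** (g \<cdot> f)"
    "(g ** idn a) \<cdot> (f ** idn a) = (g \<cdot> f) ** idn a"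
  using assms by (simp_all add: ten_comp)

text \<open>Kelly's argument: \<open>\<I> \<otimes> -\<close> is faithful, and after applying it the
  equation follows from the pentagon for \<open>\<I>, \<I>, a, b\<close> and the triangles for
  \<open>\<I>, a\<close> and \<open>\<I>, a \<otimes> b\<close>.\<close>

lemma lun_ten:
  assumes [simp]: "a \<in> Ob V" "b \<in> Ob V"
  shows "lun (a \<otimes> b) \<cdot> asc \<I> a b = lun a ** idn b"
proof (rule ten_unit_faithful(1), simp_all)
  let ?k = "asc \<I> (\<I> \<otimes> a) b \<cdot> (asc \<I> \<I> a ** idn b)"
  have "(idn \<I> ** (lun (a \<otimes> b) \<cdot> asc \<I> a b)) \<cdot> ?k
    = (idn \<I> ** lun (a \<otimes> b)) \<cdot> (idn \<I> ** asc \<I> a b) \<cdot> ?k"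
    by (simp flip: wh_comp)
  also have "\<dots> = ((idn \<I> ** lun (a \<otimes> b)) \<cdot> asc \<I> \<I> (a \<otimes> b)) \<cdot> asc (\<I> \<otimes> \<I>) a b"
    by (simp add: pentagon)
  also have "\<dots> = (run \<I> ** (idn a ** idn b)) \<cdot> asc (\<I> \<otimes> \<I>) a b"
    by (simp add: triangle del: cmp_assoc)
  also have "\<dots> = asc \<I> a b \<cdot> ((run \<I> ** idn a) ** idn b)"
    by (rule asc_nat3(1)[symmetric]) simp_all
  also have "\<dots> = asc \<I> a b \<cdot> ((idn \<I> ** lun a) ** idn b) \<cdot> (asc \<I> \<I> a ** idn b)"
    by (simp add: wh_comp triangle)
  also have "\<dots> = (asc \<I> a b \<cdot> ((idn \<I> ** lun a) ** idn b)) \<cdot> (asc \<I> \<I> a ** idn b)"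
    by simp
  also have "asc \<I> a b \<cdot> ((idn \<I> ** lun a) ** idn b) = (idn \<I> ** (lun a ** idn b)) \<cdot> asc \<I> (\<I> \<otimes> a) b"
    by (rule asc_nat3(1)) simp_all
  finally show "idn \<I> ** (lun (a \<otimes> b) \<cdot> asc \<I> a b) = idn \<I> ** (lun a ** idn b)"
    by (intro iso_cancelR[of ?k "idn \<I> ** (lun (a \<otimes> b) \<cdot> asc \<I> a b)"]) (simp_all add: iso_cmp)
qed

text \<open>The mirror image of the previous argument, with the pentagon for \<open>a, b, \<I>,
  \<I>\<close>.\<close>

lemma run_ten:
  assumes [simp]: "a \<in> Ob V" "b \<in> Ob V"
  shows "(idn a ** run b) \<cdot> asc a b \<I> = run (a \<otimes> b)"
proof (rule ten_unit_faithful(2), simp_all)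
  let ?k = "asc a b \<I> ** idn \<I>"
  have "asc a b \<I> \<cdot> (((idn a ** run b) \<cdot> asc a b \<I>) ** idn \<I>)
    = (asc a b \<I> \<cdot> ((idn a ** run b) ** idn \<I>)) \<cdot> ?k"
    by (simp flip: wh_comp)
  also have "asc a b \<I> \<cdot> ((idn a ** run b) ** idn \<I>) = (idn a ** (run b ** idn \<I>)) \<cdot> asc a (b \<otimes> \<I>) \<I>"
    by (rule asc_nat3(1)) simp_all
  also have "idn a ** (run b ** idn \<I>) = (idn a ** (idn b ** lun \<I>)) \<cdot> (idn a ** asc b \<I> \<I>)"
    by (simp add: wh_comp triangle)
  also have "(\<dots> \<cdot> asc a (b \<otimes> \<I>) \<I>) \<cdot> ?k
     = (idn a ** (idn b ** lun \<I>)) \<cdot> ((idn a ** asc b \<I> \<I>) \<cdot> asc a (b \<otimes> \<I>) \<I> \<cdot> ?k)"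
    by simp
  also have "\<dots> = ((idn a ** (idn b ** lun \<I>)) \<cdot> asc a b (\<I> \<otimes> \<I>)) \<cdot> asc (a \<otimes> b) \<I> \<I>"
    by (simp add: pentagon)
  also have "(idn a ** (idn b ** lun \<I>)) \<cdot> asc a b (\<I> \<otimes> \<I>) = asc a b \<I> \<cdot> ((idn a ** idn b) ** lun \<I>)"
    by (rule asc_nat3(1)[symmetric]) simp_all
  also have "\<dots> \<cdot> asc (a \<otimes> b) \<I> \<I> = asc a b \<I> \<cdot> (run (a \<otimes> b) ** idn \<I>)"
    by (simp add: triangle)
  finally show "((idn a ** run b) \<cdot> asc a b \<I>) ** idn \<I> = run (a \<otimes> b) ** idn \<I>"
    by (intro iso_cancelL[of "asc a b \<I>" "((idn a ** run b) \<cdot> asc a b \<I>) ** idn \<I>"]) simp_all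
qed

lemma symnat:
  assumes "f \<in> Ar V" "g \<in> Ar V" "Dom V f = a" "Dom V g = b" "Cod V f = a'" "Cod V g = b'"
  shows "sym a' b' \<cdot> (f ** g) = (g ** f) \<cdot> sym a b"
  using sym_nat[of f a a' g b b'] assms by (simp add: hom_iff)

text \<open>The hexagon for \<open>a, \<I>, \<I>\<close>, followed by the left unitor of \<open>\<I>
  \<otimes> a\<close>, is this equation tensored with \<open>\<I>\<close> and followed by a
  symmetry.\<close>

lemma lun_sym:
  assumes [simp]: "a \<in> Ob V"
  shows "lun a \<cdot> sym a \<I> = run a"
proof (rule ten_unit_faithful(2), simp_all)
  have "sym a \<I> \<cdot> (run a ** idn \<I>) = sym a \<I> \<cdot> (idn a ** lun \<I>) \<cdot> asc a \<I> \<I>"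
    by (simp add: triangle)
  also have "\<dots> = (sym a \<I> \<cdot> (idn a ** lun \<I>)) \<cdot> asc a \<I> \<I>" by simp
  also have "sym a \<I> \<cdot> (idn a ** lun \<I>) = (lun \<I> ** idn a) \<cdot> sym a (\<I> \<otimes> \<I>)"
    by (rule symnat) simp_all
  also have "lun \<I> ** idn a = lun (\<I> \<otimes> a) \<cdot> asc \<I> \<I> a"
    by (simp add: lun_ten)
  also have "(\<dots> \<cdot> sym a (\<I> \<otimes> \<I>)) \<cdot> asc a \<I> \<I> = lun (\<I> \<otimes> a) \<cdot> (asc \<I> \<I> a \<cdot> sym a (\<I> \<otimes> \<I>) \<cdot> asc a \<I> \<I>)"
    by simp
  also have "\<dots> = (lun (\<I> \<otimes> a) \<cdot> (idn \<I> ** sym a \<I>)) \<cdot> asc \<I> a \<I> \<cdot> (sym a \<I> ** idn \<I>)"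
    by (simp add: hexagon)
  also have "lun (\<I> \<otimes> a) \<cdot> (idn \<I> ** sym a \<I>) = sym a \<I> \<cdot> lun (a \<otimes> \<I>)"
    by (rule lun_nat) (simp add: hom_iff)
  also have "\<dots> \<cdot> asc \<I> a \<I> \<cdot> (sym a \<I> ** idn \<I>) = sym a \<I> \<cdot> (lun (a \<otimes> \<I>) \<cdot> asc \<I> a \<I>) \<cdot> (sym a \<I> ** idn \<I>)"
    by simp
  also have "\<dots> = sym a \<I> \<cdot> ((lun a \<cdot> sym a \<I>) ** idn \<I>)"
    by (simp add: lun_ten wh_comp del: cmp_assoc)
  finally show "(lun a \<cdot> sym a \<I>) ** idn \<I> = run a ** idn \<I>"
    by (intro iso_cancelL[of "sym a \<I>" "(lun a \<cdot> sym a \<I>) ** idn \<I>"]) simp_all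
qed

lemma run_sym:
  assumes [simp]: "a \<in> Ob V"
  shows "run a \<cdot> sym \<I> a = lun a"
proof -
  have "run a \<cdot> sym \<I> a = lun a \<cdot> sym a \<I> \<cdot> sym \<I> a"
    by (simp flip: lun_sym)
  then show ?thesis by (simp add: sym_sym)
qed

lemma exch_ar [simp]:
  assumes "a \<in> Ob V" "b \<in> Ob V" "c \<in> Ob V"
  shows "exch a b c \<in> Ar V" "Dom V (exch a b c) = a \<otimes> (b \<otimes> c)" "Cod V (exch a b c) = b \<otimes> (a \<otimes> c)"
    "iso (exch a b c)"
  using assms unfolding exch_def by (simp_all add: iso_cmp)

lemma exch_nat:
  assumes [simp]: "f \<in> Ar V" "g \<in> Ar V" "h \<in> Ar V" and d: "Dom V f = a" "Dom V g = b" "Dom V h = c"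
    "Cod V f = a'" "Cod V g = b'" "Cod V h = c'"
  shows "exch a' b' c' \<cdot> (f ** (g ** h)) = (g ** (f ** h)) \<cdot> exch a b c"
proof -
  have [simp]: "a \<in> Ob V" "b \<in> Ob V" "c \<in> Ob V" "a' \<in> Ob V" "b' \<in> Ob V" "c' \<in> Ob V" using d by auto
  have "exch a' b' c' \<cdot> (f ** (g ** h))
    = asc b' a' c' \<cdot> (sym a' b' ** idn c') \<cdot> inv (asc a' b' c') \<cdot> (f ** (g ** h))"
    by (simp add: exch_def d)
  also have "\<dots> = asc b' a' c' \<cdot> (sym a' b' ** idn c') \<cdot> ((f ** g) ** h) \<cdot> inv (asc a b c)"
    by (simp add: asc_nat3[OF _ _ _ d])
  also have "\<dots> = asc b' a' c' \<cdot> ((sym a' b' \<cdot> (f ** g)) ** h) \<cdot> inv (asc a b c)"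
    by (simp add: d ten_comp')
  also have "\<dots> = asc b' a' c' \<cdot> ((g ** f) ** h) \<cdot> (sym a b ** idn c) \<cdot> inv (asc a b c)"
    by (simp add: d ten_comp' symnat[OF _ _ d(1,2,4,5)])
  also have "\<dots> = (asc b' a' c' \<cdot> ((g ** f) ** h)) \<cdot> (sym a b ** idn c) \<cdot> inv (asc a b c)"
    by (simp add: d)
  also have "\<dots> = (g ** (f ** h)) \<cdot> exch a b c"
    by (subst asc_nat3[where a=b and b=a and c=c]) (simp_all add: d exch_def)
  finally show ?thesis .
qed

lemma inv_flip:
  assumes "iso f" "g \<in> Ar V" "h \<in> Ar V" "Dom V g = Dom V f" "Dom V h = Cod V f" "g = h \<cdot> f"
  shows "g \<cdot> inv f = h"
  using assms iso_ar by simp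

text \<open>The hexagon with all its arrows inverted. The next lemma is the same equation read in the other
  direction, by the involutivity of the symmetry.\<close>

lemma sym_assoc:
  assumes [simp]: "x \<in> Ob V" "l \<in> Ob V" "m \<in> Ob V"
  shows "sym (x \<otimes> l) m \<cdot> inv (asc x l m) = exch x m l \<cdot> (idn x ** sym l m)"
proof -
  have "inv (asc x l m \<cdot> sym m (x \<otimes> l) \<cdot> asc m x l)
    = inv ((idn x ** sym m l) \<cdot> asc x m l \<cdot> (sym m x ** idn l))"
    by (simp add: hexagon)
  then have e: "inv (asc m x l) \<cdot> sym (x \<otimes> l) m \<cdot> inv (asc x l m)
     = (sym x m ** idn l) \<cdot> inv (asc x m l) \<cdot> (idn x ** sym l m)"
    by (simp add: iso_cmp)
  have "asc m x l \<cdot> (inv (asc m x l) \<cdot> sym (x \<otimes> l) m \<cdot> inv (asc x l m))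
     = asc m x l \<cdot> (sym x m ** idn l) \<cdot> inv (asc x m l) \<cdot> (idn x ** sym l m)"
    unfolding e ..
  then show ?thesis by (simp add: exch_def)
qed

lemma exch_sym:
  assumes [simp]: "x \<in> Ob V" "l \<in> Ob V" "m \<in> Ob V"
  shows "sym m (x \<otimes> l) \<cdot> exch x m l = inv (asc x l m) \<cdot> (idn x ** sym m l)"
proof -
  have "sym m (x \<otimes> l) \<cdot> exch x m l \<cdot> (idn x ** sym l m) \<cdot> (idn x ** sym m l)
     = sym m (x \<otimes> l) \<cdot> (exch x m l \<cdot> (idn x ** sym l m)) \<cdot> (idn x ** sym m l)"
    by simp
  also have "\<dots> = sym m (x \<otimes> l) \<cdot> sym (x \<otimes> l) m \<cdot> inv (asc x l m) \<cdot> (idn x ** sym m l)"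
    by (simp flip: sym_assoc)
  also have "\<dots> = inv (asc x l m) \<cdot> (idn x ** sym m l)"
    by (simp add: trail[OF sym_sym])
  finally show ?thesis by (simp add: wh_comp sym_sym)
qed

lemma pentagon':
  assumes [simp]: "a \<in> Ob V" "b \<in> Ob V" "c \<in> Ob V" "d \<in> Ob V"
  shows "asc (a \<otimes> b) c d \<cdot> (inv (asc a b c) ** idn d) \<cdot> inv (asc a (b \<otimes> c) d)
    = inv (asc a b (c \<otimes> d)) \<cdot> (idn a ** asc b c d)"
proof -
  let ?k = "asc a (b \<otimes> c) d \<cdot> (asc a b c ** idn d)"
  have "inv (asc a b (c \<otimes> d)) \<cdot> (idn a ** asc b c d) \<cdot> ?k
    = inv (asc a b (c \<otimes> d)) \<cdot> asc a b (c \<otimes> d) \<cdot> asc (a \<otimes> b) c d"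
    by (simp add: pentagon)
  also have "\<dots> = asc (a \<otimes> b) c d" by simp
  finally have e: "asc (a \<otimes> b) c d = (inv (asc a b (c \<otimes> d)) \<cdot> (idn a ** asc b c d)) \<cdot> ?k" by simp
  have "asc (a \<otimes> b) c d \<cdot> inv ?k = inv (asc a b (c \<otimes> d)) \<cdot> (idn a ** asc b c d)"
    by (rule inv_flip[OF _ _ _ _ _ e]) (simp_all add: iso_cmp)
  then show ?thesis by (simp add: iso_cmp)
qed

text \<open>This and the next equation are the coherence facts behind \<open>assoc_step_middle\<close> and
  \<open>assoc_step_right\<close>: a factor that stands in front of everything is moved into its
  place, before or after reassociating the rest. Both reduce to the pentagon, the second also to
  the hexagon.\<close>

lemma exch_assoc1:
  assumes [simp]: "y \<in> Ob V" "l \<in> Ob V" "m \<in> Ob V" "n \<in> Ob V"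
  shows "asc l (y \<otimes> m) n \<cdot> (exch y l m ** idn n) \<cdot> inv (asc y (l \<otimes> m) n)
    = (idn l ** inv (asc y m n)) \<cdot> exch y l (m \<otimes> n) \<cdot> (idn y ** asc l m n)"
proof -
  have "(idn l ** asc y m n) \<cdot> asc l (y \<otimes> m) n \<cdot> (exch y l m ** idn n) \<cdot> inv (asc y (l \<otimes> m) n)
    = ((idn l ** asc y m n) \<cdot> asc l (y \<otimes> m) n \<cdot> (asc l y m ** idn n))
        \<cdot> ((sym y l ** idn m) ** idn n) \<cdot> (inv (asc y l m) ** idn n) \<cdot> inv (asc y (l \<otimes> m) n)"
    unfolding exch_def by (simp flip: wh_comp)
  also have "\<dots> = asc l y (m \<otimes> n) \<cdot> (asc (l \<otimes> y) m n \<cdot> ((sym y l ** idn m) ** idn n))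
        \<cdot> (inv (asc y l m) ** idn n) \<cdot> inv (asc y (l \<otimes> m) n)"
    by (simp add: pentagon)
  also have "asc (l \<otimes> y) m n \<cdot> ((sym y l ** idn m) ** idn n)
     = (sym y l ** (idn m ** idn n)) \<cdot> asc (y \<otimes> l) m n"
    by (rule asc_nat3) simp_all
  also have "asc l y (m \<otimes> n) \<cdot> (\<dots>) \<cdot> (inv (asc y l m) ** idn n) \<cdot> inv (asc y (l \<otimes> m) n)
     = exch y l (m \<otimes> n) \<cdot> (idn y ** asc l m n)"
    by (simp add: pentagon' exch_def)
  finally have e: "(idn l ** asc y m n) \<cdot> asc l (y \<otimes> m) n \<cdot> (exch y l m ** idn n) \<cdot> inv (asc y (l \<otimes> m) n)
     = exch y l (m \<otimes> n) \<cdot> (idn y ** asc l m n)" .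
  have "(idn l ** inv (asc y m n)) \<cdot> (idn l ** asc y m n) \<cdot> asc l (y \<otimes> m) n \<cdot> (exch y l m ** idn n) \<cdot> inv (asc y (l \<otimes> m) n)
     = (idn l ** inv (asc y m n)) \<cdot> exch y l (m \<otimes> n) \<cdot> (idn y ** asc l m n)"
    by (simp add: e)
  then show ?thesis by (simp add: ten_comp')
qed

lemma exch_assoc2:
  assumes [simp]: "z \<in> Ob V" "l \<in> Ob V" "m \<in> Ob V" "n \<in> Ob V"
  shows "asc l m (z \<otimes> n) \<cdot> exch z (l \<otimes> m) n
    = (idn l ** exch z m n) \<cdot> exch z l (m \<otimes> n) \<cdot> (idn z ** asc l m n)"
proof -
  let ?t = "(inv (asc z l m) ** idn n) \<cdot> inv (asc z (l \<otimes> m) n)"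
  have s: "sym z (l \<otimes> m) = inv (asc l m z) \<cdot> (idn l ** sym z m) \<cdot> asc l z m \<cdot> (sym z l ** idn m) \<cdot> inv (asc z l m)"
  proof -
    have "inv (asc l m z) \<cdot> (asc l m z \<cdot> sym z (l \<otimes> m) \<cdot> asc z l m) \<cdot> inv (asc z l m)
      = inv (asc l m z) \<cdot> ((idn l ** sym z m) \<cdot> asc l z m \<cdot> (sym z l ** idn m)) \<cdot> inv (asc z l m)"
      by (simp add: hexagon)
    then show ?thesis by simp
  qed
  have p1: "asc l m (z \<otimes> n) \<cdot> asc (l \<otimes> m) z n \<cdot> (inv (asc l m z) ** idn n) \<cdot> k
    = (idn l ** asc m z n) \<cdot> asc l (m \<otimes> z) n \<cdot> k" if "k \<in> Ar V" "Cod V k = (l \<otimes> (m \<otimes> z)) \<otimes> n" for k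
    using that by (simp add: trail[OF pentagon[symmetric]] ten_comp')
  have p2: "asc l (z \<otimes> m) n \<cdot> (asc l z m ** idn n) \<cdot> k
     = (idn l ** inv (asc z m n)) \<cdot> asc l z (m \<otimes> n) \<cdot> asc (l \<otimes> z) m n \<cdot> k"
    if k: "k \<in> Ar V" "Cod V k = ((l \<otimes> z) \<otimes> m) \<otimes> n" for k
    using that by (simp add: trail[OF pentagon[symmetric]] ten_comp')
  have "asc l m (z \<otimes> n) \<cdot> exch z (l \<otimes> m) n
    = asc l m (z \<otimes> n) \<cdot> asc (l \<otimes> m) z n \<cdot> (inv (asc l m z) ** idn n) \<cdot> ((idn l ** sym z m) ** idn n)
       \<cdot> (asc l z m ** idn n) \<cdot> ((sym z l ** idn m) ** idn n) \<cdot> ?t"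
    unfolding exch_def s by (simp flip: wh_comp)
  also have "\<dots> = (idn l ** asc m z n) \<cdot> (asc l (m \<otimes> z) n \<cdot> ((idn l ** sym z m) ** idn n))
       \<cdot> (asc l z m ** idn n) \<cdot> ((sym z l ** idn m) ** idn n) \<cdot> ?t"
    by (simp add: p1)
  also have "asc l (m \<otimes> z) n \<cdot> ((idn l ** sym z m) ** idn n)
     = (idn l ** (sym z m ** idn n)) \<cdot> asc l (z \<otimes> m) n"
    by (rule asc_nat3) simp_all
  also have "(idn l ** asc m z n) \<cdot> (\<dots>) \<cdot> (asc l z m ** idn n) \<cdot> ((sym z l ** idn m) ** idn n) \<cdot> ?t
     = (idn l ** exch z m n) \<cdot> asc l z (m \<otimes> n) \<cdot> (asc (l \<otimes> z) m n \<cdot> ((sym z l ** idn m) ** idn n)) \<cdot> ?t"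
    by (simp add: p2, simp add: ten_comp' exch_def)
  also have "asc (l \<otimes> z) m n \<cdot> ((sym z l ** idn m) ** idn n) = (sym z l ** (idn m ** idn n)) \<cdot> asc (z \<otimes> l) m n"
    by (rule asc_nat3) simp_all
  also have "(idn l ** exch z m n) \<cdot> asc l z (m \<otimes> n) \<cdot> (\<dots>) \<cdot> ?t
     = (idn l ** exch z m n) \<cdot> exch z l (m \<otimes> n) \<cdot> (idn z ** asc l m n)"
    by (simp add: pentagon' exch_def)
  finally show ?thesis .
qed

end

section \<open>Contexts of named variables\<close>

text \<open>A context is a list of variables, each with a name and an object as its type, sorted by name.
  Merging forgets from which of two contexts a variable came, so that it is strictly commutative
  and associative. This is what makes associators and symmetries disappear from calculations with
  elements.\<close>

fun merge :: "(nat \<times> 'o) list \<Rightarrow> (nat \<times> 'o) list \<Rightarrow> (nat \<times> 'o) list" where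
  "merge [] m = m"
| "merge (x # l) [] = x # l"
| "merge (x # l) (y # m) = (if fst x < fst y then x # merge l (y # m) else y # merge (x # l) m)"

lemma merge_Nil [simp]: "merge l [] = l"
  by (cases l) auto

lemma set_merge [simp]: "set (merge l m) = set l \<union> set m"
  by (induction l m rule: merge.induct) auto

lemma merge_comm:
  assumes "fst ` set l \<inter> fst ` set m = {}"
  shows "merge l m = merge m l"
  using assms by (induction l m rule: merge.induct) auto

lemma merge_assoc: "merge (merge l m) n = merge l (merge m n)"
proof (induction "length l + length m + length n" arbitrary: l m n rule: less_induct)
  case less
  show ?case
  proof (cases "l = [] \<or> m = [] \<or> n = []")
    case True
    then show ?thesis by auto
  next
    case False
    then obtain x l' y m' z n' where l: "l = x # l'" and m: "m = y # m'" and n: "n = z # n'"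
      by (meson neq_Nil_conv)
    show ?thesis using less[of l' m n] less[of l m' n] less[of l m n'] unfolding l m n by auto
  qed
qed

abbreviation (input) sctx :: "(nat \<times> 'o) list \<Rightarrow> bool" where
  "sctx l \<equiv> sorted_wrt (<) (map fst l)"

lemma sctx_merge:
  assumes "sctx l" "sctx m" "fst ` set l \<inter> fst ` set m = {}"
  shows "sctx (merge l m)"
  using assms by (induction l m rule: merge.induct) (auto intro: order.strict_trans)

lemma filter_merge:
  assumes "i \<notin> fst ` set l"
  shows "filter (\<lambda>x. fst x \<noteq> i) (merge l [(i, a)]) = l"
proof -
  have f: "filter (\<lambda>x. fst x \<noteq> i) k = k" if "i \<notin> fst ` set k" for k :: "(nat \<times> 'b) list"
    using that by (induction k) auto
  show ?thesis using assms by (induction l) (auto simp: f)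
qed

type_synonym ('o, 'm) el = "(nat \<times> 'o) list \<times> 'm"

context vbase
begin

text \<open>The tensor product of a context, bracketed to the right, and the canonical permutation
  \<open>unmerge l m : ctx_ob (merge l m) \<rightarrow> ctx_ob l \<otimes> ctx_ob m\<close>.\<close>

fun ctx_ob :: "(nat \<times> 'o) list \<Rightarrow> 'o" where
  "ctx_ob [] = \<I>"
| "ctx_ob (x # l) = snd x \<otimes> ctx_ob l"

fun unmerge :: "(nat \<times> 'o) list \<Rightarrow> (nat \<times> 'o) list \<Rightarrow> 'm" where
  "unmerge [] m = inv (lun (ctx_ob m))"
| "unmerge (x # l) [] = inv (run (ctx_ob (x # l)))"
| "unmerge (x # l) (y # m) =
     (if fst x < fst y then inv (asc (snd x) (ctx_ob l) (ctx_ob (y # m))) \<cdot> (idn (snd x) ** unmerge l (y # m))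
      else exch (snd y) (ctx_ob (x # l)) (ctx_ob m) \<cdot> (idn (snd y) ** unmerge (x # l) m))"

text \<open>A generalised element of \<open>a\<close> is an arrow \<open>ctx_ob l \<rightarrow> a\<close>,
  kept together with its context \<open>l\<close>. Arrows are applied to elements, and elements
  over disjoint contexts can be paired. The variable \<open>var i a\<close> is the right unitor
  because its context has tensor product \<open>a \<otimes> \<I>\<close>; \<open>un\<close> is the
  generic element of \<open>\<I>\<close>, over the empty context.\<close>

definition app :: "'m \<Rightarrow> ('o, 'm) el \<Rightarrow> ('o, 'm) el" (infixr "$" 54) where
  "f $ e = (fst e, f \<cdot> snd e)"

definition pr :: "('o, 'm) el \<Rightarrow> ('o, 'm) el \<Rightarrow> ('o, 'm) el" ("\<langle>_,/ _\<rangle>") where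
  "\<langle>s, t\<rangle> = (merge (fst s) (fst t), (snd s ** snd t) \<cdot> unmerge (fst s) (fst t))"

definition var :: "nat \<Rightarrow> 'o \<Rightarrow> ('o, 'm) el" where
  "var i a = ([(i, a)], run a)"

definition un :: "('o, 'm) el" where
  "un = ([], idn \<I>)"

definition names :: "('o, 'm) el \<Rightarrow> nat set" where
  "names e = fst ` set (fst e)"

definition ctx :: "('o, 'm) el \<Rightarrow> (nat \<times> 'o) list" where
  "ctx e = fst e"

definition ty :: "('o, 'm) el \<Rightarrow> 'o" where
  "ty e = Cod V (snd e)"

definition apart :: "('o, 'm) el \<Rightarrow> ('o, 'm) el \<Rightarrow> bool" where
  "apart s t \<longleftrightarrow> names s \<inter> names t = {}"

fun obs :: "(nat \<times> 'o) list \<Rightarrow> bool" where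
  "obs [] = True"
| "obs (x # l) \<longleftrightarrow> snd x \<in> Ob V \<and> obs l"

definition good :: "('o, 'm) el \<Rightarrow> bool" where
  "good e \<longleftrightarrow> sctx (fst e) \<and> obs (fst e) \<and> snd e \<in> Ar V \<and> Dom V (snd e) = ctx_ob (fst e)"

text \<open>A list of elements over pairwise disjoint contexts, with their types.\<close>

fun els :: "(('o, 'm) el \<times> 'o) list \<Rightarrow> bool" where
  "els [] = True"
| "els ((e, a) # l) \<longleftrightarrow> good e \<and> ty e = a \<and> (\<forall>d\<in>set l. apart e (fst d)) \<and> els l"

text \<open>Tuples of distinct variables are full. Since they are invertible arrows, arrows out of their
  type can be compared on them.\<close>

definition full :: "('o, 'm) el \<Rightarrow> bool" where
  "full e \<longleftrightarrow> good e \<and> iso (snd e)"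

end

context symmetric_monoidal_closed
begin

lemma ctx_ob_ob [simp]: "obs l \<Longrightarrow> ctx_ob l \<in> Ob V"
  by (induction l) auto

lemma obs_merge [simp]: "obs (merge l m) \<longleftrightarrow> obs l \<and> obs m"
  by (induction l m rule: merge.induct) auto

lemma lun_run_unt: "lun \<I> = run \<I>"
proof -
  have "(lun \<I> \<cdot> lun (\<I> \<otimes> \<I>)) = lun \<I> \<cdot> (idn \<I> ** lun \<I>)"
    using lun_nat[of "lun \<I>" "\<I> \<otimes> \<I>" \<I>] by (simp add: hom_iff)
  then have "lun (\<I> \<otimes> \<I>) = idn \<I> ** lun \<I>"
    by (rule iso_cancelL[rotated -1]) simp_all
  then have "run \<I> ** idn \<I> = lun \<I> ** idn \<I>"
    using triangle[of \<I> \<I>] lun_ten[of \<I> \<I>] by simp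
  then show ?thesis by (metis ten_unit_faithful(2) lun_ar run_ar unt_ob)
qed

lemma unmerge_Nil: "unmerge l [] = inv (run (ctx_ob l))"
  by (cases l) (auto simp: lun_run_unt)

lemma unmerge_ar [simp]:
  assumes "obs l" "obs m"
  shows "unmerge l m \<in> Ar V" "Dom V (unmerge l m) = ctx_ob (merge l m)" "Cod V (unmerge l m) = ctx_ob l \<otimes> ctx_ob m" "iso (unmerge l m)"
proof -
  have "unmerge l m \<in> Ar V \<and> Dom V (unmerge l m) = ctx_ob (merge l m) \<and> Cod V (unmerge l m) = ctx_ob l \<otimes> ctx_ob m \<and> iso (unmerge l m)"
    using assms by (induction l m rule: merge.induct) (simp_all add: iso_cmp)
  then show "unmerge l m \<in> Ar V" "Dom V (unmerge l m) = ctx_ob (merge l m)" "Cod V (unmerge l m) = ctx_ob l \<otimes> ctx_ob m" "iso (unmerge l m)"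
    by auto
qed

text \<open>This lemma and \<open>unmerge_assoc\<close> contain the coherence theorem for symmetric monoidal
  categories, for tensor words in distinct variables: every structural map between two such words
  is the canonical permutation.\<close>

lemma unmerge_comm:
  assumes "obs l" "obs m" "fst ` set l \<inter> fst ` set m = {}"
  shows "sym (ctx_ob l) (ctx_ob m) \<cdot> unmerge l m = unmerge m l"
  using assms
proof (induction l m rule: merge.induct)
  case (1 m)
  have "sym \<I> (ctx_ob m) \<cdot> inv (lun (ctx_ob m)) = inv (run (ctx_ob m))"
    using 1 by (intro iso_cancelL[of "run (ctx_ob m)" "sym \<I> (ctx_ob m) \<cdot> inv (lun (ctx_ob m))"])
     (simp_all add: trail[OF run_sym])
  then show ?case by (simp add: unmerge_Nil)
next
  case (2 x l)
  have "sym (ctx_ob (x # l)) \<I> \<cdot> inv (run (ctx_ob (x # l))) = inv (lun (ctx_ob (x # l)))"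
    using 2 by (intro iso_cancelL[of "lun (ctx_ob (x # l))" "sym (ctx_ob (x # l)) \<I> \<cdot> inv (run (ctx_ob (x # l)))"])
     (simp_all add: trail[OF lun_sym])
  then show ?case by simp
next
  case (3 x l y m)
  show ?case
  proof (cases "fst x < fst y")
    case True
    have "sym (snd x \<otimes> ctx_ob l) (ctx_ob (y # m)) \<cdot> inv (asc (snd x) (ctx_ob l) (ctx_ob (y # m))) \<cdot> (idn (snd x) ** unmerge l (y # m))
       = (exch (snd x) (ctx_ob (y # m)) (ctx_ob l) \<cdot> (idn (snd x) ** sym (ctx_ob l) (ctx_ob (y # m)))) \<cdot> (idn (snd x) ** unmerge l (y # m))"
      using 3(3-) by (simp flip: sym_assoc)
    also have "\<dots> = exch (snd x) (ctx_ob (y # m)) (ctx_ob l) \<cdot> (idn (snd x) ** unmerge (y # m) l)"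
      using 3(3-) 3(1)[OF True] by (simp add: wh_comp)
    finally show ?thesis using True 3(5) by auto
  next
    case False
    have ne: "fst y < fst x" using False 3(5) by auto
    have "sym (ctx_ob (x # l)) (snd y \<otimes> ctx_ob m) \<cdot> exch (snd y) (ctx_ob (x # l)) (ctx_ob m) \<cdot> (idn (snd y) ** unmerge (x # l) m)
       = (inv (asc (snd y) (ctx_ob m) (ctx_ob (x # l))) \<cdot> (idn (snd y) ** sym (ctx_ob (x # l)) (ctx_ob m))) \<cdot> (idn (snd y) ** unmerge (x # l) m)"
      using 3(3-) by (simp flip: exch_sym)
    also have "\<dots> = inv (asc (snd y) (ctx_ob m) (ctx_ob (x # l))) \<cdot> (idn (snd y) ** unmerge m (x # l))"
      using 3(3-) 3(2)[OF False] by (simp add: wh_comp)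
    finally show ?thesis using False ne by auto
  qed
qed

lemma assoc_unit_left:
  assumes [simp]: "m \<in> Ob V" "n \<in> Ob V" "s \<in> Ar V" "Dom V s = p" "Cod V s = m \<otimes> n"
  shows "asc \<I> m n \<cdot> (inv (lun m) ** idn n) \<cdot> s = (idn \<I> ** s) \<cdot> inv (lun p)"
proof (rule iso_cancelL[of "lun (m \<otimes> n)"])
  have [simp]: "p \<in> Ob V" using ar_ob(1)[of s] by simp
  have "lun (m \<otimes> n) \<cdot> (idn \<I> ** s) = s \<cdot> lun p"
    by (rule lun_nat) (simp add: hom_iff)
  from trail[OF this]
  show "lun (m \<otimes> n) \<cdot> asc \<I> m n \<cdot> (inv (lun m) ** idn n) \<cdot> s = lun (m \<otimes> n) \<cdot> (idn \<I> ** s) \<cdot> inv (lun p)"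
    by (simp add: trail[OF lun_ten] ten_comp')
  show "Cod V ((idn \<I> ** s) \<cdot> inv (lun p)) = Dom V (lun (m \<otimes> n))" "(idn \<I> ** s) \<cdot> inv (lun p) \<in> Ar V" by simp_all
qed simp_all

lemma assoc_unit_middle:
  assumes [simp]: "l \<in> Ob V" "n \<in> Ob V" "s \<in> Ar V" "Cod V s = l \<otimes> n"
  shows "asc l \<I> n \<cdot> (inv (run l) ** idn n) \<cdot> s = (idn l ** inv (lun n)) \<cdot> s"
  by (rule iso_cancelL[of "idn l ** lun n"]) (simp_all add: trail[OF triangle] ten_comp')

lemma assoc_unit_right:
  assumes [simp]: "l \<in> Ob V" "m \<in> Ob V" "s \<in> Ar V" "Dom V s = p" "Cod V s = l \<otimes> m"
  shows "asc l m \<I> \<cdot> (s ** idn \<I>) \<cdot> inv (run p) = (idn l ** inv (run m)) \<cdot> s"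
proof (rule iso_cancelL[of "idn l ** run m"])
  have [simp]: "p \<in> Ob V" using ar_ob(1)[of s] by simp
  have "run (l \<otimes> m) \<cdot> (s ** idn \<I>) = s \<cdot> run p"
    by (rule run_nat) (simp add: hom_iff)
  from trail[OF this]
  show "(idn l ** run m) \<cdot> asc l m \<I> \<cdot> (s ** idn \<I>) \<cdot> inv (run p) = (idn l ** run m) \<cdot> (idn l ** inv (run m)) \<cdot> s"
    by (simp add: trail[OF run_ten] ten_comp')
  show "Cod V (asc l m \<I> \<cdot> (s ** idn \<I>) \<cdot> inv (run p)) = Dom V (idn l ** run m)"
    "asc l m \<I> \<cdot> (s ** idn \<I>) \<cdot> inv (run p) \<in> Ar V" by simp_all
qed simp_all

text \<open>One step in the proof of \<open>unmerge_assoc\<close>. The arrows \<open>s, t, w, z\<close>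
  stand for the canonical permutations of the remaining contexts, which are related by the
  induction hypothesis, and a new smallest variable is put in front of the first, second or third
  context.\<close>

context
  fixes l m n p q r s t w z
  assumes o [simp]: "l \<in> Ob V" "m \<in> Ob V" "n \<in> Ob V"
    and s [unfolded hom_iff, simp]: "s \<in> hom p (l \<otimes> m)" and t [unfolded hom_iff, simp]: "t \<in> hom q (p \<otimes> n)"
    and w [unfolded hom_iff, simp]: "w \<in> hom r (m \<otimes> n)" and z [unfolded hom_iff, simp]: "z \<in> hom q (l \<otimes> r)"
    and IH: "asc l m n \<cdot> (s ** idn n) \<cdot> t = (idn l ** w) \<cdot> z"
begin

lemma pqr_ob: "p \<in> Ob V" "q \<in> Ob V" "r \<in> Ob V"
  using ar_ob(1)[of s] ar_ob(1)[of t] ar_ob(1)[of w] by simp_all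

lemma assoc_step_left:
  assumes [simp]: "x \<in> Ob V"
  shows "asc (x \<otimes> l) m n \<cdot> ((inv (asc x l m) \<cdot> (idn x ** s)) ** idn n) \<cdot> inv (asc x p n) \<cdot> (idn x ** t)
    = (idn (x \<otimes> l) ** w) \<cdot> inv (asc x l r) \<cdot> (idn x ** z)"
proof -
  note [simp] = pqr_ob
  have "asc (x \<otimes> l) m n \<cdot> ((inv (asc x l m) \<cdot> (idn x ** s)) ** idn n) \<cdot> inv (asc x p n) \<cdot> (idn x ** t)
    = asc (x \<otimes> l) m n \<cdot> (inv (asc x l m) ** idn n) \<cdot> (((idn x ** s) ** idn n) \<cdot> inv (asc x p n)) \<cdot> (idn x ** t)"
    by (simp flip: wh_comp)
  also have "((idn x ** s) ** idn n) \<cdot> inv (asc x p n) = inv (asc x (l \<otimes> m) n) \<cdot> (idn x ** (s ** idn n))"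
    by (rule asc_nat3(2)[symmetric]) simp_all
  also have "asc (x \<otimes> l) m n \<cdot> (inv (asc x l m) ** idn n) \<cdot> (\<dots>) \<cdot> (idn x ** t)
    = inv (asc x l (m \<otimes> n)) \<cdot> (idn x ** (asc l m n \<cdot> (s ** idn n) \<cdot> t))"
    by (simp add: trail3[OF pentagon'], simp add: ten_comp)
  also have "\<dots> = (inv (asc x l (m \<otimes> n)) \<cdot> (idn x ** (idn l ** w))) \<cdot> (idn x ** z)"
    unfolding IH by (simp add: ten_comp)
  also have "inv (asc x l (m \<otimes> n)) \<cdot> (idn x ** (idn l ** w)) = ((idn x ** idn l) ** w) \<cdot> inv (asc x l r)"
    by (rule asc_nat3(2)) simp_all
  finally show ?thesis by simp
qed

lemma assoc_step_middle:
  assumes [simp]: "y \<in> Ob V"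
  shows "asc l (y \<otimes> m) n \<cdot> ((exch y l m \<cdot> (idn y ** s)) ** idn n) \<cdot> inv (asc y p n) \<cdot> (idn y ** t)
    = (idn l ** (inv (asc y m n) \<cdot> (idn y ** w))) \<cdot> exch y l r \<cdot> (idn y ** z)"
proof -
  note [simp] = pqr_ob
  have "asc l (y \<otimes> m) n \<cdot> ((exch y l m \<cdot> (idn y ** s)) ** idn n) \<cdot> inv (asc y p n) \<cdot> (idn y ** t)
    = asc l (y \<otimes> m) n \<cdot> (exch y l m ** idn n) \<cdot> (((idn y ** s) ** idn n) \<cdot> inv (asc y p n)) \<cdot> (idn y ** t)"
    by (simp flip: wh_comp)
  also have "((idn y ** s) ** idn n) \<cdot> inv (asc y p n) = inv (asc y (l \<otimes> m) n) \<cdot> (idn y ** (s ** idn n))"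
    by (rule asc_nat3(2)[symmetric]) simp_all
  also have "asc l (y \<otimes> m) n \<cdot> (exch y l m ** idn n) \<cdot> (\<dots>) \<cdot> (idn y ** t)
    = (idn l ** inv (asc y m n)) \<cdot> exch y l (m \<otimes> n) \<cdot> (idn y ** (asc l m n \<cdot> (s ** idn n) \<cdot> t))"
    by (simp add: trail3[OF exch_assoc1], simp add: ten_comp)
  also have "\<dots> = (idn l ** inv (asc y m n)) \<cdot> (exch y l (m \<otimes> n) \<cdot> (idn y ** (idn l ** w))) \<cdot> (idn y ** z)"
    unfolding IH by (simp add: ten_comp)
  also have "exch y l (m \<otimes> n) \<cdot> (idn y ** (idn l ** w)) = (idn l ** (idn y ** w)) \<cdot> exch y l r"
    by (rule exch_nat) simp_all
  finally show ?thesis by (simp add: ten_comp')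
qed

lemma assoc_step_right:
  assumes [simp]: "x \<in> Ob V"
  shows "asc l m (x \<otimes> n) \<cdot> (s ** idn (x \<otimes> n)) \<cdot> exch x p n \<cdot> (idn x ** t)
    = (idn l ** (exch x m n \<cdot> (idn x ** w))) \<cdot> exch x l r \<cdot> (idn x ** z)"
proof -
  note [simp] = pqr_ob
  have "asc l m (x \<otimes> n) \<cdot> (s ** idn (x \<otimes> n)) \<cdot> exch x p n \<cdot> (idn x ** t)
    = asc l m (x \<otimes> n) \<cdot> ((s ** (idn x ** idn n)) \<cdot> exch x p n) \<cdot> (idn x ** t)"
    by simp
  also have "(s ** (idn x ** idn n)) \<cdot> exch x p n = exch x (l \<otimes> m) n \<cdot> (idn x ** (s ** idn n))"
    by (rule exch_nat[symmetric]) simp_all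
  also have "asc l m (x \<otimes> n) \<cdot> (\<dots>) \<cdot> (idn x ** t)
    = (idn l ** exch x m n) \<cdot> exch x l (m \<otimes> n) \<cdot> (idn x ** (asc l m n \<cdot> (s ** idn n) \<cdot> t))"
    by (simp add: trail[OF exch_assoc2], simp add: ten_comp)
  also have "\<dots> = (idn l ** exch x m n) \<cdot> (exch x l (m \<otimes> n) \<cdot> (idn x ** (idn l ** w))) \<cdot> (idn x ** z)"
    unfolding IH by (simp add: ten_comp)
  also have "exch x l (m \<otimes> n) \<cdot> (idn x ** (idn l ** w)) = (idn l ** (idn x ** w)) \<cdot> exch x l r"
    by (rule exch_nat) simp_all
  finally show ?thesis by (simp add: ten_comp')
qed

end

text \<open>By induction on the total length, removing the smallest variable. It lies in the first, second
  or third context, which gives the three steps above; an empty context gives one of the unit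
  laws.\<close>

lemma unmerge_assoc:
  assumes "obs l" "obs m" "obs n"
    "fst ` set l \<inter> fst ` set m = {}" "fst ` set l \<inter> fst ` set n = {}" "fst ` set m \<inter> fst ` set n = {}"
  shows "asc (ctx_ob l) (ctx_ob m) (ctx_ob n) \<cdot> (unmerge l m ** idn (ctx_ob n)) \<cdot> unmerge (merge l m) n
       = (idn (ctx_ob l) ** unmerge m n) \<cdot> unmerge l (merge m n)"
  using assms
proof (induction "length l + length m + length n" arbitrary: l m n rule: less_induct)
  case less
  note [simp] = less(2-4)
  consider "l = []" | "m = []" | "n = []" | "l \<noteq> [] \<and> m \<noteq> [] \<and> n \<noteq> []" by blast
  then show ?case
  proof cases
    case 1
    show ?thesis unfolding 1 by (simp add: assoc_unit_left)
  next
    case 2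
    show ?thesis unfolding 2 by (simp add: unmerge_Nil assoc_unit_middle)
  next
    case 3
    show ?thesis unfolding 3 by (simp add: unmerge_Nil assoc_unit_right)
  next
    case 4
    then obtain x l' y m' z n' where l: "l = x # l'" and m: "m = y # m'" and n: "n = z # n'"
      by (meson neq_Nil_conv)
    have ne: "fst x \<noteq> fst y" "fst x \<noteq> fst z" "fst y \<noteq> fst z" using less(5-7) l m n by auto
    have ob [simp]: "snd x \<in> Ob V" "snd y \<in> Ob V" "snd z \<in> Ob V" "obs l'" "obs m'" "obs n'"
      using less(2-4) unfolding l m n by auto
    have co: "ctx_ob l = snd x \<otimes> ctx_ob l'" "ctx_ob m = snd y \<otimes> ctx_ob m'" "ctx_ob n = snd z \<otimes> ctx_ob n'"
      by (simp_all add: l m n)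
    \<comment> \<open>the smallest of the three first names heads both merged contexts\<close>
    consider "fst x < fst y \<and> fst x < fst z" | "fst y < fst x \<and> fst y < fst z" | "fst z < fst x \<and> fst z < fst y"
      using ne by linarith
    then show ?thesis
    proof cases
      case 1
      have um: "unmerge l m = inv (asc (snd x) (ctx_ob l') (ctx_ob m)) \<cdot> (idn (snd x) ** unmerge l' m)"
        "unmerge (merge l m) n = inv (asc (snd x) (ctx_ob (merge l' m)) (ctx_ob n)) \<cdot> (idn (snd x) ** unmerge (merge l' m) n)"
        "unmerge l (merge m n) = inv (asc (snd x) (ctx_ob l') (ctx_ob (merge m n))) \<cdot> (idn (snd x) ** unmerge l' (merge m n))"
        using 1 by (auto simp: l m n)
      have IH: "asc (ctx_ob l') (ctx_ob m) (ctx_ob n) \<cdot> (unmerge l' m ** idn (ctx_ob n)) \<cdot> unmerge (merge l' m) n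
        = (idn (ctx_ob l') ** unmerge m n) \<cdot> unmerge l' (merge m n)"
        by (rule less(1)) (use less(5-7) in \<open>auto simp: l\<close>)
      show ?thesis unfolding um co(1)
        by (rule assoc_step_left[OF _ _ _ _ _ _ _ IH]) (simp_all add: hom_iff merge_assoc)
    next
      case 2
      have um: "unmerge l m = exch (snd y) (ctx_ob l) (ctx_ob m') \<cdot> (idn (snd y) ** unmerge l m')"
        "unmerge (merge l m) n = inv (asc (snd y) (ctx_ob (merge l m')) (ctx_ob n)) \<cdot> (idn (snd y) ** unmerge (merge l m') n)"
        "unmerge m n = inv (asc (snd y) (ctx_ob m') (ctx_ob n)) \<cdot> (idn (snd y) ** unmerge m' n)"
        "unmerge l (merge m n) = exch (snd y) (ctx_ob l) (ctx_ob (merge m' n)) \<cdot> (idn (snd y) ** unmerge l (merge m' n))"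
        using 2 by (auto simp: l m n)
      have IH: "asc (ctx_ob l) (ctx_ob m') (ctx_ob n) \<cdot> (unmerge l m' ** idn (ctx_ob n)) \<cdot> unmerge (merge l m') n
        = (idn (ctx_ob l) ** unmerge m' n) \<cdot> unmerge l (merge m' n)"
        by (rule less(1)) (use less(5-7) in \<open>auto simp: m\<close>)
      show ?thesis unfolding um co(2)
        by (rule assoc_step_middle[OF _ _ _ _ _ _ _ IH]) (simp_all add: hom_iff merge_assoc)
    next
      case 3
      have "unmerge (merge l m) n = exch (snd z) (ctx_ob (merge l m)) (ctx_ob n') \<cdot> (idn (snd z) ** unmerge (merge l m) n')"
        by (cases "merge l m") (use 3 in \<open>auto simp: l m n split: if_splits\<close>)
      then have um: "unmerge (merge l m) n = exch (snd z) (ctx_ob (merge l m)) (ctx_ob n') \<cdot> (idn (snd z) ** unmerge (merge l m) n')"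
        "unmerge m n = exch (snd z) (ctx_ob m) (ctx_ob n') \<cdot> (idn (snd z) ** unmerge m n')"
        "unmerge l (merge m n) = exch (snd z) (ctx_ob l) (ctx_ob (merge m n')) \<cdot> (idn (snd z) ** unmerge l (merge m n'))"
        using 3 by (auto simp: l m n)
      have IH: "asc (ctx_ob l) (ctx_ob m) (ctx_ob n') \<cdot> (unmerge l m ** idn (ctx_ob n')) \<cdot> unmerge (merge l m) n'
        = (idn (ctx_ob l) ** unmerge m n') \<cdot> unmerge l (merge m n')"
        by (rule less(1)) (use less(5-7) in \<open>auto simp: n\<close>)
      show ?thesis unfolding um co(3)
        by (rule assoc_step_right[OF _ _ _ _ _ _ _ IH]) (simp_all add: hom_iff merge_assoc)
    qed
  qed
qed

section \<open>Generalised elements\<close>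

lemma good_snd [simp]:
  assumes "good e"
  shows "snd e \<in> Ar V" "Dom V (snd e) = ctx_ob (fst e)" "obs (fst e)" "Cod V (snd e) = ty e"
  using assms unfolding good_def ty_def by auto

lemma good_ty [simp]: "good e \<Longrightarrow> ty e \<in> Ob V"
  unfolding good_def ty_def by auto

lemma app_good [simp]:
  assumes "good e" "f \<in> Ar V" "Dom V f = ty e"
  shows "good (f $ e)" "ty (f $ e) = Cod V f"
  using assms unfolding good_def app_def ty_def by simp_all

lemma app_cx [simp]: "ctx (f $ e) = ctx e" "apart (f $ e) d = apart e d" "apart d (f $ e) = apart d e" "names (f $ e) = names e"
  by (auto simp: ctx_def app_def apart_def names_def)

lemma pr_cx [simp]: "ctx \<langle>s, t\<rangle> = merge (ctx s) (ctx t)" "apart \<langle>s, t\<rangle> d \<longleftrightarrow> apart s d \<and> apart t d"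
  "apart d \<langle>s, t\<rangle> \<longleftrightarrow> apart d s \<and> apart d t" "names \<langle>s, t\<rangle> = names s \<union> names t"
  by (auto simp: ctx_def pr_def apart_def names_def)

lemma pr_good [simp]:
  assumes "good s" "good t" "apart s t"
  shows "good \<langle>s, t\<rangle>" "ty \<langle>s, t\<rangle> = ty s \<otimes> ty t"
  using assms unfolding good_def pr_def ty_def apart_def names_def by (simp_all add: sctx_merge)

lemma un_rules [simp]: "good un" "ty un = \<I>" "ctx un = []" "apart un d" "apart d un" "names un = {}"
  unfolding un_def good_def ty_def ctx_def apart_def names_def by simp_all

lemma var_good [simp]:
  assumes "a \<in> Ob V"
  shows "good (var i a)" "ty (var i a) = a"
  using assms unfolding var_def good_def ty_def by simp_all

lemma var_rules [simp]: "ctx (var i a) = [(i, a)]" "names (var i a) = {i}"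
    "apart d (var i a) \<longleftrightarrow> i \<notin> names d" "apart (var i a) d \<longleftrightarrow> i \<notin> names d"
  by (auto simp: var_def ctx_def apart_def names_def)

lemma apart_sym: "apart s t \<Longrightarrow> apart t s"
  by (auto simp: apart_def)

lemma app_cmp [simp]:
  assumes "good e" "f \<in> Ar V" "g \<in> Ar V" "Dom V f = ty e" "Cod V f = Dom V g"
  shows "g \<cdot> f $ e = g $ f $ e"
  using assms by (simp add: app_def)

lemma app_id [simp]: "good e \<Longrightarrow> ty e = a \<Longrightarrow> idn a $ e = e"
  by (simp add: app_def prod_eq_iff)

lemma app_ten [simp]:
  assumes "good s" "good t" "f \<in> Ar V" "g \<in> Ar V" "Dom V f = ty s" "Dom V g = ty t"
  shows "f ** g $ \<langle>s, t\<rangle> = \<langle>f $ s, g $ t\<rangle>"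
  using assms by (simp add: app_def pr_def ten_comp')

text \<open>On tuples of elements the structural maps act as they do for sets, the names of the variables
  keeping track of the factors.\<close>

lemma app_sym [simp]:
  assumes "els [(s, a), (t, b)]"
  shows "sym a b $ \<langle>s, t\<rangle> = \<langle>t, s\<rangle>"
proof -
  have d: "fst ` set (fst s) \<inter> fst ` set (fst t) = {}" using assms by (simp add: apart_def names_def)
  have "sym a b \<cdot> (snd s ** snd t) \<cdot> unmerge (fst s) (fst t) = (sym a b \<cdot> (snd s ** snd t)) \<cdot> unmerge (fst s) (fst t)"
    using assms by auto
  also have "sym a b \<cdot> (snd s ** snd t) = (snd t ** snd s) \<cdot> sym (ctx_ob (fst s)) (ctx_ob (fst t))"
    by (rule symnat) (use assms in auto)
  also have "\<dots> \<cdot> unmerge (fst s) (fst t) = (snd t ** snd s) \<cdot> unmerge (fst t) (fst s)"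
    using assms unmerge_comm[OF _ _ d] by simp
  finally show ?thesis unfolding app_def pr_def using merge_comm[OF d] by simp
qed

lemma app_asc [simp]:
  assumes "els [(s, a), (t, b), (u, c)]"
  shows "asc a b c $ \<langle>\<langle>s, t\<rangle>, u\<rangle> = \<langle>s, \<langle>t, u\<rangle>\<rangle>"
proof -
  have d: "fst ` set (fst s) \<inter> fst ` set (fst t) = {}" "fst ` set (fst s) \<inter> fst ` set (fst u) = {}"
    "fst ` set (fst t) \<inter> fst ` set (fst u) = {}"
    using assms by (simp_all add: apart_def names_def)
  have [simp]: "a \<in> Ob V" "b \<in> Ob V" "c \<in> Ob V" using assms by auto
  let ?l = "fst s" and ?m = "fst t" and ?n = "fst u"
  have "asc a b c \<cdot> (((snd s ** snd t) \<cdot> unmerge ?l ?m) ** snd u) \<cdot> unmerge (merge ?l ?m) ?n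
    = (asc a b c \<cdot> ((snd s ** snd t) ** snd u)) \<cdot> (unmerge ?l ?m ** idn (ctx_ob ?n)) \<cdot> unmerge (merge ?l ?m) ?n"
    using assms by (simp add: ten_comp')
  also have "asc a b c \<cdot> ((snd s ** snd t) ** snd u) = (snd s ** (snd t ** snd u)) \<cdot> asc (ctx_ob ?l) (ctx_ob ?m) (ctx_ob ?n)"
    by (rule asc_nat3) (use assms in auto)
  also have "\<dots> \<cdot> (unmerge ?l ?m ** idn (ctx_ob ?n)) \<cdot> unmerge (merge ?l ?m) ?n
     = (snd s ** ((snd t ** snd u) \<cdot> unmerge ?m ?n)) \<cdot> unmerge ?l (merge ?m ?n)"
    using assms unmerge_assoc[OF _ _ _ d] by (simp add: ten_comp')
  finally show ?thesis unfolding app_def pr_def by (simp add: merge_assoc)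
qed

lemma app_lun [simp]:
  assumes "good t" "ty t = a"
  shows "lun a $ \<langle>un, t\<rangle> = t"
proof -
  have "lun a \<cdot> (idn \<I> ** snd t) \<cdot> inv (lun (ctx_ob (fst t))) = (lun a \<cdot> (idn \<I> ** snd t)) \<cdot> inv (lun (ctx_ob (fst t)))"
    using assms by auto
  also have "lun a \<cdot> (idn \<I> ** snd t) = snd t \<cdot> lun (ctx_ob (fst t))"
    by (rule lun_nat) (use assms in \<open>auto simp: hom_iff\<close>)
  finally show ?thesis using assms unfolding app_def pr_def un_def by simp
qed

lemma app_run [simp]:
  assumes "good t" "ty t = a"
  shows "run a $ \<langle>t, un\<rangle> = t"
proof -
  have "run a \<cdot> (snd t ** idn \<I>) \<cdot> inv (run (ctx_ob (fst t))) = (run a \<cdot> (snd t ** idn \<I>)) \<cdot> inv (run (ctx_ob (fst t)))"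
    using assms by auto
  also have "run a \<cdot> (snd t ** idn \<I>) = snd t \<cdot> run (ctx_ob (fst t))"
    by (rule run_nat) (use assms in \<open>auto simp: hom_iff\<close>)
  finally show ?thesis using assms unfolding app_def pr_def un_def by (simp add: unmerge_Nil)
qed

lemma app_inv:
  assumes "f $ s = t" "iso f" "good s" "Dom V f = ty s"
  shows "inv f $ t = s"
proof -
  have "inv f $ f $ s = inv f \<cdot> f $ s" using assms(2-4) iso_ar[OF assms(2)] by (simp del: inv_cmp)
  also have "\<dots> = s" using assms(2-4) by (simp del: app_cmp)
  finally show ?thesis using assms(1) by simp
qed

lemma app_inv_lun [simp]: "good t \<Longrightarrow> ty t = a \<Longrightarrow> inv (lun a) $ t = \<langle>un, t\<rangle>"
  by (rule app_inv) auto

lemma app_inv_run [simp]: "good t \<Longrightarrow> ty t = a \<Longrightarrow> inv (run a) $ t = \<langle>t, un\<rangle>"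
  by (rule app_inv) auto

lemma app_inv_asc [simp]:
  assumes "els [(s, a), (t, b), (u, c)]"
  shows "inv (asc a b c) $ \<langle>s, \<langle>t, u\<rangle>\<rangle> = \<langle>\<langle>s, t\<rangle>, u\<rangle>"
  by (rule app_inv) (use assms in auto)

lemma app_exch [simp]:
  assumes "els [(s, a), (t, b), (u, c)]"
  shows "exch a b c $ \<langle>s, \<langle>t, u\<rangle>\<rangle> = \<langle>t, \<langle>s, u\<rangle>\<rangle>"
proof -
  have "apart t s" using assms apart_sym by auto
  have [simp]: "a \<in> Ob V" "b \<in> Ob V" "c \<in> Ob V" using assms by auto
  show ?thesis using assms \<open>apart t s\<close> unfolding exch_def by simp
qed

lemma mid_ar [simp]:
  assumes "a \<in> Ob V" "b \<in> Ob V" "c \<in> Ob V" "d \<in> Ob V"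
  shows "mid a b c d \<in> Ar V" "Dom V (mid a b c d) = (a \<otimes> b) \<otimes> (c \<otimes> d)"
    "Cod V (mid a b c d) = (a \<otimes> c) \<otimes> (b \<otimes> d)"
  using assms by (simp_all add: mid_def)

lemma app_mid [simp]:
  assumes "els [(s, a), (t, b), (u, c), (w, d)]"
  shows "mid a b c d $ \<langle>\<langle>s, t\<rangle>, \<langle>u, w\<rangle>\<rangle> = \<langle>\<langle>s, u\<rangle>, \<langle>t, w\<rangle>\<rangle>"
proof -
  have "apart u t" using assms apart_sym by auto
  have [simp]: "a \<in> Ob V" "b \<in> Ob V" "c \<in> Ob V" "d \<in> Ob V" using assms by auto
  show ?thesis using assms \<open>apart u t\<close> unfolding mid_def by simp
qed

subsection \<open>Extensionality\<close>

lemma full_good [simp]: "full e \<Longrightarrow> good e"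
  by (simp add: full_def)

lemma full_un [simp]: "full un"
  by (simp add: full_def) (simp add: un_def)

lemma full_var [simp]: "a \<in> Ob V \<Longrightarrow> full (var i a)"
  by (simp add: full_def) (simp add: var_def)

lemma full_pr [simp]: "full s \<Longrightarrow> full t \<Longrightarrow> apart s t \<Longrightarrow> full \<langle>s, t\<rangle>"
  by (simp add: full_def) (simp add: pr_def iso_cmp)

lemma el_ext:
  assumes "full e" "f $ e = g $ e" "f \<in> Ar V" "g \<in> Ar V" "Dom V f = ty e" "Dom V g = ty e"
  shows "f = g"
  using assms unfolding full_def
  by (intro iso_cancelR[of "snd e" f]) (auto simp: app_def)

lemma el_lift:
  assumes "full e" "f $ g $ e = h $ k $ e" "f \<in> Ar V" "g \<in> Ar V" "h \<in> Ar V" "k \<in> Ar V"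
    "Dom V f = Cod V g" "Dom V h = Cod V k" "Dom V g = ty e" "Dom V k = ty e"
  shows "f \<cdot> g = h \<cdot> k"
  by (rule el_ext[OF assms(1)]) (use assms in simp_all)

subsection \<open>Currying\<close>

lemma curry_ex1:
  assumes "f \<in> Ar V" "Dom V f = c \<otimes> a" "Cod V f = b" "a \<in> Ob V" "c \<in> Ob V"
  shows "\<exists>!g. g \<in> hom c (a \<multimap> b) \<and> ev a b \<cdot> (g ** idn a) = f"
  by (rule closed) (use assms in \<open>auto simp: hom_iff\<close>)

lemma curry_ar [simp]:
  assumes "f \<in> Ar V" "Dom V f = c \<otimes> a" "Cod V f = b" "a \<in> Ob V" "c \<in> Ob V"
  shows "curry c a b f \<in> Ar V" "Dom V (curry c a b f) = c" "Cod V (curry c a b f) = a \<multimap> b"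
    "ev a b \<cdot> (curry c a b f ** idn a) = f"
  using theI'[OF curry_ex1[OF assms]] unfolding curry_def hom_iff by blast+

lemma ev_curry [simp]:
  assumes "f \<in> Ar V" "Dom V f = c \<otimes> a" "Cod V f = b" "els [(s, c), (t, a)]"
  shows "ev a b $ \<langle>curry c a b f $ s, t\<rangle> = f $ \<langle>s, t\<rangle>"
proof -
  have [simp]: "a \<in> Ob V" "b \<in> Ob V" "c \<in> Ob V" using assms ar_ob[of f] by auto
  have "ev a b $ \<langle>curry c a b f $ s, t\<rangle> = ev a b \<cdot> (curry c a b f ** idn a) $ \<langle>s, t\<rangle>"
    using assms by (simp del: curry_ar(4))
  also have "\<dots> = f $ \<langle>s, t\<rangle>" using assms by (simp del: app_cmp)
  finally show ?thesis .
qed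

lemma curry_unique:
  assumes "u \<in> Ar V" "Dom V u = c" "Cod V u = a \<multimap> b" "v \<in> Ar V" "Dom V v = c" "Cod V v = a \<multimap> b"
    "ev a b \<cdot> (u ** idn a) = ev a b \<cdot> (v ** idn a)" "a \<in> Ob V" "b \<in> Ob V"
  shows "u = v"
proof -
  have "\<exists>!g. g \<in> hom c (a \<multimap> b) \<and> ev a b \<cdot> (g ** idn a) = ev a b \<cdot> (u ** idn a)"
    by (rule curry_ex1) (use assms in auto)
  then show ?thesis using assms by (auto simp: hom_iff)
qed

text \<open>Elements of \<open>[a, b]\<close> are compared on a fresh variable. The equation also forces the
  two contexts to agree, as deleting the fresh variable recovers them.\<close>

lemma ih_ext:
  assumes e: "ev a b $ \<langle>s, var i a\<rangle> = ev a b $ \<langle>t, var i a\<rangle>" and [simp]: "good s" "good t"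
    "ty s = a \<multimap> b" "ty t = a \<multimap> b" "i \<notin> names s" "i \<notin> names t" "a \<in> Ob V" "b \<in> Ob V"
  shows "s = t"
proof -
  have "ctx (ev a b $ \<langle>s, var i a\<rangle>) = ctx (ev a b $ \<langle>t, var i a\<rangle>)" using e by simp
  then have c: "merge (ctx s) [(i, a)] = merge (ctx t) [(i, a)]" by simp
  have nin: "i \<notin> fst ` set (ctx s)" "i \<notin> fst ` set (ctx t)" using assms(6,7) by (auto simp: ctx_def names_def)
  have cc: "ctx s = ctx t"
    using arg_cong[OF c, of "filter (\<lambda>x. fst x \<noteq> i)"] by (simp add: filter_merge nin)
  let ?l = "fst s"
  have l: "fst t = ?l" using cc by (simp add: ctx_def)
  have o: "sctx ?l" "obs ?l" using assms(2) unfolding good_def by blast+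
  have gl: "good (?l, idn (ctx_ob ?l))" unfolding good_def using o by simp
  have tl: "ty (?l, idn (ctx_ob ?l)) = ctx_ob ?l" unfolding ty_def using o by simp
  have ex: "\<langle>x, var i a\<rangle> = snd x ** idn a $ \<langle>(?l, idn (ctx_ob ?l)), var i a\<rangle>" if "good x" "fst x = ?l" "i \<notin> names x" for x
  proof -
    have "snd x $ (?l, idn (ctx_ob ?l)) = x" using that good_snd[OF that(1)] by (simp add: app_def prod_eq_iff)
    then show ?thesis using gl tl that by simp
  qed
  have fl: "full (?l, idn (ctx_ob ?l))" unfolding full_def using gl o by simp
  have f: "full \<langle>(?l, idn (ctx_ob ?l)), var i a\<rangle>"
    by (rule full_pr) (use fl assms(6,8) in \<open>auto simp: names_def\<close>)
  have t2: "ty \<langle>(?l, idn (ctx_ob ?l)), var i a\<rangle> = ctx_ob ?l \<otimes> a"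
    by (subst pr_good(2)) (use assms(6) gl tl in \<open>auto simp: names_def\<close>)
  have "ev a b \<cdot> (snd s ** idn a) = ev a b \<cdot> (snd t ** idn a)"
    by (rule el_lift[OF f]) (use e t2 l in \<open>simp_all add: ex[of s] ex[of t]\<close>)
  then have "snd s = snd t"
    by (intro curry_unique[of "snd s" "ctx_ob ?l" a b "snd t"]) (use l in simp_all)
  then show ?thesis using l by (simp add: prod_eq_iff)
qed

section \<open>Limits, and colimits by duality\<close>

text \<open>The limits that compute ends: universal families \<open>\<pi> a : e \<rightarrow> P a\<close>
  with \<open>u a b \<cdot> \<pi> a = v a b \<cdot> \<pi> b\<close> for all \<open>a, b\<close>;
  and dually for coends.\<close>

definition is_wlim where
  "is_wlim S P u v e \<pi> \<longleftrightarrow> e \<in> Ob V \<and> (\<forall>a\<in>S. \<pi> a \<in> hom e (P a)) \<and>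
     (\<forall>a\<in>S. \<forall>b\<in>S. u a b \<cdot> \<pi> a = v a b \<cdot> \<pi> b) \<and>
     (\<forall>e' \<pi>'. e' \<in> Ob V \<longrightarrow> (\<forall>a\<in>S. \<pi>' a \<in> hom e' (P a)) \<longrightarrow> (\<forall>a\<in>S. \<forall>b\<in>S. u a b \<cdot> \<pi>' a = v a b \<cdot> \<pi>' b) \<longrightarrow>
        (\<exists>!w. w \<in> hom e' e \<and> (\<forall>a\<in>S. \<pi> a \<cdot> w = \<pi>' a)))"

definition is_wcolim where
  "is_wcolim S P u v c \<iota> \<longleftrightarrow> c \<in> Ob V \<and> (\<forall>a\<in>S. \<iota> a \<in> hom (P a) c) \<and>
     (\<forall>a\<in>S. \<forall>b\<in>S. \<iota> a \<cdot> u a b = \<iota> b \<cdot> v a b) \<and>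
     (\<forall>c' \<iota>'. c' \<in> Ob V \<longrightarrow> (\<forall>a\<in>S. \<iota>' a \<in> hom (P a) c') \<longrightarrow> (\<forall>a\<in>S. \<forall>b\<in>S. \<iota>' a \<cdot> u a b = \<iota>' b \<cdot> v a b) \<longrightarrow>
        (\<exists>!w. w \<in> hom c c' \<and> (\<forall>a\<in>S. w \<cdot> \<iota> a = \<iota>' a)))"

definition is_prod where
  "is_prod S P l \<pi> \<longleftrightarrow> l \<in> Ob V \<and> (\<forall>a\<in>S. \<pi> a \<in> hom l (P a)) \<and>
     (\<forall>l' \<pi>'. l' \<in> Ob V \<longrightarrow> (\<forall>a\<in>S. \<pi>' a \<in> hom l' (P a)) \<longrightarrow> (\<exists>!w. w \<in> hom l' l \<and> (\<forall>a\<in>S. \<pi> a \<cdot> w = \<pi>' a)))"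

lemma is_prodD:
  assumes "is_prod S P l \<pi>"
  shows "l \<in> Ob V" "a \<in> S \<Longrightarrow> \<pi> a \<in> hom l (P a)"
    "l' \<in> Ob V \<Longrightarrow> (\<And>a. a \<in> S \<Longrightarrow> \<pi>' a \<in> hom l' (P a)) \<Longrightarrow> \<exists>!w. w \<in> hom l' l \<and> (\<forall>a\<in>S. \<pi> a \<cdot> w = \<pi>' a)"
  using assms unfolding is_prod_def by blast+

end

locale complete_star = star_autonomous_unit V for V :: "('o, 'm) smc" +
  fixes S :: "'s itself"
  assumes complete: "complete_cat S V" and inf: "infinite (UNIV :: 's set)"
begin

lemma product_exists:
  fixes I :: "'s set"
  assumes P: "\<And>a. a \<in> I \<Longrightarrow> P a \<in> Ob V"
  shows "\<exists>l \<pi>. is_prod I P l \<pi>"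
proof -
  let ?J = "\<lparr>Ob = I, Ar = I, Dom = (\<lambda>x. x), Cod = (\<lambda>x. x), Idn = (\<lambda>x. x), Cmp = (\<lambda>g f. f)\<rparr>"
  have J: "category ?J" by (auto simp: category_def Hom_def)
  have F: "ord_functor ?J V P (\<lambda>a. idn (P a))"
    using P by (auto simp: ord_functor_def Hom_def)
  obtain l \<pi> where l: "is_limit ?J V P (\<lambda>a. idn (P a)) l \<pi>"
    using complete J F unfolding complete_cat_def by blast
  have c: "is_cone ?J V P (\<lambda>a. idn (P a)) l' \<pi>' \<longleftrightarrow> l' \<in> Ob V \<and> (\<forall>i\<in>I. \<pi>' i \<in> hom l' (P i))" for l' \<pi>'
    using P by (auto simp: is_cone_def Hom_def)
  have "is_prod I P l \<pi>" using l unfolding is_limit_def is_prod_def c by simp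
  then show ?thesis by blast
qed

text \<open>The category with two objects and two parallel arrows between them is coded by four elements of
  the infinite type \<open>'s\<close>, where \<open>s0\<close> and \<open>s1\<close> serve both as
  the objects and as their identities.\<close>

lemma equaliser_exists:
  assumes u: "u \<in> hom a b" "v \<in> hom a b"
  shows "\<exists>e i. is_equaliser e i u v"
proof -
  fix s0 :: 's
  obtain s1 where d1: "s1 \<notin> {s0}" using ex_new_if_finite[OF inf, of "{s0}"] by blast
  obtain s2 where d2: "s2 \<notin> {s0, s1}" using ex_new_if_finite[OF inf, of "{s0, s1}"] by blast
  obtain s3 where d3: "s3 \<notin> {s0, s1, s2}" using ex_new_if_finite[OF inf, of "{s0, s1, s2}"] by blast
  have d: "s0 \<noteq> s1" "s0 \<noteq> s2" "s0 \<noteq> s3" "s1 \<noteq> s2" "s1 \<noteq> s3" "s2 \<noteq> s3" using d1 d2 d3 by auto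
  let ?J = "\<lparr>Ob = {s0, s1}, Ar = {s0, s1, s2, s3}, Dom = (\<lambda>x. if x = s1 then s1 else s0),
    Cod = (\<lambda>x. if x = s0 then s0 else s1), Idn = (\<lambda>x. x), Cmp = (\<lambda>g f. if f = s0 \<or> f = s1 then g else f)\<rparr>"
  have hj: "Hom ?J s0 s0 = {s0}" "Hom ?J s0 s1 = {s2, s3}" "Hom ?J s1 s1 = {s1}" "Hom ?J s1 s0 = {}"
    using d by (auto simp: Hom_def)
  have hj2: "f \<in> Hom ?J i j \<longleftrightarrow> (i = s0 \<and> j = s0 \<and> f = s0) \<or> (i = s0 \<and> j = s1 \<and> (f = s2 \<or> f = s3)) \<or> (i = s1 \<and> j = s1 \<and> f = s1)" for f i j
    using d by (auto simp: Hom_def)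
  have J: "category ?J" unfolding category_def hj2 using d by auto
  let ?Do = "\<lambda>x. if x = s0 then a else b"
  let ?Da = "\<lambda>x. if x = s0 then idn a else if x = s1 then idn b else if x = s2 then u else v"
  have [simp]: "a \<in> Ob V" "b \<in> Ob V" "u \<in> Ar V" "v \<in> Ar V" "Dom V u = a" "Dom V v = a" "Cod V u = b" "Cod V v = b"
    using u ar_ob[of u] by (auto simp: hom_iff)
  have F: "ord_functor ?J V ?Do ?Da"
    unfolding ord_functor_def hj2 using d by (auto simp: hom_iff)
  obtain e \<pi> where e: "is_limit ?J V ?Do ?Da e \<pi>"
    using complete J F unfolding complete_cat_def by blast
  have c: "is_cone ?J V ?Do ?Da l' \<pi>' \<longleftrightarrow> l' \<in> Ob V \<and> \<pi>' s0 \<in> hom l' a \<and> \<pi>' s1 = u \<cdot> \<pi>' s0 \<and> \<pi>' s1 = v \<cdot> \<pi>' s0" for l' \<pi>'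
  proof -
    have al: "(\<forall>i j f. f \<in> Hom ?J i j \<longrightarrow> R i j f) \<longleftrightarrow> R s0 s0 s0 \<and> R s0 s1 s2 \<and> R s0 s1 s3 \<and> R s1 s1 s1" for R
      unfolding hj2 by blast
    show ?thesis unfolding is_cone_def al using d by (auto simp: hom_iff)
  qed
  have "is_equaliser e (\<pi> s0) u v"
    unfolding is_equaliser_def
  proof (intro conjI allI impI)
    fix e' i' assume i: "i' \<in> hom e' (Dom V u)" "u \<cdot> i' = v \<cdot> i'"
    let ?p = "\<lambda>x. if x = s0 then i' else u \<cdot> i'"
    have cc: "is_cone ?J V ?Do ?Da e' ?p" unfolding c using i d by (auto simp: hom_iff)
    have ec: "is_cone ?J V ?Do ?Da e \<pi>" using e by (simp add: is_limit_def)
    have "\<exists>!w. w \<in> hom e' e \<and> (\<forall>x\<in>{s0, s1}. \<pi> x \<cdot> w = ?p x)"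
      using e[unfolded is_limit_def, THEN conjunct2, rule_format, OF cc] by simp
    moreover have "(\<forall>x\<in>{s0, s1}. \<pi> x \<cdot> w = ?p x) \<longleftrightarrow> \<pi> s0 \<cdot> w = i'" if "w \<in> hom e' e" for w
      using that d ec[unfolded c] i by (auto simp: hom_iff)
    ultimately show "\<exists>!w. w \<in> hom e' e \<and> \<pi> s0 \<cdot> w = i'" by (metis (no_types, lifting))
  qed (use e in \<open>auto simp: is_limit_def c hom_iff\<close>)
  then show ?thesis by blast
qed

text \<open>The limit is the equaliser of two maps from the product of all \<open>P a\<close> to the product
  of all \<open>Q a b\<close>. The latter is formed as an iterated product, so that no set of
  pairs has to be coded in the type \<open>'s\<close> that measures smallness.\<close>

lemma wlim_exists:
  fixes I :: "'s set"
  assumes P: "\<And>a. a \<in> I \<Longrightarrow> P a \<in> Ob V"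
    and u: "\<And>a b. a \<in> I \<Longrightarrow> b \<in> I \<Longrightarrow> u a b \<in> hom (P a) (Q a b)"
    and v: "\<And>a b. a \<in> I \<Longrightarrow> b \<in> I \<Longrightarrow> v a b \<in> hom (P b) (Q a b)"
  shows "\<exists>e \<pi>. is_wlim I P u v e \<pi>"
proof -
  obtain p \<pi> where p: "is_prod I P p \<pi>" using product_exists[of I P] P by blast
  have "\<exists>q \<rho>. is_prod I (Q a) q \<rho>" if "a \<in> I" for a
    by (rule product_exists) (use u[OF that] in \<open>metis ar_ob(2) hom_iff\<close>)
  then obtain q \<rho> where q: "\<And>a. a \<in> I \<Longrightarrow> is_prod I (Q a) (q a) (\<rho> a)" by metis
  obtain r \<sigma> where r: "is_prod I q r \<sigma>" using product_exists[of I q] q unfolding is_prod_def by blast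
  have pair: "\<exists>f. f \<in> hom p r \<and> (\<forall>a\<in>I. \<forall>b\<in>I. \<rho> a b \<cdot> \<sigma> a \<cdot> f = k a b)"
    if k: "\<And>a b. a \<in> I \<Longrightarrow> b \<in> I \<Longrightarrow> k a b \<in> hom p (Q a b)" for k
  proof -
    have "\<exists>h. h \<in> hom p (q a) \<and> (\<forall>b\<in>I. \<rho> a b \<cdot> h = k a b)" if "a \<in> I" for a
      using q[OF that] k[OF that] p unfolding is_prod_def by metis
    then obtain h where h: "\<And>a. a \<in> I \<Longrightarrow> h a \<in> hom p (q a) \<and> (\<forall>b\<in>I. \<rho> a b \<cdot> h a = k a b)" by metis
    then have "\<exists>f. f \<in> hom p r \<and> (\<forall>a\<in>I. \<sigma> a \<cdot> f = h a)"
      using r p unfolding is_prod_def by metis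
    then show ?thesis using h by auto
  qed
  have pp: "\<And>a. a \<in> I \<Longrightarrow> \<pi> a \<in> hom p (P a)" using p by (simp add: is_prod_def)
  obtain f where f: "f \<in> hom p r" "\<And>a b. a \<in> I \<Longrightarrow> b \<in> I \<Longrightarrow> \<rho> a b \<cdot> \<sigma> a \<cdot> f = u a b \<cdot> \<pi> a"
    using pair[of "\<lambda>a b. u a b \<cdot> \<pi> a"] pp u by (auto simp: hom_iff)
  obtain g where g: "g \<in> hom p r" "\<And>a b. a \<in> I \<Longrightarrow> b \<in> I \<Longrightarrow> \<rho> a b \<cdot> \<sigma> a \<cdot> g = v a b \<cdot> \<pi> b"
    using pair[of "\<lambda>a b. v a b \<cdot> \<pi> b"] pp v by (auto simp: hom_iff)
  obtain e i where e: "is_equaliser e i f g" using equaliser_exists f g by blast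
  have ty: "\<And>a. a \<in> I \<Longrightarrow> \<sigma> a \<in> hom r (q a)" "\<And>a b. a \<in> I \<Longrightarrow> b \<in> I \<Longrightarrow> \<rho> a b \<in> hom (q a) (Q a b)"
    using q r by (auto simp: is_prod_def)
  have i: "i \<in> hom e p" "f \<cdot> i = g \<cdot> i" using e f by (auto simp: is_equaliser_def hom_iff)
  have f': "\<rho> a b \<cdot> \<sigma> a \<cdot> f \<cdot> k = u a b \<cdot> \<pi> a \<cdot> k" "\<rho> a b \<cdot> \<sigma> a \<cdot> g \<cdot> k = v a b \<cdot> \<pi> b \<cdot> k"
    if "a \<in> I" "b \<in> I" "k \<in> hom e' p" for a b k e'
    using trail3[OF f(2)[OF that(1,2)]] trail3[OF g(2)[OF that(1,2)]] that ty[OF that(1)] ty(2)[OF that(1,2)] pp u[OF that(1,2)] v[OF that(1,2)] f(1) g(1)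
    by (simp_all add: hom_iff)
  have epi: "x = y" if x: "x \<in> hom e' r" and y: "y \<in> hom e' r" and xy: "\<And>a b. a \<in> I \<Longrightarrow> b \<in> I \<Longrightarrow> \<rho> a b \<cdot> \<sigma> a \<cdot> x = \<rho> a b \<cdot> \<sigma> a \<cdot> y" for x y e'
  proof -
    have eo: "e' \<in> Ob V" using x by (auto simp: hom_iff)
    have "\<sigma> a \<cdot> x = \<sigma> a \<cdot> y" if a: "a \<in> I" for a
    proof -
      have "\<exists>!w. w \<in> hom e' (q a) \<and> (\<forall>b\<in>I. \<rho> a b \<cdot> w = \<rho> a b \<cdot> \<sigma> a \<cdot> x)"
        by (rule is_prodD(3)[OF q[OF a] eo]) (use x ty(1)[OF a] ty(2)[OF a] in \<open>auto simp: hom_iff\<close>)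
      moreover have "\<sigma> a \<cdot> x \<in> hom e' (q a)" "\<sigma> a \<cdot> y \<in> hom e' (q a)"
        using x y ty(1)[OF a] by (auto simp: hom_iff)
      moreover have "\<forall>b\<in>I. \<rho> a b \<cdot> \<sigma> a \<cdot> y = \<rho> a b \<cdot> \<sigma> a \<cdot> x" using a xy by simp
      ultimately show ?thesis by blast
    qed
    moreover have "\<exists>!w. w \<in> hom e' r \<and> (\<forall>a\<in>I. \<sigma> a \<cdot> w = \<sigma> a \<cdot> x)"
      by (rule is_prodD(3)[OF r eo]) (use x ty(1) in \<open>auto simp: hom_iff\<close>)
    ultimately show ?thesis using x y by metis
  qed
  have "is_wlim I P u v e (\<lambda>a. \<pi> a \<cdot> i)"
    unfolding is_wlim_def
  proof (intro conjI allI impI ballI)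
    show "e \<in> Ob V" using i by (auto simp: hom_iff)
    show "\<pi> a \<cdot> i \<in> hom e (P a)" if "a \<in> I" for a using that pp i by (auto simp: hom_iff)
    show "u a b \<cdot> \<pi> a \<cdot> i = v a b \<cdot> \<pi> b \<cdot> i" if "a \<in> I" "b \<in> I" for a b
      using f'[OF that i(1)] i(2) by simp
  next
    fix e' \<pi>' assume eo: "e' \<in> Ob V" and h: "\<forall>a\<in>I. \<pi>' a \<in> hom e' (P a)"
      and c: "\<forall>a\<in>I. \<forall>b\<in>I. u a b \<cdot> \<pi>' a = v a b \<cdot> \<pi>' b"
    have pu: "\<exists>!w. w \<in> hom e' p \<and> (\<forall>a\<in>I. \<pi> a \<cdot> w = \<pi>' a)"
      using p eo h unfolding is_prod_def by blast
    then obtain w where w: "w \<in> hom e' p" "\<And>a. a \<in> I \<Longrightarrow> \<pi> a \<cdot> w = \<pi>' a" by blast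
    have "f \<cdot> w = g \<cdot> w"
      by (rule epi[of _ e']) (use w f(1) g(1) c in \<open>auto simp: f'[OF _ _ w(1)]\<close>, auto simp: hom_iff)
    then have ex: "\<exists>!k. k \<in> hom e' e \<and> i \<cdot> k = w"
      using e[unfolded is_equaliser_def, THEN conjunct2, THEN conjunct2, THEN conjunct2, THEN conjunct2, rule_format, of w e']
        w f(1) by (simp add: hom_iff)
    show "\<exists>!k. k \<in> hom e' e \<and> (\<forall>a\<in>I. (\<pi> a \<cdot> i) \<cdot> k = \<pi>' a)"
    proof -
      have "(\<forall>a\<in>I. (\<pi> a \<cdot> i) \<cdot> k = \<pi>' a) \<longleftrightarrow> i \<cdot> k = w" if "k \<in> hom e' e" for k
      proof -
        have eq: "(\<pi> a \<cdot> i) \<cdot> k = \<pi> a \<cdot> i \<cdot> k" if "a \<in> I" for a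
          using pp[OF that] i \<open>k \<in> hom e' e\<close> by (auto simp: hom_iff)
        have ik: "i \<cdot> k \<in> hom e' p" using i that by (auto simp: hom_iff)
        show ?thesis
        proof
          assume "\<forall>a\<in>I. (\<pi> a \<cdot> i) \<cdot> k = \<pi>' a"
          then have "\<forall>a\<in>I. \<pi> a \<cdot> i \<cdot> k = \<pi>' a" using eq by simp
          moreover have "\<forall>a\<in>I. \<pi> a \<cdot> w = \<pi>' a" using w by blast
          ultimately show "i \<cdot> k = w" using pu ik w(1) by blast
        next
          assume "i \<cdot> k = w"
          then show "\<forall>a\<in>I. (\<pi> a \<cdot> i) \<cdot> k = \<pi>' a" using eq w(2) by simp
        qed
      qed
      then show ?thesis using ex by (metis (no_types, lifting))
    qed
  qed
  then show ?thesis by blast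
qed

subsection \<open>Duality\<close>

text \<open>The duality \<open>a \<mapsto> [a, \<I>]\<close> and the canonical map into the double dual,
  which is invertible because \<open>\<I>\<close> is dualising.\<close>

definition Du :: "'o \<Rightarrow> 'o" where "Du a = a \<multimap> \<I>"

definition Dm :: "'m \<Rightarrow> 'm" where
  "Dm f = curry (Du (Cod V f)) (Dom V f) \<I> (ev (Cod V f) \<I> \<cdot> (idn (Du (Cod V f)) ** f))"

definition dd :: "'o \<Rightarrow> 'm" where
  "dd a = curry a (Du a) \<I> (ev a \<I> \<cdot> sym a (Du a))"

lemma Du_ob [simp]: "a \<in> Ob V \<Longrightarrow> Du a \<in> Ob V"
  by (simp add: Du_def)

lemma Dm_ar [simp]:
  assumes "f \<in> Ar V"
  shows "Dm f \<in> Ar V" "Dom V (Dm f) = Du (Cod V f)" "Cod V (Dm f) = Du (Dom V f)"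
  using assms by (simp_all add: Dm_def Du_def)

lemma dd_ar [simp]:
  assumes "a \<in> Ob V"
  shows "dd a \<in> Ar V" "Dom V (dd a) = a" "Cod V (dd a) = Du (Du a)" "iso (dd a)"
  using assms unit_dualising by (simp_all add: dd_def Du_def dualising_def)

lemma Dm_app [simp]:
  assumes "f \<in> Ar V" "Dom V f = a" "Cod V f = b" "els [(s, Du b), (t, a)]"
  shows "ev a \<I> $ \<langle>Dm f $ s, t\<rangle> = ev b \<I> $ \<langle>s, f $ t\<rangle>"
  using assms ar_ob[of f] by (simp add: Dm_def Du_def)

lemma dd_app [simp]:
  assumes "els [(s, a), (t, Du a)]"
  shows "ev (Du a) \<I> $ \<langle>dd a $ s, t\<rangle> = ev a \<I> $ \<langle>t, s\<rangle>"
proof -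
  have "a \<in> Ob V" using assms by auto
  then show ?thesis using assms by (simp add: dd_def Du_def)
qed

lemma Dm_cmp:
  assumes [simp]: "f \<in> Ar V" "g \<in> Ar V" "Cod V f = Dom V g"
  shows "Dm (g \<cdot> f) = Dm f \<cdot> Dm g"
  by (rule el_ext[of "var 0 (Du (Cod V g))"], simp, rule ih_ext[where a = "Dom V f" and b = \<I> and i = 1])
    (simp_all add: Du_def[of "Dom V f"])

lemma dd_nat:
  assumes [simp]: "f \<in> Ar V" "Dom V f = a" "Cod V f = b"
  shows "Dm (Dm f) \<cdot> dd a = dd b \<cdot> f"
proof -
  have [simp]: "a \<in> Ob V" "b \<in> Ob V" using assms ar_ob[of f] by auto
  show ?thesis
  by (rule el_ext[of "var 0 a"], simp, rule ih_ext[where a = "Du b" and b = \<I> and i = 1])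
    (simp_all add: Du_def[of "Du b"])
qed

text \<open>By naturality of \<open>dd\<close>, the double dual of \<open>f\<close> determines
  \<open>f\<close>.\<close>

lemma Dm_faithful:
  assumes [simp]: "f \<in> hom a b" "g \<in> hom a b" and e: "Dm f = Dm g"
  shows "f = g"
proof -
  have t: "f \<in> Ar V" "g \<in> Ar V" "Dom V f = a" "Dom V g = a" "Cod V f = b" "Cod V g = b"
    using assms by (auto simp: hom_iff)
  have "dd b \<cdot> f = dd b \<cdot> g" using dd_nat[OF t(1,3,5)] dd_nat[OF t(2,4,6)] e by simp
  then show ?thesis using t ar_ob[OF t(1)] by (intro iso_cancelL[of "dd b" f g]) auto
qed

text \<open>The preimage of \<open>g\<close> is the dual of \<open>g\<close>, conjugated with
  \<open>dd\<close>.\<close>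

lemma Dm_full:
  assumes "g \<in> hom (Du b) (Du a)" "a \<in> Ob V" "b \<in> Ob V"
  shows "\<exists>f. f \<in> hom a b \<and> Dm f = g"
proof -
  let ?f = "inv (dd b) \<cdot> Dm g \<cdot> dd a"
  have t: "g \<in> Ar V" "Dom V g = Du b" "Cod V g = Du a" using assms by (auto simp: hom_iff)
  have ft: "?f \<in> Ar V" "Dom V ?f = a" "Cod V ?f = b" using assms t by auto
  have "Dm (Dm ?f) \<cdot> dd a = Dm g \<cdot> dd a"
    unfolding dd_nat[OF ft] using assms(2,3) t by simp
  then have "Dm (Dm ?f) = Dm g" by (rule iso_cancelR[rotated -1]) (use assms(2,3) t ft in simp_all)
  then have "Dm ?f = g" by (rule Dm_faithful[rotated -1]) (use assms(2,3) t ft in \<open>simp_all add: hom_iff\<close>)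
  then show ?thesis using ft by (auto simp: hom_iff)
qed

text \<open>The colimit is the dual of the limit \<open>e\<close> of the dual diagram. As dualising is fully
  faithful, cocones to \<open>c'\<close> are the same as cones from the dual of \<open>c'\<close>,
  hence as arrows from there to \<open>e\<close>, hence as arrows from the dual of
  \<open>e\<close> to \<open>c'\<close>.\<close>

lemma wcolim_exists:
  fixes I :: "'s set"
  assumes P: "\<And>a. a \<in> I \<Longrightarrow> P a \<in> Ob V"
    and u: "\<And>a b. a \<in> I \<Longrightarrow> b \<in> I \<Longrightarrow> u a b \<in> hom (Q a b) (P a)"
    and v: "\<And>a b. a \<in> I \<Longrightarrow> b \<in> I \<Longrightarrow> v a b \<in> hom (Q a b) (P b)"
  shows "\<exists>c \<iota>. is_wcolim I P u v c \<iota>"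
proof -
  have "\<exists>e \<pi>. is_wlim I (\<lambda>a. Du (P a)) (\<lambda>a b. Dm (u a b)) (\<lambda>a b. Dm (v a b)) e \<pi>"
    by (rule wlim_exists[where Q = "\<lambda>a b. Du (Q a b)"]) (use P u v in \<open>auto simp: hom_iff\<close>)
  then obtain e w where e: "is_wlim I (\<lambda>a. Du (P a)) (\<lambda>a b. Dm (u a b)) (\<lambda>a b. Dm (v a b)) e w" by blast
  have eo [simp]: "e \<in> Ob V" and w: "\<And>a. a \<in> I \<Longrightarrow> w a \<in> hom e (Du (P a))"
    and wc: "\<And>a b. a \<in> I \<Longrightarrow> b \<in> I \<Longrightarrow> Dm (u a b) \<cdot> w a = Dm (v a b) \<cdot> w b"
    using e by (auto simp: is_wlim_def)
  have "\<exists>f. f \<in> hom (P a) (Du e) \<and> Dm f = w a \<cdot> inv (dd e)" if "a \<in> I" for a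
    by (rule Dm_full) (use P w that in \<open>auto simp: hom_iff\<close>)
  then obtain \<iota> where i: "\<And>a. a \<in> I \<Longrightarrow> \<iota> a \<in> hom (P a) (Du e)"
    and iw: "\<And>a. a \<in> I \<Longrightarrow> Dm (\<iota> a) = w a \<cdot> inv (dd e)" by metis
  have "is_wcolim I P u v (Du e) \<iota>"
    unfolding is_wcolim_def
  proof (intro conjI allI impI ballI)
    show "Du e \<in> Ob V" by simp
    show "\<iota> a \<in> hom (P a) (Du e)" if "a \<in> I" for a by (rule i[OF that])
    show "\<iota> a \<cdot> u a b = \<iota> b \<cdot> v a b" if a: "a \<in> I" "b \<in> I" for a b
    proof (rule Dm_faithful[of _ "Q a b" "Du e"])
      have "Dm (u a b) \<cdot> w a \<cdot> inv (dd e) = Dm (v a b) \<cdot> w b \<cdot> inv (dd e)"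
        using trail[OF wc[OF a]] u[OF a] v[OF a] w[OF a(1)] w[OF a(2)] by (simp add: hom_iff)
      then show "Dm (\<iota> a \<cdot> u a b) = Dm (\<iota> b \<cdot> v a b)"
        using u[OF a] v[OF a] i[OF a(1)] i[OF a(2)] iw a by (simp add: Dm_cmp hom_iff)
    qed (use u[OF a] v[OF a] i[OF a(1)] i[OF a(2)] in \<open>auto simp: hom_iff\<close>)
  next
    fix c' \<iota>' assume co: "c' \<in> Ob V" and h: "\<forall>a\<in>I. \<iota>' a \<in> hom (P a) c'"
      and c: "\<forall>a\<in>I. \<forall>b\<in>I. \<iota>' a \<cdot> u a b = \<iota>' b \<cdot> v a b"
    have "\<exists>!k. k \<in> hom (Du c') e \<and> (\<forall>a\<in>I. w a \<cdot> k = Dm (\<iota>' a))"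
    proof -
      have "\<forall>a\<in>I. \<forall>b\<in>I. Dm (u a b) \<cdot> Dm (\<iota>' a) = Dm (v a b) \<cdot> Dm (\<iota>' b)"
      proof (intro ballI)
        fix a b assume a: "a \<in> I" "b \<in> I"
        have "Dm (\<iota>' a \<cdot> u a b) = Dm (\<iota>' b \<cdot> v a b)" using a c by simp
        then show "Dm (u a b) \<cdot> Dm (\<iota>' a) = Dm (v a b) \<cdot> Dm (\<iota>' b)"
          using u[OF a] v[OF a] h a by (simp add: Dm_cmp hom_iff)
      qed
      moreover have "Dm (\<iota>' a) \<in> hom (Du c') (Du (P a))" if "a \<in> I" for a using h that by (auto simp: hom_iff)
      ultimately show ?thesis
        using co e[unfolded is_wlim_def, THEN conjunct2, THEN conjunct2, THEN conjunct2, rule_format, of "Du c'" "\<lambda>a. Dm (\<iota>' a)"]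
        by simp
    qed
    then obtain k where k: "k \<in> hom (Du c') e" "\<And>a. a \<in> I \<Longrightarrow> w a \<cdot> k = Dm (\<iota>' a)"
      and ku: "\<And>k'. k' \<in> hom (Du c') e \<Longrightarrow> (\<And>a. a \<in> I \<Longrightarrow> w a \<cdot> k' = Dm (\<iota>' a)) \<Longrightarrow> k' = k" by metis
    have "dd e \<cdot> k \<in> hom (Du c') (Du (Du e))" using k by (auto simp: hom_iff)
    then obtain m where m: "m \<in> hom (Du e) c'" "Dm m = dd e \<cdot> k" using Dm_full[of _ c' "Du e"] co by auto
    show "\<exists>!m. m \<in> hom (Du e) c' \<and> (\<forall>a\<in>I. m \<cdot> \<iota> a = \<iota>' a)"
    proof (rule ex1I[of _ m], intro conjI ballI)
      fix a assume a: "a \<in> I"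
      have "Dm (m \<cdot> \<iota> a) = Dm (\<iota>' a)"
        using m i[OF a] iw[OF a] k(1) k(2)[OF a] w[OF a] by (auto simp: Dm_cmp hom_iff)
      then show "m \<cdot> \<iota> a = \<iota>' a"
        by (rule Dm_faithful[rotated -1]) (use m(1) i[OF a] h a in \<open>auto simp: hom_iff\<close>)
    next
      fix m' assume m': "m' \<in> hom (Du e) c' \<and> (\<forall>a\<in>I. m' \<cdot> \<iota> a = \<iota>' a)"
      have "inv (dd e) \<cdot> Dm m' = k"
      proof (rule ku)
        show "inv (dd e) \<cdot> Dm m' \<in> hom (Du c') e" using m' by (auto simp: hom_iff)
        fix a assume a: "a \<in> I"
        have "w a \<cdot> inv (dd e) \<cdot> Dm m' = Dm (\<iota> a) \<cdot> Dm m'"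
          unfolding iw[OF a] using w[OF a] m' by (auto simp: hom_iff)
        also have "\<dots> = Dm (\<iota>' a)" using Dm_cmp[of "\<iota> a" m'] m' i[OF a] a by (auto simp: hom_iff)
        finally show "w a \<cdot> inv (dd e) \<cdot> Dm m' = Dm (\<iota>' a)" .
      qed
      then have "dd e \<cdot> inv (dd e) \<cdot> Dm m' = dd e \<cdot> k" by simp
      then have "Dm m' = Dm m" using m' m by (auto simp: hom_iff)
      then show "m' = m" by (rule Dm_faithful[rotated -1]) (use m' m in \<open>auto simp: hom_iff\<close>)
    qed (rule m)
  qed
  then show ?thesis by blast
qed

end

section \<open>\<open>\<V>\<close>-categories and \<open>\<V>\<close>-functors in elements\<close>

declare One_nat_def [simp del]

context symmetric_monoidal_closed
begin

lemma vhom_ob [simp]: "vcategory C \<Longrightarrow> a \<in> VOb C \<Longrightarrow> b \<in> VOb C \<Longrightarrow> VHom C a b \<in> Ob V"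
  unfolding vcategory_def by blast

lemma vid_ar [simp]:
  assumes "vcategory C" "a \<in> VOb C"
  shows "VId C a \<in> Ar V" "Dom V (VId C a) = \<I>" "Cod V (VId C a) = VHom C a a"
  using assms unfolding vcategory_def hom_iff by blast+

lemma vcmp_ar [simp]:
  assumes "vcategory C" "a \<in> VOb C" "b \<in> VOb C" "c \<in> VOb C"
  shows "VCmp C a b c \<in> Ar V" "Dom V (VCmp C a b c) = VHom C b c \<otimes> VHom C a b"
    "Cod V (VCmp C a b c) = VHom C a c"
  using assms unfolding vcategory_def hom_iff by blast+

lemma vcmp_assoc [simp]:
  assumes C: "vcategory C" "a \<in> VOb C" "b \<in> VOb C" "c \<in> VOb C" "d \<in> VOb C"
    and e: "els [(h, VHom C c d), (g, VHom C b c), (f, VHom C a b)]"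
  shows "VCmp C a b d $ \<langle>VCmp C b c d $ \<langle>h, g\<rangle>, f\<rangle> = VCmp C a c d $ \<langle>h, VCmp C a b c $ \<langle>g, f\<rangle>\<rangle>"
proof -
  have "VCmp C a b d \<cdot> (VCmp C b c d ** idn (VHom C a b)) $ \<langle>\<langle>h, g\<rangle>, f\<rangle>
    = VCmp C a c d \<cdot> (idn (VHom C c d) ** VCmp C a b c) \<cdot> asc (VHom C c d) (VHom C b c) (VHom C a b) $ \<langle>\<langle>h, g\<rangle>, f\<rangle>"
    using C unfolding vcategory_def by metis
  then show ?thesis using C e by simp
qed

lemma vcmp_idL [simp]:
  assumes C: "vcategory C" "a \<in> VOb C" "b \<in> VOb C" and e: "good f" "ty f = VHom C a b"
  shows "VCmp C a b b $ \<langle>VId C b $ un, f\<rangle> = f"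
proof -
  have "VCmp C a b b \<cdot> (VId C b ** idn (VHom C a b)) $ \<langle>un, f\<rangle> = lun (VHom C a b) $ \<langle>un, f\<rangle>"
    using C unfolding vcategory_def by metis
  then show ?thesis using C e by simp
qed

lemma vcmp_idR [simp]:
  assumes C: "vcategory C" "a \<in> VOb C" "b \<in> VOb C" and e: "good f" "ty f = VHom C a b"
  shows "VCmp C a a b $ \<langle>f, VId C a $ un\<rangle> = f"
proof -
  have "VCmp C a a b \<cdot> (idn (VHom C a b) ** VId C a) $ \<langle>f, un\<rangle> = run (VHom C a b) $ \<langle>f, un\<rangle>"
    using C unfolding vcategory_def by metis
  then show ?thesis using C e by simp
qed

lemma vcategoryI:
  assumes ob: "\<And>a b. a \<in> VOb C \<Longrightarrow> b \<in> VOb C \<Longrightarrow> VHom C a b \<in> Ob V"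
    and i: "\<And>a. a \<in> VOb C \<Longrightarrow> VId C a \<in> hom \<I> (VHom C a a)"
    and m: "\<And>a b c. a \<in> VOb C \<Longrightarrow> b \<in> VOb C \<Longrightarrow> c \<in> VOb C \<Longrightarrow> VCmp C a b c \<in> hom (VHom C b c \<otimes> VHom C a b) (VHom C a c)"
    and iL: "\<And>a b. a \<in> VOb C \<Longrightarrow> b \<in> VOb C \<Longrightarrow>
      VCmp C a b b $ \<langle>VId C b $ un, var 0 (VHom C a b)\<rangle> = var 0 (VHom C a b)"
    and iR: "\<And>a b. a \<in> VOb C \<Longrightarrow> b \<in> VOb C \<Longrightarrow>
      VCmp C a a b $ \<langle>var 0 (VHom C a b), VId C a $ un\<rangle> = var 0 (VHom C a b)"
    and as: "\<And>a b c d. a \<in> VOb C \<Longrightarrow> b \<in> VOb C \<Longrightarrow> c \<in> VOb C \<Longrightarrow> d \<in> VOb C \<Longrightarrow>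
      VCmp C a b d $ \<langle>VCmp C b c d $ \<langle>var 0 (VHom C c d), var 1 (VHom C b c)\<rangle>, var 2 (VHom C a b)\<rangle>
        = VCmp C a c d $ \<langle>var 0 (VHom C c d), VCmp C a b c $ \<langle>var 1 (VHom C b c), var 2 (VHom C a b)\<rangle>\<rangle>"
  shows "vcategory C"
proof -
  have [simp]: "VId C a \<in> Ar V" "Dom V (VId C a) = \<I>" "Cod V (VId C a) = VHom C a a" if "a \<in> VOb C" for a
    using i[OF that] by (auto simp: hom_iff)
  have [simp]: "VCmp C a b c \<in> Ar V" "Dom V (VCmp C a b c) = VHom C b c \<otimes> VHom C a b"
    "Cod V (VCmp C a b c) = VHom C a c" if "a \<in> VOb C" "b \<in> VOb C" "c \<in> VOb C" for a b c
    using m[OF that] by (auto simp: hom_iff)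
  note ob [simp]
  show ?thesis
    unfolding vcategory_def
  proof (intro conjI ballI)
    fix a b assume [simp]: "a \<in> VOb C" "b \<in> VOb C"
    show "VCmp C a b b \<cdot> (VId C b ** idn (VHom C a b)) = lun (VHom C a b)"
      by (rule el_ext[of "\<langle>un, var 0 (VHom C a b)\<rangle>"]) (simp_all add: iL)
    show "VCmp C a a b \<cdot> (idn (VHom C a b) ** VId C a) = run (VHom C a b)"
      by (rule el_ext[of "\<langle>var 0 (VHom C a b), un\<rangle>"]) (simp_all add: iR)
    fix c d assume [simp]: "c \<in> VOb C" "d \<in> VOb C"
    show "VCmp C a b d \<cdot> (VCmp C b c d ** idn (VHom C a b))
          = VCmp C a c d \<cdot> (idn (VHom C c d) ** VCmp C a b c)
              \<cdot> asc (VHom C c d) (VHom C b c) (VHom C a b)"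
      by (rule el_ext[of "\<langle>\<langle>var 0 (VHom C c d), var 1 (VHom C b c)\<rangle>, var 2 (VHom C a b)\<rangle>"]) (simp_all add: as)
  qed (use ob i m in auto)
qed

subsection \<open>\<open>\<V>\<close>-functors\<close>

lemma vfun_ar:
  assumes "vfunctor C D F"
  shows "a \<in> VOb C \<Longrightarrow> FOb F a \<in> VOb D"
    "a \<in> VOb C \<Longrightarrow> b \<in> VOb C \<Longrightarrow> FMap F a b \<in> Ar V"
    "a \<in> VOb C \<Longrightarrow> b \<in> VOb C \<Longrightarrow> Dom V (FMap F a b) = VHom C a b"
    "a \<in> VOb C \<Longrightarrow> b \<in> VOb C \<Longrightarrow> Cod V (FMap F a b) = VHom D (FOb F a) (FOb F b)"
    "vcategory C" "vcategory D"
  using assms unfolding vfunctor_def hom_iff by blast+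

lemma vfun_id:
  assumes F: "vfunctor C D F" and a: "a \<in> VOb C"
  shows "FMap F a a $ VId C a $ un = VId D (FOb F a) $ un"
proof -
  have "FMap F a a \<cdot> VId C a $ un = VId D (FOb F a) $ un"
    using F a unfolding vfunctor_def by metis
  then show ?thesis using a by (simp add: vfun_ar[OF F])
qed

lemma vfun_cmp:
  assumes F: "vfunctor C D F" and a: "a \<in> VOb C" "b \<in> VOb C" "c \<in> VOb C"
    and e: "els [(g, VHom C b c), (f, VHom C a b)]"
  shows "FMap F a c $ VCmp C a b c $ \<langle>g, f\<rangle>
    = VCmp D (FOb F a) (FOb F b) (FOb F c) $ \<langle>FMap F b c $ g, FMap F a b $ f\<rangle>"
proof -
  have "FMap F a c \<cdot> VCmp C a b c $ \<langle>g, f\<rangle>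
    = VCmp D (FOb F a) (FOb F b) (FOb F c) \<cdot> (FMap F b c ** FMap F a b) $ \<langle>g, f\<rangle>"
    using F a unfolding vfunctor_def by metis
  then show ?thesis using a e by (simp add: vfun_ar[OF F])
qed

lemma mkfun_simps [simp]:
  "a \<in> VOb C \<Longrightarrow> FOb (mkfun C fo fm) a = fo a"
  "a \<in> VOb C \<Longrightarrow> b \<in> VOb C \<Longrightarrow> FMap (mkfun C fo fm) a b = fm a b"
  by (simp_all add: mkfun_def)

text \<open>The action of \<open>h : C(a,b)\<close> on an element of \<open>F a\<close>, for a \<open>\<V>\<close>-valued functor \<open>F\<close>.\<close>

abbreviation (input) push where
  "push F a b h t \<equiv> ev (FOb F a) (FOb F b) $ \<langle>FMap F a b $ h, t\<rangle>"

text \<open>The component at \<open>a\<close> of an element \<open>n\<close> of \<open>[A,\<V>](F,G)\<close>, applied to an element of \<open>F a\<close>.\<close>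

abbreviation (input) nat_at where
  "nat_at A F G a n t \<equiv> ev (FOb F a) (FOb G a) $ \<langle>nproj A F G a $ n, t\<rangle>"

lemma vfunctorI:
  assumes C: "vcategory C" and D: "vcategory D"
    and ob: "\<And>a. a \<in> VOb C \<Longrightarrow> fo a \<in> VOb D"
    and ar: "\<And>a b. a \<in> VOb C \<Longrightarrow> b \<in> VOb C \<Longrightarrow> fm a b \<in> hom (VHom C a b) (VHom D (fo a) (fo b))"
    and i: "\<And>a. a \<in> VOb C \<Longrightarrow> fm a a $ VId C a $ un = VId D (fo a) $ un"
    and m: "\<And>a b c. a \<in> VOb C \<Longrightarrow> b \<in> VOb C \<Longrightarrow> c \<in> VOb C \<Longrightarrow>
       fm a c $ VCmp C a b c $ \<langle>var 0 (VHom C b c), var 1 (VHom C a b)\<rangle>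
         = VCmp D (fo a) (fo b) (fo c) $ \<langle>fm b c $ var 0 (VHom C b c), fm a b $ var 1 (VHom C a b)\<rangle>"
  shows "vfunctor C D (mkfun C fo fm)"
proof -
  note [simp] = C D ob
  have [simp]: "fm a b \<in> Ar V" "Dom V (fm a b) = VHom C a b" "Cod V (fm a b) = VHom D (fo a) (fo b)"
    if "a \<in> VOb C" "b \<in> VOb C" for a b using ar[OF that] by (auto simp: hom_iff)
  have "fm a a \<cdot> VId C a = VId D (fo a)" if [simp]: "a \<in> VOb C" for a
    by (rule el_ext[of un]) (simp_all add: i)
  moreover have "fm a c \<cdot> VCmp C a b c = VCmp D (fo a) (fo b) (fo c) \<cdot> (fm b c ** fm a b)"
    if [simp]: "a \<in> VOb C" "b \<in> VOb C" "c \<in> VOb C" for a b c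
    by (rule el_ext[of "\<langle>var 0 (VHom C b c), var 1 (VHom C a b)\<rangle>"]) (simp_all add: m)
  ultimately show ?thesis unfolding vfunctor_def using ar by (auto simp: mkfun_def)
qed

lemma postcomp_ar [simp]:
  assumes "vcategory C" "a \<in> VOb C" "b \<in> VOb C" "c \<in> VOb C" "e \<in> Ar V" "Dom V e = \<I>" "Cod V e = VHom C b c"
  shows "postcomp C a b c e \<in> Ar V" "Dom V (postcomp C a b c e) = VHom C a b"
    "Cod V (postcomp C a b c e) = VHom C a c"
  using assms by (simp_all add: postcomp_def)

lemma precomp_ar [simp]:
  assumes "vcategory C" "a \<in> VOb C" "b \<in> VOb C" "c \<in> VOb C" "e \<in> Ar V" "Dom V e = \<I>" "Cod V e = VHom C a b"
  shows "precomp C a b c e \<in> Ar V" "Dom V (precomp C a b c e) = VHom C b c"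
    "Cod V (precomp C a b c e) = VHom C a c"
  using assms by (simp_all add: precomp_def)

lemma app_postcomp [simp]:
  assumes "vcategory C" "a \<in> VOb C" "b \<in> VOb C" "c \<in> VOb C" "e \<in> Ar V" "Dom V e = \<I>" "Cod V e = VHom C b c"
    "good f" "ty f = VHom C a b"
  shows "postcomp C a b c e $ f = VCmp C a b c $ \<langle>e $ un, f\<rangle>"
  using assms by (simp add: postcomp_def)

lemma app_precomp [simp]:
  assumes "vcategory C" "a \<in> VOb C" "b \<in> VOb C" "c \<in> VOb C" "e \<in> Ar V" "Dom V e = \<I>" "Cod V e = VHom C a b"
    "good f" "ty f = VHom C b c"
  shows "precomp C a b c e $ f = VCmp C a b c $ \<langle>f, e $ un\<rangle>"
  using assms by (simp add: precomp_def)

lemma ucomp_ar [simp]: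
  assumes "vcategory C" "a \<in> VOb C" "b \<in> VOb C" "c \<in> VOb C" "f \<in> Ar V" "Dom V f = \<I>" "Cod V f = VHom C a b"
    "g \<in> Ar V" "Dom V g = \<I>" "Cod V g = VHom C b c"
  shows "ucomp C a b c g f \<in> Ar V" "Dom V (ucomp C a b c g f) = \<I>" "Cod V (ucomp C a b c g f) = VHom C a c"
    "ucomp C a b c g f $ un = VCmp C a b c $ \<langle>g $ un, f $ un\<rangle>"
  using assms by (simp_all add: ucomp_def)

subsection \<open>\<open>\<V>\<close> as a \<open>\<V>\<close>-category\<close>

lemma vself_simps [simp]: "VOb vself = Ob V" "VHom vself a b = (a \<multimap> b)"
  by (simp_all add: vself_def)

lemma vself_id_ar:
  assumes "a \<in> Ob V"
  shows "VId vself a \<in> Ar V" "Dom V (VId vself a) = \<I>" "Cod V (VId vself a) = a \<multimap> a"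
  using assms by (simp_all add: vself_def)

lemma vself_cmp_ar:
  assumes "a \<in> Ob V" "b \<in> Ob V" "c \<in> Ob V"
  shows "VCmp vself a b c \<in> Ar V" "Dom V (VCmp vself a b c) = (b \<multimap> c) \<otimes> (a \<multimap> b)" "Cod V (VCmp vself a b c) = a \<multimap> c"
  using assms by (simp_all add: vself_def)

lemma ev_vself_cmp [simp]:
  assumes "els [(g, b \<multimap> c), (f, a \<multimap> b), (t, a)]"
    "a \<in> Ob V" "b \<in> Ob V" "c \<in> Ob V"
  shows "ev a c $ \<langle>VCmp vself a b c $ \<langle>g, f\<rangle>, t\<rangle> = ev b c $ \<langle>g, ev a b $ \<langle>f, t\<rangle>\<rangle>"
  using assms by (simp add: vself_def)

lemma ev_vself_id [simp]:
  assumes "good t" "ty t = a" "a \<in> Ob V"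
  shows "ev a a $ \<langle>VId vself a $ un, t\<rangle> = t"
  using assms by (simp add: vself_def)

lemma vcategory_vself [simp]: "vcategory vself"
proof (rule vcategoryI)
  note [simp] = vself_id_ar vself_cmp_ar
  fix a b :: 'o assume "a \<in> VOb vself" "b \<in> VOb vself"
  then have [simp]: "a \<in> Ob V" "b \<in> Ob V" by auto
  show "VCmp vself a b b $ \<langle>VId vself b $ un, var 0 (VHom vself a b)\<rangle> = var 0 (VHom vself a b)"
    by (rule ih_ext[where a = a and b = b and i = 3]) simp_all
  show "VCmp vself a a b $ \<langle>var 0 (VHom vself a b), VId vself a $ un\<rangle> = var 0 (VHom vself a b)"
    by (rule ih_ext[where a = a and b = b and i = 3]) simp_all
  fix c d :: 'o assume "c \<in> VOb vself" "d \<in> VOb vself"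
  then have [simp]: "c \<in> Ob V" "d \<in> Ob V" by auto
  show "VCmp vself a b d $ \<langle>VCmp vself b c d $ \<langle>var 0 (VHom vself c d), var 1 (VHom vself b c)\<rangle>, var 2 (VHom vself a b)\<rangle>
        = VCmp vself a c d $ \<langle>var 0 (VHom vself c d), VCmp vself a b c $ \<langle>var 1 (VHom vself b c), var 2 (VHom vself a b)\<rangle>\<rangle>"
    by (rule ih_ext[where a = a and b = d and i = 3]) simp_all
qed (simp_all add: hom_iff vself_id_ar vself_cmp_ar)

lemma vop_simps [simp]: "VOb (vop A) = VOb A" "VHom (vop A) a b = VHom A b a" "VId (vop A) = VId A"
  by (simp_all add: vop_def)

lemma vop_cmp_ar:
  assumes "vcategory A" "a \<in> VOb A" "b \<in> VOb A" "c \<in> VOb A"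
  shows "VCmp (vop A) a b c \<in> Ar V" "Dom V (VCmp (vop A) a b c) = VHom A c b \<otimes> VHom A b a"
    "Cod V (VCmp (vop A) a b c) = VHom A c a"
  using assms by (simp_all add: vop_def)

lemma vop_cmp [simp]:
  assumes "vcategory A" "a \<in> VOb A" "b \<in> VOb A" "c \<in> VOb A" "els [(g, VHom A c b), (f, VHom A b a)]"
  shows "VCmp (vop A) a b c $ \<langle>g, f\<rangle> = VCmp A c b a $ \<langle>f, g\<rangle>"
  using assms apart_sym by (simp add: vop_def)

lemma vcategory_vop [simp]:
  assumes [simp]: "vcategory A"
  shows "vcategory (vop A)"
  by (rule vcategoryI) (simp_all add: hom_iff vop_cmp_ar)

text \<open>The laws of the action are required as equations between arrows. Where the values of the functor
  are coends, these are not verified on variables but on coprojections.\<close>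

lemma vfunctor_actionI:
  assumes C: "vcategory C"
    and ob: "\<And>a. a \<in> VOb C \<Longrightarrow> fo a \<in> Ob V"
    and ar: "\<And>a b. a \<in> VOb C \<Longrightarrow> b \<in> VOb C \<Longrightarrow> t a b \<in> hom (VHom C a b \<otimes> fo a) (fo b)"
    and i: "\<And>a. a \<in> VOb C \<Longrightarrow> t a a \<cdot> (VId C a ** idn (fo a)) = lun (fo a)"
    and m: "\<And>a b c. a \<in> VOb C \<Longrightarrow> b \<in> VOb C \<Longrightarrow> c \<in> VOb C \<Longrightarrow>
       t a c \<cdot> (VCmp C a b c ** idn (fo a)) = t b c \<cdot> (idn (VHom C b c) ** t a b) \<cdot> asc (VHom C b c) (VHom C a b) (fo a)"
  shows "vfunctor C vself (mkfun C fo (\<lambda>a b. curry (VHom C a b) (fo a) (fo b) (t a b)))"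
proof -
  note [simp] = C ob
  have [simp]: "t a b \<in> Ar V" "Dom V (t a b) = VHom C a b \<otimes> fo a" "Cod V (t a b) = fo b"
    if "a \<in> VOb C" "b \<in> VOb C" for a b using ar[OF that] by (auto simp: hom_iff)
  show ?thesis
  proof (rule vfunctorI)
    fix a assume [simp]: "a \<in> VOb C"
    have "t a a \<cdot> (VId C a ** idn (fo a)) $ \<langle>un, var 0 (fo a)\<rangle> = lun (fo a) $ \<langle>un, var 0 (fo a)\<rangle>"
      by (simp only: i \<open>a \<in> VOb C\<close>)
    then have e: "t a a $ \<langle>VId C a $ un, var 0 (fo a)\<rangle> = var 0 (fo a)" by simp
    show "curry (VHom C a a) (fo a) (fo a) (t a a) $ VId C a $ un = VId vself (fo a) $ un"
      by (rule ih_ext[where a = "fo a" and b = "fo a" and i = 0]) (simp_all add: e)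
    fix b c assume [simp]: "b \<in> VOb C" "c \<in> VOb C"
    let ?e = "\<langle>\<langle>var 0 (VHom C b c), var 1 (VHom C a b)\<rangle>, var 2 (fo a)\<rangle>"
    have "t a c \<cdot> (VCmp C a b c ** idn (fo a)) $ ?e = t b c \<cdot> (idn (VHom C b c) ** t a b) \<cdot> asc (VHom C b c) (VHom C a b) (fo a) $ ?e"
      by (simp only: m \<open>a \<in> VOb C\<close> \<open>b \<in> VOb C\<close> \<open>c \<in> VOb C\<close>)
    then have e: "t a c $ \<langle>VCmp C a b c $ \<langle>var 0 (VHom C b c), var 1 (VHom C a b)\<rangle>, var 2 (fo a)\<rangle>
       = t b c $ \<langle>var 0 (VHom C b c), t a b $ \<langle>var 1 (VHom C a b), var 2 (fo a)\<rangle>\<rangle>"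
      by simp
    show "curry (VHom C a c) (fo a) (fo c) (t a c) $ VCmp C a b c $ \<langle>var 0 (VHom C b c), var 1 (VHom C a b)\<rangle>
         = VCmp vself (fo a) (fo b) (fo c) $ \<langle>curry (VHom C b c) (fo b) (fo c) (t b c) $ var 0 (VHom C b c),
            curry (VHom C a b) (fo a) (fo b) (t a b) $ var 1 (VHom C a b)\<rangle>"
      by (rule ih_ext[where a = "fo a" and b = "fo c" and i = 2]) (simp_all add: e)
  qed (simp_all add: hom_iff)
qed

lemma apart_comm [simp]: "apart s t \<longleftrightarrow> apart t s"
  by (auto simp: apart_def)

section \<open>Hom functors and tensor products of functors\<close>

lemma vtens_simps [simp]: "VOb (vtens A B) = VOb A \<times> VOb B"
  "VHom (vtens A B) (a, b) (a', b') = VHom A a a' \<otimes> VHom B b b'"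
  by (simp_all add: vtens_def)

lemma partR_ar:
  assumes "vcategory A" "vcategory B" "a \<in> VOb A" "b \<in> VOb B" "b' \<in> VOb B"
    "FMap T (a, b) (a, b') \<in> Ar V" "Dom V (FMap T (a, b) (a, b')) = VHom A a a \<otimes> VHom B b b'"
  shows "FMap (partR A B T a) b b' \<in> Ar V" "Dom V (FMap (partR A B T a) b b') = VHom B b b'"
    "Cod V (FMap (partR A B T a) b b') = Cod V (FMap T (a, b) (a, b'))"
    "good h \<Longrightarrow> ty h = VHom B b b' \<Longrightarrow>
       FMap (partR A B T a) b b' $ h = FMap T (a, b) (a, b') $ \<langle>VId A a $ un, h\<rangle>"
  using assms by (simp_all add: partR_def)

lemma partL_ar:
  assumes "vcategory A" "vcategory B" "a \<in> VOb A" "a' \<in> VOb A" "b \<in> VOb B"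
    "FMap T (a, b) (a', b) \<in> Ar V" "Dom V (FMap T (a, b) (a', b)) = VHom A a a' \<otimes> VHom B b b"
  shows "FMap (partL A B T b) a a' \<in> Ar V" "Dom V (FMap (partL A B T b) a a') = VHom A a a'"
    "Cod V (FMap (partL A B T b) a a') = Cod V (FMap T (a, b) (a', b))"
    "good h \<Longrightarrow> ty h = VHom A a a' \<Longrightarrow>
       FMap (partL A B T b) a a' $ h = FMap T (a, b) (a', b) $ \<langle>h, VId B b $ un\<rangle>"
  using assms by (simp_all add: partL_def)

lemma part_ob [simp]:
  "b \<in> VOb B \<Longrightarrow> FOb (partR A B T a) b = FOb T (a, b)"
  "a \<in> VOb A \<Longrightarrow> FOb (partL A B T b) a = FOb T (a, b)"
  by (simp_all add: partR_def partL_def)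

lemma homfun_ob [simp]:
  "a \<in> VOb A \<Longrightarrow> b \<in> VOb B \<Longrightarrow> FOb (homfun C A B F G) (a, b) = VHom C (FOb F a) (FOb G b)"
  by (simp add: homfun_def)

lemma homfun_ar:
  assumes F: "vfunctor A vself F" and G: "vfunctor B vself G"
    and o [simp]: "a \<in> VOb A" "a' \<in> VOb A" "b \<in> VOb B" "b' \<in> VOb B"
  shows "FMap (homfun vself A B F G) (a, b) (a', b') \<in> Ar V" (is ?th1)
    "Dom V (FMap (homfun vself A B F G) (a, b) (a', b')) = VHom A a' a \<otimes> VHom B b b'" (is ?th2)
    "Cod V (FMap (homfun vself A B F G) (a, b) (a', b')) = ((FOb F a \<multimap> FOb G b) \<multimap> (FOb F a' \<multimap> FOb G b'))" (is ?th3)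
    "els [(p, VHom A a' a), (q, VHom B b b'), (k, FOb F a \<multimap> FOb G b), (t, FOb F a')] \<Longrightarrow>
     ev (FOb F a') (FOb G b') $ \<langle>ev (FOb F a \<multimap> FOb G b) (FOb F a' \<multimap> FOb G b') $
       \<langle>FMap (homfun vself A B F G) (a, b) (a', b') $ \<langle>p, q\<rangle>, k\<rangle>, t\<rangle>
     = push G b b' q (ev (FOb F a) (FOb G b) $ \<langle>k, push F a' a p t\<rangle>)" (is "_ \<Longrightarrow> ?th4")
proof -
  note f = vfun_ar[OF F] vfun_ar[OF G]
  have [simp]: "FOb F a \<in> Ob V" "FOb F a' \<in> Ob V" "FOb G b \<in> Ob V" "FOb G b' \<in> Ob V"
    using f(1,7) by auto
  note [simp] = f(2-6,8-12) vself_cmp_ar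
  show ?th1
    ?th2
    ?th3
    by (simp_all add: homfun_def Let_def)
  assume "els [(p, VHom A a' a), (q, VHom B b b'), (k, FOb F a \<multimap> FOb G b), (t, FOb F a')]"
  moreover from this have "apart k p" "apart q p" by (auto intro: apart_sym)
  ultimately show ?th4
    by (simp add: homfun_def Let_def)
qed

text \<open>In elements the two actions on \<open>[F a, G b]\<close> are composition with \<open>G h\<close>
  and precomposition with \<open>F h\<close>, so that a wedge is a natural family.\<close>

lemma act_homfun:
  fixes A :: "('a, 'o, 'm) vcat"
  assumes F: "vfunctor A vself F" and G: "vfunctor A vself G"
    and o [simp]: "a \<in> VOb A" "b \<in> VOb A"
  defines "T \<equiv> homfun vself A A F G"
  shows "act A (partR (vop A) A T a) a b \<in> hom (VHom A a b \<otimes> FOb T (a, a)) (FOb T (a, b))" (is ?th1)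
    "act (vop A) (partL (vop A) A T b) b a \<in> hom (VHom A a b \<otimes> FOb T (b, b)) (FOb T (a, b))" (is ?th2)
    "els [(h, VHom A a b), (k, FOb F a \<multimap> FOb G a), (t, FOb F a)] \<Longrightarrow>
     ev (FOb F a) (FOb G b) $ \<langle>act A (partR (vop A) A T a) a b $ \<langle>h, k\<rangle>, t\<rangle>
       = push G a b h (ev (FOb F a) (FOb G a) $ \<langle>k, t\<rangle>)" (is "PROP ?th3")
    "els [(h, VHom A a b), (k, FOb F b \<multimap> FOb G b), (t, FOb F a)] \<Longrightarrow>
     ev (FOb F a) (FOb G b) $ \<langle>act (vop A) (partL (vop A) A T b) b a $ \<langle>h, k\<rangle>, t\<rangle>
       = ev (FOb F b) (FOb G b) $ \<langle>k, push F a b h t\<rangle>" (is "PROP ?th4")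
proof -
  note f = vfun_ar[OF F] vfun_ar[OF G]
  have ob [simp]: "FOb F c \<in> Ob V" "FOb G c \<in> Ob V" if "c \<in> VOb A" for c
    using f(1)[of c] f(7)[of c] that by auto
  note [simp] = f(2-6,8-12) vself_cmp_ar homfun_ar[OF F G] partR_ar partL_ar T_def vfun_id[OF F] vfun_id[OF G]
  show ?th1
    ?th2
    by (simp_all add: act_def hom_iff)
  show "PROP ?th3"
    "PROP ?th4"
    by (simp_all add: act_def)
qed

lemma contraten_ob [simp]:
  "a \<in> VOb A \<Longrightarrow> b \<in> VOb A \<Longrightarrow> FOb (contraten A F G) (a, b) = FOb F a \<otimes> FOb G b"
  by (simp add: contraten_def tensfun_def)

lemma contraten_ar:
  assumes F: "vfunctor (vop A) vself F" and G: "vfunctor A vself G"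
    and o [simp]: "a \<in> VOb A" "a' \<in> VOb A" "b \<in> VOb A" "b' \<in> VOb A"
  shows "FMap (contraten A F G) (a, b) (a', b') \<in> Ar V"
    "Dom V (FMap (contraten A F G) (a, b) (a', b')) = VHom A a' a \<otimes> VHom A b b'" (is ?th1)
    "Cod V (FMap (contraten A F G) (a, b) (a', b')) = ((FOb F a \<otimes> FOb G b) \<multimap> (FOb F a' \<otimes> FOb G b'))" (is ?th2)
    "els [(p, VHom A a' a), (q, VHom A b b'), (k, FOb F a), (t, FOb G b)] \<Longrightarrow>
     ev (FOb F a \<otimes> FOb G b) (FOb F a' \<otimes> FOb G b') $ \<langle>FMap (contraten A F G) (a, b) (a', b') $ \<langle>p, q\<rangle>, \<langle>k, t\<rangle>\<rangle>
     = \<langle>push F a a' p k, push G b b' q t\<rangle>" (is "PROP ?th3")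
proof -
  note f = vfun_ar[OF F] vfun_ar[OF G]
  have [simp]: "FOb F a \<in> Ob V" "FOb F a' \<in> Ob V" "FOb G b \<in> Ob V" "FOb G b' \<in> Ob V"
    using f(1,7) by auto
  note [simp] = f(2-6,8-12)
  show "FMap (contraten A F G) (a, b) (a', b') \<in> Ar V"
    ?th1
    ?th2
    by (simp_all add: contraten_def tensfun_def Let_def act_def)
  show "PROP ?th3"
    by (simp add: contraten_def tensfun_def Let_def act_def)
qed

text \<open>In elements the two actions on \<open>F a \<otimes> G b\<close> are those on the factors.\<close>

lemma act_contraten:
  assumes F: "vfunctor (vop A) vself F" and G: "vfunctor A vself G"
    and o [simp]: "a \<in> VOb A" "b \<in> VOb A"
  defines "T \<equiv> contraten A F G"
  shows "act A (partR (vop A) A T b) a b \<in> hom (VHom A a b \<otimes> FOb T (b, a)) (FOb T (b, b))" (is ?th1)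
    "act (vop A) (partL (vop A) A T a) b a \<in> hom (VHom A a b \<otimes> FOb T (b, a)) (FOb T (a, a))" (is ?th2)
    "els [(h, VHom A a b), (k, FOb F b), (t, FOb G a)] \<Longrightarrow>
     act A (partR (vop A) A T b) a b $ \<langle>h, \<langle>k, t\<rangle>\<rangle> = \<langle>k, push G a b h t\<rangle>" (is "PROP ?th3")
    "els [(h, VHom A a b), (k, FOb F b), (t, FOb G a)] \<Longrightarrow>
     act (vop A) (partL (vop A) A T a) b a $ \<langle>h, \<langle>k, t\<rangle>\<rangle> = \<langle>push F b a h k, t\<rangle>" (is "PROP ?th4")
proof -
  note f = vfun_ar[OF F] vfun_ar[OF G]
  have ob [simp]: "FOb F c \<in> Ob V" "FOb G c \<in> Ob V" if "c \<in> VOb A" for c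
    using f(1)[of c] f(7)[of c] that by auto
  have vi: "FMap F c c $ VId A c $ un = VId vself (FOb F c) $ un" if "c \<in> VOb A" for c
    using vfun_id[OF F, of c] that by simp
  note [simp] = f(2-6,8-12) vself_cmp_ar contraten_ar[OF F G] partR_ar partL_ar T_def vi vfun_id[OF G]
  show ?th1
    ?th2
    by (simp_all add: act_def hom_iff)
  show "PROP ?th3"
    "PROP ?th4"
    by (simp_all add: act_def)
qed

text \<open>Transposition turns the dinaturality condition, which compares arrows out of \<open>p \<otimes>
  e\<close>, into a condition on the legs themselves, as in the definition of
  \<open>is_wlim\<close>.\<close>

lemma transpose_eq:
  assumes [simp]: "f \<in> Ar V" "g \<in> Ar V" "Dom V f = p \<otimes> x" "Dom V g = p \<otimes> y" "Cod V f = c" "Cod V g = c"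
    "\<pi> \<in> Ar V" "\<pi>' \<in> Ar V" "Dom V \<pi> = e" "Dom V \<pi>' = e" "Cod V \<pi> = x" "Cod V \<pi>' = y" "p \<in> Ob V"
  shows "f \<cdot> (idn p ** \<pi>) = g \<cdot> (idn p ** \<pi>') \<longleftrightarrow> curry x p c (f \<cdot> sym x p) \<cdot> \<pi> = curry y p c (g \<cdot> sym y p) \<cdot> \<pi>'"
    (is "?L \<longleftrightarrow> ?R")
proof -
  have [simp]: "e \<in> Ob V" "x \<in> Ob V" "y \<in> Ob V" "c \<in> Ob V"
    using ar_ob[of \<pi>] ar_ob[of \<pi>'] ar_ob[of f] by auto
  show ?thesis
  proof
    assume ?L
    then have "f \<cdot> (idn p ** \<pi>) $ \<langle>var 1 p, var 0 e\<rangle> = g \<cdot> (idn p ** \<pi>') $ \<langle>var 1 p, var 0 e\<rangle>" by (simp only:)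
    then have q: "f $ \<langle>var 1 p, \<pi> $ var 0 e\<rangle> = g $ \<langle>var 1 p, \<pi>' $ var 0 e\<rangle>" by simp
    show ?R
      by (rule el_ext[of "var 0 e"], simp, rule ih_ext[where a = p and b = c and i = 1]) (simp_all add: q)
  next
    assume ?R
    then have "ev p c $ \<langle>curry x p c (f \<cdot> sym x p) \<cdot> \<pi> $ var 0 e, var 1 p\<rangle> = ev p c $ \<langle>curry y p c (g \<cdot> sym y p) \<cdot> \<pi>' $ var 0 e, var 1 p\<rangle>"
      by (simp only:)
    then have q: "f $ \<langle>var 1 p, \<pi> $ var 0 e\<rangle> = g $ \<langle>var 1 p, \<pi>' $ var 0 e\<rangle>" by simp
    show ?L
      by (rule el_ext[of "\<langle>var 1 p, var 0 e\<rangle>"]) (simp_all add: q)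
  qed
qed

text \<open>The two sides of naturality for a family \<open>X a : p \<rightarrow> [F a, G a]\<close>, as
  arrows out of \<open>(A(a,b) \<otimes> p) \<otimes> F a\<close>. In this form naturality can be
  verified on coprojections if \<open>F a\<close> is a coend.\<close>

definition nat_l where
  "nat_l A F G p X a b = ev (FOb G a) (FOb G b) \<cdot> (FMap G a b ** (ev (FOb F a) (FOb G a) \<cdot> (X a ** idn (FOb F a))))
     \<cdot> asc (VHom A a b) p (FOb F a)"

definition nat_r where
  "nat_r A F G p X a b = ev (FOb F b) (FOb G b) \<cdot> (X b ** (ev (FOb F a) (FOb F b) \<cdot> (FMap F a b ** idn (FOb F a))))
     \<cdot> asc p (VHom A a b) (FOb F a) \<cdot> (sym (VHom A a b) p ** idn (FOb F a))"

lemma nat_lr: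
  assumes F: "vfunctor A vself F" and G: "vfunctor A vself G" and o [simp]: "a \<in> VOb A" "b \<in> VOb A" "p \<in> Ob V"
    and X: "X a \<in> hom p (FOb F a \<multimap> FOb G a)" "X b \<in> hom p (FOb F b \<multimap> FOb G b)"
  shows "nat_l A F G p X a b \<in> Ar V" "Dom V (nat_l A F G p X a b) = (VHom A a b \<otimes> p) \<otimes> FOb F a" (is ?th1)
    "nat_r A F G p X a b \<in> Ar V" "Dom V (nat_r A F G p X a b) = (VHom A a b \<otimes> p) \<otimes> FOb F a" (is ?th2)
    "els [(h, VHom A a b), (s, p), (t, FOb F a)] \<Longrightarrow>
     nat_l A F G p X a b $ \<langle>\<langle>h, s\<rangle>, t\<rangle> = push G a b h (ev (FOb F a) (FOb G a) $ \<langle>X a $ s, t\<rangle>)" (is "_ \<Longrightarrow> ?th3")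
    "els [(h, VHom A a b), (s, p), (t, FOb F a)] \<Longrightarrow>
     nat_r A F G p X a b $ \<langle>\<langle>h, s\<rangle>, t\<rangle> = ev (FOb F b) (FOb G b) $ \<langle>X b $ s, push F a b h t\<rangle>" (is "_ \<Longrightarrow> ?th4")
proof -
  note f = vfun_ar[OF F] vfun_ar[OF G]
  have ob [simp]: "FOb F c \<in> Ob V" "FOb G c \<in> Ob V" if "c \<in> VOb A" for c
    using f(1)[of c] f(7)[of c] that by auto
  have [simp]: "X a \<in> Ar V" "Dom V (X a) = p" "Cod V (X a) = (FOb F a \<multimap> FOb G a)"
    "X b \<in> Ar V" "Dom V (X b) = p" "Cod V (X b) = (FOb F b \<multimap> FOb G b)"
    using X by (auto simp: hom_iff)
  note [simp] = f(2-6,8-12)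
  show "nat_l A F G p X a b \<in> Ar V" ?th1
    "nat_r A F G p X a b \<in> Ar V" ?th2
    by (simp_all add: nat_l_def nat_r_def)
  assume "els [(h, VHom A a b), (s, p), (t, FOb F a)]"
  moreover from this have "apart s h" by (auto intro: apart_sym)
  ultimately show ?th3
    ?th4
    by (simp_all add: nat_l_def nat_r_def)
qed

lemma homfun_wedge_iff:
  fixes A :: "('a, 'o, 'm) vcat"
  assumes F: "vfunctor A vself F" and G: "vfunctor A vself G"
  shows "is_wedge A (homfun vself A A F G) p X \<longleftrightarrow> p \<in> Ob V \<and> (\<forall>a\<in>VOb A. X a \<in> hom p (FOb F a \<multimap> FOb G a)) \<and>
    (\<forall>a\<in>VOb A. \<forall>b\<in>VOb A. nat_l A F G p X a b = nat_r A F G p X a b)"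
proof (cases "p \<in> Ob V \<and> (\<forall>a\<in>VOb A. X a \<in> hom p (FOb F a \<multimap> FOb G a))")
  case True
  then have [simp]: "p \<in> Ob V" and X: "\<And>a. a \<in> VOb A \<Longrightarrow> X a \<in> hom p (FOb F a \<multimap> FOb G a)" by auto
  have [simp]: "X a \<in> Ar V" "Dom V (X a) = p" "Cod V (X a) = (FOb F a \<multimap> FOb G a)" if "a \<in> VOb A" for a
    using X[OF that] by (auto simp: hom_iff)
  let ?T = "homfun vself A A F G"
  note f = vfun_ar[OF F] vfun_ar[OF G]
  have ob [simp]: "FOb F c \<in> Ob V" "FOb G c \<in> Ob V" if "c \<in> VOb A" for c
    using f(1)[of c] f(7)[of c] that by auto
  note [simp] = f(2-6,8-12)
  have "act A (partR (vop A) A ?T a) a b \<cdot> (idn (VHom A a b) ** X a) = act (vop A) (partL (vop A) A ?T b) b a \<cdot> (idn (VHom A a b) ** X b)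
     \<longleftrightarrow> nat_l A F G p X a b = nat_r A F G p X a b" (is "?L \<longleftrightarrow> ?R") if o [simp]: "a \<in> VOb A" "b \<in> VOb A" for a b
  proof -
    note n [simp] = nat_lr[OF F G o, of p X, OF _ X X, simplified]
    let ?l = "act A (partR (vop A) A ?T a) a b" and ?r = "act (vop A) (partL (vop A) A ?T b) b a"
    have [simp]: "?l \<in> Ar V" "Dom V ?l = VHom A a b \<otimes> (FOb F a \<multimap> FOb G a)" "Cod V ?l = (FOb F a \<multimap> FOb G b)"
      "?r \<in> Ar V" "Dom V ?r = VHom A a b \<otimes> (FOb F b \<multimap> FOb G b)" "Cod V ?r = (FOb F a \<multimap> FOb G b)"
      using act_homfun(1,2)[OF F G o] by (auto simp: hom_iff)
    note [simp] = act_homfun(3,4)[OF F G o]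
    let ?e = "\<langle>var 0 (VHom A a b), var 1 p\<rangle>"
    have "?L \<longleftrightarrow> ?l \<cdot> (idn (VHom A a b) ** X a) $ ?e = ?r \<cdot> (idn (VHom A a b) ** X b) $ ?e"
      by (rule iffI, simp only:, rule el_ext[of ?e]) simp_all
    also have "\<dots> \<longleftrightarrow> ?l $ \<langle>var 0 (VHom A a b), X a $ var 1 p\<rangle> = ?r $ \<langle>var 0 (VHom A a b), X b $ var 1 p\<rangle>"
      by simp
    also have "\<dots> \<longleftrightarrow> ev (FOb F a) (FOb G b) $ \<langle>?l $ \<langle>var 0 (VHom A a b), X a $ var 1 p\<rangle>, var 2 (FOb F a)\<rangle>
       = ev (FOb F a) (FOb G b) $ \<langle>?r $ \<langle>var 0 (VHom A a b), X b $ var 1 p\<rangle>, var 2 (FOb F a)\<rangle>"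
      by (rule iffI, simp only:, rule ih_ext[where a = "FOb F a" and b = "FOb G b" and i = 2]) (assumption, simp_all)
    also have "\<dots> \<longleftrightarrow> nat_l A F G p X a b $ \<langle>?e, var 2 (FOb F a)\<rangle> = nat_r A F G p X a b $ \<langle>?e, var 2 (FOb F a)\<rangle>"
      by simp
    also have "\<dots> \<longleftrightarrow> ?R"
      by (rule iffI, rule el_ext[of "\<langle>?e, var 2 (FOb F a)\<rangle>"], simp_all only:) simp_all
    finally show ?thesis .
  qed
  then show ?thesis using True by (simp add: is_wedge_def)
next
  case False
  then show ?thesis by (auto simp: is_wedge_def)
qed

end

context complete_star
begin

section \<open>The functor \<open>\<V>\<close>-category\<close>

lemma end_exists:
  fixes A :: "('s, 'o, 'm) vcat"
  assumes A [simp]: "vcategory A" and T: "\<And>a b. a \<in> VOb A \<Longrightarrow> b \<in> VOb A \<Longrightarrow> FOb T (a, b) \<in> Ob V"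
    and L: "\<And>a b. a \<in> VOb A \<Longrightarrow> b \<in> VOb A \<Longrightarrow> act A (partR (vop A) A T a) a b \<in> hom (VHom A a b \<otimes> FOb T (a, a)) (FOb T (a, b))"
    and R: "\<And>a b. a \<in> VOb A \<Longrightarrow> b \<in> VOb A \<Longrightarrow> act (vop A) (partL (vop A) A T b) b a \<in> hom (VHom A a b \<otimes> FOb T (b, b)) (FOb T (a, b))"
  shows "is_end A T (endob A T) (endproj A T)"
proof -
  let ?l = "\<lambda>a b. act A (partR (vop A) A T a) a b" and ?r = "\<lambda>a b. act (vop A) (partL (vop A) A T b) b a"
  let ?u = "\<lambda>a b. curry (FOb T (a, a)) (VHom A a b) (FOb T (a, b)) (?l a b \<cdot> sym (FOb T (a, a)) (VHom A a b))"
  let ?v = "\<lambda>a b. curry (FOb T (b, b)) (VHom A a b) (FOb T (a, b)) (?r a b \<cdot> sym (FOb T (b, b)) (VHom A a b))"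
  have l [simp]: "?l a b \<in> Ar V" "Dom V (?l a b) = VHom A a b \<otimes> FOb T (a, a)" "Cod V (?l a b) = FOb T (a, b)"
    if "a \<in> VOb A" "b \<in> VOb A" for a b using L[OF that] by (auto simp: hom_iff)
  have r [simp]: "?r a b \<in> Ar V" "Dom V (?r a b) = VHom A a b \<otimes> FOb T (b, b)" "Cod V (?r a b) = FOb T (a, b)"
    if "a \<in> VOb A" "b \<in> VOb A" for a b using R[OF that] by (auto simp: hom_iff)
  have "\<exists>e \<pi>. is_wlim (VOb A) (\<lambda>a. FOb T (a, a)) ?u ?v e \<pi>"
    by (rule wlim_exists[where Q = "\<lambda>a b. VHom A a b \<multimap> FOb T (a, b)"]) (simp_all add: hom_iff T)
  then obtain e \<pi> where e: "is_wlim (VOb A) (\<lambda>a. FOb T (a, a)) ?u ?v e \<pi>" by blast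
  have w: "is_wedge A T p X \<longleftrightarrow> p \<in> Ob V \<and> (\<forall>a\<in>VOb A. X a \<in> hom p (FOb T (a, a))) \<and>
     (\<forall>a\<in>VOb A. \<forall>b\<in>VOb A. ?u a b \<cdot> X a = ?v a b \<cdot> X b)" for p X
    unfolding is_wedge_def
    by (intro conj_cong refl ball_cong transpose_eq) (simp_all add: hom_iff)
  have "is_end A T e \<pi>"
    using e unfolding is_end_def w is_wlim_def by blast
  then have "is_end A T (fst (the_end A T)) (snd (the_end A T))"
    unfolding the_end_def by (metis (mono_tags, lifting) fst_conv snd_conv someI)
  then show ?thesis by (simp add: endob_def endproj_def)
qed

lemma coend_exists:
  fixes A :: "('s, 'o, 'm) vcat"
  assumes A [simp]: "vcategory A" and T: "\<And>a b. a \<in> VOb A \<Longrightarrow> b \<in> VOb A \<Longrightarrow> FOb T (a, b) \<in> Ob V"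
    and L: "\<And>a b. a \<in> VOb A \<Longrightarrow> b \<in> VOb A \<Longrightarrow> act A (partR (vop A) A T b) a b \<in> hom (VHom A a b \<otimes> FOb T (b, a)) (FOb T (b, b))"
    and R: "\<And>a b. a \<in> VOb A \<Longrightarrow> b \<in> VOb A \<Longrightarrow> act (vop A) (partL (vop A) A T a) b a \<in> hom (VHom A a b \<otimes> FOb T (b, a)) (FOb T (a, a))"
  shows "is_coend A T (coend A T) (coproj A T)"
proof -
  let ?l = "\<lambda>a b. act A (partR (vop A) A T b) a b" and ?r = "\<lambda>a b. act (vop A) (partL (vop A) A T a) b a"
  have "\<exists>c \<iota>. is_wcolim (VOb A) (\<lambda>a. FOb T (a, a)) ?r ?l c \<iota>"
    by (rule wcolim_exists[where Q = "\<lambda>a b. VHom A a b \<otimes> FOb T (b, a)"]) (use L R T in auto)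
  then obtain c \<iota> where c: "is_wcolim (VOb A) (\<lambda>a. FOb T (a, a)) ?r ?l c \<iota>" by blast
  have w: "is_cowedge A T p X \<longleftrightarrow> p \<in> Ob V \<and> (\<forall>a\<in>VOb A. X a \<in> hom (FOb T (a, a)) p) \<and>
     (\<forall>a\<in>VOb A. \<forall>b\<in>VOb A. X a \<cdot> ?r a b = X b \<cdot> ?l a b)" for p X
    unfolding is_cowedge_def by (intro conj_cong refl ball_cong) auto
  have "is_coend A T c \<iota>"
    using c unfolding is_coend_def w is_wcolim_def by blast
  then have "is_coend A T (fst (the_coend A T)) (snd (the_coend A T))"
    unfolding the_coend_def by (metis (mono_tags, lifting) fst_conv snd_conv someI)
  then show ?thesis by (simp add: coend_def coproj_def)
qed

lemma fcat_simps [simp]: "F \<in> VOb (fcat A) \<longleftrightarrow> vfunctor A vself F" "VHom (fcat A) = nhom A"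
  by (simp_all add: fcat_def)

context
  fixes A :: "('s, 'o, 'm) vcat" and F G :: "('s, 'o, 'm) vfun"
  assumes F: "vfunctor A vself F" and G: "vfunctor A vself G"
begin

lemma fg_ob: "c \<in> VOb A \<Longrightarrow> FOb F c \<in> Ob V" "c \<in> VOb A \<Longrightarrow> FOb G c \<in> Ob V"
  using vfun_ar(1)[OF F] vfun_ar(1)[OF G] by simp_all

lemma nhom_end: "is_end A (homfun vself A A F G) (nhom A F G) (nproj A F G)"
  unfolding nhom_def nproj_def
  by (rule end_exists, rule vfun_ar(5)[OF F], simp add: fg_ob, (rule act_homfun(1,2)[OF F G]; assumption)+)

lemma nhom_wedge: "is_wedge A (homfun vself A A F G) (nhom A F G) (nproj A F G)"
  using nhom_end by (simp add: is_end_def)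

lemma nhom_ob: "nhom A F G \<in> Ob V"
  using nhom_wedge by (simp add: is_wedge_def)

lemma nproj_ar:
  "a \<in> VOb A \<Longrightarrow> nproj A F G a \<in> Ar V" "a \<in> VOb A \<Longrightarrow> Dom V (nproj A F G a) = nhom A F G"
  "a \<in> VOb A \<Longrightarrow> Cod V (nproj A F G a) = (FOb F a \<multimap> FOb G a)"
  using nhom_wedge by (auto simp: is_wedge_def hom_iff)

lemma nproj_nat:
  assumes a: "a \<in> VOb A" "b \<in> VOb A" and e: "els [(h, VHom A a b), (n, nhom A F G), (t, FOb F a)]"
  shows "push G a b h (nat_at A F G a n t)
     = nat_at A F G b n (push F a b h t)"
proof -
  have h: "nproj A F G c \<in> hom (nhom A F G) (FOb F c \<multimap> FOb G c)" if "c \<in> VOb A" for c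
    using that by (simp add: hom_iff nproj_ar)
  have "nat_l A F G (nhom A F G) (nproj A F G) a b $ \<langle>\<langle>h, n\<rangle>, t\<rangle> = nat_r A F G (nhom A F G) (nproj A F G) a b $ \<langle>\<langle>h, n\<rangle>, t\<rangle>"
    using nhom_wedge a unfolding homfun_wedge_iff[OF F G] by simp
  then show ?thesis using a e nhom_ob by (simp add: nat_lr[OF F G] h)
qed

lemma nhom_univ:
  assumes "p \<in> Ob V" "\<And>a. a \<in> VOb A \<Longrightarrow> X a \<in> hom p (FOb F a \<multimap> FOb G a)"
    "\<And>a b. a \<in> VOb A \<Longrightarrow> b \<in> VOb A \<Longrightarrow> nat_l A F G p X a b = nat_r A F G p X a b"
  shows "\<exists>!u. u \<in> hom p (nhom A F G) \<and> (\<forall>a\<in>VOb A. nproj A F G a \<cdot> u = X a)"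
proof -
  have "is_wedge A (homfun vself A A F G) p X" using assms by (simp add: homfun_wedge_iff[OF F G])
  then show ?thesis using nhom_end unfolding is_end_def by blast
qed

lemma nhom_ext:
  assumes u: "u \<in> hom p (nhom A F G)" "v \<in> hom p (nhom A F G)"
    and e: "\<And>a. a \<in> VOb A \<Longrightarrow> nproj A F G a \<cdot> u = nproj A F G a \<cdot> v"
  shows "u = v"
proof -
  have pu: "u \<in> Ar V" "Dom V u = p" "Cod V u = nhom A F G" using u by (auto simp: hom_iff)
  then have p [simp]: "p \<in> Ob V" using ar_ob[of u] by simp
  have h: "nproj A F G a \<cdot> u \<in> hom p (FOb F a \<multimap> FOb G a)" if "a \<in> VOb A" for a
    using that pu by (simp add: hom_iff nproj_ar)
  have "nat_l A F G p (\<lambda>a. nproj A F G a \<cdot> u) a b = nat_r A F G p (\<lambda>a. nproj A F G a \<cdot> u) a b"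
    if o: "a \<in> VOb A" "b \<in> VOb A" for a b
    by (rule el_ext[of "\<langle>\<langle>var 0 (VHom A a b), var 1 p\<rangle>, var 2 (FOb F a)\<rangle>"])
      (use o pu vfun_ar[OF F] fg_ob in \<open>simp_all add: nat_lr[OF F G] h nproj_ar nproj_nat del: vself_simps\<close>)
  then have "\<exists>!w. w \<in> hom p (nhom A F G) \<and> (\<forall>a\<in>VOb A. nproj A F G a \<cdot> w = nproj A F G a \<cdot> u)"
    by (intro nhom_univ p h)
  then show ?thesis using u e by metis
qed

text \<open>Elements of \<open>[A,\<V>](F,G)\<close> are compared on their components. The contexts are
  required to agree because they cannot be recovered from the components if \<open>A\<close> has
  no objects.\<close>

lemma nhom_el_ext:
  assumes n: "good n" "good n'" "ty n = nhom A F G" "ty n' = nhom A F G" "ctx n = ctx n'" "i \<notin> names n"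
    and e: "\<And>a. a \<in> VOb A \<Longrightarrow> nat_at A F G a n (var i (FOb F a))
      = nat_at A F G a n' (var i (FOb F a))"
  shows "n = n'"
proof -
  have i: "i \<notin> names n'" using n by (simp add: names_def ctx_def)
  have "nproj A F G a $ n = nproj A F G a $ n'" if a: "a \<in> VOb A" for a
    by (rule ih_ext[OF e[OF a]]) (use a n i in \<open>simp_all add: nproj_ar fg_ob\<close>)
  then have eq: "nproj A F G a \<cdot> snd n = nproj A F G a \<cdot> snd n'" if "a \<in> VOb A" for a
    using that by (simp add: app_def)
  have "snd n = snd n'"
    by (rule nhom_ext[of _ "ctx_ob (fst n)", OF _ _ eq]) (use n in \<open>simp_all add: hom_iff ctx_def\<close>)
  then show ?thesis using n by (simp add: ctx_def prod_eq_iff)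
qed

end

lemma fcat_id:
  fixes A :: "('s, 'o, 'm) vcat"
  assumes F: "vfunctor A vself F"
  shows "VId (fcat A) F \<in> hom \<I> (nhom A F F)" "a \<in> VOb A \<Longrightarrow> nproj A F F a \<cdot> VId (fcat A) F = VId vself (FOb F a)" (is "PROP ?th1")
proof -
  note [simp] = fg_ob[OF F F] vfun_ar(2-5)[OF F] vself_id_ar
  have "\<exists>!u. u \<in> hom \<I> (nhom A F F) \<and> (\<forall>a\<in>VOb A. nproj A F F a \<cdot> u = VId vself (FOb F a))"
  proof (rule nhom_univ[OF F F])
    fix a b assume [simp]: "a \<in> VOb A" "b \<in> VOb A"
    show "nat_l A F F \<I> (\<lambda>a. VId vself (FOb F a)) a b = nat_r A F F \<I> (\<lambda>a. VId vself (FOb F a)) a b"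
      by (rule el_ext[of "\<langle>\<langle>var 0 (VHom A a b), un\<rangle>, var 2 (FOb F a)\<rangle>"]) (simp_all add: nat_lr[OF F F] hom_iff)
  qed (simp_all add: hom_iff)
  from theI'[OF this] show "VId (fcat A) F \<in> hom \<I> (nhom A F F)"
    "PROP ?th1"
    unfolding fcat_def by simp_all
qed

lemma fcat_cmp:
  fixes A :: "('s, 'o, 'm) vcat"
  assumes F: "vfunctor A vself F" and G: "vfunctor A vself G" and H: "vfunctor A vself H"
  shows "VCmp (fcat A) F G H \<in> hom (nhom A G H \<otimes> nhom A F G) (nhom A F H)" (is ?th1)
    "a \<in> VOb A \<Longrightarrow> nproj A F H a \<cdot> VCmp (fcat A) F G H
       = VCmp vself (FOb F a) (FOb G a) (FOb H a) \<cdot> (nproj A G H a ** nproj A F G a)"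
proof -
  note [simp] = fg_ob[OF F H] fg_ob[OF G G] vfun_ar(2-5)[OF F] vfun_ar(2-4)[OF G] vfun_ar(2-4)[OF H] vself_cmp_ar
    nhom_ob[OF F G] nhom_ob[OF G H] nhom_ob[OF F H] nproj_ar[OF F G] nproj_ar[OF G H] nproj_ar[OF F H]
  let ?P = "nhom A G H \<otimes> nhom A F G"
  let ?X = "\<lambda>a. VCmp vself (FOb F a) (FOb G a) (FOb H a) \<cdot> (nproj A G H a ** nproj A F G a)"
  have "\<exists>!u. u \<in> hom ?P (nhom A F H) \<and> (\<forall>a\<in>VOb A. nproj A F H a \<cdot> u = ?X a)"
  proof (rule nhom_univ[OF F H])
    fix a b assume [simp]: "a \<in> VOb A" "b \<in> VOb A"
    show "nat_l A F H ?P ?X a b = nat_r A F H ?P ?X a b"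
      by (rule el_ext[of "\<langle>\<langle>var 0 (VHom A a b), \<langle>var 1 (nhom A G H), var 2 (nhom A F G)\<rangle>\<rangle>, var 3 (FOb F a)\<rangle>"])
        (simp_all add: nat_lr[OF F H] hom_iff nproj_nat[OF F G] nproj_nat[OF G H])
  qed (simp_all add: hom_iff)
  from theI'[OF this] show ?th1
    "a \<in> VOb A \<Longrightarrow> nproj A F H a \<cdot> VCmp (fcat A) F G H = ?X a"
    unfolding fcat_def by simp_all
qed

lemma fcat_id_app:
  fixes A :: "('s, 'o, 'm) vcat"
  assumes F: "vfunctor A vself F" and a: "a \<in> VOb A"
  shows "nproj A F F a $ VId (fcat A) F $ un = VId vself (FOb F a) $ un"
proof -
  have "nproj A F F a \<cdot> VId (fcat A) F $ un = VId vself (FOb F a) $ un"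
    unfolding fcat_id(2)[OF F a] ..
  then show ?thesis using fcat_id(1)[OF F] a by (simp add: hom_iff nproj_ar[OF F F])
qed

lemma fcat_cmp_app:
  fixes A :: "('s, 'o, 'm) vcat"
  assumes F: "vfunctor A vself F" and G: "vfunctor A vself G" and H: "vfunctor A vself H"
    and a: "a \<in> VOb A" and e: "els [(n, nhom A G H), (m, nhom A F G)]"
  shows "nproj A F H a $ VCmp (fcat A) F G H $ \<langle>n, m\<rangle>
    = VCmp vself (FOb F a) (FOb G a) (FOb H a) $ \<langle>nproj A G H a $ n, nproj A F G a $ m\<rangle>"
proof -
  have "nproj A F H a \<cdot> VCmp (fcat A) F G H $ \<langle>n, m\<rangle>
    = VCmp vself (FOb F a) (FOb G a) (FOb H a) \<cdot> (nproj A G H a ** nproj A F G a) $ \<langle>n, m\<rangle>"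
    unfolding fcat_cmp(2)[OF F G H a] ..
  then show ?thesis using fcat_cmp(1)[OF F G H] a e
    by (simp add: hom_iff nproj_ar[OF F G] nproj_ar[OF G H] nproj_ar[OF F H] vself_cmp_ar fg_ob[OF F H] fg_ob[OF G G])
qed

lemma vcategory_fcat:
  fixes A :: "('s, 'o, 'm) vcat"
  shows "vcategory (fcat A)"
proof (rule vcategoryI)
  fix F G assume "F \<in> VOb (fcat A)" "G \<in> VOb (fcat A)"
  then have F: "vfunctor A vself F" and G: "vfunctor A vself G" by auto
  note [simp] = fg_ob[OF F G] nhom_ob[OF F G] nproj_ar[OF F G] nproj_ar[OF F F] nproj_ar[OF G G]
  note i = fcat_id(1)[OF F, unfolded hom_iff] fcat_id(1)[OF G, unfolded hom_iff] fcat_cmp(1)[OF F F G, unfolded hom_iff]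
      fcat_cmp(1)[OF F G G, unfolded hom_iff]
  show "VHom (fcat A) F G \<in> Ob V" by simp
  show "VCmp (fcat A) F G G $ \<langle>VId (fcat A) G $ un, var 0 (VHom (fcat A) F G)\<rangle> = var 0 (VHom (fcat A) F G)"
    by (rule nhom_el_ext[OF F G, where i = 1]) (simp_all add: i fcat_id_app[OF G] fcat_cmp_app[OF F G G])
  show "VCmp (fcat A) F F G $ \<langle>var 0 (VHom (fcat A) F G), VId (fcat A) F $ un\<rangle> = var 0 (VHom (fcat A) F G)"
    by (rule nhom_el_ext[OF F G, where i = 1]) (simp_all add: i fcat_id_app[OF F] fcat_cmp_app[OF F F G])
  fix H K assume "H \<in> VOb (fcat A)" "K \<in> VOb (fcat A)"
  then have H: "vfunctor A vself H" and K: "vfunctor A vself K" by auto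
  note [simp] = fg_ob[OF H K] nhom_ob[OF G H] nhom_ob[OF H K] nproj_ar[OF F K] nproj_ar[OF G K] nproj_ar[OF H K]
     nproj_ar[OF G H] nproj_ar[OF F H]
  note j = fcat_cmp(1)[OF F G H, unfolded hom_iff] fcat_cmp(1)[OF F G K, unfolded hom_iff]
      fcat_cmp(1)[OF F H K, unfolded hom_iff] fcat_cmp(1)[OF G H K, unfolded hom_iff]
  show "VCmp (fcat A) F G K $ \<langle>VCmp (fcat A) G H K $ \<langle>var 0 (VHom (fcat A) H K), var 1 (VHom (fcat A) G H)\<rangle>, var 2 (VHom (fcat A) F G)\<rangle>
        = VCmp (fcat A) F H K $ \<langle>var 0 (VHom (fcat A) H K), VCmp (fcat A) F G H $ \<langle>var 1 (VHom (fcat A) G H), var 2 (VHom (fcat A) F G)\<rangle>\<rangle>"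
    by (rule nhom_el_ext[OF F K, where i = 3])
      (simp_all add: j fcat_cmp_app[OF F G H] fcat_cmp_app[OF F G K] fcat_cmp_app[OF F H K] fcat_cmp_app[OF G H K])
qed (use fcat_id(1) fcat_cmp(1) in auto)

subsection \<open>Coends\<close>

context
  fixes A :: "('s, 'o, 'm) vcat" and F G :: "('s, 'o, 'm) vfun"
  assumes F: "vfunctor (vop A) vself F" and G: "vfunctor A vself G"
begin

lemma ct_fg_ob: "c \<in> VOb A \<Longrightarrow> FOb F c \<in> Ob V" "c \<in> VOb A \<Longrightarrow> FOb G c \<in> Ob V"
  using vfun_ar(1)[OF F] vfun_ar(1)[OF G] by simp_all

lemma ct_coend: "is_coend A (contraten A F G) (coend A (contraten A F G)) (coproj A (contraten A F G))"
  by (rule coend_exists, rule vfun_ar(5)[OF G], simp add: ct_fg_ob, (rule act_contraten(1,2)[OF F G]; assumption)+)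

lemma ct_ob: "coend A (contraten A F G) \<in> Ob V"
  using ct_coend by (simp add: is_coend_def is_cowedge_def)

lemma coproj_ar:
  "a \<in> VOb A \<Longrightarrow> coproj A (contraten A F G) a \<in> Ar V"
  "a \<in> VOb A \<Longrightarrow> Dom V (coproj A (contraten A F G) a) = FOb F a \<otimes> FOb G a"
  "a \<in> VOb A \<Longrightarrow> Cod V (coproj A (contraten A F G) a) = coend A (contraten A F G)"
  using ct_coend by (auto simp: is_coend_def is_cowedge_def hom_iff)

lemma coproj_dinat:
  assumes a: "a \<in> VOb A" "b \<in> VOb A" and e: "els [(h, VHom A a b), (k, FOb F b), (t, FOb G a)]"
  shows "coproj A (contraten A F G) b $ \<langle>k, push G a b h t\<rangle>
    = coproj A (contraten A F G) a $ \<langle>push F b a h k, t\<rangle>"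
proof -
  let ?T = "contraten A F G"
  have "coproj A ?T b \<cdot> act A (partR (vop A) A ?T b) a b $ \<langle>h, \<langle>k, t\<rangle>\<rangle>
    = coproj A ?T a \<cdot> act (vop A) (partL (vop A) A ?T a) b a $ \<langle>h, \<langle>k, t\<rangle>\<rangle>"
    using ct_coend a unfolding is_coend_def is_cowedge_def by metis
  then show ?thesis using a e act_contraten(1,2)[OF F G a]
    by (simp add: hom_iff coproj_ar act_contraten(3,4)[OF F G])
qed

text \<open>The functor \<open>p \<otimes> -\<close> preserves coends since it has a right adjoint: arrows
  out of \<open>p \<otimes> \<integral>\<^sup>a F a \<otimes> G a\<close> are the transposes of
  arrows from the coend to \<open>[p, c]\<close>.\<close>

lemma coend_univ:
  assumes p: "p \<in> Ob V" "c \<in> Ob V" and X: "\<And>a. a \<in> VOb A \<Longrightarrow> X a \<in> hom (p \<otimes> (FOb F a \<otimes> FOb G a)) c"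
    and d: "\<And>a b. a \<in> VOb A \<Longrightarrow> b \<in> VOb A \<Longrightarrow>
      X b $ \<langle>var 0 p, \<langle>var 1 (FOb F b), push G a b (var 2 (VHom A a b)) (var 3 (FOb G a))\<rangle>\<rangle>
      = X a $ \<langle>var 0 p, \<langle>push F b a (var 2 (VHom A a b)) (var 1 (FOb F b)), var 3 (FOb G a)\<rangle>\<rangle>"
  shows "\<exists>!u. u \<in> hom (p \<otimes> coend A (contraten A F G)) c \<and> (\<forall>a\<in>VOb A. u \<cdot> (idn p ** coproj A (contraten A F G) a) = X a)"
proof -
  let ?T = "contraten A F G" and ?C = "coend A (contraten A F G)" and ?i = "coproj A (contraten A F G)"
  note [simp] = p ct_fg_ob ct_ob coproj_ar
  have x [simp]: "X a \<in> Ar V" "Dom V (X a) = p \<otimes> (FOb F a \<otimes> FOb G a)" "Cod V (X a) = c" if "a \<in> VOb A" for a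
    using X[OF that] by (auto simp: hom_iff)
  let ?Y = "\<lambda>a. curry (FOb F a \<otimes> FOb G a) p c (X a \<cdot> sym (FOb F a \<otimes> FOb G a) p)"
  have "is_cowedge A ?T (p \<multimap> c) ?Y"
    unfolding is_cowedge_def
  proof (intro conjI ballI)
    fix a b assume [simp]: "a \<in> VOb A" "b \<in> VOb A"
    note [simp] = vfun_ar[OF F, simplified] vfun_ar[OF G]
    show "?Y b \<cdot> act A (partR (vop A) A ?T b) a b = ?Y a \<cdot> act (vop A) (partL (vop A) A ?T a) b a"
    proof -
      note [simp] = act_contraten(1,2)[OF F G, of a b, unfolded hom_iff, simplified] act_contraten(3,4)[OF F G]
      show ?thesis
        by (rule el_ext[of "\<langle>var 2 (VHom A a b), \<langle>var 1 (FOb F b), var 3 (FOb G a)\<rangle>\<rangle>"], simp,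
           rule ih_ext[where a = p and b = c and i = 0]) (simp_all add: d)
    qed
  qed (simp_all add: hom_iff)
  then have ex: "\<exists>!u. u \<in> hom ?C (p \<multimap> c) \<and> (\<forall>a\<in>VOb A. u \<cdot> ?i a = ?Y a)"
    using ct_coend unfolding is_coend_def by blast
  have iff: "u \<cdot> (idn p ** ?i a) = X a \<longleftrightarrow> curry ?C p c (u \<cdot> sym ?C p) \<cdot> ?i a = ?Y a"
    if a [simp]: "a \<in> VOb A" and [simp]: "u \<in> Ar V" "Dom V u = p \<otimes> ?C" "Cod V u = c" for u a
    using transpose_eq[of u "X a" p ?C "FOb F a \<otimes> FOb G a" c "?i a" "idn (FOb F a \<otimes> FOb G a)" "FOb F a \<otimes> FOb G a"]
    by simp
  have inj: "u = v" if [simp]: "u \<in> Ar V" "Dom V u = p \<otimes> ?C" "Cod V u = c" "v \<in> Ar V" "Dom V v = p \<otimes> ?C" "Cod V v = c"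
    and "curry ?C p c (u \<cdot> sym ?C p) = curry ?C p c (v \<cdot> sym ?C p)" for u v
    using transpose_eq[of u v p ?C ?C c "idn ?C" "idn ?C" ?C] that(7) by simp
  obtain w where w [simp]: "w \<in> Ar V" "Dom V w = ?C" "Cod V w = (p \<multimap> c)" and wi: "\<And>a. a \<in> VOb A \<Longrightarrow> w \<cdot> ?i a = ?Y a"
    and uniq: "\<And>w'. w' \<in> hom ?C (p \<multimap> c) \<Longrightarrow> \<forall>a\<in>VOb A. w' \<cdot> ?i a = ?Y a \<Longrightarrow> w' = w"
    using ex unfolding hom_iff by metis
  let ?u = "ev p c \<cdot> (w ** idn p) \<cdot> sym p ?C"
  have cw: "curry ?C p c (?u \<cdot> sym ?C p) = w"
    by (rule el_ext[of "var 0 ?C"], simp, rule ih_ext[where a = p and b = c and i = 1]) simp_all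
  show ?thesis
  proof (rule ex1I[of _ ?u], intro conjI ballI)
    show "?u \<cdot> (idn p ** ?i a) = X a" if "a \<in> VOb A" for a
      by (subst iff[OF that]) (simp_all only: cw wi[OF that], simp_all)
    fix v assume v: "v \<in> hom (p \<otimes> ?C) c \<and> (\<forall>a\<in>VOb A. v \<cdot> (idn p ** ?i a) = X a)"
    then have vt: "v \<in> Ar V" "Dom V v = p \<otimes> ?C" "Cod V v = c" by (auto simp: hom_iff)
    have "curry ?C p c (v \<cdot> sym ?C p) = w"
      by (rule uniq) (use v vt iff in \<open>auto simp: hom_iff\<close>)
    then show "v = ?u" using cw inj[OF vt, of ?u] by simp
  qed (simp add: hom_iff)
qed

text \<open>The parameter \<open>p\<close> may be the type of any full element, such as a tuple of several
  variables, or \<open>un\<close> if there is no parameter.\<close>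

lemma coend_ext:
  assumes [simp]: "f \<in> Ar V" "g \<in> Ar V" "Dom V f = p \<otimes> coend A (contraten A F G)" "Dom V g = p \<otimes> coend A (contraten A F G)"
    "Cod V f = Cod V g" and e [simp]: "full e" "ty e = p" and ij [simp]: "i \<notin> names e" "j \<notin> names e" "i \<noteq> j"
    and eq: "\<And>a. a \<in> VOb A \<Longrightarrow> f $ \<langle>e, coproj A (contraten A F G) a $ \<langle>var i (FOb F a), var j (FOb G a)\<rangle>\<rangle>
       = g $ \<langle>e, coproj A (contraten A F G) a $ \<langle>var i (FOb F a), var j (FOb G a)\<rangle>\<rangle>"
  shows "f = g"
proof -
  let ?T = "contraten A F G" and ?C = "coend A (contraten A F G)" and ?i = "coproj A (contraten A F G)"
  note [simp] = ct_fg_ob ct_ob coproj_ar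
  have [simp]: "p \<in> Ob V" "Cod V g \<in> Ob V" using good_ty[of e] ar_ob[of g] by auto
  have [simp]: "j \<noteq> i" by (rule not_sym[OF ij(3)])
  have fg: "g \<cdot> (idn p ** ?i a) = f \<cdot> (idn p ** ?i a)" if [simp]: "a \<in> VOb A" for a
    by (rule el_ext[of "\<langle>e, \<langle>var i (FOb F a), var j (FOb G a)\<rangle>\<rangle>"]) (simp_all add: eq)
  have "\<exists>!u. u \<in> hom (p \<otimes> ?C) (Cod V g) \<and> (\<forall>a\<in>VOb A. u \<cdot> (idn p ** ?i a) = f \<cdot> (idn p ** ?i a))"
  proof (rule coend_univ)
    fix a b assume [simp]: "a \<in> VOb A" "b \<in> VOb A"
    note [simp] = vfun_ar[OF F, simplified] vfun_ar[OF G]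
    show "f \<cdot> (idn p ** ?i b) $ \<langle>var 0 p, \<langle>var 1 (FOb F b), push G a b (var 2 (VHom A a b)) (var 3 (FOb G a))\<rangle>\<rangle>
      = f \<cdot> (idn p ** ?i a) $ \<langle>var 0 p, \<langle>push F b a (var 2 (VHom A a b)) (var 1 (FOb F b)), var 3 (FOb G a)\<rangle>\<rangle>"
      by (simp add: coproj_dinat)
  qed (simp_all add: hom_iff)
  moreover have "f \<in> hom (p \<otimes> ?C) (Cod V g)" "g \<in> hom (p \<otimes> ?C) (Cod V g)" by (simp_all add: hom_iff)
  ultimately show ?thesis using fg by blast
qed

end

lemma end_act:
  fixes A :: "('s, 'o, 'm) vcat"
  assumes F: "vfunctor A vself F" and G: "vfunctor A vself G" and F': "vfunctor A vself F'" and G': "vfunctor A vself G'"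
    and P [simp]: "P \<in> Ob V" and t: "\<And>x. x \<in> VOb A \<Longrightarrow> t x \<in> hom (P \<otimes> (FOb F x \<multimap> FOb G x)) (FOb F' x \<multimap> FOb G' x)"
    and nat: "\<And>x y. x \<in> VOb A \<Longrightarrow> y \<in> VOb A \<Longrightarrow>
       push G' x y (var 0 (VHom A x y)) (ev (FOb F' x) (FOb G' x) $ \<langle>t x $ \<langle>var 1 P, nproj A F G x $ var 2 (nhom A F G)\<rangle>, var 3 (FOb F' x)\<rangle>)
     = ev (FOb F' y) (FOb G' y) $ \<langle>t y $ \<langle>var 1 P, nproj A F G y $ var 2 (nhom A F G)\<rangle>,
         push F' x y (var 0 (VHom A x y)) (var 3 (FOb F' x))\<rangle>"
  defines "e \<equiv> end_act A P (homfun vself A A F G) (homfun vself A A F' G') t"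
  shows "e \<in> Ar V" "Dom V e = P \<otimes> nhom A F G" "Cod V e = nhom A F' G'"
    "x \<in> VOb A \<Longrightarrow> els [(p, P), (w, nhom A F G)] \<Longrightarrow>
       nproj A F' G' x $ e $ \<langle>p, w\<rangle> = t x $ \<langle>p, nproj A F G x $ w\<rangle>" (is "PROP ?th1")
proof -
  have [simp]: "vcategory A" using vfun_ar(5)[OF F] .
  note [simp] = nproj_ar[OF F G] nhom_ob[OF F G] nproj_ar[OF F' G'] nhom_ob[OF F' G'] fg_ob[OF F G] fg_ob[OF F' G']
    vfun_ar(2-4)[OF F'] vfun_ar(2-4)[OF G']
  have [simp]: "t x \<in> Ar V" "Dom V (t x) = P \<otimes> (FOb F x \<multimap> FOb G x)" "Cod V (t x) = (FOb F' x \<multimap> FOb G' x)" if "x \<in> VOb A" for x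
    using t[OF that] by (auto simp: hom_iff)
  let ?X = "\<lambda>x. t x \<cdot> (idn P ** nproj A F G x)"
  have ex: "\<exists>!u. u \<in> hom (P \<otimes> nhom A F G) (nhom A F' G') \<and> (\<forall>x\<in>VOb A. nproj A F' G' x \<cdot> u = ?X x)"
  proof (rule nhom_univ[OF F' G'])
    fix x y assume [simp]: "x \<in> VOb A" "y \<in> VOb A"
    show "nat_l A F' G' (P \<otimes> nhom A F G) ?X x y = nat_r A F' G' (P \<otimes> nhom A F G) ?X x y"
      by (rule el_ext[of "\<langle>\<langle>var 0 (VHom A x y), \<langle>var 1 P, var 2 (nhom A F G)\<rangle>\<rangle>, var 3 (FOb F' x)\<rangle>"])
        (simp_all add: nat_lr[OF F' G'] hom_iff nat)
  qed (simp_all add: hom_iff)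
  have E: "e \<in> hom (P \<otimes> nhom A F G) (nhom A F' G')" and N: "\<And>x. x \<in> VOb A \<Longrightarrow> nproj A F' G' x \<cdot> e = ?X x"
    using theI'[OF ex] unfolding e_def end_act_def nhom_def nproj_def by blast+
  then show [simp]: "e \<in> Ar V" "Dom V e = P \<otimes> nhom A F G" "Cod V e = nhom A F' G'" by (auto simp: hom_iff)
  show "PROP ?th1"
    using arg_cong[OF N[of x], of "\<lambda>f. f $ \<langle>p, w\<rangle>"] by simp
qed

lemma coend_act:
  fixes A :: "('s, 'o, 'm) vcat"
  assumes F: "vfunctor (vop A) vself F" and G: "vfunctor A vself G" and F': "vfunctor (vop A) vself F'" and G': "vfunctor A vself G'"
    and P [simp]: "P \<in> Ob V" and t: "\<And>a. a \<in> VOb A \<Longrightarrow> t a \<in> hom (P \<otimes> (FOb F a \<otimes> FOb G a)) (FOb F' a \<otimes> FOb G' a)"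
    and d: "\<And>a b. a \<in> VOb A \<Longrightarrow> b \<in> VOb A \<Longrightarrow>
      coproj A (contraten A F' G') b $ t b $ \<langle>var 0 P, \<langle>var 1 (FOb F b), push G a b (var 2 (VHom A a b)) (var 3 (FOb G a))\<rangle>\<rangle>
      = coproj A (contraten A F' G') a $ t a $ \<langle>var 0 P, \<langle>push F b a (var 2 (VHom A a b)) (var 1 (FOb F b)), var 3 (FOb G a)\<rangle>\<rangle>"
  defines "e \<equiv> coend_act A P (contraten A F G) (contraten A F' G') t"
  shows "e \<in> Ar V" "Dom V e = P \<otimes> coend A (contraten A F G)" "Cod V e = coend A (contraten A F' G')"
    "a \<in> VOb A \<Longrightarrow> els [(p, P), (s, FOb F a \<otimes> FOb G a)] \<Longrightarrow>
       e $ \<langle>p, coproj A (contraten A F G) a $ s\<rangle> = coproj A (contraten A F' G') a $ t a $ \<langle>p, s\<rangle>" (is "PROP ?th1")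
proof -
  have [simp]: "vcategory A" using vfun_ar(5)[OF G] .
  note [simp] = ct_fg_ob[OF F G] ct_ob[OF F G] coproj_ar[OF F G] ct_fg_ob[OF F' G'] ct_ob[OF F' G'] coproj_ar[OF F' G']
    vfun_ar(2-4)[OF F, simplified] vfun_ar(2-4)[OF G]
  have [simp]: "t x \<in> Ar V" "Dom V (t x) = P \<otimes> (FOb F x \<otimes> FOb G x)" "Cod V (t x) = (FOb F' x \<otimes> FOb G' x)" if "x \<in> VOb A" for x
    using t[OF that] by (auto simp: hom_iff)
  let ?X = "\<lambda>a. coproj A (contraten A F' G') a \<cdot> t a"
  have ex: "\<exists>!u. u \<in> hom (P \<otimes> coend A (contraten A F G)) (coend A (contraten A F' G')) \<and>
      (\<forall>a\<in>VOb A. u \<cdot> (idn P ** coproj A (contraten A F G) a) = ?X a)"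
    by (rule coend_univ[OF F G]) (simp_all add: hom_iff d)
  have E: "e \<in> hom (P \<otimes> coend A (contraten A F G)) (coend A (contraten A F' G'))"
    and N: "\<And>a. a \<in> VOb A \<Longrightarrow> e \<cdot> (idn P ** coproj A (contraten A F G) a) = ?X a"
    using theI'[OF ex] unfolding e_def coend_act_def by blast+
  then show [simp]: "e \<in> Ar V" "Dom V e = P \<otimes> coend A (contraten A F G)" "Cod V e = coend A (contraten A F' G')" by (auto simp: hom_iff)
  show "PROP ?th1"
    using arg_cong[OF N[of a], of "\<lambda>f. f $ \<langle>p, s\<rangle>"] by simp
qed

lemma coend_univ0:
  fixes A :: "('s, 'o, 'm) vcat"
  assumes F: "vfunctor (vop A) vself F" and G: "vfunctor A vself G" and c [simp]: "c \<in> Ob V"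
    and X: "\<And>a. a \<in> VOb A \<Longrightarrow> X a \<in> hom (FOb F a \<otimes> FOb G a) c"
    and d: "\<And>a b. a \<in> VOb A \<Longrightarrow> b \<in> VOb A \<Longrightarrow>
      X b $ \<langle>var 1 (FOb F b), push G a b (var 2 (VHom A a b)) (var 3 (FOb G a))\<rangle>
      = X a $ \<langle>push F b a (var 2 (VHom A a b)) (var 1 (FOb F b)), var 3 (FOb G a)\<rangle>"
  shows "\<exists>!u. u \<in> hom (coend A (contraten A F G)) c \<and> (\<forall>a\<in>VOb A. u \<cdot> coproj A (contraten A F G) a = X a)"
proof -
  let ?T = "contraten A F G"
  note [simp] = ct_fg_ob[OF F G] vfun_ar[OF F, simplified] vfun_ar[OF G]
  have [simp]: "X a \<in> Ar V" "Dom V (X a) = FOb F a \<otimes> FOb G a" "Cod V (X a) = c" if "a \<in> VOb A" for a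
    using X[OF that] by (auto simp: hom_iff)
  have "is_cowedge A ?T c X"
    unfolding is_cowedge_def
  proof (intro conjI ballI)
    fix a b assume [simp]: "a \<in> VOb A" "b \<in> VOb A"
    note [simp] = act_contraten(1,2)[OF F G, of a b, unfolded hom_iff, simplified] act_contraten(3,4)[OF F G]
    show "X b \<cdot> act A (partR (vop A) A ?T b) a b = X a \<cdot> act (vop A) (partL (vop A) A ?T a) b a"
      by (rule el_ext[of "\<langle>var 2 (VHom A a b), \<langle>var 1 (FOb F b), var 3 (FOb G a)\<rangle>\<rangle>"]) (simp_all add: d)
  qed (simp_all add: hom_iff)
  then show ?thesis using ct_coend[OF F G] unfolding is_coend_def by blast
qed

end

context symmetric_monoidal_closed
begin

section \<open>\<open>\<V>\<close>-categories embedded in \<open>\<V>\<close>-categories\<close>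

lemma monoI:
  assumes "f \<in> Ar V" "\<And>a u v. u \<in> hom a (Dom V f) \<Longrightarrow> v \<in> hom a (Dom V f) \<Longrightarrow> f \<cdot> u = f \<cdot> v \<Longrightarrow> u = v"
  shows "mono f"
  using assms unfolding mono_def by blast

lemma mono_cancel:
  assumes "mono f" "u \<in> Ar V" "v \<in> Ar V" "Dom V u = Dom V v" "Cod V u = Dom V f" "Cod V v = Dom V f" "f \<cdot> u = f \<cdot> v"
  shows "u = v"
proof -
  have "u \<in> hom (Dom V u) (Dom V f)" "v \<in> hom (Dom V u) (Dom V f)" using assms by (simp_all add: hom_iff)
  then show ?thesis using assms(1,7) unfolding mono_def by blast
qed

lemma iso_mono: "iso f \<Longrightarrow> mono f"
  by (rule monoI) (auto simp: hom_iff iso_ar intro: iso_cancelL[of f])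

lemma mono_el:
  assumes "mono f" "good x" "good y" "ty x = Dom V f" "ty y = Dom V f" "f $ x = f $ y"
  shows "x = y"
proof -
  have f: "fst x = fst y" "f \<cdot> snd x = f \<cdot> snd y" using assms(6) by (simp_all add: app_def)
  have "snd x = snd y"
    by (rule mono_cancel[OF assms(1)]) (use assms(2-5) f in simp_all)
  then show ?thesis using f by (simp add: prod_eq_iff)
qed

lemma equaliser_facts:
  assumes "is_equaliser e i u v"
  shows "u \<in> Ar V" "v \<in> hom (Dom V u) (Cod V u)" "i \<in> hom e (Dom V u)" "u \<cdot> i = v \<cdot> i"
    "\<And>e' i'. i' \<in> hom e' (Dom V u) \<Longrightarrow> u \<cdot> i' = v \<cdot> i' \<Longrightarrow> \<exists>!w. w \<in> hom e' e \<and> i \<cdot> w = i'"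
  using assms unfolding is_equaliser_def by blast+

lemma equaliser_mono:
  assumes e: "is_equaliser e i u v"
  shows "mono i"
proof (rule monoI)
  note f = equaliser_facts[OF e]
  show ia: "i \<in> Ar V" using f by (simp add: hom_iff)
  fix a x y assume x: "x \<in> hom a (Dom V i)" "y \<in> hom a (Dom V i)" and xy: "i \<cdot> x = i \<cdot> y"
  have "u \<cdot> i \<cdot> x = v \<cdot> i \<cdot> x" using trail[OF f(4)] f(1-3) x by (simp add: hom_iff)
  with f(3) x have "\<exists>!w. w \<in> hom a e \<and> i \<cdot> w = i \<cdot> x"
    using f(5)[of "i \<cdot> x" a] by (simp add: hom_iff)
  moreover have "x \<in> hom a e" "y \<in> hom a e" using x f(3) by (simp_all add: hom_iff)
  ultimately show "x = y" using xy by metis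
qed

lemma equaliser_iso:
  assumes e: "is_equaliser e i u v" and e': "is_equaliser e' i' u v"
  shows "\<exists>!w. w \<in> hom e' e \<and> i \<cdot> w = i'" (is ?th1) "\<exists>w. w \<in> hom e' e \<and> i \<cdot> w = i' \<and> iso w" (is ?th2)
proof -
  note f = equaliser_facts[OF e] and f' = equaliser_facts[OF e']
  show ex: ?th1 by (rule f(5)[OF f'(3,4)])
  then obtain w where w: "w \<in> hom e' e" "i \<cdot> w = i'" by blast
  obtain z where z: "z \<in> hom e e'" "i' \<cdot> z = i" using f'(5)[OF f(3,4)] by blast
  have t: "i \<in> Ar V" "Dom V i = e" "i' \<in> Ar V" "Dom V i' = e'" "w \<in> Ar V" "Dom V w = e'" "Cod V w = e"
    "z \<in> Ar V" "Dom V z = e" "Cod V z = e'" using f(3) f'(3) w z by (auto simp: hom_iff)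
  have "e \<in> Ob V" "e' \<in> Ob V" using t ar_ob[of i] ar_ob[of i'] by auto
  have "i \<cdot> w \<cdot> z = i" using trail[OF w(2)] z t by simp
  with t \<open>e \<in> Ob V\<close> have 1: "w \<cdot> z = idn e"
    using mono_cancel[OF equaliser_mono[OF e], of "w \<cdot> z" "idn e"] by simp
  have "i' \<cdot> z \<cdot> w = i'" using trail[OF z(2)] w t by simp
  with t \<open>e' \<in> Ob V\<close> have "z \<cdot> w = idn e'"
    using mono_cancel[OF equaliser_mono[OF e'], of "z \<cdot> w" "idn e'"] by simp
  then have "iso w" using isoI(1)[of w z] 1 t by simp
  then show ?th2 using w by blast
qed

text \<open>If monomorphisms \<open>J\<close> embed the homs in those of \<open>D\<close>, and identities
  and composition are restricted from \<open>D\<close>, then the laws of a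
  \<open>\<V>\<close>-category are inherited. Both the Kleisli category and the Joyal-Wiener
  category arise in this way.\<close>

lemma sub_vcategory:
  assumes D: "vcategory D" and o: "\<And>a. a \<in> VOb C \<Longrightarrow> fo a \<in> VOb D"
    and J: "\<And>a b. a \<in> VOb C \<Longrightarrow> b \<in> VOb C \<Longrightarrow> J a b \<in> hom (VHom C a b) (VHom D (fo a) (fo b)) \<and> mono (J a b)"
    and i: "\<And>a. a \<in> VOb C \<Longrightarrow> VId C a \<in> hom \<I> (VHom C a a) \<and> J a a \<cdot> VId C a = VId D (fo a)"
    and m: "\<And>a b c. a \<in> VOb C \<Longrightarrow> b \<in> VOb C \<Longrightarrow> c \<in> VOb C \<Longrightarrow>
        VCmp C a b c \<in> hom (VHom C b c \<otimes> VHom C a b) (VHom C a c) \<and>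
        J a c \<cdot> VCmp C a b c = VCmp D (fo a) (fo b) (fo c) \<cdot> (J b c ** J a b)"
  shows "vcategory C" "faithful C D (mkfun C fo J)"
proof -
  note [simp] = D o
  have [simp]: "J a b \<in> Ar V" "Dom V (J a b) = VHom C a b" "Cod V (J a b) = VHom D (fo a) (fo b)"
    if "a \<in> VOb C" "b \<in> VOb C" for a b using J[OF that] by (auto simp: hom_iff)
  have ob [simp]: "VHom C a b \<in> Ob V" if "a \<in> VOb C" "b \<in> VOb C" for a b
    using that ar_ob(1)[of "J a b"] by simp
  have [simp]: "VId C a \<in> Ar V" "Dom V (VId C a) = \<I>" "Cod V (VId C a) = VHom C a a" if "a \<in> VOb C" for a
    using i[OF that] by (auto simp: hom_iff)
  have [simp]: "VCmp C a b c \<in> Ar V" "Dom V (VCmp C a b c) = VHom C b c \<otimes> VHom C a b"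
    "Cod V (VCmp C a b c) = VHom C a c" if "a \<in> VOb C" "b \<in> VOb C" "c \<in> VOb C" for a b c
    using m[OF that] by (auto simp: hom_iff)
  have Ji [simp]: "J a a $ VId C a $ un = VId D (fo a) $ un" if a: "a \<in> VOb C" for a
  proof -
    have "J a a \<cdot> VId C a $ un = VId D (fo a) $ un" using i[OF a] by simp
    then show ?thesis using a by simp
  qed
  have Jm [simp]: "J a c $ VCmp C a b c $ \<langle>g, f\<rangle> = VCmp D (fo a) (fo b) (fo c) $ \<langle>J b c $ g, J a b $ f\<rangle>"
    if a: "a \<in> VOb C" "b \<in> VOb C" "c \<in> VOb C" and e: "els [(g, VHom C b c), (f, VHom C a b)]"
    for a b c g f
  proof -
    have "J a c \<cdot> VCmp C a b c $ \<langle>g, f\<rangle> = VCmp D (fo a) (fo b) (fo c) \<cdot> (J b c ** J a b) $ \<langle>g, f\<rangle>"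
      using m[OF a] by simp
    then show ?thesis using a e by simp
  qed
  have mo: "mono (J a b)" if "a \<in> VOb C" "b \<in> VOb C" for a b using J[OF that] by blast
  show C: "vcategory C"
  proof (rule vcategoryI)
    fix a b assume [simp]: "a \<in> VOb C" "b \<in> VOb C"
    show "VCmp C a b b $ \<langle>VId C b $ un, var 0 (VHom C a b)\<rangle> = var 0 (VHom C a b)"
      by (rule mono_el[OF mo[of a b]]) simp_all
    show "VCmp C a a b $ \<langle>var 0 (VHom C a b), VId C a $ un\<rangle> = var 0 (VHom C a b)"
      by (rule mono_el[OF mo[of a b]]) simp_all
    fix c d assume [simp]: "c \<in> VOb C" "d \<in> VOb C"
    show "VCmp C a b d $ \<langle>VCmp C b c d $ \<langle>var 0 (VHom C c d), var 1 (VHom C b c)\<rangle>, var 2 (VHom C a b)\<rangle>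
        = VCmp C a c d $ \<langle>var 0 (VHom C c d), VCmp C a b c $ \<langle>var 1 (VHom C b c), var 2 (VHom C a b)\<rangle>\<rangle>"
      by (rule mono_el[OF mo[of a d]]) simp_all
  qed (use i m in auto)
  have "vfunctor C D (mkfun C fo J)"
    by (rule vfunctorI[OF C D]) (simp_all add: hom_iff)
  then show "faithful C D (mkfun C fo J)" unfolding faithful_def using mo by simp
qed

lemma idfun_simps [simp]:
  "a \<in> VOb C \<Longrightarrow> FOb (idfun C) a = a"
  "a \<in> VOb C \<Longrightarrow> b \<in> VOb C \<Longrightarrow> FMap (idfun C) a b = idn (VHom C a b)"
  by (simp_all add: idfun_def)

lemma compfun_simps [simp]:
  "a \<in> VOb C \<Longrightarrow> FOb (compfun C G F) a = FOb G (FOb F a)"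
  "a \<in> VOb C \<Longrightarrow> b \<in> VOb C \<Longrightarrow> FMap (compfun C G F) a b = FMap G (FOb F a) (FOb F b) \<cdot> FMap F a b"
  by (simp_all add: compfun_def)

lemma mkfun_cong:
  assumes "\<And>a. a \<in> VOb C \<Longrightarrow> fo a = fo' a" "\<And>a b. a \<in> VOb C \<Longrightarrow> b \<in> VOb C \<Longrightarrow> fm a b = fm' a b"
  shows "mkfun C fo fm = mkfun C fo' fm'"
  using assms unfolding mkfun_def by (auto intro!: ext)

lemma vfun_mkfun:
  assumes "vfunctor C D F"
  shows "F = mkfun C (FOb F) (FMap F)"
  using assms unfolding mkfun_def vfunctor_def by (intro vfun.equality) (auto intro!: ext)

lemma vnat_iso_id:
  assumes [simp]: "vcategory C"
  shows "vnat_iso C C (idfun C) (idfun C) (VId C)"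
  unfolding vnat_iso_def vnat_def uiso_def
proof (intro conjI ballI)
  fix a b assume [simp]: "a \<in> VOb C" "b \<in> VOb C"
  show "postcomp C (FOb (idfun C) a) (FOb (idfun C) b) (FOb (idfun C) b) (VId C b) \<cdot> FMap (idfun C) a b =
           precomp C (FOb (idfun C) a) (FOb (idfun C) a) (FOb (idfun C) b) (VId C a) \<cdot> FMap (idfun C) a b"
    by (rule el_ext[of "var 0 (VHom C a b)"]) simp_all
  have "ucomp C a a a (VId C a) (VId C a) = VId C a"
    by (rule el_ext[of un]) simp_all
  then show "\<exists>g. g \<in> hom \<I> (VHom C (FOb (idfun C) a) (FOb (idfun C) a)) \<and>
      ucomp C (FOb (idfun C) a) (FOb (idfun C) a) (FOb (idfun C) a) g (VId C a) = VId C (FOb (idfun C) a) \<and>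
      ucomp C (FOb (idfun C) a) (FOb (idfun C) a) (FOb (idfun C) a) (VId C a) g = VId C (FOb (idfun C) a)"
    by (intro exI[of _ "VId C a"]) (simp add: hom_iff)
qed (simp_all add: hom_iff)

text \<open>Such a functor is even an isomorphism of \<open>\<V>\<close>-categories, so that both natural
  isomorphisms can be taken to be identities.\<close>

lemma vequivalence_idI:
  assumes F: "vfunctor C E (mkfun C (\<lambda>a. a) w)" and ob: "VOb E = VOb C"
    and w: "\<And>a b. a \<in> VOb C \<Longrightarrow> b \<in> VOb C \<Longrightarrow> iso (w a b)"
  shows "vequivalence C E (mkfun C (\<lambda>a. a) w)"
proof -
  let ?F = "mkfun C (\<lambda>a. a) w" and ?G = "mkfun E (\<lambda>a. a) (\<lambda>a b. inv (w a b))"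
  have C [simp]: "vcategory C" and E [simp]: "vcategory E" using vfun_ar[OF F] by auto
  note [simp] = ob w
  have wt [simp]: "w a b \<in> Ar V" "Dom V (w a b) = VHom C a b" "Cod V (w a b) = VHom E a b" if "a \<in> VOb C" "b \<in> VOb C" for a b
    using vfun_ar(2-4)[OF F that] that by auto
  have winv [simp]: "inv (w a b) $ w a b $ x = x" if "a \<in> VOb C" "b \<in> VOb C" "good x" "ty x = VHom C a b" for a b x
    using app_inv[of "w a b" x "w a b $ x"] that by simp
  have winv2 [simp]: "w a b $ inv (w a b) $ x = x" if "a \<in> VOb C" "b \<in> VOb C" "good x" "ty x = VHom E a b" for a b x
    using app_inv[of "inv (w a b)" x "inv (w a b) $ x"] that by simp
  have wi: "w a a $ VId C a $ un = VId E a $ un" if "a \<in> VOb C" for a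
    using vfun_id[OF F that] that by simp
  have wm: "w a c $ VCmp C a b c $ \<langle>g, f\<rangle> = VCmp E a b c $ \<langle>w b c $ g, w a b $ f\<rangle>"
    if a: "a \<in> VOb C" "b \<in> VOb C" "c \<in> VOb C" and e: "els [(g, VHom C b c), (f, VHom C a b)]"
    for a b c g f
    using vfun_cmp[OF F a e] a by simp
  have G: "vfunctor E C ?G"
  proof (rule vfunctorI)
    fix a b c assume "a \<in> VOb E" "b \<in> VOb E" "c \<in> VOb E"
    then have [simp]: "a \<in> VOb C" "b \<in> VOb C" "c \<in> VOb C" by auto
    show "inv (w a a) $ VId E a $ un = VId C a $ un"
      by (rule mono_el[OF iso_mono[OF w[of a a]]]) (simp_all add: wi)
    show "inv (w a c) $ VCmp E a b c $ \<langle>var 0 (VHom E b c), var 1 (VHom E a b)\<rangle> =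
       VCmp C a b c $ \<langle>inv (w b c) $ var 0 (VHom E b c), inv (w a b) $ var 1 (VHom E a b)\<rangle>"
      by (rule mono_el[OF iso_mono[OF w[of a c]]]) (simp_all add: wm)
  qed (simp_all add: hom_iff)
  have GF: "compfun C ?G ?F = idfun C" unfolding compfun_def idfun_def by (rule mkfun_cong) simp_all
  have FG: "compfun E ?F ?G = idfun E" unfolding compfun_def idfun_def by (rule mkfun_cong) simp_all
  show ?thesis unfolding vequivalence_def
    using F G vnat_iso_id[OF C] vnat_iso_id[OF E] GF FG by metis
qed

lemma uiso_vfun:
  assumes F: "vfunctor C D F" and u: "uiso C a b f" and [simp]: "a \<in> VOb C" "b \<in> VOb C"
  shows "uiso D (FOb F a) (FOb F b) (FMap F a b \<cdot> f)"
proof -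
  obtain g where g: "g \<in> hom \<I> (VHom C b a)" "ucomp C a b a g f = VId C a" "ucomp C b a b f g = VId C b"
    and f: "f \<in> hom \<I> (VHom C a b)" using u unfolding uiso_def by blast
  have [simp]: "f \<in> Ar V" "Dom V f = \<I>" "Cod V f = VHom C a b" "g \<in> Ar V" "Dom V g = \<I>" "Cod V g = VHom C b a"
    using f g by (auto simp: hom_iff)
  note [simp] = vfun_ar[OF F]
  have gf: "VCmp C a b a $ \<langle>g $ un, f $ un\<rangle> = VId C a $ un" "VCmp C b a b $ \<langle>f $ un, g $ un\<rangle> = VId C b $ un"
    using arg_cong[OF g(2), of "\<lambda>x. x $ un"] arg_cong[OF g(3), of "\<lambda>x. x $ un"] by simp_all
  have "ucomp D (FOb F a) (FOb F b) (FOb F a) (FMap F b a \<cdot> g) (FMap F a b \<cdot> f) = VId D (FOb F a)"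
    by (rule el_ext[of un]) (simp_all add: vfun_cmp[OF F, symmetric] gf vfun_id[OF F])
  moreover have "ucomp D (FOb F b) (FOb F a) (FOb F b) (FMap F a b \<cdot> f) (FMap F b a \<cdot> g) = VId D (FOb F b)"
    by (rule el_ext[of un]) (simp_all add: vfun_cmp[OF F, symmetric] gf vfun_id[OF F])
  ultimately show ?thesis unfolding uiso_def
    by (intro conjI exI[of _ "FMap F b a \<cdot> g"]) (simp_all add: hom_iff)
qed

end

section \<open>The Kleisli and Joyal-Wiener categories of a \<open>\<V>\<close>-adjunction\<close>

text \<open>An adjunction of \<open>\<V>\<close>-categories. Since \<open>n\<close> and \<open>m\<close> are
  elements over arbitrary contexts, and not only arrows \<open>\<I> \<rightarrow> C(a,b)\<close>,
  the naturality laws are the enriched ones.\<close>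

locale vadjunction = symmetric_monoidal_closed V for V :: "('o, 'm) smc" +
  fixes C :: "('c, 'o, 'm) vcat" and D :: "('d, 'o, 'm) vcat"
    and L :: "('c, 'd, 'm) vfun" and R :: "('d, 'c, 'm) vfun" and \<eta> :: "'c \<Rightarrow> 'm" and \<epsilon> :: "'d \<Rightarrow> 'm"
  assumes L: "vfunctor C D L" and R: "vfunctor D C R"
    and eta_hom: "a \<in> VOb C \<Longrightarrow> \<eta> a \<in> hom \<I> (VHom C a (FOb R (FOb L a)))"
    and eps_hom: "x \<in> VOb D \<Longrightarrow> \<epsilon> x \<in> hom \<I> (VHom D (FOb L (FOb R x)) x)"
    and eta_nat: "\<lbrakk>a \<in> VOb C; b \<in> VOb C; good n; ty n = VHom C a b\<rbrakk> \<Longrightarrow>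
      VCmp C a b (FOb R (FOb L b)) $ \<langle>\<eta> b $ un, n\<rangle>
        = VCmp C a (FOb R (FOb L a)) (FOb R (FOb L b)) $ \<langle>FMap R (FOb L a) (FOb L b) $ FMap L a b $ n, \<eta> a $ un\<rangle>"
    and eps_nat: "\<lbrakk>x \<in> VOb D; y \<in> VOb D; good m; ty m = VHom D x y\<rbrakk> \<Longrightarrow>
      VCmp D (FOb L (FOb R x)) (FOb L (FOb R y)) y $ \<langle>\<epsilon> y $ un, FMap L (FOb R x) (FOb R y) $ FMap R x y $ m\<rangle>
        = VCmp D (FOb L (FOb R x)) x y $ \<langle>m, \<epsilon> x $ un\<rangle>"
    and triangle_L: "a \<in> VOb C \<Longrightarrow>
      VCmp D (FOb L a) (FOb L (FOb R (FOb L a))) (FOb L a) $ \<langle>\<epsilon> (FOb L a) $ un, FMap L a (FOb R (FOb L a)) $ \<eta> a $ un\<rangle>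
        = VId D (FOb L a) $ un"
    and triangle_R: "x \<in> VOb D \<Longrightarrow>
      VCmp C (FOb R x) (FOb R (FOb L (FOb R x))) (FOb R x) $ \<langle>FMap R (FOb L (FOb R x)) x $ \<epsilon> x $ un, \<eta> (FOb R x) $ un\<rangle>
        = VId C (FOb R x) $ un"
begin

abbreviation Lo where "Lo \<equiv> FOb L"
abbreviation Ro where "Ro \<equiv> FOb R"
abbreviation RL where "RL a \<equiv> FOb R (FOb L a)"

text \<open>The monad of the adjunction, its Kleisli category, and the two functors \<open>C \<rightarrow>
  Kl \<rightarrow> D\<close> through which \<open>L\<close> factors.\<close>

definition "mon = compfun C R L"
definition "mult a = FMap R (Lo (RL a)) (Lo a) \<cdot> \<epsilon> (Lo a)"
definition "Kl = kleisli C mon mult \<eta>"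
definition "KlF = kleisli_functor C mon \<eta>"
definition "KlC = kleisli_comparison C D L R \<epsilon>"

lemmas L_ar [simp] = vfun_ar[OF L] and R_ar [simp] = vfun_ar[OF R]
lemmas L_id [simp] = vfun_id[OF L] and R_id [simp] = vfun_id[OF R]
lemmas L_cmp [simp] = vfun_cmp[OF L] and R_cmp [simp] = vfun_cmp[OF R]

lemma eta_ar [simp]:
  assumes "a \<in> VOb C"
  shows "\<eta> a \<in> Ar V" "Dom V (\<eta> a) = \<I>" "Cod V (\<eta> a) = VHom C a (RL a)"
  using eta_hom[OF assms] by (auto simp: hom_iff)

lemma eps_ar [simp]:
  assumes "x \<in> VOb D"
  shows "\<epsilon> x \<in> Ar V" "Dom V (\<epsilon> x) = \<I>" "Cod V (\<epsilon> x) = VHom D (Lo (Ro x)) x"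
  using eps_hom[OF assms] by (auto simp: hom_iff)

declare eps_nat [simp] triangle_L [simp] triangle_R [simp]

lemma eps_nat' [simp]:
  assumes o [simp]: "x \<in> VOb D" "y \<in> VOb D" "z \<in> VOb D" and e [simplified, simp]: "els [(m, VHom D x y), (k, VHom D z (Lo (Ro x)))]"
  shows "VCmp D z (Lo (Ro y)) y $ \<langle>\<epsilon> y $ un, VCmp D z (Lo (Ro x)) (Lo (Ro y)) $ \<langle>FMap L (Ro x) (Ro y) $ FMap R x y $ m, k\<rangle>\<rangle>
     = VCmp D z x y $ \<langle>m, VCmp D z (Lo (Ro x)) x $ \<langle>\<epsilon> x $ un, k\<rangle>\<rangle>"
proof -
  have "VCmp D z (Lo (Ro y)) y $ \<langle>\<epsilon> y $ un, VCmp D z (Lo (Ro x)) (Lo (Ro y)) $ \<langle>FMap L (Ro x) (Ro y) $ FMap R x y $ m, k\<rangle>\<rangle>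
    = VCmp D z (Lo (Ro x)) y $ \<langle>VCmp D (Lo (Ro x)) (Lo (Ro y)) y $ \<langle>\<epsilon> y $ un, FMap L (Ro x) (Ro y) $ FMap R x y $ m\<rangle>, k\<rangle>"
    using e by (simp del: eps_nat)
  then show ?thesis using e by simp
qed

lemma triangle_L' [simp]:
  assumes [simp]: "a \<in> VOb C" "z \<in> VOb D" "good k" "ty k = VHom D z (Lo a)"
  shows "VCmp D z (Lo (RL a)) (Lo a) $ \<langle>\<epsilon> (Lo a) $ un, VCmp D z (Lo a) (Lo (RL a)) $ \<langle>FMap L a (RL a) $ \<eta> a $ un, k\<rangle>\<rangle> = k"
proof -
  have "VCmp D z (Lo (RL a)) (Lo a) $ \<langle>\<epsilon> (Lo a) $ un, VCmp D z (Lo a) (Lo (RL a)) $ \<langle>FMap L a (RL a) $ \<eta> a $ un, k\<rangle>\<rangle>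
    = VCmp D z (Lo a) (Lo a) $ \<langle>VCmp D (Lo a) (Lo (RL a)) (Lo a) $ \<langle>\<epsilon> (Lo a) $ un, FMap L a (RL a) $ \<eta> a $ un\<rangle>, k\<rangle>"
    by (simp del: triangle_L)
  then show ?thesis by simp
qed

subsection \<open>The Kleisli category\<close>

lemma KlC_ob [simp]: "a \<in> VOb C \<Longrightarrow> FOb KlC a = Lo a"
  by (simp add: KlC_def kleisli_comparison_def)

lemma KlC_ar [simp]:
  assumes [simp]: "a \<in> VOb C" "b \<in> VOb C"
  shows "FMap KlC a b \<in> Ar V" "Dom V (FMap KlC a b) = VHom C a (RL b)" "Cod V (FMap KlC a b) = VHom D (Lo a) (Lo b)"
    "good n \<Longrightarrow> ty n = VHom C a (RL b) \<Longrightarrow>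
       FMap KlC a b $ n = VCmp D (Lo a) (Lo (RL b)) (Lo b) $ \<langle>\<epsilon> (Lo b) $ un, FMap L a (RL b) $ n\<rangle>"
  by (simp_all add: KlC_def kleisli_comparison_def Let_def)

lemma mult_ar [simp]:
  assumes [simp]: "a \<in> VOb C"
  shows "mult a \<in> Ar V" "Dom V (mult a) = \<I>" "Cod V (mult a) = VHom C (RL (RL a)) (RL a)"
    "mult a $ un = FMap R (Lo (RL a)) (Lo a) $ \<epsilon> (Lo a) $ un"
  by (simp_all add: mult_def)

lemma mon_simps [simp]:
  "a \<in> VOb C \<Longrightarrow> FOb mon a = RL a"
  "a \<in> VOb C \<Longrightarrow> b \<in> VOb C \<Longrightarrow> FMap mon a b = FMap R (Lo a) (Lo b) \<cdot> FMap L a b"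
  by (simp_all add: mon_def)

lemma Kl_simps [simp]: "VOb Kl = VOb C" "b \<in> VOb C \<Longrightarrow> VHom Kl a b = VHom C a (RL b)" "VId Kl = \<eta>"
  by (simp_all add: Kl_def kleisli_def)

lemma Kl_cmp [simp]:
  assumes [simp]: "a \<in> VOb C" "b \<in> VOb C" "c \<in> VOb C"
  shows "VCmp Kl a b c \<in> Ar V" "Dom V (VCmp Kl a b c) = VHom C b (RL c) \<otimes> VHom C a (RL b)"
    "Cod V (VCmp Kl a b c) = VHom C a (RL c)"
    "els [(g, VHom C b (RL c)), (f, VHom C a (RL b))] \<Longrightarrow>
      VCmp Kl a b c $ \<langle>g, f\<rangle> = VCmp C a (RL b) (RL c) $
        \<langle>VCmp C (RL b) (RL (RL c)) (RL c) $ \<langle>FMap R (Lo (RL c)) (Lo c) $ \<epsilon> (Lo c) $ un,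
           FMap R (Lo b) (Lo (RL c)) $ FMap L b (RL c) $ g\<rangle>, f\<rangle>"
  by (simp_all add: Kl_def kleisli_def Let_def)

text \<open>The transpose \<open>m \<mapsto> R m \<circ> \<eta>\<close>.\<close>

definition phi where "phi a b = precomp C a (RL a) (RL b) (\<eta> a) \<cdot> FMap R (Lo a) (Lo b)"

lemma phi_ar [simp]:
  assumes [simp]: "a \<in> VOb C" "b \<in> VOb C"
  shows "phi a b \<in> Ar V" "Dom V (phi a b) = VHom D (Lo a) (Lo b)" "Cod V (phi a b) = VHom C a (RL b)"
    "good m \<Longrightarrow> ty m = VHom D (Lo a) (Lo b) \<Longrightarrow>
       phi a b $ m = VCmp C a (RL a) (RL b) $ \<langle>FMap R (Lo a) (Lo b) $ m, \<eta> a $ un\<rangle>"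
  by (simp_all add: phi_def)

text \<open>On homs the comparison is the transposition \<open>n \<mapsto> \<epsilon> \<circ> L n\<close>,
  which is inverse to \<open>phi\<close> by the two triangle laws.\<close>

lemma KlC_iso:
  assumes [simp]: "a \<in> VOb C" "b \<in> VOb C"
  shows "iso (FMap KlC a b)" "inv (FMap KlC a b) = phi a b"
proof -
  have 1: "FMap KlC a b \<cdot> phi a b = idn (VHom D (Lo a) (Lo b))"
    by (rule el_ext[of "var 0 (VHom D (Lo a) (Lo b))"]) simp_all
  have 2: "phi a b \<cdot> FMap KlC a b = idn (VHom C a (RL b))"
  proof (rule el_ext[of "var 0 (VHom C a (RL b))"])
    let ?n = "var 0 (VHom C a (RL b)) :: ('o, 'm) el"
    have "phi a b \<cdot> FMap KlC a b $ ?n = VCmp C a (RL (RL b)) (RL b) $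
       \<langle>FMap R (Lo (RL b)) (Lo b) $ \<epsilon> (Lo b) $ un, VCmp C a (RL a) (RL (RL b)) $ \<langle>FMap R (Lo a) (Lo (RL b)) $ FMap L a (RL b) $ ?n, \<eta> a $ un\<rangle>\<rangle>"
      by simp
    also have "\<dots> = VCmp C a (RL b) (RL b) $ \<langle>VCmp C (RL b) (RL (RL b)) (RL b) $
       \<langle>FMap R (Lo (RL b)) (Lo b) $ \<epsilon> (Lo b) $ un, \<eta> (RL b) $ un\<rangle>, ?n\<rangle>"
      by (simp del: triangle_R add: eta_nat)
    finally show "phi a b \<cdot> FMap KlC a b $ ?n = idn (VHom C a (RL b)) $ ?n" by simp
  qed simp_all
  show "iso (FMap KlC a b)" "inv (FMap KlC a b) = phi a b"
    by (rule isoI[of _ "phi a b"]; simp add: 1 2)+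
qed

text \<open>Along the transposition, composition in the Kleisli category becomes composition in
  \<open>D\<close>, by naturality of \<open>\<epsilon>\<close>.\<close>

lemma Kl_sub: "vcategory Kl" "faithful Kl D (mkfun Kl Lo (FMap KlC))"
proof -
  have i: "VId Kl a \<in> hom \<I> (VHom Kl a a) \<and> FMap KlC a a \<cdot> VId Kl a = VId D (Lo a)" if "a \<in> VOb Kl" for a
  proof -
    have [simp]: "a \<in> VOb C" using that by simp
    have "FMap KlC a a \<cdot> VId Kl a = VId D (Lo a)"
      by (rule el_ext[of un]) simp_all
    then show ?thesis by (simp add: hom_iff)
  qed
  have m: "VCmp Kl a b c \<in> hom (VHom Kl b c \<otimes> VHom Kl a b) (VHom Kl a c) \<and>
    FMap KlC a c \<cdot> VCmp Kl a b c = VCmp D (Lo a) (Lo b) (Lo c) \<cdot> (FMap KlC b c ** FMap KlC a b)"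
    if "a \<in> VOb Kl" "b \<in> VOb Kl" "c \<in> VOb Kl" for a b c
  proof -
    have [simp]: "a \<in> VOb C" "b \<in> VOb C" "c \<in> VOb C" using that by simp_all
    have "FMap KlC a c \<cdot> VCmp Kl a b c = VCmp D (Lo a) (Lo b) (Lo c) \<cdot> (FMap KlC b c ** FMap KlC a b)"
      by (rule el_ext[of "\<langle>var 0 (VHom Kl b c), var 1 (VHom Kl a b)\<rangle>"]) simp_all
    then show ?thesis by (simp add: hom_iff)
  qed
  have J: "FMap KlC a b \<in> hom (VHom Kl a b) (VHom D (Lo a) (Lo b)) \<and> mono (FMap KlC a b)"
    if "a \<in> VOb Kl" "b \<in> VOb Kl" for a b
    using that by (simp add: hom_iff iso_mono KlC_iso)
  have o: "vcategory D" "\<And>a. a \<in> VOb Kl \<Longrightarrow> Lo a \<in> VOb D" by simp_all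
  show "vcategory Kl" by (rule sub_vcategory(1)[OF o J i m])
  show "faithful Kl D (mkfun Kl Lo (FMap KlC))" by (rule sub_vcategory(2)[OF o J i m])
qed

lemma KlC_mkfun: "mkfun Kl Lo (FMap KlC) = KlC"
proof -
  have "KlC = mkfun C Lo (FMap KlC)" unfolding KlC_def kleisli_comparison_def by (rule mkfun_cong) simp_all
  then show ?thesis by (simp add: mkfun_def)
qed

lemma KlC_vfun: "vfunctor Kl D KlC"
  using Kl_sub(2) unfolding faithful_def KlC_mkfun by blast

theorem KlC_fully_faithful: "fully_faithful Kl D KlC"
  using KlC_vfun KlC_iso unfolding fully_faithful_def by simp

lemma KlF_simps [simp]:
  "a \<in> VOb C \<Longrightarrow> FOb KlF a = a"
  "a \<in> VOb C \<Longrightarrow> b \<in> VOb C \<Longrightarrow> FMap KlF a b = postcomp C a b (RL b) (\<eta> b)"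
  by (simp_all add: KlF_def kleisli_functor_def)

lemma KlC_KlF:
  assumes [simp]: "a \<in> VOb C" "b \<in> VOb C"
  shows "FMap KlC a b \<cdot> postcomp C a b (RL b) (\<eta> b) = FMap L a b"
  by (rule el_ext[of "var 0 (VHom C a b)"]) simp_all

theorem Kleisli_factorisation: "L = compfun C KlC KlF"
  by (subst vfun_mkfun[OF L], unfold compfun_def, rule mkfun_cong) (simp_all add: KlC_KlF)

lemma KlF_vfun: "vfunctor C Kl KlF"
proof -
  have [simp]: "vcategory Kl" by (rule Kl_sub)
  have KL: "postcomp C a b (RL b) (\<eta> b) $ n = phi a b $ FMap L a b $ n"
    if [simp]: "a \<in> VOb C" "b \<in> VOb C" "good n" "ty n = VHom C a b" for a b n
    by (simp add: eta_nat)
  have m: "mono (FMap KlC a b)" if "a \<in> VOb C" "b \<in> VOb C" for a b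
    using KlC_iso[OF that] iso_mono by blast
  have "vfunctor C Kl (mkfun C (\<lambda>a. a) (\<lambda>a b. postcomp C a b (FOb mon b) (\<eta> b)))"
  proof (rule vfunctorI)
    fix a b c assume [simp]: "a \<in> VOb C" "b \<in> VOb C" "c \<in> VOb C"
    show "postcomp C a a (FOb mon a) (\<eta> a) $ VId C a $ un = VId Kl a $ un"
      by simp
    show "postcomp C a c (FOb mon c) (\<eta> c) $ VCmp C a b c $ \<langle>var 0 (VHom C b c), var 1 (VHom C a b)\<rangle> =
       VCmp Kl a b c $ \<langle>postcomp C b c (FOb mon c) (\<eta> c) $ var 0 (VHom C b c),
          postcomp C a b (FOb mon b) (\<eta> b) $ var 1 (VHom C a b)\<rangle>"
      by (rule mono_el[OF m[of a c]]) simp_all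
  qed (simp_all add: hom_iff)
  then show ?thesis by (simp add: KlF_def kleisli_functor_def)
qed

subsection \<open>The Joyal-Wiener category\<close>

text \<open>The Joyal-Wiener hom is the equaliser of \<open>\<alpha> \<mapsto> L R \<alpha> \<circ> L
  \<eta>\<close> and \<open>\<alpha> \<mapsto> L \<eta> \<circ> \<alpha>\<close>.\<close>

definition "ju a b = precomp D (Lo a) (Lo (RL a)) (Lo (RL b)) (FMap L a (RL a) \<cdot> \<eta> a) \<cdot> FMap L (RL a) (RL b) \<cdot> FMap R (Lo a) (Lo b)"
definition "jv a b = postcomp D (Lo a) (Lo b) (Lo (RL b)) (FMap L b (RL b) \<cdot> \<eta> b)"

lemma j_ar [simp]:
  assumes [simp]: "a \<in> VOb C" "b \<in> VOb C"
  shows "ju a b \<in> Ar V" "Dom V (ju a b) = VHom D (Lo a) (Lo b)" "Cod V (ju a b) = VHom D (Lo a) (Lo (RL b))"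
    "jv a b \<in> Ar V" "Dom V (jv a b) = VHom D (Lo a) (Lo b)" "Cod V (jv a b) = VHom D (Lo a) (Lo (RL b))"
    "good m \<Longrightarrow> ty m = VHom D (Lo a) (Lo b) \<Longrightarrow>
      ju a b $ m = VCmp D (Lo a) (Lo (RL a)) (Lo (RL b)) $ \<langle>FMap L (RL a) (RL b) $ FMap R (Lo a) (Lo b) $ m, FMap L a (RL a) $ \<eta> a $ un\<rangle>"
    "good m \<Longrightarrow> ty m = VHom D (Lo a) (Lo b) \<Longrightarrow>
      jv a b $ m = VCmp D (Lo a) (Lo b) (Lo (RL b)) $ \<langle>FMap L b (RL b) $ \<eta> b $ un, m\<rangle>"
  by (simp_all add: ju_def jv_def)

text \<open>Arrows of the form \<open>L n\<close> are regular: this is \<open>L\<close> applied to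
  naturality of \<open>\<eta>\<close>.\<close>

lemma L_regular_el:
  assumes [simp]: "a \<in> VOb C" "b \<in> VOb C" "good n" "ty n = VHom C a b"
  shows "VCmp D (Lo a) (Lo (RL a)) (Lo (RL b)) $ \<langle>FMap L (RL a) (RL b) $ FMap R (Lo a) (Lo b) $ FMap L a b $ n, FMap L a (RL a) $ \<eta> a $ un\<rangle>
     = VCmp D (Lo a) (Lo b) (Lo (RL b)) $ \<langle>FMap L b (RL b) $ \<eta> b $ un, FMap L a b $ n\<rangle>"
  using arg_cong[OF eta_nat[OF assms], of "\<lambda>x. FMap L a (RL b) $ x"] by simp

lemma L_regular:
  assumes [simp]: "a \<in> VOb C" "b \<in> VOb C"
  shows "ju a b \<cdot> FMap L a b = jv a b \<cdot> FMap L a b"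
  by (rule el_ext[of "var 0 (VHom C a b)"]) (simp_all add: L_regular_el)

end

locale vadjunction_regular = vadjunction +
  assumes eta_regular: "a \<in> VOb C \<Longrightarrow> regular_mono C a (FOb R (FOb L a)) (\<eta> a)"
begin

text \<open>If \<open>L x = L y\<close> then \<open>\<eta> \<circ> x = R L x \<circ> \<eta> = R L y \<circ>
  \<eta> = \<eta> \<circ> y\<close>, and \<open>\<eta>\<close> is a monomorphism.\<close>

lemma L_mono_el:
  assumes o [simp]: "a \<in> VOb C" "b \<in> VOb C" and [simp]: "good x" "good y" "ty x = VHom C a b" "ty y = VHom C a b"
    and e: "FMap L a b $ x = FMap L a b $ y"
  shows "x = y"
proof -
  obtain c u v where "is_equaliser (VHom C a b) (postcomp C a b (RL b) (\<eta> b)) (postcomp C a (RL b) c u) (postcomp C a (RL b) c v)"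
    using eta_regular[OF o(2)] o(1) unfolding regular_mono_def by blast
  then have m: "mono (postcomp C a b (RL b) (\<eta> b))" by (rule equaliser_mono)
  show ?thesis by (rule mono_el[OF m]) (simp_all add: eta_nat e)
qed

text \<open>Regular arrows come from \<open>C\<close>. Let \<open>\<eta> b\<close> be the equaliser of
  \<open>u\<close> and \<open>v\<close>, and let \<open>m : L a \<rightarrow> L b\<close> be
  regular. Then \<open>u\<close> and \<open>v\<close> agree on the transpose of \<open>m\<close>:
  the functor \<open>L\<close> is faithful, and it takes \<open>u \<circ> R m \<circ> \<eta>
  a\<close> to \<open>L u \<circ> L R m \<circ> L (\<eta> a) = L (u \<circ> \<eta> b) \<circ>
  m\<close>. So the transpose of \<open>m\<close> factors through \<open>\<eta> b\<close>, and as
  the transpose of \<open>L w\<close> is \<open>\<eta> b \<circ> w\<close>, the factor is the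
  preimage of \<open>m\<close>.\<close>

theorem L_equaliser:
  assumes a [simp]: "a \<in> VOb C" and b [simp]: "b \<in> VOb C"
  shows "is_equaliser (VHom C a b) (FMap L a b) (ju a b) (jv a b)"
proof -
  obtain c u v where c [simp]: "c \<in> VOb C" and u: "u \<in> hom \<I> (VHom C (RL b) c)" and v: "v \<in> hom \<I> (VHom C (RL b) c)"
    and uv: "ucomp C b (RL b) c u (\<eta> b) = ucomp C b (RL b) c v (\<eta> b)"
    and eq: "is_equaliser (VHom C a b) (postcomp C a b (RL b) (\<eta> b)) (postcomp C a (RL b) c u) (postcomp C a (RL b) c v)"
    using eta_regular[OF b] a unfolding regular_mono_def by metis
  have [simp]: "u \<in> Ar V" "Dom V u = \<I>" "Cod V u = VHom C (RL b) c" "v \<in> Ar V" "Dom V v = \<I>" "Cod V v = VHom C (RL b) c"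
    using u v by (auto simp: hom_iff)
  have uv': "VCmp C b (RL b) c $ \<langle>u $ un, \<eta> b $ un\<rangle> = VCmp C b (RL b) c $ \<langle>v $ un, \<eta> b $ un\<rangle>"
    using arg_cong[OF uv, of "\<lambda>x. x $ un"] by simp
  show ?thesis unfolding is_equaliser_def
  proof (intro conjI allI impI)
    fix e i assume i: "i \<in> hom e (Dom V (ju a b))" and ij: "ju a b \<cdot> i = jv a b \<cdot> i"
    then have [simp]: "i \<in> Ar V" "Dom V i = e" "Cod V i = VHom D (Lo a) (Lo b)" by (auto simp: hom_iff)
    have [simp]: "e \<in> Ob V" using ar_ob[of i] by simp
    let ?m = "i $ var 0 e"
    have reg: "VCmp D (Lo a) (Lo (RL a)) (Lo (RL b)) $ \<langle>FMap L (RL a) (RL b) $ FMap R (Lo a) (Lo b) $ ?m, FMap L a (RL a) $ \<eta> a $ un\<rangle>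
      = VCmp D (Lo a) (Lo b) (Lo (RL b)) $ \<langle>FMap L b (RL b) $ \<eta> b $ un, ?m\<rangle>"
      using arg_cong[OF ij, of "\<lambda>x. x $ var 0 e"] by simp
    have Lw: "FMap L a c $ VCmp C a (RL b) c $ \<langle>w $ un, phi a b $ ?m\<rangle>
      = VCmp D (Lo a) (Lo b) (Lo c) $ \<langle>FMap L b c $ VCmp C b (RL b) c $ \<langle>w $ un, \<eta> b $ un\<rangle>, ?m\<rangle>"
      if [simp]: "w \<in> Ar V" "Dom V w = \<I>" "Cod V w = VHom C (RL b) c" for w
      by (simp add: reg)
    have "VCmp C a (RL b) c $ \<langle>u $ un, phi a b $ ?m\<rangle> = VCmp C a (RL b) c $ \<langle>v $ un, phi a b $ ?m\<rangle>"
    proof (rule L_mono_el[OF a c])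
      show "FMap L a c $ VCmp C a (RL b) c $ \<langle>u $ un, phi a b $ ?m\<rangle> = FMap L a c $ VCmp C a (RL b) c $ \<langle>v $ un, phi a b $ ?m\<rangle>"
        by (subst (1 2) Lw) (simp_all only: uv', simp_all)
    qed simp_all
    from this have q: "postcomp C a (RL b) c u \<cdot> phi a b \<cdot> i = postcomp C a (RL b) c v \<cdot> phi a b \<cdot> i"
      by - (rule el_ext[of "var 0 e"], simp_all del: phi_ar(4))
    have "\<exists>!w. w \<in> hom e (VHom C a b) \<and> postcomp C a b (RL b) (\<eta> b) \<cdot> w = phi a b \<cdot> i"
      by (rule equaliser_facts(5)[OF eq _ q]) (simp add: hom_iff)
    moreover have "postcomp C a b (RL b) (\<eta> b) \<cdot> w = phi a b \<cdot> i \<longleftrightarrow> FMap L a b \<cdot> w = i" if "w \<in> hom e (VHom C a b)" for w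
    proof -
      have [simp]: "w \<in> Ar V" "Dom V w = e" "Cod V w = VHom C a b" using that by (auto simp: hom_iff)
      have p: "postcomp C a b (RL b) (\<eta> b) = phi a b \<cdot> FMap L a b"
        by (rule el_ext[of "var 0 (VHom C a b)"]) (simp_all add: eta_nat)
      have "iso (phi a b)" using KlC_iso[of a b] iso_inv(1)[of "FMap KlC a b"] by simp
      then show ?thesis using iso_cancelL[of "phi a b" "FMap L a b \<cdot> w" i] by (auto simp: p)
    qed
    ultimately show "\<exists>!w. w \<in> hom e (VHom C a b) \<and> FMap L a b \<cdot> w = i" by (metis (no_types, lifting))
  qed (simp_all add: hom_iff L_regular)
qed

text \<open>The inverse \<open>g\<close> of \<open>L f\<close> is again regular, because \<open>L R g
  \<circ> L \<eta> = L R g \<circ> L \<eta> \<circ> L f \<circ> g = L R g \<circ> L R L f \<circ>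
  L \<eta> \<circ> g = L \<eta> \<circ> g\<close>. Hence \<open>g = L h\<close>, and
  \<open>h\<close> is inverse to \<open>f\<close> since \<open>L\<close> is faithful.\<close>

lemma L_reflects_iso:
  assumes a [simp]: "a \<in> VOb C" and b [simp]: "b \<in> VOb C" and f: "f \<in> hom \<I> (VHom C a b)" and u: "uiso D (Lo a) (Lo b) (FMap L a b \<cdot> f)"
  shows "uiso C a b f"
proof -
  have [simp]: "f \<in> Ar V" "Dom V f = \<I>" "Cod V f = VHom C a b" using f by (auto simp: hom_iff)
  obtain g where g: "g \<in> hom \<I> (VHom D (Lo b) (Lo a))" and g1: "ucomp D (Lo a) (Lo b) (Lo a) g (FMap L a b \<cdot> f) = VId D (Lo a)"
    and g2: "ucomp D (Lo b) (Lo a) (Lo b) (FMap L a b \<cdot> f) g = VId D (Lo b)" using u unfolding uiso_def by blast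
  have [simp]: "g \<in> Ar V" "Dom V g = \<I>" "Cod V g = VHom D (Lo b) (Lo a)" using g by (auto simp: hom_iff)
  let ?g = "g $ un" and ?f = "FMap L a b $ f $ un"
  have gf: "VCmp D (Lo a) (Lo b) (Lo a) $ \<langle>?g, ?f\<rangle> = VId D (Lo a) $ un" "VCmp D (Lo b) (Lo a) (Lo b) $ \<langle>?f, ?g\<rangle> = VId D (Lo b) $ un"
    using arg_cong[OF g1, of "\<lambda>x. x $ un"] arg_cong[OF g2, of "\<lambda>x. x $ un"] by simp_all
  have "VCmp D (Lo b) (Lo (RL b)) (Lo (RL a)) $ \<langle>FMap L (RL b) (RL a) $ FMap R (Lo b) (Lo a) $ ?g, FMap L b (RL b) $ \<eta> b $ un\<rangle>
     = VCmp D (Lo b) (Lo b) (Lo (RL a)) $ \<langle>VCmp D (Lo b) (Lo (RL b)) (Lo (RL a)) $ \<langle>FMap L (RL b) (RL a) $ FMap R (Lo b) (Lo a) $ ?g, FMap L b (RL b) $ \<eta> b $ un\<rangle>,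
        VCmp D (Lo b) (Lo a) (Lo b) $ \<langle>?f, ?g\<rangle>\<rangle>"
    unfolding gf by simp
  also have "\<dots> = VCmp D (Lo b) (Lo (RL b)) (Lo (RL a)) $ \<langle>FMap L (RL b) (RL a) $ FMap R (Lo b) (Lo a) $ ?g,
        VCmp D (Lo b) (Lo a) (Lo (RL b)) $ \<langle>VCmp D (Lo a) (Lo b) (Lo (RL b)) $ \<langle>FMap L b (RL b) $ \<eta> b $ un, ?f\<rangle>, ?g\<rangle>\<rangle>"
    by simp
  also have "VCmp D (Lo a) (Lo b) (Lo (RL b)) $ \<langle>FMap L b (RL b) $ \<eta> b $ un, ?f\<rangle>
     = VCmp D (Lo a) (Lo (RL a)) (Lo (RL b)) $ \<langle>FMap L (RL a) (RL b) $ FMap R (Lo a) (Lo b) $ ?f, FMap L a (RL a) $ \<eta> a $ un\<rangle>"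
    by (simp add: L_regular_el)
  also have "VCmp D (Lo b) (Lo (RL b)) (Lo (RL a)) $ \<langle>FMap L (RL b) (RL a) $ FMap R (Lo b) (Lo a) $ ?g,
        VCmp D (Lo b) (Lo a) (Lo (RL b)) $ \<langle>\<dots>, ?g\<rangle>\<rangle>
    = VCmp D (Lo b) (Lo (RL a)) (Lo (RL a)) $ \<langle>FMap L (RL a) (RL a) $ FMap R (Lo a) (Lo a) $ VCmp D (Lo a) (Lo b) (Lo a) $ \<langle>?g, ?f\<rangle>,
        VCmp D (Lo b) (Lo a) (Lo (RL a)) $ \<langle>FMap L a (RL a) $ \<eta> a $ un, ?g\<rangle>\<rangle>"
    by simp
  also have "\<dots> = VCmp D (Lo b) (Lo a) (Lo (RL a)) $ \<langle>FMap L a (RL a) $ \<eta> a $ un, ?g\<rangle>"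
    unfolding gf by simp
  finally have "ju b a \<cdot> g = jv b a \<cdot> g"
    by - (rule el_ext[of un], simp_all)
  then obtain h where h: "h \<in> hom \<I> (VHom C b a)" "FMap L b a \<cdot> h = g"
    using equaliser_facts(5)[OF L_equaliser[OF b a], of g \<I>] g by auto
  have [simp]: "h \<in> Ar V" "Dom V h = \<I>" "Cod V h = VHom C b a" using h by (auto simp: hom_iff)
  have Lh: "FMap L b a $ h $ un = ?g" using arg_cong[OF h(2), of "\<lambda>x. x $ un"] by simp
  have "VCmp C a b a $ \<langle>h $ un, f $ un\<rangle> = VId C a $ un"
    by (rule L_mono_el[OF a a]) (simp_all add: Lh gf)
  then have "ucomp C a b a h f = VId C a"
    by - (rule el_ext[of un], simp_all)
  moreover have "VCmp C b a b $ \<langle>f $ un, h $ un\<rangle> = VId C b $ un"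
    by (rule L_mono_el[OF b b]) (simp_all add: Lh gf)
  then have "ucomp C b a b f h = VId C b"
    by - (rule el_ext[of un], simp_all)
  ultimately show ?thesis unfolding uiso_def using f h by blast
qed

theorem KlF_conservative: "conservative C Kl KlF"
  unfolding conservative_def
proof (intro conjI ballI allI impI KlF_vfun)
  fix a b f assume [simp]: "a \<in> VOb C" "b \<in> VOb C" and f: "f \<in> hom \<I> (VHom C a b)"
    and u: "uiso Kl (FOb KlF a) (FOb KlF b) (FMap KlF a b \<cdot> f)"
  have [simp]: "f \<in> Ar V" "Dom V f = \<I>" "Cod V f = VHom C a b" using f by (auto simp: hom_iff)
  have "uiso D (Lo a) (Lo b) (FMap KlC a b \<cdot> FMap KlF a b \<cdot> f)"
    using uiso_vfun[OF KlC_vfun, of a b "FMap KlF a b \<cdot> f"] u by simp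
  also have "FMap KlC a b \<cdot> FMap KlF a b \<cdot> f = FMap L a b \<cdot> f"
    using trail[OF KlC_KlF[of a b], of f] by simp
  finally show "uiso C a b f" by (rule L_reflects_iso[rotated -1]) (simp_all add: f)
qed

text \<open>The Joyal-Wiener category of the adjunction, with its inclusions into the Kleisli category and
  into \<open>D\<close>, and the functor from \<open>C\<close> through which \<open>L\<close>
  factors.\<close>

definition "the_jw a b = (SOME z. is_equaliser (fst z) (snd z) (ju a b) (jv a b))"
definition "jw_hom a b = fst (the_jw a b)"
definition "jw_incl a b = snd (the_jw a b)"
definition "jw_incl_T a b = inv (FMap KlC a b) \<cdot> jw_incl a b"
definition "JW = \<lparr>VOb = VOb C, VHom = jw_hom,
      VId = (\<lambda>f. THE u. u \<in> hom \<I> (jw_hom f f) \<and> jw_incl_T f f \<cdot> u = VId Kl f),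
      VCmp = (\<lambda>f g h. THE u. u \<in> hom (jw_hom g h \<otimes> jw_hom f g) (jw_hom f h) \<and>
                jw_incl_T f h \<cdot> u
                  = VCmp Kl f g h \<cdot> (jw_incl_T g h ** jw_incl_T f g))\<rparr>"
definition "jw_sub = mkfun JW (\<lambda>f. f) jw_incl_T"
definition "jw_emb = mkfun JW Lo jw_incl"
definition "jw_map f g = (THE u. u \<in> hom (VHom C f g) (jw_hom f g) \<and> jw_incl f g \<cdot> u = FMap L f g)"
definition "jw_equiv = mkfun C (\<lambda>f. f) jw_map"

lemma JW_simps [simp]: "VOb JW = VOb C" "VHom JW = jw_hom"
  by (simp_all add: JW_def)

lemma jw_equaliser: "a \<in> VOb C \<Longrightarrow> b \<in> VOb C \<Longrightarrow> is_equaliser (jw_hom a b) (jw_incl a b) (ju a b) (jv a b)"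
  unfolding jw_hom_def jw_incl_def the_jw_def
  by (rule someI[of "\<lambda>z. is_equaliser (fst z) (snd z) (ju a b) (jv a b)" "(VHom C a b, FMap L a b)"]) (simp add: L_equaliser)

text \<open>Both \<open>C(a,b)\<close> and the Joyal-Wiener hom are equalisers of the same pair of maps.\<close>

lemma jw_map:
  assumes o: "a \<in> VOb C" "b \<in> VOb C"
  shows "jw_map a b \<in> Ar V" "Dom V (jw_map a b) = VHom C a b" "Cod V (jw_map a b) = jw_hom a b"
    "jw_incl a b \<cdot> jw_map a b = FMap L a b" "iso (jw_map a b)"
proof -
  note E = equaliser_iso[OF jw_equaliser[OF o] L_equaliser[OF o]]
  have "jw_map a b \<in> hom (VHom C a b) (jw_hom a b) \<and> jw_incl a b \<cdot> jw_map a b = FMap L a b"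
    unfolding jw_map_def by (rule theI'[OF E(1)])
  then show "jw_map a b \<in> Ar V" "Dom V (jw_map a b) = VHom C a b" "Cod V (jw_map a b) = jw_hom a b"
    "jw_incl a b \<cdot> jw_map a b = FMap L a b" "iso (jw_map a b)"
    using E by (auto simp: hom_iff)
qed

lemma jw_incl:
  assumes o [simp]: "a \<in> VOb C" "b \<in> VOb C"
  shows "jw_incl a b \<in> Ar V" "Dom V (jw_incl a b) = jw_hom a b" "Cod V (jw_incl a b) = VHom D (Lo a) (Lo b)" "mono (jw_incl a b)"
    "jw_hom a b \<in> Ob V"
proof -
  show *: "jw_incl a b \<in> Ar V" "Dom V (jw_incl a b) = jw_hom a b" "Cod V (jw_incl a b) = VHom D (Lo a) (Lo b)" "mono (jw_incl a b)"
    using equaliser_facts(3)[OF jw_equaliser[OF o]] equaliser_mono[OF jw_equaliser[OF o]] by (simp_all add: hom_iff)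
  show "jw_hom a b \<in> Ob V" using ar_ob(1)[OF *(1)] *(2) by simp
qed

lemma jw_incl_T:
  assumes o [simp]: "a \<in> VOb C" "b \<in> VOb C"
  shows "jw_incl_T a b \<in> Ar V" "Dom V (jw_incl_T a b) = jw_hom a b" "Cod V (jw_incl_T a b) = VHom C a (RL b)" "mono (jw_incl_T a b)"
    "FMap KlC a b \<cdot> jw_incl_T a b = jw_incl a b" "jw_incl_T a b \<cdot> jw_map a b = FMap KlF a b"
proof -
  note [simp] = jw_incl jw_map KlC_iso(1)
  show t [simp]: "jw_incl_T a b \<in> Ar V" "Dom V (jw_incl_T a b) = jw_hom a b" "Cod V (jw_incl_T a b) = VHom C a (RL b)"
    by (simp_all add: jw_incl_T_def)
  show k: "FMap KlC a b \<cdot> jw_incl_T a b = jw_incl a b" by (simp add: jw_incl_T_def)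
  show "mono (jw_incl_T a b)"
  proof (rule monoI)
    fix c u v assume uv: "u \<in> hom c (Dom V (jw_incl_T a b))" "v \<in> hom c (Dom V (jw_incl_T a b))" and e: "jw_incl_T a b \<cdot> u = jw_incl_T a b \<cdot> v"
    then have [simp]: "u \<in> Ar V" "v \<in> Ar V" "Dom V u = c" "Dom V v = c" "Cod V u = jw_hom a b" "Cod V v = jw_hom a b" by (auto simp: hom_iff)
    have "jw_incl a b \<cdot> u = jw_incl a b \<cdot> v" using trail[OF k, of u] trail[OF k, of v] e by simp
    then show "u = v" by (rule mono_cancel[OF jw_incl(4)[OF o], rotated -1]) simp_all
  qed simp
  have "FMap KlC a b \<cdot> jw_incl_T a b \<cdot> jw_map a b = FMap KlC a b \<cdot> FMap KlF a b"
    using trail[OF k, of "jw_map a b"] by (simp add: KlC_KlF)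
  then show "jw_incl_T a b \<cdot> jw_map a b = FMap KlF a b"
    by (rule iso_cancelL[rotated -1]) simp_all
qed

text \<open>Identities and composition of the Kleisli category restrict to the Joyal-Wiener homs because,
  along the isomorphism \<open>jw_map\<close>, they are those of \<open>C\<close>.\<close>

lemma JW_id:
  assumes o [simp]: "a \<in> VOb C"
  shows "VId JW a \<in> hom \<I> (jw_hom a a)" "jw_incl_T a a \<cdot> VId JW a = VId Kl a" "VId JW a = jw_map a a \<cdot> VId C a"
proof -
  note [simp] = jw_incl jw_map(1-3,5) jw_incl_T
  have i: "jw_incl_T a a \<cdot> jw_map a a \<cdot> VId C a = VId Kl a"
  proof -
    have "postcomp C a a (RL a) (\<eta> a) \<cdot> VId C a = \<eta> a"
      by (rule el_ext[of un]) simp_all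
    then show ?thesis using trail[OF jw_incl_T(6)[OF o o], of "VId C a"] by simp
  qed
  have "VId JW a = (THE u. u \<in> hom \<I> (jw_hom a a) \<and> jw_incl_T a a \<cdot> u = VId Kl a)"
    by (simp add: JW_def)
  also have "\<dots> = jw_map a a \<cdot> VId C a"
  proof (rule the_equality)
    fix w assume w: "w \<in> hom \<I> (jw_hom a a) \<and> jw_incl_T a a \<cdot> w = VId Kl a"
    then have "jw_incl_T a a \<cdot> w = jw_incl_T a a \<cdot> jw_map a a \<cdot> VId C a" using i by simp
    then show "w = jw_map a a \<cdot> VId C a"
      by (rule mono_cancel[OF jw_incl_T(4)[OF o o], rotated -1]) (use w in \<open>simp_all add: hom_iff\<close>)
  qed (use i in \<open>simp add: hom_iff\<close>)
  finally have 1: "VId JW a = jw_map a a \<cdot> VId C a" .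
  show "VId JW a = jw_map a a \<cdot> VId C a" by (rule 1)
  show "VId JW a \<in> hom \<I> (jw_hom a a)" "jw_incl_T a a \<cdot> VId JW a = VId Kl a"
    unfolding 1 using i by (simp_all add: hom_iff)
qed

lemma JW_cmp:
  assumes o [simp]: "a \<in> VOb C" "b \<in> VOb C" "c \<in> VOb C"
  shows "VCmp JW a b c \<in> hom (jw_hom b c \<otimes> jw_hom a b) (jw_hom a c)" (is ?th1)
    "jw_incl_T a c \<cdot> VCmp JW a b c = VCmp Kl a b c \<cdot> (jw_incl_T b c ** jw_incl_T a b)" (is ?th2)
proof -
  note [simp] = jw_incl jw_map(1-3,5) jw_incl_T(1-3)
  let ?u = "jw_map a c \<cdot> VCmp C a b c \<cdot> (inv (jw_map b c) ** inv (jw_map a b))"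
  have F: "FMap KlF a c \<cdot> VCmp C a b c = VCmp Kl a b c \<cdot> (FMap KlF b c ** FMap KlF a b)"
    using KlF_vfun o unfolding vfunctor_def by (metis KlF_simps(1))
  have inv: "FMap KlF x y \<cdot> inv (jw_map x y) = jw_incl_T x y" if [simp]: "x \<in> VOb C" "y \<in> VOb C" for x y
    unfolding jw_incl_T(6)[OF that, symmetric] by simp
  have [simp]: "FMap KlF x y \<in> Ar V" "Dom V (FMap KlF x y) = VHom C x y" "Cod V (FMap KlF x y) = VHom C x (RL y)"
    if [simp]: "x \<in> VOb C" "y \<in> VOb C" for x y by simp_all
  note KlF_simps(2) [simp del]
  have "jw_incl_T a c \<cdot> ?u = (FMap KlF a c \<cdot> VCmp C a b c) \<cdot> (inv (jw_map b c) ** inv (jw_map a b))"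
    using trail[OF jw_incl_T(6)[of a c], of "VCmp C a b c \<cdot> (inv (jw_map b c) ** inv (jw_map a b))"] by simp
  also have "\<dots> = VCmp Kl a b c \<cdot> (jw_incl_T b c ** jw_incl_T a b)"
    unfolding F by (simp add: ten_comp inv)
  finally have i: "jw_incl_T a c \<cdot> ?u = VCmp Kl a b c \<cdot> (jw_incl_T b c ** jw_incl_T a b)" .
  have "VCmp JW a b c = (THE u. u \<in> hom (jw_hom b c \<otimes> jw_hom a b) (jw_hom a c) \<and>
                jw_incl_T a c \<cdot> u = VCmp Kl a b c \<cdot> (jw_incl_T b c ** jw_incl_T a b))"
    by (simp add: JW_def)
  also have "\<dots> = ?u"
  proof (rule the_equality)
    fix w assume w: "w \<in> hom (jw_hom b c \<otimes> jw_hom a b) (jw_hom a c) \<and>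
                jw_incl_T a c \<cdot> w = VCmp Kl a b c \<cdot> (jw_incl_T b c ** jw_incl_T a b)"
    then have "jw_incl_T a c \<cdot> w = jw_incl_T a c \<cdot> ?u" using i by simp
    then show "w = ?u" by (rule mono_cancel[OF jw_incl_T(4)[OF o(1,3)], rotated -1]) (use w in \<open>simp_all add: hom_iff\<close>)
  qed (use i in \<open>simp add: hom_iff\<close>)
  finally have 1: "VCmp JW a b c = ?u" .
  show ?th1
    ?th2
    unfolding 1 using i by (simp_all add: hom_iff)
qed

theorem JW_sub: "vcategory JW" "faithful JW Kl jw_sub"
proof -
  have J: "jw_incl_T a b \<in> hom (VHom JW a b) (VHom Kl a b) \<and> mono (jw_incl_T a b)"
    if "a \<in> VOb JW" "b \<in> VOb JW" for a b
    using that jw_incl_T[of a b] by (simp add: hom_iff)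
  have i: "VId JW a \<in> hom \<I> (VHom JW a a) \<and> jw_incl_T a a \<cdot> VId JW a = VId Kl a" if "a \<in> VOb JW" for a
    using that JW_id(1,2)[of a] by simp
  have m: "VCmp JW a b c \<in> hom (VHom JW b c \<otimes> VHom JW a b) (VHom JW a c) \<and>
       jw_incl_T a c \<cdot> VCmp JW a b c = VCmp Kl a b c \<cdot> (jw_incl_T b c ** jw_incl_T a b)"
    if "a \<in> VOb JW" "b \<in> VOb JW" "c \<in> VOb JW" for a b c
    using that JW_cmp[of a b c] by simp
  have o: "\<And>a. a \<in> VOb JW \<Longrightarrow> a \<in> VOb Kl" by simp
  show "vcategory JW" by (rule sub_vcategory(1)[OF Kl_sub(1) o J i m])
  show "faithful JW Kl jw_sub" unfolding jw_sub_def by (rule sub_vcategory(2)[OF Kl_sub(1) o J i m])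
qed

theorem JW_emb: "faithful JW D jw_emb"
  unfolding jw_emb_def
proof (rule sub_vcategory(2)[where J = jw_incl])
  note [simp] = jw_incl jw_map(1-3,5) jw_incl_T(1-3)
  have KF: "FMap KlC x x \<cdot> VId Kl x = VId D (Lo x)" if "x \<in> VOb C" for x
    using KlC_vfun that unfolding vfunctor_def by (metis KlC_ob Kl_simps(1))
  have KM: "FMap KlC x z \<cdot> VCmp Kl x y z = VCmp D (Lo x) (Lo y) (Lo z) \<cdot> (FMap KlC y z ** FMap KlC x y)"
    if "x \<in> VOb C" "y \<in> VOb C" "z \<in> VOb C" for x y z
    using KlC_vfun that unfolding vfunctor_def by (metis KlC_ob Kl_simps(1))
  fix a assume "a \<in> VOb JW"
  then have [simp]: "a \<in> VOb C" by simp
  note i = JW_id(1)[of a, unfolded hom_iff, simplified]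
  show "VId JW a \<in> hom \<I> (VHom JW a a) \<and> jw_incl a a \<cdot> VId JW a = VId D (Lo a)"
    using trail[OF jw_incl_T(5)[of a a], of "VId JW a"] JW_id(1,2)[of a] i KF[of a] by simp
  fix b c assume "b \<in> VOb JW" "c \<in> VOb JW"
  then have [simp]: "b \<in> VOb C" "c \<in> VOb C" by simp_all
  note m = JW_cmp(1)[of a b c, unfolded hom_iff, simplified]
  have "jw_incl a c \<cdot> VCmp JW a b c = FMap KlC a c \<cdot> jw_incl_T a c \<cdot> VCmp JW a b c"
    using trail[OF jw_incl_T(5)[of a c], of "VCmp JW a b c"] m by simp
  also have "\<dots> = (FMap KlC a c \<cdot> VCmp Kl a b c) \<cdot> (jw_incl_T b c ** jw_incl_T a b)"
    by (simp add: JW_cmp)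
  also have "\<dots> = VCmp D (Lo a) (Lo b) (Lo c) \<cdot> (jw_incl b c ** jw_incl a b)"
    unfolding KM[OF \<open>a \<in> VOb C\<close> \<open>b \<in> VOb C\<close> \<open>c \<in> VOb C\<close>] by (simp add: ten_comp jw_incl_T(5))
  finally show "VCmp JW a b c \<in> hom (VHom JW b c \<otimes> VHom JW a b) (VHom JW a c) \<and>
       jw_incl a c \<cdot> VCmp JW a b c = VCmp D (Lo a) (Lo b) (Lo c) \<cdot> (jw_incl b c ** jw_incl a b)"
    using JW_cmp(1)[of a b c] by simp
  show "jw_incl a b \<in> hom (VHom JW a b) (VHom D (Lo a) (Lo b)) \<and> mono (jw_incl a b)" by (simp add: hom_iff)
qed simp_all

lemma jw_equiv_vfun: "vfunctor C JW jw_equiv"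
  unfolding jw_equiv_def
proof (rule vfunctorI)
  note [simp] = jw_incl jw_map(1-3,5) jw_incl_T(1-3)
  have J [simp]: "vcategory JW" by (rule JW_sub)
  then show "vcategory JW" .
  have E: "vfunctor JW D jw_emb" using JW_emb by (simp add: faithful_def)
  fix a assume [simp]: "a \<in> VOb C"
  show "jw_map a a $ VId C a $ un = VId JW a $ un" by (simp add: JW_id(3))
  fix b c assume [simp]: "b \<in> VOb C" "c \<in> VOb C"
  have iw: "jw_incl x y $ jw_map x y $ n = FMap L x y $ n" if [simp]: "x \<in> VOb C" "y \<in> VOb C" "good n" "ty n = VHom C x y" for x y n
    using arg_cong[OF jw_map(4)[OF that(1,2)], of "\<lambda>f. f $ n"] by simp
  have em [simp]: "FOb jw_emb x = Lo x" "y \<in> VOb C \<Longrightarrow> FMap jw_emb x y = jw_incl x y" if "x \<in> VOb C" for x y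
    using that by (simp_all add: jw_emb_def)
  note [simp] = JW_cmp(1)[of a b c, unfolded hom_iff, simplified]
  have vc: "jw_incl a c $ VCmp JW a b c $ \<langle>jw_map b c $ var 0 (VHom C b c), jw_map a b $ var 1 (VHom C a b)\<rangle>
    = VCmp D (Lo a) (Lo b) (Lo c) $ \<langle>jw_incl b c $ jw_map b c $ var 0 (VHom C b c), jw_incl a b $ jw_map a b $ var 1 (VHom C a b)\<rangle>"
    using vfun_cmp[OF E, of a b c "jw_map b c $ var 0 (VHom C b c)" "jw_map a b $ var 1 (VHom C a b)"] by simp
  show "jw_map a c $ VCmp C a b c $ \<langle>var 0 (VHom C b c), var 1 (VHom C a b)\<rangle> =
       VCmp JW a b c $ \<langle>jw_map b c $ var 0 (VHom C b c), jw_map a b $ var 1 (VHom C a b)\<rangle>"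
    by (rule mono_el[OF jw_incl(4)[of a c]]) (simp_all add: vc iw)
qed (simp_all add: hom_iff jw_map)

theorem JW_equivalence: "vequivalence C JW jw_equiv"
  using jw_equiv_vfun unfolding jw_equiv_def
  by (rule vequivalence_idI) (simp_all add: jw_map)

theorem JW_emb_conservative: "conservative JW D jw_emb"
  unfolding conservative_def
proof (intro conjI ballI allI impI)
  note [simp] = jw_incl jw_map(1-3,5)
  show "vfunctor JW D jw_emb" using JW_emb by (simp add: faithful_def)
  fix a b f assume "a \<in> VOb JW" "b \<in> VOb JW" and f: "f \<in> hom \<I> (VHom JW a b)"
    and u: "uiso D (FOb jw_emb a) (FOb jw_emb b) (FMap jw_emb a b \<cdot> f)"
  then have [simp]: "a \<in> VOb C" "b \<in> VOb C" by simp_all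
  have [simp]: "f \<in> Ar V" "Dom V f = \<I>" "Cod V f = jw_hom a b" using f by (auto simp: hom_iff)
  let ?g = "inv (jw_map a b) \<cdot> f"
  have "FMap L a b \<cdot> ?g = jw_incl a b \<cdot> f"
    using trail[OF jw_map(4)[of a b], of ?g] by simp
  then have "uiso D (Lo a) (Lo b) (FMap L a b \<cdot> ?g)" using u by (simp add: jw_emb_def)
  then have "uiso C a b ?g" by (rule L_reflects_iso[rotated -1]) (simp_all add: hom_iff)
  from uiso_vfun[OF jw_equiv_vfun this] show "uiso JW a b f" by (simp add: jw_equiv_def)
qed

end

context symmetric_monoidal_closed
begin

section \<open>The Kan adjunction of a kernel\<close>

lemma vtens_id:
  assumes "vcategory A" "vcategory B" "a \<in> VOb A" "b \<in> VOb B"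
  shows "VId (vtens A B) (a, b) $ un = \<langle>VId A a $ un, VId B b $ un\<rangle>"
  using assms by (simp add: vtens_def)

lemma vtens_cmp:
  assumes "vcategory A" "vcategory B" "a \<in> VOb A" "b \<in> VOb B" "a' \<in> VOb A" "b' \<in> VOb B" "a'' \<in> VOb A" "b'' \<in> VOb B"
    "els [(p, VHom A a a'), (q, VHom B b b'), (p', VHom A a' a''), (q', VHom B b' b'')]"
  shows "VCmp (vtens A B) (a, b) (a', b') (a'', b'') $ \<langle>\<langle>p', q'\<rangle>, \<langle>p, q\<rangle>\<rangle>
    = \<langle>VCmp A a a' a'' $ \<langle>p', p\<rangle>, VCmp B b b' b'' $ \<langle>q', q\<rangle>\<rangle>"
  using assms by (simp add: vtens_def)

lemma vtens_fun_cmp: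
  assumes T: "vfunctor (vtens A B) D T" and A [simp]: "vcategory A" and B [simp]: "vcategory B"
    and [simp]: "a \<in> VOb A" "b \<in> VOb B" "a' \<in> VOb A" "b' \<in> VOb B" "a'' \<in> VOb A" "b'' \<in> VOb B"
    and e [simplified, simp]: "els [(p, VHom A a a'), (q, VHom B b b'), (p', VHom A a' a''), (q', VHom B b' b'')]"
  shows "VCmp D (FOb T (a, b)) (FOb T (a', b')) (FOb T (a'', b''))
      $ \<langle>FMap T (a', b') (a'', b'') $ \<langle>p', q'\<rangle>, FMap T (a, b) (a', b') $ \<langle>p, q\<rangle>\<rangle>
    = FMap T (a, b) (a'', b'') $ \<langle>VCmp A a a' a'' $ \<langle>p', p\<rangle>, VCmp B b b' b'' $ \<langle>q', q\<rangle>\<rangle>"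
proof -
  have "VCmp D (FOb T (a, b)) (FOb T (a', b')) (FOb T (a'', b''))
      $ \<langle>FMap T (a', b') (a'', b'') $ \<langle>p', q'\<rangle>, FMap T (a, b) (a', b') $ \<langle>p, q\<rangle>\<rangle>
    = FMap T (a, b) (a'', b'') $ VCmp (vtens A B) (a, b) (a', b') (a'', b'') $ \<langle>\<langle>p', q'\<rangle>, \<langle>p, q\<rangle>\<rangle>"
    by (subst vfun_cmp[OF T, symmetric]) simp_all
  also have "VCmp (vtens A B) (a, b) (a', b') (a'', b'') $ \<langle>\<langle>p', q'\<rangle>, \<langle>p, q\<rangle>\<rangle>
    = \<langle>VCmp A a a' a'' $ \<langle>p', p\<rangle>, VCmp B b b' b'' $ \<langle>q', q\<rangle>\<rangle>"
    by (rule vtens_cmp) simp_all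
  finally show ?thesis .
qed

lemma vfunctor_partR:
  assumes T: "vfunctor (vtens A B) D T" and [simp]: "vcategory A" "vcategory B" "a \<in> VOb A"
  shows "vfunctor B D (partR A B T a)"
  unfolding partR_def
proof (rule vfunctorI)
  note [simp] = vfun_ar[OF T]
  fix b assume [simp]: "b \<in> VOb B"
  have "FMap T (a, b) (a, b) $ \<langle>VId A a $ un, VId B b $ un\<rangle> = VId D (FOb T (a, b)) $ un"
    using vfun_id[OF T, of "(a, b)"] by (simp add: vtens_id)
  then show "FMap T (a, b) (a, b) \<cdot> (VId A a ** idn (VHom B b b)) \<cdot> inv (lun (VHom B b b)) $ VId B b $ un = VId D (FOb T (a, b)) $ un"
    by simp
  fix b' b'' assume [simp]: "b' \<in> VOb B" "b'' \<in> VOb B"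
  show "FMap T (a, b) (a, b'') \<cdot> (VId A a ** idn (VHom B b b'')) \<cdot> inv (lun (VHom B b b'')) $ VCmp B b b' b'' $ \<langle>var 0 (VHom B b' b''), var 1 (VHom B b b')\<rangle>
    = VCmp D (FOb T (a, b)) (FOb T (a, b')) (FOb T (a, b'')) $ \<langle>FMap T (a, b') (a, b'') \<cdot> (VId A a ** idn (VHom B b' b'')) \<cdot> inv (lun (VHom B b' b'')) $ var 0 (VHom B b' b''),
       FMap T (a, b) (a, b') \<cdot> (VId A a ** idn (VHom B b b')) \<cdot> inv (lun (VHom B b b')) $ var 1 (VHom B b b')\<rangle>"
    by (simp add: vtens_fun_cmp[OF T])
qed (simp_all add: vfun_ar[OF T] hom_iff)

lemma vfunctor_partL:
  assumes T: "vfunctor (vtens A B) D T" and [simp]: "vcategory A" "vcategory B" "b \<in> VOb B"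
  shows "vfunctor A D (partL A B T b)"
  unfolding partL_def
proof (rule vfunctorI)
  note [simp] = vfun_ar[OF T]
  fix a assume [simp]: "a \<in> VOb A"
  have "FMap T (a, b) (a, b) $ \<langle>VId A a $ un, VId B b $ un\<rangle> = VId D (FOb T (a, b)) $ un"
    using vfun_id[OF T, of "(a, b)"] by (simp add: vtens_id)
  then show "FMap T (a, b) (a, b) \<cdot> (idn (VHom A a a) ** VId B b) \<cdot> inv (run (VHom A a a)) $ VId A a $ un = VId D (FOb T (a, b)) $ un"
    by simp
  fix a' a'' assume [simp]: "a' \<in> VOb A" "a'' \<in> VOb A"
  show "FMap T (a, b) (a'', b) \<cdot> (idn (VHom A a a'') ** VId B b) \<cdot> inv (run (VHom A a a'')) $ VCmp A a a' a'' $ \<langle>var 0 (VHom A a' a''), var 1 (VHom A a a')\<rangle>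
    = VCmp D (FOb T (a, b)) (FOb T (a', b)) (FOb T (a'', b)) $ \<langle>FMap T (a', b) (a'', b) \<cdot> (idn (VHom A a' a'') ** VId B b) \<cdot> inv (run (VHom A a' a'')) $ var 0 (VHom A a' a''),
       FMap T (a, b) (a', b) \<cdot> (idn (VHom A a a') ** VId B b) \<cdot> inv (run (VHom A a a')) $ var 1 (VHom A a a')\<rangle>"
    by (simp add: vtens_fun_cmp[OF T])
qed (simp_all add: vfun_ar[OF T] hom_iff)

text \<open>The arrow \<open>T(p,q)\<close> factors through its two partial functors in either order; with
  \<open>T = K\<close> this is the interchange law below.\<close>

lemma partL_partR:
  assumes T: "vfunctor (vtens A B) D T" and [simp]: "vcategory A" "vcategory B"
    and [simp]: "a \<in> VOb A" "a' \<in> VOb A" "b \<in> VOb B" "b' \<in> VOb B" and e [simplified, simp]: "els [(p, VHom A a a'), (q, VHom B b b')]"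
  shows "VCmp D (FOb T (a, b)) (FOb T (a', b)) (FOb T (a', b')) $ \<langle>FMap (partR A B T a') b b' $ q, FMap (partL A B T b) a a' $ p\<rangle>
    = FMap T (a, b) (a', b') $ \<langle>p, q\<rangle>" (is ?th1)
    "VCmp D (FOb T (a, b)) (FOb T (a, b')) (FOb T (a', b')) $ \<langle>FMap (partL A B T b') a a' $ p, FMap (partR A B T a) b b' $ q\<rangle>
    = FMap T (a, b) (a', b') $ \<langle>p, q\<rangle>" (is ?th2)
proof -
  note [simp] = vfun_ar[OF T] partR_ar partL_ar
  show ?th1
    ?th2
    by (simp_all add: vtens_fun_cmp[OF T])
qed

end

locale kernel = complete_star V S + kernel_data V A X K
  for V :: "('o, 'm) smc" and S :: "'s itself" and A X :: "('s, 'o, 'm) vcat" and K :: "('s \<times> 's, 'o, 'm) vfun" +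
  assumes A [simp]: "vcategory A" and X [simp]: "vcategory X" and K: "vfunctor (vtens (vop A) X) vself K"
begin

lemma Kl_vfun: "x \<in> VOb X \<Longrightarrow> vfunctor (vop A) vself (Kl x)"
  unfolding Kl_def by (rule vfunctor_partL[OF K]) simp_all

lemma Kr_vfun [simp]: "a \<in> VOb A \<Longrightarrow> vfunctor X vself (Kr a)"
  unfolding Kr_def by (rule vfunctor_partR[OF K]) simp_all

lemma K_ob [simp]: "a \<in> VOb A \<Longrightarrow> x \<in> VOb X \<Longrightarrow> FOb K (a, x) \<in> Ob V"
  using vfun_ar(1)[OF K, of "(a, x)"] by simp

lemma Klr_ob [simp]:
  "a \<in> VOb A \<Longrightarrow> FOb (Kl x) a = FOb K (a, x)" "x \<in> VOb X \<Longrightarrow> FOb (Kr a) x = FOb K (a, x)"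
  by (simp_all add: Kl_def Kr_def)

text \<open>The left action of \<open>A\<close> and the right action of \<open>X\<close> on \<open>K\<close>.\<close>

abbreviation (input) lact where
  "lact x b a p k \<equiv> ev (FOb K (b, x)) (FOb K (a, x)) $ \<langle>FMap (Kl x) b a $ p, k\<rangle>"

abbreviation (input) ract where
  "ract a x y q k \<equiv> ev (FOb K (a, x)) (FOb K (a, y)) $ \<langle>FMap (Kr a) x y $ q, k\<rangle>"

lemma Kl_ar [simp]:
  assumes "x \<in> VOb X" "a \<in> VOb A" "b \<in> VOb A"
  shows "FMap (Kl x) b a \<in> Ar V" "Dom V (FMap (Kl x) b a) = VHom A a b" "Cod V (FMap (Kl x) b a) = (FOb K (b, x) \<multimap> FOb K (a, x))"
  using vfun_ar(2-4)[OF Kl_vfun[OF assms(1)], of b a] assms by simp_all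

lemma Kl_id [simp]:
  assumes "x \<in> VOb X" "a \<in> VOb A"
  shows "FMap (Kl x) a a $ VId A a $ un = VId vself (FOb K (a, x)) $ un"
  using vfun_id[OF Kl_vfun[OF assms(1)], of a] assms by simp

lemma Kl_cmp [simp]:
  assumes "x \<in> VOb X" "a \<in> VOb A" "b \<in> VOb A" "c \<in> VOb A" "els [(g, VHom A b c), (f, VHom A a b)]"
  shows "FMap (Kl x) c a $ VCmp A a b c $ \<langle>g, f\<rangle>
    = VCmp vself (FOb K (c, x)) (FOb K (b, x)) (FOb K (a, x)) $ \<langle>FMap (Kl x) b a $ f, FMap (Kl x) c b $ g\<rangle>"
  using vfun_cmp[OF Kl_vfun[OF assms(1)], of c b a f g] assms by simp

lemma interchange:
  assumes [simp]: "a \<in> VOb A" "b \<in> VOb A" "x \<in> VOb X" "y \<in> VOb X" and e [simplified, simp]: "els [(p, VHom A a b), (q, VHom X x y), (k, FOb K (b, x))]"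
  shows "ract a x y q (lact x b a p k)
   = lact y b a p (ract b x y q k)"
proof -
  note [simp] = vfun_ar[OF Kr_vfun]
  have "ev (FOb K (b, x)) (FOb K (a, y)) $ \<langle>VCmp vself (FOb K (b, x)) (FOb K (a, x)) (FOb K (a, y)) $
       \<langle>FMap (Kr a) x y $ q, FMap (Kl x) b a $ p\<rangle>, k\<rangle>
    = ev (FOb K (b, x)) (FOb K (a, y)) $ \<langle>VCmp vself (FOb K (b, x)) (FOb K (b, y)) (FOb K (a, y)) $
       \<langle>FMap (Kl y) b a $ p, FMap (Kr b) x y $ q\<rangle>, k\<rangle>"
    unfolding Kl_def Kr_def by (subst partL_partR(1)[OF K], simp_all, subst partL_partR(2)[OF K], simp_all)
  then show ?thesis by simp
qed

lemma fun_ob [simp]: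
  "vfunctor A vself F \<Longrightarrow> a \<in> VOb A \<Longrightarrow> FOb F a \<in> Ob V" "vfunctor X vself G \<Longrightarrow> a \<in> VOb X \<Longrightarrow> FOb G a \<in> Ob V"
  using vfun_ar(1)[of A vself F] vfun_ar(1)[of X vself G] by simp_all

lemma nhom_ob' [simp]:
  "vfunctor A vself F \<Longrightarrow> vfunctor A vself G \<Longrightarrow> nhom A F G \<in> Ob V"
  "vfunctor X vself F \<Longrightarrow> vfunctor X vself G \<Longrightarrow> nhom X F G \<in> Ob V"
  by (rule nhom_ob; assumption)+

lemmas nproj_ar' [simp] = nproj_ar[of A] nproj_ar[of X]
lemmas fun_ar [simp] = vfun_ar(2-4)[of A vself, simplified] vfun_ar(2-4)[of X vself, simplified]
  vfun_id[of A vself, simplified] vfun_id[of X vself, simplified] vfun_cmp[of A vself, simplified] vfun_cmp[of X vself, simplified]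
lemmas nat_lr' [simp] = nat_lr[of A] nat_lr[of X]
declare vcategory_fcat [simp]

lemmas fcat_app [simp] = fcat_id_app[of A] fcat_id_app[of X] fcat_cmp_app[of A] fcat_cmp_app[of X]

text \<open>The coend \<open>\<integral>\<^sup>a K(a,x) \<otimes> f a\<close> and its coprojections.\<close>

abbreviation B where "B f x \<equiv> coend A (contraten A (Kl x) f)"
abbreviation io where "io f x a \<equiv> coproj A (contraten A (Kl x) f) a"

lemma B_ar [simp]:
  assumes "vfunctor A vself f" "x \<in> VOb X"
  shows "B f x \<in> Ob V" "a \<in> VOb A \<Longrightarrow> io f x a \<in> Ar V" "a \<in> VOb A \<Longrightarrow> Dom V (io f x a) = FOb K (a, x) \<otimes> FOb f a"
    "a \<in> VOb A \<Longrightarrow> Cod V (io f x a) = B f x"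
  using ct_ob[OF Kl_vfun assms(1)] coproj_ar[OF Kl_vfun assms(1)] assms by simp_all

lemma io_dinat:
  assumes "vfunctor A vself f" "x \<in> VOb X" "a \<in> VOb A" "b \<in> VOb A" "els [(h, VHom A a b), (k, FOb K (b, x)), (t, FOb f a)]"
  shows "io f x b $ \<langle>k, push f a b h t\<rangle>
     = io f x a $ \<langle>lact x b a h k, t\<rangle>"
  using coproj_dinat[OF Kl_vfun assms(1), of x a b h k t] assms by simp

lemma B_ext:
  assumes "vfunctor A vself f" "x \<in> VOb X" "u \<in> Ar V" "v \<in> Ar V" "Dom V u = ty e \<otimes> B f x" "Dom V v = ty e \<otimes> B f x"
    "Cod V u = Cod V v" "full e" "i \<notin> names e" "j \<notin> names e" "i \<noteq> j"
    "\<And>a. a \<in> VOb A \<Longrightarrow> u $ \<langle>e, io f x a $ \<langle>var i (FOb K (a, x)), var j (FOb f a)\<rangle>\<rangle>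
       = v $ \<langle>e, io f x a $ \<langle>var i (FOb K (a, x)), var j (FOb f a)\<rangle>\<rangle>"
  shows "u = v"
  by (rule coend_ext[OF Kl_vfun assms(1), of x u v "ty e" e i j]) (use assms in simp_all)

subsection \<open>The functor \<open>Kbar\<close>\<close>

text \<open>The action \<open>X(x,y) \<otimes> B f x \<rightarrow> B f y\<close>.\<close>

abbreviation "bact f x y \<equiv> coend_act A (VHom X x y) (contraten A (Kl x) f) (contraten A (Kl y) f)
  (\<lambda>a. whL (VHom X x y) (FOb (Kl x) a) (FOb f a) (act X (Kr a) x y))"

lemma bact [simp]:
  assumes f [simp]: "vfunctor A vself f" and [simp]: "x \<in> VOb X" "y \<in> VOb X"
  shows "bact f x y \<in> Ar V" "Dom V (bact f x y) = VHom X x y \<otimes> B f x" "Cod V (bact f x y) = B f y"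
    "a \<in> VOb A \<Longrightarrow> els [(q, VHom X x y), (k, FOb K (a, x)), (t, FOb f a)] \<Longrightarrow>
       bact f x y $ \<langle>q, io f x a $ \<langle>k, t\<rangle>\<rangle> = io f y a $ \<langle>ract a x y q k, t\<rangle>" (is "PROP ?th1")
proof -
  let ?t = "\<lambda>a. whL (VHom X x y) (FOb K (a, x)) (FOb f a) (act X (Kr a) x y)"
  have t [simp]: "?t a \<in> Ar V" "Dom V (?t a) = VHom X x y \<otimes> (FOb K (a, x) \<otimes> FOb f a)" "Cod V (?t a) = FOb K (a, y) \<otimes> FOb f a"
    if [simp]: "a \<in> VOb A" for a by (simp_all add: whL_def act_def)
  have ta: "?t a $ \<langle>q, \<langle>k, t\<rangle>\<rangle> = \<langle>ract a x y q k, t\<rangle>"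
    if "a \<in> VOb A" "els [(q, VHom X x y), (k, FOb K (a, x)), (t, FOb f a)]"
    for a q k t using that by (simp add: whL_def act_def)
  have d: "io f y b $ ?t b $ \<langle>var 0 (VHom X x y), \<langle>var 1 (FOb K (b, x)), push f a b (var 2 (VHom A a b)) (var 3 (FOb f a))\<rangle>\<rangle>
      = io f y a $ ?t a $ \<langle>var 0 (VHom X x y), \<langle>lact x b a (var 2 (VHom A a b)) (var 1 (FOb K (b, x))), var 3 (FOb f a)\<rangle>\<rangle>"
    if [simp]: "a \<in> VOb A" "b \<in> VOb A" for a b
    by (simp add: ta io_dinat interchange)
  show [simp]: "bact f x y \<in> Ar V" "Dom V (bact f x y) = VHom X x y \<otimes> B f x" "Cod V (bact f x y) = B f y"
    by (rule coend_act[OF Kl_vfun f Kl_vfun f]; simp add: hom_iff d)+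
  show "PROP ?th1"
    by (subst coend_act(4)[OF Kl_vfun f Kl_vfun f]) (simp_all add: hom_iff ta io_dinat interchange)
qed

lemma Kbar_ob_eq: "Kbar_ob f = mkfun X (B f) (\<lambda>x y. curry (VHom X x y) (B f x) (B f y) (bact f x y))"
  by (simp add: Kbar_ob_def par1_def coend_fun_def)

lemma Kbar_ob_vfun [simp]:
  assumes f [simp]: "vfunctor A vself f"
  shows "vfunctor X vself (Kbar_ob f)"
  unfolding Kbar_ob_eq
proof (rule vfunctor_actionI)
  fix x assume [simp]: "x \<in> VOb X"
  show "bact f x x \<cdot> (VId X x ** idn (B f x)) = lun (B f x)"
    by (rule B_ext[of f x _ _ un 0 1]) simp_all
  fix y z assume [simp]: "y \<in> VOb X" "z \<in> VOb X"
  show "bact f x z \<cdot> (VCmp X x y z ** idn (B f x)) = bact f y z \<cdot> (idn (VHom X y z) ** bact f x y) \<cdot> asc (VHom X y z) (VHom X x y) (B f x)"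
    by (rule B_ext[of f x _ _ "\<langle>var 0 (VHom X y z), var 1 (VHom X x y)\<rangle>" 2 3]) simp_all
qed (simp_all add: hom_iff)

lemma Kbar_ob_simps [simp]:
  assumes f [simp]: "vfunctor A vself f" and [simp]: "x \<in> VOb X"
  shows "FOb (Kbar_ob f) x = B f x"
    "y \<in> VOb X \<Longrightarrow> a \<in> VOb A \<Longrightarrow> els [(q, VHom X x y), (k, FOb K (a, x)), (t, FOb f a)] \<Longrightarrow>
       ev (B f x) (B f y) $ \<langle>FMap (Kbar_ob f) x y $ q, io f x a $ \<langle>k, t\<rangle>\<rangle> = io f y a $ \<langle>ract a x y q k, t\<rangle>"
  by (simp_all add: Kbar_ob_eq)

text \<open>Elements of \<open>[X,\<V>](Kbar f, g)\<close> are compared on the components at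
  \<open>x\<close> and there on the coprojections of the coend.\<close>

lemma bar_ext:
  assumes f [simp]: "vfunctor A vself f" and g [simp]: "vfunctor X vself g"
    and [simp]: "u \<in> Ar V" "v \<in> Ar V" "Dom V u = ty e" "Dom V v = ty e" "Cod V u = nhom X (Kbar_ob f) g" "Cod V v = nhom X (Kbar_ob f) g"
    "full e" "i \<notin> names e" "j \<notin> names e" "i \<noteq> j"
    and eq: "\<And>a x. a \<in> VOb A \<Longrightarrow> x \<in> VOb X \<Longrightarrow>
       ev (B f x) (FOb g x) $ \<langle>nproj X (Kbar_ob f) g x $ u $ e, io f x a $ \<langle>var i (FOb K (a, x)), var j (FOb f a)\<rangle>\<rangle>
       = ev (B f x) (FOb g x) $ \<langle>nproj X (Kbar_ob f) g x $ v $ e, io f x a $ \<langle>var i (FOb K (a, x)), var j (FOb f a)\<rangle>\<rangle>"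
  shows "u = v"
proof (rule nhom_ext[OF Kbar_ob_vfun[OF f] g, of _ "ty e"])
  fix x assume [simp]: "x \<in> VOb X"
  have [simp]: "ty e \<in> Ob V" by simp
  have [simp]: "j \<noteq> i" by (rule not_sym) fact
  show "nproj X (Kbar_ob f) g x \<cdot> u = nproj X (Kbar_ob f) g x \<cdot> v"
  proof (rule curry_unique[of _ "ty e" "B f x" "FOb g x"])
    show "ev (B f x) (FOb g x) \<cdot> ((nproj X (Kbar_ob f) g x \<cdot> u) ** idn (B f x)) = ev (B f x) (FOb g x) \<cdot> ((nproj X (Kbar_ob f) g x \<cdot> v) ** idn (B f x))"
      by (rule B_ext[of f x _ _ e i j]) (simp_all add: eq)
  qed simp_all
qed (simp_all add: hom_iff)

text \<open>The action \<open>[A,\<V>](f,g) \<otimes> B f x \<rightarrow> B g x\<close>.\<close>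

abbreviation "bmap f g x \<equiv> coend_act A (nhom A f g) (contraten A (Kl x) f) (contraten A (Kl x) g)
                 (\<lambda>a. whR (nhom A f g) (FOb K (a, x)) (FOb f a)
                        (ev (FOb f a) (FOb g a) \<cdot> (nproj A f g a ** idn (FOb f a))))"

lemma bmap [simp]:
  assumes f [simp]: "vfunctor A vself f" and g [simp]: "vfunctor A vself g" and [simp]: "x \<in> VOb X"
  shows "bmap f g x \<in> Ar V" "Dom V (bmap f g x) = nhom A f g \<otimes> B f x" "Cod V (bmap f g x) = B g x"
    "a \<in> VOb A \<Longrightarrow> els [(n, nhom A f g), (k, FOb K (a, x)), (t, FOb f a)] \<Longrightarrow>
       bmap f g x $ \<langle>n, io f x a $ \<langle>k, t\<rangle>\<rangle> = io g x a $ \<langle>k, nat_at A f g a n t\<rangle>" (is "PROP ?th1")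
proof -
  let ?t = "\<lambda>a. whR (nhom A f g) (FOb K (a, x)) (FOb f a) (ev (FOb f a) (FOb g a) \<cdot> (nproj A f g a ** idn (FOb f a)))"
  have t [simp]: "?t a \<in> Ar V" "Dom V (?t a) = nhom A f g \<otimes> (FOb K (a, x) \<otimes> FOb f a)" "Cod V (?t a) = FOb K (a, x) \<otimes> FOb g a"
    if [simp]: "a \<in> VOb A" for a by (simp_all add: whR_def)
  have ta: "?t a $ \<langle>n, \<langle>k, t\<rangle>\<rangle> = \<langle>k, nat_at A f g a n t\<rangle>"
    if "a \<in> VOb A" "els [(n, nhom A f g), (k, FOb K (a, x)), (t, FOb f a)]"
    for a n k t using that by (simp add: whR_def)
  have d: "io g x b $ ?t b $ \<langle>var 0 (nhom A f g), \<langle>var 1 (FOb K (b, x)), push f a b (var 2 (VHom A a b)) (var 3 (FOb f a))\<rangle>\<rangle>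
      = io g x a $ ?t a $ \<langle>var 0 (nhom A f g), \<langle>lact x b a (var 2 (VHom A a b)) (var 1 (FOb K (b, x))), var 3 (FOb f a)\<rangle>\<rangle>"
    if [simp]: "a \<in> VOb A" "b \<in> VOb A" for a b
    by (simp add: ta io_dinat nproj_nat[OF f g, symmetric])
  show [simp]: "bmap f g x \<in> Ar V" "Dom V (bmap f g x) = nhom A f g \<otimes> B f x" "Cod V (bmap f g x) = B g x"
    by (rule coend_act[OF Kl_vfun f Kl_vfun g]; simp add: hom_iff d)+
  show "PROP ?th1"
    by (subst coend_act(4)[OF Kl_vfun f Kl_vfun g]) (simp_all add: hom_iff ta io_dinat nproj_nat[OF f g, symmetric])
qed

lemma Kbar_map_ex:
  assumes f [simp]: "vfunctor A vself f" and g [simp]: "vfunctor A vself g"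
  shows "Kbar_map f g \<in> hom (nhom A f g) (nhom X (Kbar_ob f) (Kbar_ob g))" (is ?th1)
    "x \<in> VOb X \<Longrightarrow> nproj X (Kbar_ob f) (Kbar_ob g) x \<cdot> Kbar_map f g = curry (nhom A f g) (B f x) (B g x) (bmap f g x)"
proof -
  let ?X = "\<lambda>x. curry (nhom A f g) (B f x) (B g x) (bmap f g x)"
  have "\<exists>!u. u \<in> hom (nhom A f g) (nhom X (Kbar_ob f) (Kbar_ob g)) \<and> (\<forall>x\<in>VOb X. nproj X (Kbar_ob f) (Kbar_ob g) x \<cdot> u = ?X x)"
  proof (rule nhom_univ[OF Kbar_ob_vfun[OF f] Kbar_ob_vfun[OF g]])
    fix x y assume [simp]: "x \<in> VOb X" "y \<in> VOb X"
    show "nat_l X (Kbar_ob f) (Kbar_ob g) (nhom A f g) ?X x y = nat_r X (Kbar_ob f) (Kbar_ob g) (nhom A f g) ?X x y"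
      by (rule B_ext[of f x _ _ "\<langle>var 0 (VHom X x y), var 1 (nhom A f g)\<rangle>" 2 3])
        (simp_all add: hom_iff, simp_all add: nat_l_def nat_r_def)
  qed (simp_all add: hom_iff)
  from theI'[OF this] show ?th1
    "x \<in> VOb X \<Longrightarrow> nproj X (Kbar_ob f) (Kbar_ob g) x \<cdot> Kbar_map f g = ?X x"
    unfolding Kbar_map_def by blast+
qed

lemma Kbar_map [simp]:
  assumes f [simp]: "vfunctor A vself f" and g [simp]: "vfunctor A vself g"
  shows "Kbar_map f g \<in> Ar V" "Dom V (Kbar_map f g) = nhom A f g" "Cod V (Kbar_map f g) = nhom X (Kbar_ob f) (Kbar_ob g)" (is ?th1)
    "x \<in> VOb X \<Longrightarrow> a \<in> VOb A \<Longrightarrow> els [(n, nhom A f g), (k, FOb K (a, x)), (t, FOb f a)] \<Longrightarrow>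
      ev (B f x) (B g x) $ \<langle>nproj X (Kbar_ob f) (Kbar_ob g) x $ Kbar_map f g $ n, io f x a $ \<langle>k, t\<rangle>\<rangle>
       = io g x a $ \<langle>k, nat_at A f g a n t\<rangle>" (is "_ \<Longrightarrow> _ \<Longrightarrow> _ \<Longrightarrow> ?th2")
proof -
  show [simp]: "Kbar_map f g \<in> Ar V" "Dom V (Kbar_map f g) = nhom A f g" ?th1
    using Kbar_map_ex(1)[OF f g] by (auto simp: hom_iff)
  assume [simp]: "x \<in> VOb X" "a \<in> VOb A" and d [simplified, simp]: "els [(n, nhom A f g), (k, FOb K (a, x)), (t, FOb f a)]"
  have "nproj X (Kbar_ob f) (Kbar_ob g) x $ Kbar_map f g $ n = curry (nhom A f g) (B f x) (B g x) (bmap f g x) $ n"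
    using arg_cong[OF Kbar_map_ex(2)[OF f g, of x], of "\<lambda>f. f $ n"] by simp
  then show ?th2
    using d by simp
qed

lemma Kbar_simps [simp]:
  "vfunctor A vself f \<Longrightarrow> FOb Kbar f = Kbar_ob f"
  "vfunctor A vself f \<Longrightarrow> vfunctor A vself g \<Longrightarrow> FMap Kbar f g = Kbar_map f g"
  by (simp_all add: Kbar_def)

lemma Kbar_vfun: "vfunctor (fcat A) (fcat X) Kbar"
  unfolding Kbar_def
proof (rule vfunctorI)
  fix f assume "f \<in> VOb (fcat A)"
  then have [simp]: "vfunctor A vself f" by simp
  have "Kbar_map f f \<cdot> VId (fcat A) f = VId (fcat X) (Kbar_ob f)"
    by (rule bar_ext[of f "Kbar_ob f" _ _ un 0 1]) simp_all
  from arg_cong[OF this, of "\<lambda>u. u $ un"] show "Kbar_map f f $ VId (fcat A) f $ un = VId (fcat X) (Kbar_ob f) $ un" by simp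
  fix g h assume "g \<in> VOb (fcat A)" "h \<in> VOb (fcat A)"
  then have [simp]: "vfunctor A vself g" "vfunctor A vself h" by simp_all
  let ?e = "\<langle>var 0 (nhom A g h), var 1 (nhom A f g)\<rangle>"
  have "Kbar_map f h \<cdot> VCmp (fcat A) f g h = VCmp (fcat X) (Kbar_ob f) (Kbar_ob g) (Kbar_ob h) \<cdot> (Kbar_map g h ** Kbar_map f g)"
    by (rule bar_ext[of f "Kbar_ob h" _ _ ?e 2 3]) simp_all
  from arg_cong[OF this, of "\<lambda>u. u $ ?e"]
  show "Kbar_map f h $ VCmp (fcat A) f g h $ \<langle>var 0 (VHom (fcat A) g h), var 1 (VHom (fcat A) f g)\<rangle>
     = VCmp (fcat X) (Kbar_ob f) (Kbar_ob g) (Kbar_ob h) $ \<langle>Kbar_map g h $ var 0 (VHom (fcat A) g h), Kbar_map f g $ var 1 (VHom (fcat A) f g)\<rangle>"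
    by simp
qed (simp_all add: hom_iff)

subsection \<open>The functor \<open>Kund\<close>\<close>

text \<open>The value of \<open>Kund g\<close> at \<open>a\<close>: the end \<open>\<integral>\<^sub>x
  [K(a,x), g x]\<close> is a hom of \<open>[X,\<V>]\<close>, so that what is known about these
  applies.\<close>

abbreviation U where "U g a \<equiv> nhom X (Kr a) g"

text \<open>The component at \<open>x\<close> of an element \<open>w\<close> of \<open>[X,\<V>](K(a,-), g)\<close>, applied to an element of \<open>K(a,x)\<close>.\<close>

abbreviation (input) kat where
  "kat g a x w k \<equiv> ev (FOb K (a, x)) (FOb g x) $ \<langle>nproj X (Kr a) g x $ w, k\<rangle>"

lemma Kg_end: "endob X (Kg g a) = U g a" "endproj X (Kg g a) = nproj X (Kr a) g"
  by (simp_all add: Kg_def nhom_def nproj_def)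

lemma U_nat:
  assumes "vfunctor X vself g" "a \<in> VOb A" "x \<in> VOb X" "y \<in> VOb X" "els [(q, VHom X x y), (w, U g a), (k, FOb K (a, x))]"
  shows "push g x y q (kat g a x w k)
    = kat g a y w (ract a x y q k)"
  using nproj_nat[OF Kr_vfun assms(1), of a x y q w k] assms by simp

text \<open>The action \<open>A(a,b) \<otimes> U g a \<rightarrow> U g b\<close>.\<close>

abbreviation "uact g a b \<equiv> end_act X (VHom A a b) (Kg g a) (Kg g b)
            (\<lambda>x. VCmp vself (FOb K (b, x)) (FOb K (a, x)) (FOb g x)
                   \<cdot> (idn (FOb K (a, x) \<multimap> FOb g x) ** FMap (Kl x) b a)
                   \<cdot> sym (VHom A a b) (FOb K (a, x) \<multimap> FOb g x))"

lemma uact [simp]: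
  assumes g [simp]: "vfunctor X vself g" and a [simp]: "a \<in> VOb A" and b [simp]: "b \<in> VOb A"
  shows "uact g a b \<in> Ar V" "Dom V (uact g a b) = VHom A a b \<otimes> U g a" "Cod V (uact g a b) = U g b"
    "x \<in> VOb X \<Longrightarrow> els [(h, VHom A a b), (w, U g a), (k, FOb K (b, x))] \<Longrightarrow>
       kat g b x (uact g a b $ \<langle>h, w\<rangle>) k
        = kat g a x w (lact x b a h k)" (is "_ \<Longrightarrow> _ \<Longrightarrow> ?th1")
proof -
  note [simp] = vself_cmp_ar
  note e = end_act[OF Kr_vfun[OF a] g Kr_vfun[OF b] g]
  have u: "uact g a b \<in> Ar V \<and> Dom V (uact g a b) = VHom A a b \<otimes> U g a \<and> Cod V (uact g a b) = U g b"
    unfolding Kg_def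
    by (intro conjI; rule e; simp add: hom_iff U_nat interchange)
  then show [simp]: "uact g a b \<in> Ar V" "Dom V (uact g a b) = VHom A a b \<otimes> U g a" "Cod V (uact g a b) = U g b"
    by blast+
  assume [simp]: "x \<in> VOb X" and d [simplified, simp]: "els [(h, VHom A a b), (w, U g a), (k, FOb K (b, x))]"
  have n: "nproj X (Kr b) g x $ uact g a b $ \<langle>h, w\<rangle> = VCmp vself (FOb K (b, x)) (FOb K (a, x)) (FOb g x)
                   \<cdot> (idn (FOb K (a, x) \<multimap> FOb g x) ** FMap (Kl x) b a)
                   \<cdot> sym (VHom A a b) (FOb K (a, x) \<multimap> FOb g x) $ \<langle>h, nproj X (Kr a) g x $ w\<rangle>"
    unfolding Kg_def
    by (rule e(4)) (simp_all add: hom_iff U_nat interchange d)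
  show ?th1
    unfolding n using d by simp
qed

lemma Kund_ob_eq: "Kund_ob g = mkfun A (U g) (\<lambda>a b. curry (VHom A a b) (U g a) (U g b) (uact g a b))"
  unfolding Kund_ob_def Kg_end ..

lemma Kund_ob_vfun [simp]:
  assumes g [simp]: "vfunctor X vself g"
  shows "vfunctor A vself (Kund_ob g)"
  unfolding Kund_ob_eq
proof (rule vfunctor_actionI)
  fix a assume a [simp]: "a \<in> VOb A"
  have "uact g a a $ \<langle>VId A a $ un, var 0 (U g a)\<rangle> = var 0 (U g a)"
    by (rule nhom_el_ext[OF Kr_vfun[OF a] g, where i = 1]) simp_all
  then show "uact g a a \<cdot> (VId A a ** idn (U g a)) = lun (U g a)"
    by - (rule el_ext[of "\<langle>un, var 0 (U g a)\<rangle>"], simp_all)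
  fix b c assume b [simp]: "b \<in> VOb A" and c [simp]: "c \<in> VOb A"
  let ?g = "var 0 (VHom A b c) :: ('o, 'm) el" and ?f = "var 1 (VHom A a b) :: ('o, 'm) el" and ?w = "var 2 (U g a) :: ('o, 'm) el"
  have "uact g a c $ \<langle>VCmp A a b c $ \<langle>?g, ?f\<rangle>, ?w\<rangle> = uact g b c $ \<langle>?g, uact g a b $ \<langle>?f, ?w\<rangle>\<rangle>"
    by (rule nhom_el_ext[OF Kr_vfun[OF c] g, where i = 3]) simp_all
  then show "uact g a c \<cdot> (VCmp A a b c ** idn (U g a)) = uact g b c \<cdot> (idn (VHom A b c) ** uact g a b) \<cdot> asc (VHom A b c) (VHom A a b) (U g a)"
    by - (rule el_ext[of "\<langle>\<langle>?g, ?f\<rangle>, ?w\<rangle>"], simp_all)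
qed (simp_all add: hom_iff)

text \<open>The object \<open>FOb g x\<close> is given a name \<open>c\<close> so that the second equation
  also applies when \<open>g\<close> is of the form \<open>Kbar_ob f\<close> and its value has
  been rewritten to \<open>B f x\<close>. The same is done below for \<open>Kund_map\<close>,
  \<open>eta\<close> and \<open>eps\<close>.\<close>

lemma Kund_ob_simps [simp]:
  assumes g [simp]: "vfunctor X vself g" and a [simp]: "a \<in> VOb A"
  shows "FOb (Kund_ob g) a = U g a"
    "b \<in> VOb A \<Longrightarrow> x \<in> VOb X \<Longrightarrow> FOb g x = c \<Longrightarrow> els [(h, VHom A a b), (w, U g a), (k, FOb K (b, x))] \<Longrightarrow>
       ev (FOb K (b, x)) c $ \<langle>nproj X (Kr b) g x $ ev (U g a) (U g b) $ \<langle>FMap (Kund_ob g) a b $ h, w\<rangle>, k\<rangle>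
        = kat g a x w (lact x b a h k)"
  by (auto simp: Kund_ob_eq)

text \<open>Elements of \<open>[A,\<V>](F, Kund g)\<close> are compared on the components at
  \<open>a\<close> and \<open>x\<close>.\<close>

lemma Kund_ext:
  assumes F [simp]: "vfunctor A vself F" and g [simp]: "vfunctor X vself g"
    and [simp]: "u \<in> Ar V" "v \<in> Ar V" "Dom V u = ty e" "Dom V v = ty e" "Cod V u = nhom A F (Kund_ob g)" "Cod V v = nhom A F (Kund_ob g)"
    "full e" "i \<notin> names e" "j \<notin> names e" "i \<noteq> j"
    and eq: "\<And>a x. a \<in> VOb A \<Longrightarrow> x \<in> VOb X \<Longrightarrow>
       kat g a x (ev (FOb F a) (U g a) $ \<langle>nproj A F (Kund_ob g) a $ u $ e, var i (FOb F a)\<rangle>) (var j (FOb K (a, x)))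
       = kat g a x (ev (FOb F a) (U g a) $ \<langle>nproj A F (Kund_ob g) a $ v $ e, var i (FOb F a)\<rangle>) (var j (FOb K (a, x)))"
  shows "u = v"
proof (rule el_ext[of e])
  have ji [simp]: "j \<noteq> i" by (rule not_sym) fact
  show "u $ e = v $ e"
  proof (rule nhom_el_ext[OF F Kund_ob_vfun[OF g], where i = i])
    fix a assume a [simp]: "a \<in> VOb A"
    have "ev (FOb F a) (U g a) $ \<langle>nproj A F (Kund_ob g) a $ u $ e, var i (FOb F a)\<rangle>
      = ev (FOb F a) (U g a) $ \<langle>nproj A F (Kund_ob g) a $ v $ e, var i (FOb F a)\<rangle>"
      by (rule nhom_el_ext[OF Kr_vfun[OF a] g, where i = j]) (simp_all add: eq)
    then show "nat_at A F (Kund_ob g) a (u $ e) (var i (FOb F a))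
      = nat_at A F (Kund_ob g) a (v $ e) (var i (FOb F a))" by simp
  qed simp_all
qed simp_all

text \<open>The action \<open>[X,\<V>](g,h) \<otimes> U g a \<rightarrow> U h a\<close>.\<close>

abbreviation "umap g h a \<equiv> end_act X (nhom X g h) (Kg g a) (Kg h a)
                 (\<lambda>x. VCmp vself (FOb K (a, x)) (FOb g x) (FOb h x)
                        \<cdot> (nproj X g h x ** idn (FOb K (a, x) \<multimap> FOb g x)))"

lemma umap [simp]:
  assumes g [simp]: "vfunctor X vself g" and h [simp]: "vfunctor X vself h" and a [simp]: "a \<in> VOb A"
  shows "umap g h a \<in> Ar V" "Dom V (umap g h a) = nhom X g h \<otimes> U g a" "Cod V (umap g h a) = U h a"
    "x \<in> VOb X \<Longrightarrow> els [(n, nhom X g h), (w, U g a), (k, FOb K (a, x))] \<Longrightarrow>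
       kat h a x (umap g h a $ \<langle>n, w\<rangle>) k
        = nat_at X g h x n (kat g a x w k)" (is "_ \<Longrightarrow> _ \<Longrightarrow> ?th1")
proof -
  note [simp] = vself_cmp_ar
  note e = end_act[OF Kr_vfun[OF a] g Kr_vfun[OF a] h]
  have u: "umap g h a \<in> Ar V \<and> Dom V (umap g h a) = nhom X g h \<otimes> U g a \<and> Cod V (umap g h a) = U h a"
    unfolding Kg_def
    by (intro conjI; rule e; simp add: hom_iff U_nat nproj_nat[OF g h])
  then show [simp]: "umap g h a \<in> Ar V" "Dom V (umap g h a) = nhom X g h \<otimes> U g a" "Cod V (umap g h a) = U h a"
    by blast+
  assume [simp]: "x \<in> VOb X" and d [simplified, simp]: "els [(n, nhom X g h), (w, U g a), (k, FOb K (a, x))]"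
  have n: "nproj X (Kr a) h x $ umap g h a $ \<langle>n, w\<rangle> = VCmp vself (FOb K (a, x)) (FOb g x) (FOb h x)
                        \<cdot> (nproj X g h x ** idn (FOb K (a, x) \<multimap> FOb g x)) $ \<langle>n, nproj X (Kr a) g x $ w\<rangle>"
    unfolding Kg_def
    by (rule e(4)) (simp_all add: hom_iff U_nat nproj_nat[OF g h] d)
  show ?th1
    unfolding n using d by simp
qed

lemma Kund_map_ex:
  assumes g [simp]: "vfunctor X vself g" and h [simp]: "vfunctor X vself h"
  shows "Kund_map g h \<in> hom (nhom X g h) (nhom A (Kund_ob g) (Kund_ob h))" (is ?th1)
    "a \<in> VOb A \<Longrightarrow> nproj A (Kund_ob g) (Kund_ob h) a \<cdot> Kund_map g h = curry (nhom X g h) (U g a) (U h a) (umap g h a)"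
proof -
  let ?X = "\<lambda>a. curry (nhom X g h) (U g a) (U h a) (umap g h a)"
  have "\<exists>!u. u \<in> hom (nhom X g h) (nhom A (Kund_ob g) (Kund_ob h)) \<and> (\<forall>a\<in>VOb A. nproj A (Kund_ob g) (Kund_ob h) a \<cdot> u = ?X a)"
  proof (rule nhom_univ[OF Kund_ob_vfun[OF g] Kund_ob_vfun[OF h]])
    fix a b assume [simp]: "a \<in> VOb A" and b [simp]: "b \<in> VOb A"
    show "nat_l A (Kund_ob g) (Kund_ob h) (nhom X g h) ?X a b = nat_r A (Kund_ob g) (Kund_ob h) (nhom X g h) ?X a b"
      by (rule el_ext[of "\<langle>\<langle>var 0 (VHom A a b), var 1 (nhom X g h)\<rangle>, var 2 (U g a)\<rangle>"], simp,
          rule nhom_el_ext[OF Kr_vfun[OF b] h, where i = 3]) (simp_all add: hom_iff)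
  qed (simp_all add: hom_iff)
  from theI'[OF this] show ?th1
    "a \<in> VOb A \<Longrightarrow> nproj A (Kund_ob g) (Kund_ob h) a \<cdot> Kund_map g h = ?X a"
    unfolding Kund_map_def Kg_end by blast+
qed

lemma Kund_map [simp]:
  assumes g [simp]: "vfunctor X vself g" and h [simp]: "vfunctor X vself h"
  shows "Kund_map g h \<in> Ar V" "Dom V (Kund_map g h) = nhom X g h" "Cod V (Kund_map g h) = nhom A (Kund_ob g) (Kund_ob h)" (is ?th1)
    "a \<in> VOb A \<Longrightarrow> x \<in> VOb X \<Longrightarrow> FOb h x = c \<Longrightarrow> els [(n, nhom X g h), (w, U g a), (k, FOb K (a, x))] \<Longrightarrow>
      ev (FOb K (a, x)) c $ \<langle>nproj X (Kr a) h x $ ev (U g a) (U h a) $ \<langle>nproj A (Kund_ob g) (Kund_ob h) a $ Kund_map g h $ n, w\<rangle>, k\<rangle>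
       = nat_at X g h x n (kat g a x w k)" (is "_ \<Longrightarrow> _ \<Longrightarrow> _ \<Longrightarrow> _ \<Longrightarrow> ?th2")
proof -
  show [simp]: "Kund_map g h \<in> Ar V" "Dom V (Kund_map g h) = nhom X g h" ?th1
    using Kund_map_ex(1)[OF g h] by (auto simp: hom_iff)
  assume c: "FOb h x = c" and [simp]: "a \<in> VOb A" "x \<in> VOb X" and d [simplified, simp]: "els [(n, nhom X g h), (w, U g a), (k, FOb K (a, x))]"
  have "nproj A (Kund_ob g) (Kund_ob h) a $ Kund_map g h $ n = curry (nhom X g h) (U g a) (U h a) (umap g h a) $ n"
    using arg_cong[OF Kund_map_ex(2)[OF g h, of a], of "\<lambda>f. f $ n"] by simp
  then show ?th2
    unfolding c[symmetric] using d by simp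
qed

lemma Kund_simps [simp]:
  "vfunctor X vself g \<Longrightarrow> FOb Kund g = Kund_ob g"
  "vfunctor X vself g \<Longrightarrow> vfunctor X vself h \<Longrightarrow> FMap Kund g h = Kund_map g h"
  by (simp_all add: Kund_def)

lemma Kund_vfun: "vfunctor (fcat X) (fcat A) Kund"
  unfolding Kund_def
proof (rule vfunctorI)
  fix f assume "f \<in> VOb (fcat X)"
  then have [simp]: "vfunctor X vself f" by simp
  have "Kund_map f f \<cdot> VId (fcat X) f = VId (fcat A) (Kund_ob f)"
    by (rule Kund_ext[of "Kund_ob f" f _ _ un 0 1]) simp_all
  from arg_cong[OF this, of "\<lambda>u. u $ un"] show "Kund_map f f $ VId (fcat X) f $ un = VId (fcat A) (Kund_ob f) $ un" by simp
  fix g h assume "g \<in> VOb (fcat X)" "h \<in> VOb (fcat X)"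
  then have [simp]: "vfunctor X vself g" "vfunctor X vself h" by simp_all
  let ?e = "\<langle>var 0 (nhom X g h), var 1 (nhom X f g)\<rangle>"
  have "Kund_map f h \<cdot> VCmp (fcat X) f g h = VCmp (fcat A) (Kund_ob f) (Kund_ob g) (Kund_ob h) \<cdot> (Kund_map g h ** Kund_map f g)"
    by (rule Kund_ext[of "Kund_ob f" h _ _ ?e 2 3]) simp_all
  from arg_cong[OF this, of "\<lambda>u. u $ ?e"]
  show "Kund_map f h $ VCmp (fcat X) f g h $ \<langle>var 0 (VHom (fcat X) g h), var 1 (VHom (fcat X) f g)\<rangle>
     = VCmp (fcat A) (Kund_ob f) (Kund_ob g) (Kund_ob h) $ \<langle>Kund_map g h $ var 0 (VHom (fcat X) g h), Kund_map f g $ var 1 (VHom (fcat X) f g)\<rangle>"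
    by simp
qed (simp_all add: hom_iff)

subsection \<open>Unit, counit and the adjunction\<close>

lemma eta_at [simp]:
  assumes f [simp]: "vfunctor A vself f" and a [simp]: "a \<in> VOb A"
  shows "eta_at f a \<in> Ar V" "Dom V (eta_at f a) = FOb f a" "Cod V (eta_at f a) = U (Kbar_ob f) a"
    "x \<in> VOb X \<Longrightarrow> els [(t, FOb f a), (k, FOb K (a, x))] \<Longrightarrow>
      ev (FOb K (a, x)) (B f x) $ \<langle>nproj X (Kr a) (Kbar_ob f) x $ eta_at f a $ t, k\<rangle> = io f x a $ \<langle>k, t\<rangle>" (is "_ \<Longrightarrow> _ \<Longrightarrow> ?th1")
proof -
  let ?X = "\<lambda>x. curry (FOb f a) (FOb K (a, x)) (B f x) (io f x a \<cdot> sym (FOb f a) (FOb K (a, x)))"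
  have ex: "\<exists>!u. u \<in> hom (FOb f a) (U (Kbar_ob f) a) \<and> (\<forall>x\<in>VOb X. nproj X (Kr a) (Kbar_ob f) x \<cdot> u = ?X x)"
  proof (rule nhom_univ[OF Kr_vfun[OF a] Kbar_ob_vfun[OF f]])
    fix x y assume [simp]: "x \<in> VOb X" "y \<in> VOb X"
    show "nat_l X (Kr a) (Kbar_ob f) (FOb f a) ?X x y = nat_r X (Kr a) (Kbar_ob f) (FOb f a) ?X x y"
      by (rule el_ext[of "\<langle>\<langle>var 0 (VHom X x y), var 1 (FOb f a)\<rangle>, var 2 (FOb K (a, x))\<rangle>"]) (simp_all add: hom_iff)
  qed (simp_all add: hom_iff)
  have E: "eta_at f a \<in> hom (FOb f a) (U (Kbar_ob f) a)" and N: "\<And>x. x \<in> VOb X \<Longrightarrow> nproj X (Kr a) (Kbar_ob f) x \<cdot> eta_at f a = ?X x"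
    using theI'[OF ex] unfolding eta_at_def Kg_end by blast+
  then show [simp]: "eta_at f a \<in> Ar V" "Dom V (eta_at f a) = FOb f a" "Cod V (eta_at f a) = U (Kbar_ob f) a"
    by (auto simp: hom_iff)
  assume [simp]: "x \<in> VOb X" and d [simplified, simp]: "els [(t, FOb f a), (k, FOb K (a, x))]"
  have "nproj X (Kr a) (Kbar_ob f) x $ eta_at f a $ t = ?X x $ t"
    using arg_cong[OF N[of x], of "\<lambda>f. f $ t"] by simp
  then show ?th1
    using d by simp
qed

lemma eta [simp]:
  assumes f [simp]: "vfunctor A vself f"
  shows "eta f \<in> Ar V" "Dom V (eta f) = \<I>" "Cod V (eta f) = nhom A f (Kund_ob (Kbar_ob f))"
    "a \<in> VOb A \<Longrightarrow> FOb f a = c \<Longrightarrow> good t \<Longrightarrow> ty t = FOb f a \<Longrightarrow>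
      ev c (U (Kbar_ob f) a) $ \<langle>nproj A f (Kund_ob (Kbar_ob f)) a $ eta f $ un, t\<rangle> = eta_at f a $ t" (is "_ \<Longrightarrow> _ \<Longrightarrow> _ \<Longrightarrow> _ \<Longrightarrow> ?th1")
proof -
  let ?h = "Kund_ob (Kbar_ob f)"
  let ?X = "\<lambda>a. curry \<I> (FOb f a) (FOb ?h a) (eta_at f a \<cdot> lun (FOb f a))"
  have ex: "\<exists>!u. u \<in> hom \<I> (nhom A f ?h) \<and> (\<forall>a\<in>VOb A. nproj A f ?h a \<cdot> u = ?X a)"
  proof (rule nhom_univ[OF f])
    fix a b assume [simp]: "a \<in> VOb A" and b [simp]: "b \<in> VOb A"
    show "nat_l A f ?h \<I> ?X a b = nat_r A f ?h \<I> ?X a b"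
      by (rule el_ext[of "\<langle>\<langle>var 0 (VHom A a b), un\<rangle>, var 1 (FOb f a)\<rangle>"], simp,
          rule nhom_el_ext[OF Kr_vfun[OF b] Kbar_ob_vfun[OF f], where i = 3]) (simp_all add: hom_iff io_dinat)
  qed (simp_all add: hom_iff)
  have E: "eta f \<in> hom \<I> (nhom A f ?h)" and N: "\<And>a. a \<in> VOb A \<Longrightarrow> nproj A f ?h a \<cdot> eta f = ?X a"
    using theI'[OF ex] unfolding eta_def Let_def by blast+
  then show [simp]: "eta f \<in> Ar V" "Dom V (eta f) = \<I>" "Cod V (eta f) = nhom A f ?h"
    by (auto simp: hom_iff)
  assume c: "FOb f a = c" and [simp]: "a \<in> VOb A" "good t" "ty t = FOb f a"
  have "nproj A f ?h a $ eta f $ un = ?X a $ un"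
    using arg_cong[OF N[of a], of "\<lambda>f. f $ un"] by simp
  then show ?th1
    unfolding c[symmetric] by simp
qed

lemma eps_at [simp]:
  assumes g [simp]: "vfunctor X vself g" and x [simp]: "x \<in> VOb X"
  shows "eps_at g x \<in> Ar V" "Dom V (eps_at g x) = B (Kund_ob g) x" "Cod V (eps_at g x) = FOb g x"
    "a \<in> VOb A \<Longrightarrow> els [(k, FOb K (a, x)), (w, U g a)] \<Longrightarrow>
      eps_at g x $ io (Kund_ob g) x a $ \<langle>k, w\<rangle> = kat g a x w k" (is "PROP ?th1")
proof -
  let ?X = "\<lambda>a. ev (FOb K (a, x)) (FOb g x) \<cdot> sym (FOb K (a, x)) (FOb K (a, x) \<multimap> FOb g x)
               \<cdot> (idn (FOb K (a, x)) ** nproj X (Kr a) g x)"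
  have ex: "\<exists>!u. u \<in> hom (B (Kund_ob g) x) (FOb g x) \<and> (\<forall>a\<in>VOb A. u \<cdot> io (Kund_ob g) x a = ?X a)"
    by (rule coend_univ0[OF Kl_vfun[OF x] Kund_ob_vfun[OF g]]) (simp_all add: hom_iff)
  have E: "eps_at g x \<in> hom (B (Kund_ob g) x) (FOb g x)" and N: "\<And>a. a \<in> VOb A \<Longrightarrow> eps_at g x \<cdot> io (Kund_ob g) x a = ?X a"
    using theI'[OF ex] unfolding eps_at_def Kg_end by blast+
  then show [simp]: "eps_at g x \<in> Ar V" "Dom V (eps_at g x) = B (Kund_ob g) x" "Cod V (eps_at g x) = FOb g x"
    by (auto simp: hom_iff)
  show "PROP ?th1"
    using arg_cong[OF N[of a], of "\<lambda>f. f $ \<langle>k, w\<rangle>"] by simp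
qed

lemma eps [simp]:
  assumes g [simp]: "vfunctor X vself g"
  shows "eps g \<in> Ar V" "Dom V (eps g) = \<I>" "Cod V (eps g) = nhom X (Kbar_ob (Kund_ob g)) g"
    "x \<in> VOb X \<Longrightarrow> FOb g x = c \<Longrightarrow> good s \<Longrightarrow> ty s = B (Kund_ob g) x \<Longrightarrow>
      ev (B (Kund_ob g) x) c $ \<langle>nproj X (Kbar_ob (Kund_ob g)) g x $ eps g $ un, s\<rangle> = eps_at g x $ s" (is "_ \<Longrightarrow> _ \<Longrightarrow> _ \<Longrightarrow> _ \<Longrightarrow> ?th1")
proof -
  let ?h = "Kbar_ob (Kund_ob g)"
  let ?X = "\<lambda>x. curry \<I> (FOb ?h x) (FOb g x) (eps_at g x \<cdot> lun (FOb ?h x))"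
  have ex: "\<exists>!u. u \<in> hom \<I> (nhom X ?h g) \<and> (\<forall>x\<in>VOb X. nproj X ?h g x \<cdot> u = ?X x)"
  proof (rule nhom_univ[OF _ g])
    fix x y assume [simp]: "x \<in> VOb X" "y \<in> VOb X"
    show "nat_l X ?h g \<I> ?X x y = nat_r X ?h g \<I> ?X x y"
      by (rule B_ext[of "Kund_ob g" x _ _ "\<langle>var 0 (VHom X x y), un\<rangle>" 1 2])
        (simp_all add: hom_iff U_nat, simp_all add: nat_l_def nat_r_def)
  qed (simp_all add: hom_iff)
  have E: "eps g \<in> hom \<I> (nhom X ?h g)" and N: "\<And>x. x \<in> VOb X \<Longrightarrow> nproj X ?h g x \<cdot> eps g = ?X x"
    using theI'[OF ex] unfolding eps_def Let_def by blast+
  then show [simp]: "eps g \<in> Ar V" "Dom V (eps g) = \<I>" "Cod V (eps g) = nhom X ?h g"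
    by (auto simp: hom_iff)
  assume c: "FOb g x = c" and [simp]: "x \<in> VOb X" "good s" "ty s = B (Kund_ob g) x"
  have "nproj X ?h g x $ eps g $ un = ?X x $ un"
    using arg_cong[OF N[of x], of "\<lambda>f. f $ un"] by simp
  then show ?th1
    unfolding c[symmetric] by simp
qed

text \<open>In elements the unit sends \<open>t\<close> to the family \<open>k \<mapsto>
  \<iota>(k,t)\<close>, where \<open>\<iota>\<close> is the coprojection, and the counit sends
  \<open>\<iota>(k,w)\<close> to \<open>w(k)\<close>. With this the first triangle law is
  \<open>\<iota>(k,t) \<mapsto> \<iota>(k, \<eta> t) \<mapsto> (\<eta> t)(k) =
  \<iota>(k,t)\<close>, and the other laws are equally direct.\<close>

theorem Kan_adjunction: "vadjunction V (fcat A) (fcat X) Kbar Kund eta eps"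
proof (unfold_locales)
  show "vfunctor (fcat A) (fcat X) Kbar" "vfunctor (fcat X) (fcat A) Kund"
    by (rule Kbar_vfun Kund_vfun)+
  fix f assume "f \<in> VOb (fcat A)"
  then have f [simp]: "vfunctor A vself f" by simp
  show "eta f \<in> hom \<I> (VHom (fcat A) f (FOb Kund (FOb Kbar f)))" by (simp add: hom_iff)
  have "VCmp (fcat X) (Kbar_ob f) (Kbar_ob (Kund_ob (Kbar_ob f))) (Kbar_ob f) \<cdot> (eps (Kbar_ob f) ** (Kbar_map f (Kund_ob (Kbar_ob f)) \<cdot> eta f)) \<cdot> inv (lun \<I>)
     = VId (fcat X) (Kbar_ob f)"
    by (rule bar_ext[of f "Kbar_ob f" _ _ un 0 1]) simp_all
  from arg_cong[OF this, of "\<lambda>u. u $ un"]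
  show "VCmp (fcat X) (FOb Kbar f) (FOb Kbar (FOb Kund (FOb Kbar f))) (FOb Kbar f) $ \<langle>eps (FOb Kbar f) $ un, FMap Kbar f (FOb Kund (FOb Kbar f)) $ eta f $ un\<rangle>
    = VId (fcat X) (FOb Kbar f) $ un" by simp
next
  fix g assume "g \<in> VOb (fcat X)"
  then have g [simp]: "vfunctor X vself g" by simp
  show "eps g \<in> hom \<I> (VHom (fcat X) (FOb Kbar (FOb Kund g)) g)" by (simp add: hom_iff)
  have "VCmp (fcat A) (Kund_ob g) (Kund_ob (Kbar_ob (Kund_ob g))) (Kund_ob g) \<cdot> ((Kund_map (Kbar_ob (Kund_ob g)) g \<cdot> eps g) ** eta (Kund_ob g)) \<cdot> inv (lun \<I>)
     = VId (fcat A) (Kund_ob g)"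
    by (rule Kund_ext[of "Kund_ob g" g _ _ un 0 1]) simp_all
  from arg_cong[OF this, of "\<lambda>u. u $ un"]
  show "VCmp (fcat A) (FOb Kund g) (FOb Kund (FOb Kbar (FOb Kund g))) (FOb Kund g) $ \<langle>FMap Kund (FOb Kbar (FOb Kund g)) g $ eps g $ un, eta (FOb Kund g) $ un\<rangle>
    = VId (fcat A) (FOb Kund g) $ un" by simp
next
  fix f g :: "('s, 'o, 'm) vfun" and n :: "('o, 'm) el" assume "f \<in> VOb (fcat A)" "g \<in> VOb (fcat A)" and [simp]: "good n" "ty n = VHom (fcat A) f g"
  then have f [simp]: "vfunctor A vself f" and g [simp]: "vfunctor A vself g" by simp_all
  have "postcomp (fcat A) f g (Kund_ob (Kbar_ob g)) (eta g)
    = precomp (fcat A) f (Kund_ob (Kbar_ob f)) (Kund_ob (Kbar_ob g)) (eta f) \<cdot> Kund_map (Kbar_ob f) (Kbar_ob g) \<cdot> Kbar_map f g"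
    by (rule Kund_ext[of f "Kbar_ob g" _ _ "var 0 (nhom A f g)" 1 2]) simp_all
  from arg_cong[OF this, of "\<lambda>u. u $ n"]
  show "VCmp (fcat A) f g (FOb Kund (FOb Kbar g)) $ \<langle>eta g $ un, n\<rangle>
        = VCmp (fcat A) f (FOb Kund (FOb Kbar f)) (FOb Kund (FOb Kbar g)) $ \<langle>FMap Kund (FOb Kbar f) (FOb Kbar g) $ FMap Kbar f g $ n, eta f $ un\<rangle>"
    by simp
next
  fix f g :: "('s, 'o, 'm) vfun" and n :: "('o, 'm) el" assume "f \<in> VOb (fcat X)" "g \<in> VOb (fcat X)" and [simp]: "good n" "ty n = VHom (fcat X) f g"
  then have f [simp]: "vfunctor X vself f" and g [simp]: "vfunctor X vself g" by simp_all
  have "postcomp (fcat X) (Kbar_ob (Kund_ob f)) (Kbar_ob (Kund_ob g)) g (eps g) \<cdot> Kbar_map (Kund_ob f) (Kund_ob g) \<cdot> Kund_map f g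
    = precomp (fcat X) (Kbar_ob (Kund_ob f)) f g (eps f)"
    by (rule bar_ext[of "Kund_ob f" g _ _ "var 0 (nhom X f g)" 1 2]) simp_all
  from arg_cong[OF this, of "\<lambda>u. u $ n"]
  show "VCmp (fcat X) (FOb Kbar (FOb Kund f)) (FOb Kbar (FOb Kund g)) g $ \<langle>eps g $ un, FMap Kbar (FOb Kund f) (FOb Kund g) $ FMap Kund f g $ n\<rangle>
        = VCmp (fcat X) (FOb Kbar (FOb Kund f)) f g $ \<langle>n, eps f $ un\<rangle>"
    by simp
qed

end

section \<open>The Joyal-Wiener category of a kernel\<close>

theorem mainTheorem2:
  fixes V :: "('o, 'm) smc"
    and A X :: "('s, 'o, 'm) vcat"
    and PA PX :: "('s, 'o, 'm) promon"
    and K :: "('s \<times> 's, 'o, 'm) vfun"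
    and k2 :: "'s \<Rightarrow> 's \<Rightarrow> 's \<Rightarrow> 'm" and k0 :: "'s \<Rightarrow> 'm"
  assumes "star_autonomous_unit V"
    and "infinite (UNIV :: 's set)"
    and "complete_cat TYPE('s) V"
    and "promonoidal_data.promonoidal V A PA"
    and "promonoidal_data.promonoidal V X PX"
    and "mult_kernel_data.multiplicative_kernel V A X K PA PX k2 k0"
    and "\<forall>f\<in>VOb (vbase.fcat V A).
           vbase.regular_mono V (vbase.fcat V A) f
             (FOb (kernel_data.Kund V A X K) (FOb (kernel_data.Kbar V A X K) f))
             (kernel_data.eta V A X K f)"
  shows "kernel_data.Kbar V A X K
           = vbase.compfun V (vbase.fcat V A) (kernel_data.Kcomp V A X K) (kernel_data.Kbar_T V A X K)
       \<and> vbase.fully_faithful V (kernel_data.Kleisli V A X K) (vbase.fcat V X) (kernel_data.Kcomp V A X K)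
       \<and> vbase.conservative V (vbase.fcat V A) (kernel_data.Kleisli V A X K) (kernel_data.Kbar_T V A X K)
       \<and> vbase.vcategory V (kernel_data.Joy V A X K)
       \<and> vbase.faithful V (kernel_data.Joy V A X K) (kernel_data.Kleisli V A X K) (kernel_data.joy_sub V A X K)
       \<and> vbase.vequivalence V (vbase.fcat V A) (kernel_data.Joy V A X K) (kernel_data.joy_equiv V A X K)
       \<and> vbase.faithful V (kernel_data.Joy V A X K) (vbase.fcat V X) (kernel_data.joy_emb V A X K)
       \<and> vbase.conservative V (kernel_data.Joy V A X K) (vbase.fcat V X) (kernel_data.joy_emb V A X K)"
proof -
  interpret star_autonomous_unit V by fact
  interpret kernel V "TYPE('s)" A X K
  proof
    show "vcategory A" "vcategory X"
      using assms(4,5) unfolding promonoidal_data.promonoidal_def by blast+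
    show "vfunctor (vtens (vop A) X) vself K"
      using assms(6) unfolding mult_kernel_data.multiplicative_kernel_def by blast
  qed fact+
  interpret adj: vadjunction V "fcat A" "fcat X" Kbar Kund eta eps
    by (rule Kan_adjunction)
  interpret adj: vadjunction_regular V "fcat A" "fcat X" Kbar Kund eta eps
    by unfold_locales (use assms(7) in blast)
  \<comment> \<open>unfolding turns the given constants into those of the abstract theory\<close>
  have T: "T = adj.mon" "mu f = adj.mult f" for f by (simp_all add: T_def mu_def adj.mon_def adj.mult_def)
  have Kl: "Kleisli = adj.Kl" "Kbar_T = adj.KlF" "Kcomp = adj.KlC"
    by (simp_all add: Kleisli_def Kbar_T_def Kcomp_def adj.Kl_def adj.KlF_def adj.KlC_def T(1) T(2)[abs_def] )
  have uv: "joy_u f g = adj.ju f g" "joy_v f g = adj.jv f g" for f g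
    by (simp_all add: joy_u_def joy_v_def adj.ju_def adj.jv_def Let_def)
  have J: "the_joy = adj.the_jw"
    unfolding the_joy_def adj.the_jw_def uv by (rule refl)
  have Jh: "joy_hom = adj.jw_hom" "joy_incl = adj.jw_incl" "joy_incl_T = adj.jw_incl_T"
    unfolding joy_hom_def joy_incl_def joy_incl_T_def[abs_def] adj.jw_hom_def adj.jw_incl_def adj.jw_incl_T_def[abs_def] J Kl
    by (rule refl)+
  have Joy: "Joy = adj.JW"
    unfolding Joy_def adj.JW_def Jh Kl ..
  have JF: "joy_sub = adj.jw_sub" "joy_emb = adj.jw_emb" "joy_equiv = adj.jw_equiv"
    unfolding joy_sub_def joy_emb_def joy_equiv_def adj.jw_sub_def adj.jw_emb_def adj.jw_equiv_def adj.jw_map_def[abs_def] Joy Jh fcat_simps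
    by (rule refl)+
  show ?thesis
    unfolding Joy JF Kl
    using adj.Kleisli_factorisation adj.KlC_fully_faithful adj.KlF_conservative adj.JW_sub adj.JW_equivalence
      adj.JW_emb adj.JW_emb_conservative
    by blast
qed

end
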